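(* Let $\mathcal W_1,\dots,\mathcal W_r$ be nontrivial pairwise non-isomorphic rational irreducible representations of $G$, with associated complex irreducible representations $V_1,\dots,V_r$, and let $H\le G$ be such that Hypothesis ( * ) of the context holds. Suppose the action of $G$ on the curve $Z$ has geometric signature $[0;(C_1,m_1),\dots,(C_t,m_t)]$. Then the number of fixed points of the correspondence $\mathcal K_X$ of the curve $X=Z/H$ is given by $$(\mathcal K_X\cdot\Delta_X)=\sum_{j=1}^t m_j\left(q\,[L:\mathbb Q]\sum_{i=1}^r(\dim V_i-\dim V_i^{G_j})-\big([G:H]-|H\backslash G/G_j|\big)\right),$$ where $G_j$ denotes any subgroup in the class $C_j$ and $q=\frac{|G|}{b\cdot n}$.
   Context: Curves are smooth projective over an algebraically closed field of characteristic $0$. $G$ is a finite group acting on a curve $Z$ so that $\pi:Z\to Y=Z/G$ is a Galois covering with Galois group $G$; $H\le G$, $X=Z/H$, with induced maps $\pi_H:Z\to X$ and $\varphi_H:X\to Y$. Correspondences on $X$ (elements of $\mathrm{Div}(X\times X)$) are described by the maps $x\mapsto D(x)$ to divisors on $X$; $\Delta_X$ is the diagonal. The number of fixed points of $\mathcal K_X$ is by definition the intersection number $(\mathcal K_X\cdot\Delta_X)$ on $X\times X$. Geometric signature: if $C$ is a conjugacy class of cyclic subgroups of $G$, a branch point $y\in Y$ of $\pi$ is of type $C$ if the stabilizer of any $z\in\pi^{-1}(y)$ lies in $C$. The geometric signature is $[g;(C_1,m_1),\dots,(C_t,m_t)]$ if $Y$ has genus $g$, $\pi$ has exactly $\sum_j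 m_j$ branch points, and exactly $m_j$ of them are of type $C_j$. Representations: for a complex irreducible representation $V$ of $G$ with character $\chi_V$, $K_V=\mathbb Q(\chi_V(g)\mid g\in G)$. A rational irreducible representation $\mathcal W$ has an associated complex irreducible representation $V$ (unique up to Galois conjugacy): $\mathcal W\otimes_{\mathbb Q}\mathbb C\simeq m_V\bigoplus_{\tau\in\mathrm{Gal}(K_V/\mathbb Q)}V^\tau$, with $m_V$ the Schur index. Hypothesis ( * ): for all $k$: (a) $\dim V_k=n$ is independent of $k$; (b) $K_{V_k}=L$ is independent of $k$; (c) $\dim V_k^H=1$; (d) for every subgroup $N$ of $G$ with $H\subsetneq N$ there is an index $k$ with $\dim V_k^N=0$. Let $H_1=H,\dots,H_d$ be the double cosets of $H$ in $G$, and $\{g_{ij}\mid 1\le i\le d,\ 1\le j\le n_i\}$ representatives for both the left and the right cosets of $H$ in $G$, with $g_{11}=1$ and $H_i=Hg_{i1}H=\bigsqcup_j g_{ij}H=\bigsqcup_j Hg_{ij}$. Put $a_{ki}=\sum_{h\in H}\mathrm{tr}_{L/\mathbb Q}(\chi_{V_k}(hg_{i1}^{-1}))\in\mathbb Z$, $b_i=\sum_{k=1}^r a_{ki}$, $b=\gcd\{b_1-b_i\mid 2\le i\le d\}$. Define $\overline{\mathcal D}(x)=\sum_{i=1}^d b_i\sum_{j=1}^{n_i}\pi_H(g_{ij}(z))$ for $x\in X$, $z\in Z$ any preimage of $x$; $\mathcal T_{X/Y}(x)=\varphi_H^*\varphi_H(x)=\sum_{i,j}\pi_H(g_{ij}(z))$;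 and the Kanev correspondence $$\mathcal K_X:=\Delta_X-\tfrac1b\overline{\mathcal D}+\left(\tfrac{b_1}{b}-1\right)\mathcal T_{X/Y},$$ which is an integral correspondence. *)

theory Defs
  imports
    "HOL-Analysis.Analysis"
    "HOL-Algebra.Group_Action"
    "HOL-Algebra.Generated_Fields"
    "HOL-Algebra.Embedded_Algebras"
    "HOL-Library.Function_Algebras"
    "HOL-Library.Poly_Mapping"
    "Jordan_Normal_Form.Matrix"
    "Jordan_Normal_Form.VS_Connect"
begin

section \<open>Spaces with functions\<close>

text \<open>Varieties over a field are treated as topological spaces with a sheaf of field-valued
  functions. The sheaf is recorded by its stalks: \<open>regular V P\<close> consists of the functions (total on
  the ambient type) that are regular on some neighbourhood of \<open>P\<close>; equality of germs is
  \<open>\<forall>\<^sub>F x in nhdsin (zariski V) P. f x = g x\<close>.\<close>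

record ('p, 'k) function_space =
  zariski :: "'p topology"
  regular :: "'p \<Rightarrow> ('p \<Rightarrow> 'k) set"

abbreviation points :: "('p, 'k) function_space \<Rightarrow> 'p set" where
  "points V \<equiv> topspace (zariski V)"

definition irreducible_closed :: "'p topology \<Rightarrow> 'p set \<Rightarrow> bool" where
  "irreducible_closed T C \<longleftrightarrow> closedin T C \<and> C \<noteq> {} \<and>
     (\<forall>A B. closedin T A \<and> closedin T B \<and> C \<subseteq> A \<union> B \<longrightarrow> C \<subseteq> A \<or> C \<subseteq> B)"

text \<open>Krull dimension 1 of an irreducible space: the longest chains of irreducible closed sets
  ending in the whole space have exactly one step.\<close>

definition dimension_one :: "'p topology \<Rightarrow> bool" where
  "dimension_one T \<longleftrightarrow>
     (\<exists>A. irreducible_closed T A \<and> A \<subset> topspace T) \<and>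
     \<not> (\<exists>A B. irreducible_closed T A \<and> irreducible_closed T B \<and> A \<subset> B \<and> B \<subset> topspace T)"

definition vanishing_ideal ::
    "('p, 'k::field) function_space \<Rightarrow> 'p \<Rightarrow> 'p set \<Rightarrow> ('p \<Rightarrow> 'k) set" where
  "vanishing_ideal V P C =
     {f \<in> regular V P. \<forall>\<^sub>F x in nhdsin (zariski V) P. x \<in> C \<longrightarrow> f x = 0}"

definition generates ::
    "('p, 'k::field) function_space \<Rightarrow> 'p \<Rightarrow> ('p \<Rightarrow> 'k) set \<Rightarrow> ('p \<Rightarrow> 'k) \<Rightarrow> bool" where
  "generates V P I t \<longleftrightarrow> t \<in> I \<and>
     (\<forall>f\<in>I. \<exists>u\<in>regular V P. \<forall>\<^sub>F x in nhdsin (zariski V) P. f x = t x * u x)"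

text \<open>For a one-dimensional irreducible space, regularity of the local ring at \<open>P\<close> says that its
  maximal ideal (the functions vanishing on \<open>{P}\<close>) is generated by one element.\<close>

definition smooth_curve :: "('p, 'k::field) function_space \<Rightarrow> bool" where
  "smooth_curve V \<longleftrightarrow>
     irreducible_closed (zariski V) (points V) \<and> dimension_one (zariski V) \<and>
     (\<forall>P\<in>points V. \<exists>t. generates V P (vanishing_ideal V P {P}) t)"


section \<open>Projective varieties\<close>

type_synonym 'k mpoly = "(nat \<Rightarrow>\<^sub>0 nat) \<Rightarrow>\<^sub>0 'k"

definition mpoly_eval :: "'k::comm_ring_1 mpoly \<Rightarrow> (nat \<Rightarrow> 'k) \<Rightarrow> 'k" where
  "mpoly_eval p x =
     (\<Sum>m\<in>Poly_Mapping.keys p. Poly_Mapping.lookup p m *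
        (\<Prod>i\<in>Poly_Mapping.keys m. x i ^ Poly_Mapping.lookup m i))"

definition homogeneous_mpoly :: "nat \<Rightarrow> 'k::zero mpoly \<Rightarrow> bool" where
  "homogeneous_mpoly d p \<longleftrightarrow>
     (\<forall>m\<in>Poly_Mapping.keys p. (\<Sum>i\<in>Poly_Mapping.keys m. Poly_Mapping.lookup m i) = d)"

text \<open>A point of \<open>N\<close>-dimensional projective space is represented by its unique homogeneous
  coordinate vector whose first nonzero entry is 1. Entries beyond index \<open>N\<close> are 0, so indeterminates
  with index above \<open>N\<close> are harmless in \<open>mpoly_eval\<close>.\<close>

definition proj_space :: "nat \<Rightarrow> (nat \<Rightarrow> 'k::field) set" where
  "proj_space N = {x. (\<forall>i>N. x i = 0) \<and> (\<exists>i\<le>N. x i = 1 \<and> (\<forall>j<i. x j = 0))}"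

definition proj_closed :: "nat \<Rightarrow> (nat \<Rightarrow> 'k::field) set \<Rightarrow> bool" where
  "proj_closed N S \<longleftrightarrow> (\<exists>I. (\<forall>F\<in>I. \<exists>d. homogeneous_mpoly d F) \<and>
      S = {x \<in> proj_space N. \<forall>F\<in>I. mpoly_eval F x = 0})"

definition proj_zariski :: "(nat \<Rightarrow> 'k::field) set \<Rightarrow> (nat \<Rightarrow> 'k) topology" where
  "proj_zariski S = topology_generated_by
     {{x \<in> S. mpoly_eval F x \<noteq> 0} | F. \<exists>d. homogeneous_mpoly d F}"

definition proj_variety :: "(nat \<Rightarrow> 'k::field) set \<Rightarrow> (nat \<Rightarrow> 'k, 'k) function_space" where
  "proj_variety S = \<lparr> zariski = proj_zariski S,
     regular = (\<lambda>P. {f. \<exists>d F G. homogeneous_mpoly d F \<and> homogeneous_mpoly d G \<and>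
        mpoly_eval G P \<noteq> 0 \<and>
        (\<forall>\<^sub>F x in nhdsin (proj_zariski S) P. f x = mpoly_eval F x / mpoly_eval G x)}) \<rparr>"

definition smooth_projective_curve :: "nat \<Rightarrow> (nat \<Rightarrow> 'k::field) set \<Rightarrow> bool" where
  "smooth_projective_curve N S \<longleftrightarrow> proj_closed N S \<and> smooth_curve (proj_variety S)"


section \<open>Group actions, quotients and products\<close>

definition acts_faithfully_on ::
    "('g, 'm) monoid_scheme \<Rightarrow> ('g \<Rightarrow> 'p \<Rightarrow> 'p) \<Rightarrow> ('p, 'k) function_space \<Rightarrow> bool" where
  "acts_faithfully_on G \<phi> V \<longleftrightarrow> faithful_action G (points V) \<phi> \<and>
     (\<forall>g\<in>carrier G. continuous_map (zariski V) (zariski V) (\<phi> g) \<and>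
        (\<forall>P\<in>points V. \<forall>f\<in>regular V (\<phi> g P). (\<lambda>x. f (\<phi> g x)) \<in> regular V P))"

definition quotient_space ::
    "('g, 'm) monoid_scheme \<Rightarrow> ('g \<Rightarrow> 'p \<Rightarrow> 'p) \<Rightarrow> ('p, 'k) function_space \<Rightarrow>
     ('p set, 'k) function_space" where
  "quotient_space G \<phi> V = \<lparr>
     zariski = topology_generated_by
       {U. U \<subseteq> orbits G (points V) \<phi> \<and> openin (zariski V) (\<Union>U)},
     regular = (\<lambda>y. {f. \<forall>z\<in>y. (\<lambda>w. f (orbit G \<phi> w)) \<in> regular V z}) \<rparr>"

text \<open>In the product of two varieties the sets on which a finite sum of functions \<open>c x * d y\<close>
  (with \<open>c\<close>, \<open>d\<close> regular on open sets of the factors) is nonzero form a basis, and the regular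
  functions are locally quotients of such sums.\<close>

definition product_zariski ::
    "('p, 'k::field) function_space \<Rightarrow> ('q, 'k) function_space \<Rightarrow> ('p \<times> 'q) topology" where
  "product_zariski V W = topology_generated_by
     {{(x, y). x \<in> A \<and> y \<in> B \<and> (\<Sum>i<m. c i x * d i y) \<noteq> 0} | A B (m::nat) c d.
        openin (zariski V) A \<and> openin (zariski W) B \<and>
        (\<forall>i<m. (\<forall>x\<in>A. c i \<in> regular V x) \<and> (\<forall>y\<in>B. d i \<in> regular W y))}"

definition product_space ::
    "('p, 'k::field) function_space \<Rightarrow> ('q, 'k) function_space \<Rightarrow>
     ('p \<times> 'q, 'k) function_space" where
  "product_space V W = \<lparr> zariski = product_zariski V W,
     regular = (\<lambda>(x0, y0). {f. \<exists>(m::nat) a b c d.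
        (\<forall>i<m. a i \<in> regular V x0 \<and> b i \<in> regular W y0 \<and>
               c i \<in> regular V x0 \<and> d i \<in> regular W y0) \<and>
        (\<Sum>i<m. c i x0 * d i y0) \<noteq> 0 \<and>
        (\<forall>\<^sub>F (x, y) in nhdsin (product_zariski V W) (x0, y0).
           f (x, y) = (\<Sum>i<m. a i x * b i y) / (\<Sum>i<m. c i x * d i y))}) \<rparr>"


section \<open>Genus\<close>

text \<open>The tangent space at \<open>P\<close> is the space of derivations of the local ring; values outside
  \<open>regular V P\<close> are normalised to 0.\<close>

definition tangent_space ::
    "('p, 'k::field) function_space \<Rightarrow> 'p \<Rightarrow> (('p \<Rightarrow> 'k) \<Rightarrow> 'k) set" where
  "tangent_space V P = {v. (\<forall>f. f \<notin> regular V P \<longrightarrow> v f = 0) \<and>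
     (\<forall>f\<in>regular V P. \<forall>g\<in>regular V P.
        ((\<forall>\<^sub>F x in nhdsin (zariski V) P. f x = g x) \<longrightarrow> v f = v g) \<and>
        v (\<lambda>x. f x + g x) = v f + v g \<and>
        v (\<lambda>x. f x * g x) = f P * v g + g P * v f) \<and>
     (\<forall>f\<in>regular V P. \<forall>c. v (\<lambda>x. c * f x) = c * v f)}"

text \<open>A regular differential form assigns to every point a linear form on the tangent space and is
  locally of the shape \<open>\<Sum>i. f i * d(g i)\<close>. The genus of a smooth projective curve is the dimension
  of the space of these forms.\<close>

definition regular_differentials ::
    "('p, 'k::field) function_space \<Rightarrow> ('p \<Rightarrow> (('p \<Rightarrow> 'k) \<Rightarrow> 'k) \<Rightarrow> 'k) set" where
  "regular_differentials V = {\<omega>.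
     (\<forall>P v. P \<notin> points V \<or> v \<notin> tangent_space V P \<longrightarrow> \<omega> P v = 0) \<and>
     (\<forall>P\<in>points V. \<exists>(m::nat) f g. (\<forall>i<m. f i \<in> regular V P \<and> g i \<in> regular V P) \<and>
        (\<forall>\<^sub>F Q in nhdsin (zariski V) P. \<forall>v\<in>tangent_space V Q.
           \<omega> Q v = (\<Sum>i<m. f i Q * v (g i))))}"

definition genus :: "('p, 'k::field) function_space \<Rightarrow> nat" where
  "genus V = vector_space.dim (\<lambda>c \<omega> P v. c * \<omega> P v) (regular_differentials V)"


section \<open>Divisors and intersection numbers on a smooth surface\<close>

definition prime_divisor :: "('p, 'k) function_space \<Rightarrow> 'p set \<Rightarrow> bool" where
  "prime_divisor V C \<longleftrightarrow> irreducible_closed (zariski V) C \<and> C \<subset> points V \<and>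
     \<not> (\<exists>B. irreducible_closed (zariski V) B \<and> C \<subset> B \<and> B \<subset> points V)"

definition divisors :: "('p, 'k) function_space \<Rightarrow> ('p set \<Rightarrow>\<^sub>0 int) set" where
  "divisors V = {D. \<forall>C\<in>Poly_Mapping.keys D. prime_divisor V C}"

text \<open>\<open>codim_at V P I\<close> is the dimension over the ground field of the quotient of the local ring at
  \<open>P\<close> by \<open>I\<close>: the length of a family \<open>e\<close> representing a basis of the quotient.\<close>

definition codim_at :: "('p, 'k::field) function_space \<Rightarrow> 'p \<Rightarrow> ('p \<Rightarrow> 'k) set \<Rightarrow> nat" where
  "codim_at V P I = (THE n. \<exists>e. (\<forall>i<n. e i \<in> regular V P) \<and>
     (\<forall>f\<in>regular V P. \<exists>!c. c \<in> {..<n} \<rightarrow>\<^sub>E UNIV \<and>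
        (\<lambda>x. f x - (\<Sum>i<n. c i * e i x)) \<in> I))"

text \<open>Local intersection multiplicity of two distinct prime divisors at \<open>P\<close>. Local equations of
  \<open>C\<close> and \<open>E\<close> at \<open>P\<close> are generators of their vanishing ideals, so the ideal below is the one
  generated by the local equations. It is the whole local ring if \<open>P\<close> is not on both curves.\<close>

definition local_intersection ::
    "('p, 'k::field) function_space \<Rightarrow> 'p \<Rightarrow> 'p set \<Rightarrow> 'p set \<Rightarrow> nat" where
  "local_intersection V P C E = codim_at V P
     {(\<lambda>x. f x + g x) | f g. f \<in> vanishing_ideal V P C \<and> g \<in> vanishing_ideal V P E}"

definition proper_intersection ::
    "('p, 'k::field) function_space \<Rightarrow> ('p set \<Rightarrow>\<^sub>0 int) \<Rightarrow> ('p set \<Rightarrow>\<^sub>0 int) \<Rightarrow> int" where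
  "proper_intersection V D E =
     (\<Sum>A\<in>Poly_Mapping.keys D. \<Sum>B\<in>Poly_Mapping.keys E.
        Poly_Mapping.lookup D A * Poly_Mapping.lookup E B *
        (\<Sum>P\<in>A \<inter> B. int (local_intersection V P A B)))"

definition vanishing_order ::
    "('p, 'k::field) function_space \<Rightarrow> 'p \<Rightarrow> 'p set \<Rightarrow> ('p \<Rightarrow> 'k) \<Rightarrow> nat \<Rightarrow> bool" where
  "vanishing_order V P C f n \<longleftrightarrow>
     (\<exists>t u. generates V P (vanishing_ideal V P C) t \<and> u \<in> regular V P \<and>
        u \<notin> vanishing_ideal V P C \<and> (\<forall>\<^sub>F x in nhdsin (zariski V) P. f x = t x ^ n * u x))"

text \<open>A principal divisor is the divisor of a nonzero rational function \<open>h\<close>, defined on a nonempty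
  open set \<open>U\<close>, which near every point is a quotient \<open>a / b\<close> of regular functions.\<close>

definition principal_divisor :: "('p, 'k::field) function_space \<Rightarrow> ('p set \<Rightarrow>\<^sub>0 int) \<Rightarrow> bool" where
  "principal_divisor V D \<longleftrightarrow> D \<in> divisors V \<and>
     (\<exists>U h. openin (zariski V) U \<and> U \<noteq> {} \<and>
       (\<forall>P\<in>points V. \<exists>a\<in>regular V P. \<exists>b\<in>regular V P.
          a \<notin> vanishing_ideal V P (points V) \<and> b \<notin> vanishing_ideal V P (points V) \<and>
          (\<forall>\<^sub>F x in nhdsin (zariski V) P. x \<in> U \<longrightarrow> h x * b x = a x) \<and>
          (\<forall>C. prime_divisor V C \<and> P \<in> C \<longrightarrow>
             (\<exists>m n. vanishing_order V P C a m \<and> vanishing_order V P C b n \<and>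
                Poly_Mapping.lookup D C = int m - int n))))"

text \<open>For divisors without common components the intersection number is the sum of the local
  multiplicities; in general the first divisor is moved in its linear equivalence class.\<close>

definition intersection_number ::
    "('p, 'k::field) function_space \<Rightarrow> ('p set \<Rightarrow>\<^sub>0 int) \<Rightarrow> ('p set \<Rightarrow>\<^sub>0 int) \<Rightarrow> int" where
  "intersection_number V D E =
     (if Poly_Mapping.keys D \<inter> Poly_Mapping.keys E = {} then proper_intersection V D E
      else (THE s. \<exists>D'\<in>divisors V. principal_divisor V (D' - D) \<and>
              Poly_Mapping.keys D' \<inter> Poly_Mapping.keys E = {} \<and>
              s = proper_intersection V D' E))"


section \<open>Correspondences\<close>

definition diagonal_divisor :: "('p, 'k) function_space \<Rightarrow> ('p \<times> 'p) set \<Rightarrow>\<^sub>0 int" where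
  "diagonal_divisor X = frag_of {(x, x) | x. x \<in> points X}"

text \<open>The coefficient of \<open>y\<close> in the divisor \<open>D(x)\<close> on \<open>X\<close>, i.e. in the intersection of \<open>D\<close> with
  the fibre \<open>{x} \<times> X\<close> of the first projection.\<close>

definition correspondence_value ::
    "('p, 'k::field) function_space \<Rightarrow> (('p \<times> 'p) set \<Rightarrow>\<^sub>0 int) \<Rightarrow> 'p \<Rightarrow> 'p \<Rightarrow> int" where
  "correspondence_value X D x y =
     (\<Sum>C\<in>Poly_Mapping.keys D. Poly_Mapping.lookup D C *
        int (local_intersection (product_space X X) (x, y) C ({x} \<times> points X)))"

text \<open>A map from \<open>X\<close> to divisors on \<open>X\<close> determines a correspondence only up to fibres \<open>{x} \<times> X\<close>,
  so such components are excluded (they would also make \<open>D(x)\<close> undefined for that \<open>x\<close>).\<close>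

definition correspondence_of ::
    "('p, 'k::field) function_space \<Rightarrow> ('p \<Rightarrow> 'p \<Rightarrow>\<^sub>0 int) \<Rightarrow> ('p \<times> 'p) set \<Rightarrow>\<^sub>0 int" where
  "correspondence_of X \<psi> = (THE D. D \<in> divisors (product_space X X) \<and>
     (\<forall>x\<in>points X. {x} \<times> points X \<notin> Poly_Mapping.keys D) \<and>
     (\<forall>x\<in>points X. \<forall>y\<in>points X.
        correspondence_value X D x y = Poly_Mapping.lookup (\<psi> x) y))"


section \<open>Double cosets and the Kanev correspondence\<close>

definition double_coset :: "('g, 'm) monoid_scheme \<Rightarrow> 'g set \<Rightarrow> 'g \<Rightarrow> 'g set \<Rightarrow> 'g set" where
  "double_coset G H a K = (H #>\<^bsub>G\<^esub> a) <#>\<^bsub>G\<^esub> K"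

definition double_cosets :: "('g, 'm) monoid_scheme \<Rightarrow> 'g set \<Rightarrow> 'g set \<Rightarrow> 'g set set" where
  "double_cosets G H K = (\<lambda>a. double_coset G H a K) ` carrier G"

definition double_coset_reps ::
    "('g, 'm) monoid_scheme \<Rightarrow> 'g set \<Rightarrow> nat \<Rightarrow> (nat \<Rightarrow> nat) \<Rightarrow> (nat \<Rightarrow> nat \<Rightarrow> 'g) \<Rightarrow> bool" where
  "double_coset_reps G H d n g \<longleftrightarrow>
     1 \<le> d \<and> g 1 1 = \<one>\<^bsub>G\<^esub> \<and>
     (\<forall>i\<in>{1..d}. 1 \<le> n i \<and> (\<forall>j\<in>{1..n i}. g i j \<in> carrier G)) \<and>
     bij_betw (\<lambda>i. double_coset G H (g i 1) H) {1..d} (double_cosets G H H) \<and>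
     (\<forall>i\<in>{1..d}.
        double_coset G H (g i 1) H = (\<Union>j\<in>{1..n i}. g i j <#\<^bsub>G\<^esub> H) \<and>
        disjoint_family_on (\<lambda>j. g i j <#\<^bsub>G\<^esub> H) {1..n i} \<and>
        double_coset G H (g i 1) H = (\<Union>j\<in>{1..n i}. H #>\<^bsub>G\<^esub> g i j) \<and>
        disjoint_family_on (\<lambda>j. H #>\<^bsub>G\<^esub> g i j) {1..n i})"

text \<open>\<open>x \<mapsto> \<Sum>i. c i * (\<Sum>j. \<pi>\<^sub>H (g i j z))\<close>, where \<open>x\<close> is a point of \<open>Z/H\<close>, i.e. an \<open>H\<close>-orbit
  on \<open>Z\<close>, and \<open>z\<close> is a preimage, i.e. an element, of \<open>x\<close>; the value is independent of its choice.\<close>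

definition double_coset_map ::
    "('g, 'm) monoid_scheme \<Rightarrow> 'g set \<Rightarrow> ('g \<Rightarrow> 'p \<Rightarrow> 'p) \<Rightarrow> nat \<Rightarrow> (nat \<Rightarrow> nat) \<Rightarrow>
     (nat \<Rightarrow> nat \<Rightarrow> 'g) \<Rightarrow> (nat \<Rightarrow> int) \<Rightarrow> 'p set \<Rightarrow> 'p set \<Rightarrow>\<^sub>0 int" where
  "double_coset_map G H \<phi> d n g c x =
     (let z = (SOME z. z \<in> x) in
      \<Sum>i=1..d. frag_cmul (c i)
        (\<Sum>j=1..n i. frag_of (orbit (G\<lparr>carrier := H\<rparr>) \<phi> (\<phi> (g i j) z))))"

definition kanev_gcd :: "nat \<Rightarrow> (nat \<Rightarrow> int) \<Rightarrow> int" where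
  "kanev_gcd d c = Gcd ((\<lambda>i. c 1 - c i) ` {2..d})"

text \<open>The map \<open>\<T>\<close> is \<open>double_coset_map\<close> with all coefficients 1. The Kanev correspondence is obtained
  by dividing the coefficients of \<open>b \<Delta> - \<D> + (b\<^sub>1 - b) \<T>\<close> by \<open>b\<close>; all of these divisions are exact.\<close>

definition kanev_correspondence ::
    "('g, 'm) monoid_scheme \<Rightarrow> 'g set \<Rightarrow> ('g \<Rightarrow> 'p \<Rightarrow> 'p) \<Rightarrow> ('p, 'k::field) function_space \<Rightarrow>
     nat \<Rightarrow> (nat \<Rightarrow> nat) \<Rightarrow> (nat \<Rightarrow> nat \<Rightarrow> 'g) \<Rightarrow> (nat \<Rightarrow> int) \<Rightarrow> ('p set \<times> 'p set) set \<Rightarrow>\<^sub>0 int" where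
  "kanev_correspondence G H \<phi> Z d n g c =
     (let X = quotient_space (G\<lparr>carrier := H\<rparr>) \<phi> Z;
          b = kanev_gcd d c;
          Dbar = correspondence_of X (double_coset_map G H \<phi> d n g c);
          T = correspondence_of X (double_coset_map G H \<phi> d n g (\<lambda>_. 1))
      in Poly_Mapping.map (\<lambda>a. a div b)
           (frag_cmul b (diagonal_divisor X) - Dbar + frag_cmul (c 1 - b) T))"


section \<open>Geometric signature\<close>

definition cyclic_class :: "('g, 'm) monoid_scheme \<Rightarrow> 'g set set \<Rightarrow> bool" where
  "cyclic_class G C \<longleftrightarrow> (\<exists>x\<in>carrier G.
     C = (\<lambda>a. a <#\<^bsub>G\<^esub> generate G {x} #>\<^bsub>G\<^esub> inv\<^bsub>G\<^esub> a) ` carrier G)"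

text \<open>A point of \<open>Z/G\<close> is an orbit, i.e. its own fibre; the covering has degree \<open>order G\<close>.\<close>

definition branch_points :: "('g, 'm) monoid_scheme \<Rightarrow> ('g \<Rightarrow> 'p \<Rightarrow> 'p) \<Rightarrow> 'p set \<Rightarrow> 'p set set" where
  "branch_points G \<phi> Z = {y \<in> orbits G Z \<phi>. card y < order G}"

definition geometric_signature ::
    "('g, 'm) monoid_scheme \<Rightarrow> ('g \<Rightarrow> 'p \<Rightarrow> 'p) \<Rightarrow> ('p, 'k::field) function_space \<Rightarrow>
     nat \<Rightarrow> nat \<Rightarrow> (nat \<Rightarrow> 'g set set) \<Rightarrow> (nat \<Rightarrow> nat) \<Rightarrow> bool" where
  "geometric_signature G \<phi> Z \<gamma> t C m \<longleftrightarrow>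
     genus (quotient_space G \<phi> Z) = \<gamma> \<and>
     inj_on C {1..t} \<and> (\<forall>j\<in>{1..t}. cyclic_class G (C j)) \<and>
     finite (branch_points G \<phi> (points Z)) \<and>
     card (branch_points G \<phi> (points Z)) = (\<Sum>j=1..t. m j) \<and>
     (\<forall>j\<in>{1..t}.
        card {y \<in> branch_points G \<phi> (points Z). \<forall>z\<in>y. stabilizer G \<phi> z \<in> C j} = m j)"


section \<open>Matrix representations\<close>

definition is_rep :: "('g, 'm) monoid_scheme \<Rightarrow> nat \<Rightarrow> ('g \<Rightarrow> 'a::field mat) \<Rightarrow> bool" where
  "is_rep G n \<rho> \<longleftrightarrow> (\<forall>g\<in>carrier G. \<rho> g \<in> carrier_mat n n) \<and> \<rho> \<one>\<^bsub>G\<^esub> = 1\<^sub>m n \<and>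
     (\<forall>g\<in>carrier G. \<forall>h\<in>carrier G. \<rho> (g \<otimes>\<^bsub>G\<^esub> h) = \<rho> g * \<rho> h)"

definition irreducible_rep :: "('g, 'm) monoid_scheme \<Rightarrow> nat \<Rightarrow> ('g \<Rightarrow> 'a::field mat) \<Rightarrow> bool" where
  "irreducible_rep G n \<rho> \<longleftrightarrow> is_rep G n \<rho> \<and> 0 < n \<and>
     (\<forall>U. subspace class_ring U (module_vec TYPE('a) n) \<and>
          (\<forall>g\<in>carrier G. \<forall>v\<in>U. \<rho> g *\<^sub>v v \<in> U) \<longrightarrow> U = {0\<^sub>v n} \<or> U = carrier_vec n)"

definition rep_iso ::
    "('g, 'm) monoid_scheme \<Rightarrow> ('g \<Rightarrow> 'a::field mat) \<Rightarrow> ('g \<Rightarrow> 'a mat) \<Rightarrow> bool" where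
  "rep_iso G \<rho> \<sigma> \<longleftrightarrow> (\<exists>n P. P \<in> carrier_mat n n \<and> invertible_mat P \<and>
     (\<forall>g\<in>carrier G. \<rho> g \<in> carrier_mat n n \<and> \<sigma> g \<in> carrier_mat n n \<and> P * \<rho> g = \<sigma> g * P))"

definition nontrivial_rep :: "('g, 'm) monoid_scheme \<Rightarrow> ('g \<Rightarrow> 'a::field mat) \<Rightarrow> bool" where
  "nontrivial_rep G \<rho> \<longleftrightarrow> \<not> rep_iso G \<rho> (\<lambda>_. 1\<^sub>m 1)"

definition character :: "('g \<Rightarrow> 'a::field mat) \<Rightarrow> 'g \<Rightarrow> 'a" where
  "character \<rho> g = (\<Sum>i<dim_row (\<rho> g). \<rho> g $$ (i, i))"

definition fixed_dim :: "nat \<Rightarrow> ('g \<Rightarrow> complex mat) \<Rightarrow> 'g set \<Rightarrow> nat" where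
  "fixed_dim n \<rho> N = vectorspace.dim class_ring
     ((module_vec TYPE(complex) n)
        \<lparr>carrier := {v \<in> carrier_vec n. \<forall>h\<in>N. \<rho> h *\<^sub>v v = v}\<rparr>)"

definition character_field :: "('g, 'm) monoid_scheme \<Rightarrow> ('g \<Rightarrow> complex mat) \<Rightarrow> complex set" where
  "character_field G \<rho> = generate_field class_ring (character \<rho> ` carrier G)"

text \<open>Field automorphisms fix the rationals automatically.\<close>

definition galois_group :: "complex set \<Rightarrow> (complex \<Rightarrow> complex) set" where
  "galois_group K = {\<tau> \<in> K \<rightarrow>\<^sub>E K. bij_betw \<tau> K K \<and>
     (\<forall>x\<in>K. \<forall>y\<in>K. \<tau> (x + y) = \<tau> x + \<tau> y \<and> \<tau> (x * y) = \<tau> x * \<tau> y)}"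

definition schur_index :: "('g, 'm) monoid_scheme \<Rightarrow> ('g \<Rightarrow> complex mat) \<Rightarrow> nat" where
  "schur_index G \<rho> = (LEAST s. \<exists>E. subfield E class_ring \<and> character_field G \<rho> \<subseteq> E \<and>
     ring.dimension class_ring s (character_field G \<rho>) E \<and>
     (\<exists>n \<sigma>. is_rep G n \<sigma> \<and> rep_iso G \<rho> \<sigma> \<and> (\<forall>g\<in>carrier G. elements_mat (\<sigma> g) \<subseteq> E)))"

text \<open>The complexification of \<open>W\<close> is \<open>m\<^sub>V\<close> times the direct sum of the Galois conjugates \<open>U \<tau>\<close> of
  \<open>V\<close>; the conjugate is the complex representation with character \<open>\<tau> \<circ> \<chi>\<^sub>V\<close>.\<close>

definition associated_rep ::
    "('g, 'm) monoid_scheme \<Rightarrow> ('g \<Rightarrow> rat mat) \<Rightarrow> nat \<Rightarrow> ('g \<Rightarrow> complex mat) \<Rightarrow> bool" where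
  "associated_rep G W n V \<longleftrightarrow> irreducible_rep G n V \<and>
     (\<exists>ts U. distinct ts \<and> set ts = galois_group (character_field G V) \<and>
        (\<forall>\<tau>\<in>set ts. is_rep G n (U \<tau>) \<and>
           (\<forall>g\<in>carrier G. character (U \<tau>) g = \<tau> (character V g))) \<and>
        rep_iso G (\<lambda>g. map_mat of_rat (W g))
          (\<lambda>g. diag_block_mat (concat (map (\<lambda>\<tau>. replicate (schur_index G V) (U \<tau> g)) ts))))"

abbreviation rat_scale :: "rat \<Rightarrow> complex \<Rightarrow> complex" where
  "rat_scale q z \<equiv> of_rat q * z"

definition rat_degree :: "complex set \<Rightarrow> nat" where
  "rat_degree L = vector_space.dim rat_scale L"

text \<open>Trace over the rationals of multiplication by \<open>x\<close> on the number field \<open>L\<close>, computed in a basis.\<close>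

definition rat_trace :: "complex set \<Rightarrow> complex \<Rightarrow> rat" where
  "rat_trace L x =
     (let B = (SOME B. \<not> Modules.module.dependent rat_scale B \<and> Modules.module.span rat_scale B = L)
      in \<Sum>e\<in>B. Modules.module.representation rat_scale B (x * e) e)"

definition hypothesis_star ::
    "('g, 'm) monoid_scheme \<Rightarrow> 'g set \<Rightarrow> nat \<Rightarrow> (nat \<Rightarrow> nat) \<Rightarrow> (nat \<Rightarrow> 'g \<Rightarrow> complex mat) \<Rightarrow>
     nat \<Rightarrow> complex set \<Rightarrow> bool" where
  "hypothesis_star G H r dimV V n L \<longleftrightarrow>
     (\<forall>k\<in>{1..r}. dimV k = n) \<and>
     (\<forall>k\<in>{1..r}. character_field G (V k) = L) \<and>
     (\<forall>k\<in>{1..r}. fixed_dim (dimV k) (V k) H = 1) \<and>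
     (\<forall>N. subgroup N G \<and> H \<subset> N \<longrightarrow> (\<exists>k\<in>{1..r}. fixed_dim (dimV k) (V k) N = 0))"

text \<open>\<open>kanev_a G H L V g\<close> is \<open>a\<^sub>k\<^sub>i\<close> for \<open>V = V\<^sub>k\<close> and \<open>g = g\<^sub>i\<^sub>1\<close>. The sum of traces is a rational integer,
  so \<open>floor\<close> only changes its type.\<close>

definition kanev_a ::
    "('g, 'm) monoid_scheme \<Rightarrow> 'g set \<Rightarrow> complex set \<Rightarrow> ('g \<Rightarrow> complex mat) \<Rightarrow> 'g \<Rightarrow> int" where
  "kanev_a G H L V g = \<lfloor>\<Sum>h\<in>H. rat_trace L (character V (h \<otimes>\<^bsub>G\<^esub> inv\<^bsub>G\<^esub> g))\<rfloor>"

end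

theory Submission
 imports Defs "Jordan_Normal_Form.Spectral_Radius"
begin

text \<open>The Kanev correspondence is an integral combination, over the nontrivial double cosets, of the curves
 \<open>{(\<pi>(z), \<pi>(\<gamma> z))}\<close> in \<open>X \<times> X\<close>. On \<open>Z \<times> Z\<close> the preimage of such a curve is the union of the graphs of the
 elements \<open>\<gamma>\<close> of the double coset, and \<open>|H|\<close> times its intersection number with the diagonal is the number of pairs
 \<open>(\<gamma>, z)\<close> with \<open>\<gamma> z = z\<close>: in characteristic 0 stabilizers act faithfully on cotangent spaces, so graphs through a
 fixed point meet transversally. The geometric signature turns these numbers into counts of conjugates in the groups
 \<open>Gj\<close>, and Schur's lemma evaluates the character sums that arise.\<close>

\<comment> \<open>The diagonal is the curve of the trivial double coset, and its coefficients 1,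
  -b_1/b and b_1/b - 1 in the Kanev correspondence cancel. So the correspondence and the diagonal
  have no common component, and no divisor has to be moved. The other coefficients are values of
  (b_1 - B)/b - 1 for a function B on the whole group that is constant on double cosets. On H this
  function is -1 and not 0, so sums over G are corrected by a sum over H; that correction produces
  the number of double cosets of H and Gj, the term -1 produces the index [G:H], and (b_1 - B)/b the
  codimensions of the fixed spaces. Two features of the setting cause most of the work.
  Correspondences and multiplicities are definite descriptions, so uniqueness has to be proved, and
  each curve must be shown to be a prime divisor, i.e. maximal among the proper irreducible closed
  sets. And the quotient X is known only through functions on Z: computations on X are computations
  with H-invariant functions, whose orders are multiples of the ramification index.\<close>
syntax "_eventually" :: "pttrn => 'a filter => bool => bool" ("(3EV _ in _./ _)" [0, 0, 10] 10)
notation iff (infixr "<->" 25)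
notation mult (infixl "*.\<index>" 70)
abbreviation (input) pts where "pts == points"
abbreviation (input) reg where "reg == regular"
abbreviation (input) cr where "cr == carrier"
abbreviation (input) chi where "chi == character"
abbreviation (input) lookup where "lookup == Poly_Mapping.lookup"
abbreviation (input) keys where "keys == Poly_Mapping.keys"

hide_const (open) up_ring.coeff

section \<open>Finitely generated algebras of functions are Noetherian\<close>

text \<open>The rings are rings of functions, whose pointwise operations come from type classes; a
  subring is therefore a plain set and not a record with a carrier.\<close>

definition subring_set :: "'a::comm_ring_1 set => bool" where
 "subring_set R <-> 1 : R & (ALL a:R. ALL b:R. a - b : R & a * b : R)"

lemma subring_setD:
 assumes "subring_set R"
 shows "1 : R" "0 : R" "a : R ==> b : R ==> a - b : R" "a : R ==> b : R ==> a * b : R"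
  "a : R ==> - a : R" "a : R ==> b : R ==> a + b : R"
proof -
 show 1: "1 : R" and d: "!!a b. a : R ==> b : R ==> a - b : R"
  and "a : R ==> b : R ==> a * b : R" for a b
  using assms by (auto simp: subring_set_def)
 show 0: "0 : R" using d[OF 1 1] by simp
 show m: "a : R ==> - a : R" for a using d[OF 0] by (metis diff_0)
 show "a : R ==> b : R ==> a + b : R" using d m by (metis diff_minus_eq_add)
qed

lemma subring_set_sum:
 "subring_set R ==> (!!i. i : I ==> f i : R) ==> sum f I : R"
 by (induction I rule: infinite_finite_induct) (auto intro: subring_setD)

definition ideal_set :: "'a::comm_ring_1 set => 'a set => bool" where
 "ideal_set R I <-> I <= R & 0 : I & (ALL a:I. ALL b:I. a + b : I) & (ALL r:R. ALL a:I. r * a : I)"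

text \<open>The chain condition is the form that \<open>adjoin\<close> inherits and that
  \<open>noetherian_sequence\<close> exploits.\<close>

definition noetherian_set :: "'a::comm_ring_1 set => bool" where
 "noetherian_set R <->
  (ALL I :: nat => 'a set. (ALL n. ideal_set R (I n) & I n <= I (Suc n)) --> (EX N. ALL n>=N. I n = I N))"

definition adjoin :: "'a::comm_ring_1 set => 'a => 'a set" where
 "adjoin R x = {poly p x | p. ALL k. coeff p k : R}"

lemma adjoinI: "(!!k. coeff p k : R) ==> poly p x : adjoin R x"
 unfolding adjoin_def by blast

lemma subring_adjoin:
 assumes R: "subring_set R"
 shows "subring_set (adjoin R x)"
proof -
 note r = subring_setD[OF R] subring_set_sum[OF R]
 have "poly (p - q) x : adjoin R x" "poly (p * q) x : adjoin R x"
  if "ALL k. coeff p k : R" "ALL k. coeff q k : R" for p q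
  using that by (auto intro!: adjoinI r(3,4,7) simp: coeff_mult simp del: poly_diff poly_mult)
 moreover have "poly 1 x : adjoin R x" by (intro adjoinI) (auto intro: r simp: coeff_1)
 ultimately show ?thesis by (auto simp: subring_set_def adjoin_def)
qed

lemma adjoin_base:
 assumes "subring_set R" "c : R"
 shows "c : adjoin R x"
proof -
 have "coeff [:c:] k : R" for k by (cases k) (use assms subring_setD in auto)
 thus ?thesis using adjoinI[of "[:c:]" R x] by simp
qed

lemma adjoin_gen:
 assumes "subring_set R"
 shows "x : adjoin R x"
proof -
 have "coeff [:0, 1:] k : R" for k
  using subring_setD(1,2)[OF assms] by (auto simp: coeff_pCons split: nat.split)
 thus ?thesis using adjoinI[of "[:0, 1:]" R x] by simp
qed

text \<open>For a chain of ideals \<open>I n\<close>, the leading coefficients of the elements of degree at most \<open>d\<close> form ideals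
 \<open>L d n\<close> increasing in both indices; stationarity of \<open>L n n\<close> and of the first few \<open>L d\<close> forces that of \<open>I\<close>.\<close>

theorem noetherian_adjoin:
 fixes R :: "'a::comm_ring_1 set"
 assumes R: "subring_set R" and N: "noetherian_set R"
 shows "noetherian_set (adjoin R x)"
 unfolding noetherian_set_def
proof (intro allI impI)
 fix I :: "nat => 'a set" assume I: "ALL n. ideal_set (adjoin R x) (I n) & I n <= I (Suc n)"
 note r = subring_setD[OF R]
 have In: "I n <= adjoin R x" "0 : I n" "a : I n ==> b : I n ==> a + b : I n"
  "s : adjoin R x ==> a : I n ==> s * a : I n" for n a b s
  using I by (auto simp: ideal_set_def)
 have Im: "I m <= I n" if "m <= n" for m n using lift_Suc_mono_le[of I, OF _ that] I by blast
 define L where "L = (%d n. {coeff p d | p. (ALL k. coeff p k : R) & (ALL k>d. coeff p k = 0) & poly p x : I n})"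
 have LI: "ideal_set R (L d n)" for d n
 proof -
  have "0 : L d n" unfolding L_def using In(2) r(2) by (auto intro!: exI[of _ 0])
  moreover have "coeff p d + coeff q d : L d n"
  if "ALL k. coeff p k : R" "ALL k>d. coeff p k = 0" "poly p x : I n"
  "ALL k. coeff q k : R" "ALL k>d. coeff q k = 0" "poly q x : I n" for p q
  unfolding L_def using that In(3) r(6) by (auto intro!: exI[of _ "p + q"])
  moreover have "s * coeff p d : L d n"
  if "s : R" "ALL k. coeff p k : R" "ALL k>d. coeff p k = 0" "poly p x : I n" for p s
  unfolding L_def using that In(4)[OF adjoin_base[OF R]] r(4) by (auto intro!: exI[of _ "[:s:] * p"])
  ultimately show ?thesis unfolding ideal_set_def by (auto simp: L_def)
 qed
 have Ln: "L d m <= L d n" if "m <= n" for d m n using Im[OF that] unfolding L_def by blast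
 have "L d n <= L (Suc d) n" for d n
 proof
  fix c assume "c : L d n"
  then obtain p where "c = coeff p d" "ALL k. coeff p k : R" "ALL k>d. coeff p k = 0" "poly p x : I n"
  by (auto simp: L_def)
  thus "c : L (Suc d) n" unfolding L_def using In(4)[OF adjoin_gen[OF R]] r(2)
  by (auto intro!: exI[of _ "pCons 0 p"] simp: coeff_pCons split: nat.split)
 qed
 hence Ld: "L e n <= L d n" if "e <= d" for d e n using lift_Suc_mono_le[of "%d. L d n", OF _ that] by blast
 have st: "EX N. ALL n>=N. C n = C N" if "ALL n. ideal_set R (C n) & C n <= C (Suc n)" for C
  using N that unfolding noetherian_set_def by blast
 have "L n n <= L (Suc n) (Suc n)" for n using Ld[of n "Suc n" n] Ln[of n "Suc n" "Suc n"] by auto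
 then obtain M where M: "!!n. n >= M ==> L n n = L M M" using st[of "%n. L n n"] LI by blast
 have "EX N. ALL n>=N. L d n = L d N" for d using st[of "L d"] LI Ln[of _ "Suc _"] by simp
 then obtain K where K: "!!d n. n >= K d ==> L d n = L d (K d)" by metis
 define J where "J = Max (insert M (K ` {..<M}))"
 have J: "M <= J" "d < M ==> K d <= J" for d by (auto simp: J_def)
 \<comment> \<open>The finitely many chains \<open>L d\<close> with \<open>d < M\<close> are
   stationary from \<open>J\<close> on. For \<open>d >= M\<close>, \<open>L d n\<close> lies below a
   term of the diagonal chain, hence in \<open>L M M\<close>, which lies in \<open>L d M\<close> and
   so in \<open>L d J\<close>.\<close>
 have eq: "L d n <= L d J" if n: "n >= J" for d n
 proof (cases "d < M")
  case True
  thus ?thesis using K[of d n] K[of d J] J(2) n by fastforce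
 next
  case False
  have "L d n <= L (max d n) n" by (rule Ld) simp
  also have "... <= L (max d n) (max d n)" by (rule Ln) simp
  also have "... = L M M" by (rule M) (use False in simp)
  also have "... <= L d M" by (rule Ld) (use False in simp)
  also have "... <= L d J" by (rule Ln) (rule J)
  finally show ?thesis .
 qed
 \<comment> \<open>Induction on a degree bound: an element of \<open>I J\<close> with the same
   coefficient in degree \<open>d\<close> is subtracted, and the bound drops by one.\<close>
 have "poly p x : I J" if "ALL k>=d. coeff p k = 0" "ALL k. coeff p k : R" "poly p x : I n" "n >= J" for p d n
  using that
 proof (induction d arbitrary: p)
  case 0
  hence "p = 0" by (simp add: poly_eq_iff)
  thus ?case using In(2) by simp
 next
  case (Suc d)
  have "coeff p d : L d n" unfolding L_def using Suc.prems by auto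
  hence "coeff p d : L d J" using eq[OF Suc.prems(4), of d] by blast
  then obtain q where q: "coeff p d = coeff q d" "ALL k. coeff q k : R" "ALL k>d. coeff q k = 0" "poly q x : I J"
  unfolding L_def by blast
  have "- 1 * poly q x : I n"
  using q(4) Im[OF Suc.prems(4)] In(4)[OF adjoin_base[OF R r(5)[OF r(1)]]] by blast
  hence "poly (p - q) x : I n" using In(3)[OF Suc.prems(3), of "- 1 * poly q x"] by simp
  moreover have "coeff (p - q) k = 0" if "k >= d" for k
  using that Suc.prems(1) q(1,3) by (cases "k = d") auto
  ultimately have "poly (p - q) x : I J" by (intro Suc.IH allI impI Suc.prems(4)) (use Suc.prems(2) q(2) r(3) in auto)
  thus ?case using In(3)[OF q(4), of "poly (p - q) x"] by simp
 qed
 note low = this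
 have "I n <= I J" if "n >= J" for n
 proof
  fix y assume y: "y : I n"
  then obtain p where p: "y = poly p x" "ALL k. coeff p k : R" using In(1) unfolding adjoin_def by blast
  have "ALL k>=Suc (degree p). coeff p k = 0" by (simp add: coeff_eq_0)
  thus "y : I J" using low p y that by blast
 qed
 thus "EX N. ALL n>=N. I n = I N" using Im by blast
qed

text \<open>The ideals generated by the first \<open>n\<close> terms form an ascending chain, and
  where it stops the next term brings nothing new. Both applications build a sequence of functions
  and exploit this single relation.\<close>

lemma noetherian_sequence:
 fixes f :: "nat => 'a::comm_ring_1"
 assumes R: "subring_set R" and N: "noetherian_set R" and f: "range f <= R"
 shows "EX n p. (ALL k<n. p k : R) & f n = (SUM k<n. p k * f k)"
proof -
 note r = subring_setD[OF R]
 define I where "I = (%n. {SUM k<n. p k * f k | p. ALL k. p k : R})"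
 have "ideal_set R (I n) & I n <= I (Suc n)" for n
 proof -
  have "0 : I n" unfolding I_def using r(2) by (auto intro!: exI[of _ "%_. 0"])
  moreover have "(SUM k<n. p k * f k) + (SUM k<n. q k * f k) : I n" if "ALL k. p k : R" "ALL k. q k : R" for p q
  unfolding I_def using that r(6) by (auto intro!: exI[of _ "%k. p k + q k"] simp: sum.distrib distrib_right)
  moreover have "s * (SUM k<n. p k * f k) : I n" if "ALL k. p k : R" "s : R" for p s
  unfolding I_def using that r(4) by (auto intro!: exI[of _ "%k. s * p k"] simp: sum_distrib_left mult.assoc)
  moreover have "(SUM k<n. p k * f k) : I (Suc n)" if "ALL k. p k : R" for p
  unfolding I_def using that r(2) by (auto intro!: exI[of _ "p(n := 0)"])
  moreover have "I n <= R" unfolding I_def using f by (auto intro!: subring_set_sum R r(4))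
  ultimately show ?thesis by (auto simp: ideal_set_def I_def)
 qed
 then obtain n where "I (Suc n) = I n" using N unfolding noetherian_set_def by (meson le_Suc_eq order_refl)
 moreover have "f n : I (Suc n)"
  unfolding I_def using r(1,2) by (auto intro!: exI[of _ "(%_. 0)(n := 1)"])
 ultimately have "f n : I n" by simp
 thus ?thesis unfolding I_def by blast
qed

inductive_set fun_alg :: "('p => 'k::field) set => ('p => 'k) set" for X where
 const: "(%_. c) : fun_alg X"
| gen: "f : X ==> f : fun_alg X"
| add: "f : fun_alg X ==> g : fun_alg X ==> (%x. f x + g x) : fun_alg X"
| mult: "f : fun_alg X ==> g : fun_alg X ==> (%x. f x * g x) : fun_alg X"

lemma subring_fun_alg: "subring_set (fun_alg X)"
proof -
 have "f - g : fun_alg X" if "f : fun_alg X" "g : fun_alg X" for f g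
 proof -
  have "(%x. f x + (- 1) * g x) : fun_alg X" by (intro fun_alg.intros that)
  thus ?thesis by (simp add: fun_diff_def)
 qed
 thus ?thesis
  unfolding subring_set_def using fun_alg.const[of 1 X] fun_alg.mult[of _ X]
  by (auto simp: one_fun_def times_fun_def)
qed

lemma fun_alg_mono: "X <= Y ==> fun_alg X <= fun_alg Y"
proof
 fix f assume "X <= Y" "f : fun_alg X"
 from this(2,1) show "f : fun_alg Y" by induction (auto intro: fun_alg.intros)
qed

lemma fun_alg_insert: "fun_alg (insert x X) = adjoin (fun_alg X) x"
proof
 let ?A = "fun_alg (insert x X)" and ?B = "adjoin (fun_alg X) x"
 note A = subring_setD[OF subring_adjoin[OF subring_fun_alg[of X], of x]]
 have "f : ?B" if "f : ?A" for f
  using that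
 proof induction
  case (gen f)
  thus ?case using adjoin_base[OF subring_fun_alg fun_alg.gen] adjoin_gen[OF subring_fun_alg] by blast
 qed (use A(4,6) adjoin_base[OF subring_fun_alg fun_alg.const] in "auto simp: plus_fun_def times_fun_def")
 thus "?A <= ?B" ..
 note B = subring_setD[OF subring_fun_alg[of "insert x X"]]
 have "poly p x : ?A" if "ALL k. coeff p k : fun_alg X" for p
  using that
 proof (induction p)
  case (pCons a p)
  have p: "ALL k. coeff p k : fun_alg X" using pCons.prems coeff_pCons_Suc by metis
  have "a : ?A"
  using pCons.prems[rule_format, of 0] fun_alg_mono[of X "insert x X"] by auto
  thus ?case unfolding poly_pCons by (rule B(6)[OF _ B(4)[OF fun_alg.gen pCons.IH[OF p]]]) simp
 qed (simp add: B(2))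
 thus "?B <= ?A" by (auto simp: adjoin_def)
qed

lemma noetherian_fun_alg:
 fixes X :: "('p => 'k::field) set"
 shows "finite X ==> noetherian_set (fun_alg X)"
proof (induction X rule: finite_induct)
 let ?A = "fun_alg {}"
 case empty
 have c: "EX c. f = (%_. c)" if "f : ?A" for f :: "'p => 'k"
  using that by induction auto
 \<comment> \<open>The constants form a field: a nonzero constant \<open>a\<close> in the ideal
   yields every constant \<open>b\<close> as \<open>b / a\<close> times \<open>a\<close>.\<close>
 have two: "I = {0} | I = ?A" if I: "ideal_set (?A) I" for I :: "('p => 'k) set"
 proof (cases "I <= {0}")
  case False
  then obtain f where f: "f : I" "f ~= 0" by auto
  have "f : ?A" using f I unfolding ideal_set_def by blast
  from c[OF this] f obtain a where a: "f = (%_. a)" "a ~= 0" by (auto simp: zero_fun_def)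
  have "(%_. b) : I" for b
  proof -
  have "(%_. b / a) * f : I" using I f(1) fun_alg.const[of "b / a" "{}"] unfolding ideal_set_def by blast
  thus ?thesis using a by (simp add: times_fun_def)
  qed
  hence "?A <= I" using c by blast
  thus ?thesis using I by (auto simp: ideal_set_def)
 qed (use that in "auto simp: ideal_set_def")
 show ?case unfolding noetherian_set_def
 proof (intro allI impI)
  fix I :: "nat => ('p => 'k) set" assume I: "ALL n. ideal_set (?A) (I n) & I n <= I (Suc n)"
  show "EX N. ALL n>=N. I n = I N"
  proof (cases "EX N. I N = ?A")
  case True
  then obtain N where N: "I N = ?A" ..
  have "I n = ?A" if "n >= N" for n
  using lift_Suc_mono_le[of I, OF _ that] I two[of "I n"] N fun_alg.const[of 1 "{}"] by (auto simp: zero_fun_def fun_eq_iff)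
  thus ?thesis using N by blast
  next
  case False
  hence "I n = {0}" for n using two I by blast
  thus ?thesis by simp
  qed
 qed
next
 case (insert x X)
 thus ?case unfolding fun_alg_insert by (intro noetherian_adjoin[OF subring_fun_alg])
qed

section \<open>Curves with cofinite topology and discrete valuation rings\<close>

text \<open>Irreducibility and dimension one enter the local arguments only in two ways: proper
  closed sets are finite, and a regular germ that is not zero has finitely many zeros. As axioms
  they can be checked for the projective curve and for its quotient alike.\<close>

locale cofinite_space =
 fixes V :: "('p, 'k::field_char_0) function_space"
 assumes openin_iff: "openin (zariski V) U <-> U <= pts V & (U = {} | finite (pts V - U))"
  and infinite_points: "infinite (pts V)"
  and regular_cong: "P : pts V ==> f : reg V P ==>
  EV x in nhdsin (zariski V) P. f x = g x ==> g : reg V P"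
  and regular_const: "P : pts V ==> (%_. c) : reg V P"
  and regular_add: "P : pts V ==> f : reg V P ==> g : reg V P ==>
  (%x. f x + g x) : reg V P"
  and regular_mult: "P : pts V ==> f : reg V P ==> g : reg V P ==>
  (%x. f x * g x) : reg V P"
  and regular_inverse: "P : pts V ==> f : reg V P ==> f P ~= 0 ==>
  (%x. inverse (f x)) : reg V P"
  and regular_open: "P : pts V ==> f : reg V P ==>
  EV Q in nhdsin (zariski V) P. f : reg V Q"
  and zero_or_finite: "P : pts V ==> f : reg V P ==>
  (EV x in nhdsin (zariski V) P. f x = 0) | finite {x : pts V. f x = 0}"
begin

abbreviation near :: "'p => 'p filter" where "near P == nhdsin (zariski V) P"

text \<open>\<open>nhdsin\<close> includes the point itself, so a statement about germs splits into
  a statement at \<open>P\<close> and a finite exceptional set; most eventualities below are handled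
  through this set.\<close>

lemma eventually_near_iff:
 assumes "P : pts V"
 shows "eventually Q (near P) <-> Q P & finite {x : pts V. ~ Q x}"
proof
 assume "eventually Q (near P)"
 then obtain S where S: "openin (zariski V) S" "P : S" "ALL x:S. Q x"
  using assms by (auto simp: eventually_nhdsin)
 hence "finite (pts V - S)" using openin_iff by auto
 moreover have "{x : pts V. ~ Q x} <= pts V - S" using S by auto
 ultimately show "Q P & finite {x : pts V. ~ Q x}" using S finite_subset by blast
next
 assume R: "Q P & finite {x : pts V. ~ Q x}"
 have "openin (zariski V) {x : pts V. Q x}"
 proof -
  have "pts V - {x : pts V. Q x} = {x : pts V. ~ Q x}" by auto
  thus ?thesis unfolding openin_iff using R by auto
 qed
 thus "eventually Q (near P)" unfolding eventually_nhdsin using R assms by blast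
qed

lemma eventually_near_self: "P : pts V ==> eventually Q (near P) ==> Q P"
 by (simp add: eventually_near_iff)

lemma eventually_near_finite: "P : pts V ==> eventually Q (near P) ==> finite {x : pts V. ~ Q x}"
 by (simp add: eventually_near_iff)

lemma eventually_near_points: "eventually (%x. x : pts V) (near P)"
 by (metis eventually_nhdsin openin_topspace)

lemma near_avoid:
 assumes "P : pts V" "finite E" "P ~: E"
 shows "EV x in near P. x ~: E & x : pts V"
proof -
 have "finite {x : pts V. ~ (x ~: E & x : pts V)}"
  by (rule finite_subset[OF _ assms(2)]) auto
 thus ?thesis using assms by (simp add: eventually_near_iff)
qed

lemma infinite_cofinite:
 assumes "finite {x : pts V. ~ Q x}"
 shows "infinite {x : pts V. Q x}"
proof
 assume "finite {x : pts V. Q x}"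
 with assms have "finite ({x : pts V. ~ Q x} Un {x : pts V. Q x})" by blast
 moreover have "pts V = {x : pts V. ~ Q x} Un {x : pts V. Q x}" by auto
 ultimately show False using infinite_points by simp
qed

lemma regular_minus: "P : pts V ==> f : reg V P ==> (%x. - f x) : reg V P"
 using regular_mult[of P "%_. - 1" f] regular_const[of P "- 1"] by simp

lemma regular_diff:
 "P : pts V ==> f : reg V P ==> g : reg V P ==> (%x. f x - g x) : reg V P"
 using regular_add[OF _ _ regular_minus, of P f g] by simp

lemma regular_sum:
 "P : pts V ==> (!!i. i : I ==> f i : reg V P) ==> (%x. SUM i:I. f i x) : reg V P"
 by (induction I rule: infinite_finite_induct) (auto intro: regular_add regular_const)

lemma regular_prod:
 "P : pts V ==> (!!i. i : I ==> f i : reg V P) ==> (%x. PROD i:I. f i x) : reg V P"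
 by (induction I rule: infinite_finite_induct) (auto intro: regular_mult regular_const)

lemma regular_power: "P : pts V ==> f : reg V P ==> (%x. f x ^ n) : reg V P"
 by (induction n) (auto intro: regular_mult regular_const)

text \<open>Identity theorem: the difference has infinitely many zeros, so its germ at
  \<open>P\<close> is zero. It transfers equality to \<open>P\<close> after cancelling functions
  that vanish there.\<close>

lemma regular_agree:
 assumes P: "P : pts V" and f: "f : reg V P" and g: "g : reg V P"
  and fin: "finite {x : pts V. f x ~= g x}"
 shows "EV x in near P. f x = g x"
proof -
 have "(EV x in near P. f x - g x = 0) | finite {x : pts V. f x - g x = 0}"
  by (rule zero_or_finite[OF P regular_diff[OF P f g]])
 thus ?thesis
  using infinite_cofinite[of "%x. f x = g x"] fin by auto
qed

lemma eventually_nonzero: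
 assumes "P : pts V" "f : reg V P" "f P ~= 0"
 shows "EV x in near P. f x ~= 0"
 using zero_or_finite[OF assms(1,2)] assms eventually_near_iff by auto

end

text \<open>The added axiom says that the germs at \<open>P\<close> form a discrete valuation ring.
  Finiteness of the zeros of \<open>t\<close> is what permits cancelling powers of
  \<open>t\<close>.\<close>

locale curve = cofinite_space V for V :: "('p, 'k::field_char_0) function_space" +
 assumes ex_uniformizer: "P : pts V ==>
  EX t:reg V P. t P = 0 & finite {x : pts V. t x = 0} &
  (ALL f:reg V P. (EV x in nhdsin (zariski V) P. f x = 0) |
  (EX n u. u : reg V P & u P ~= 0 & (EV x in nhdsin (zariski V) P. f x = t x ^ n * u x)))"
begin

definition unif :: "'p => 'p => 'k" where
 "unif P = (SOME t. t : reg V P & t P = 0 & finite {x : pts V. t x = 0} &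
  (ALL f:reg V P. (EV x in near P. f x = 0) |
  (EX n u. u : reg V P & u P ~= 0 & (EV x in near P. f x = t x ^ n * u x))))"

lemma unif:
 assumes "P : pts V"
 shows "unif P : reg V P" "unif P P = 0" "finite {x : pts V. unif P x = 0}"
  "f : reg V P ==> (EV x in near P. f x = 0) |
  (EX n u. u : reg V P & u P ~= 0 & (EV x in near P. f x = unif P x ^ n * u x))"
proof -
 have "EX t. t : reg V P & t P = 0 & finite {x : pts V. t x = 0} &
  (ALL f:reg V P. (EV x in near P. f x = 0) |
  (EX n u. u : reg V P & u P ~= 0 & (EV x in near P. f x = t x ^ n * u x)))"
  using ex_uniformizer[OF assms] by blast
 from someI_ex[OF this, folded unif_def]
 show "unif P : reg V P" "unif P P = 0" "finite {x : pts V. unif P x = 0}"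
  "f : reg V P ==> (EV x in near P. f x = 0) |
  (EX n u. u : reg V P & u P ~= 0 & (EV x in near P. f x = unif P x ^ n * u x))"
  by blast+
qed

definition has_order :: "'p => ('p => 'k) => nat => bool" where
 "has_order P f n <-> f : reg V P &
  (EX u:reg V P. u P ~= 0 & (EV x in near P. f x = unif P x ^ n * u x))"

text \<open>The zero germ satisfies every lower bound but has no order, hence a second predicate
  next to \<open>has_order\<close>; ideals are described by \<open>order_ge\<close>.\<close>

definition order_ge :: "'p => ('p => 'k) => nat => bool" where
 "order_ge P f n <-> f : reg V P &
  (EX u:reg V P. EV x in near P. f x = unif P x ^ n * u x)"

lemma has_order_regular: "has_order P f n ==> f : reg V P"
 by (simp add: has_order_def)

lemma order_ge_regular: "order_ge P f n ==> f : reg V P"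
 by (simp add: order_ge_def)

lemma has_order_imp_ge: "has_order P f n ==> order_ge P f n"
 by (auto simp: has_order_def order_ge_def)

lemma has_order_cong:
 assumes "P : pts V" "has_order P f n" "EV x in near P. f x = g x"
 shows "has_order P g n"
proof -
 obtain u where u: "u : reg V P" "u P ~= 0" "EV x in near P. f x = unif P x ^ n * u x"
  and f: "f : reg V P"
  using assms by (auto simp: has_order_def)
 have "EV x in near P. g x = unif P x ^ n * u x"
  using assms(3) u(3) by eventually_elim simp
 thus ?thesis using u regular_cong[OF assms(1) f assms(3)] by (auto simp: has_order_def)
qed

lemma order_ge_cong:
 assumes "P : pts V" "order_ge P f n" "EV x in near P. f x = g x"
 shows "order_ge P g n"
proof -
 obtain u where u: "u : reg V P" "EV x in near P. f x = unif P x ^ n * u x"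
  and f: "f : reg V P"
  using assms by (auto simp: order_ge_def)
 have "EV x in near P. g x = unif P x ^ n * u x"
  using assms(3) u(2) by eventually_elim simp
 thus ?thesis using u regular_cong[OF assms(1) f assms(3)] by (auto simp: order_ge_def)
qed

text \<open>If \<open>m\<close> exceeded \<open>n\<close>, cancelling the \<open>n\<close>-th power
  of the parameter would equate the unit \<open>u\<close> with a multiple of the parameter near
  \<open>P\<close>, hence at \<open>P\<close>, where the latter vanishes.\<close>

lemma has_order_ge_le:
 assumes P: "P : pts V" and n: "has_order P f n" and m: "order_ge P f m"
 shows "m <= n"
proof (rule ccontr)
 assume "~ m <= n"
 obtain u where u: "u : reg V P" "u P ~= 0" "EV x in near P. f x = unif P x ^ n * u x"
  using n by (auto simp: has_order_def)
 obtain v where v: "v : reg V P" "EV x in near P. f x = unif P x ^ m * v x"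
  using m by (auto simp: order_ge_def)
 let ?w = "%x. unif P x ^ (m - n) * v x"
 have w: "?w : reg V P" by (intro regular_mult regular_power unif P v)
 have m: "unif P x ^ m = unif P x ^ n * unif P x ^ (m - n)" for x
  using \<open>~ m <= n\<close> by (metis le_add_diff_inverse nat_le_linear power_add)
 have ev: "EV x in near P. unif P x ^ n * u x = unif P x ^ n * ?w x"
  using u(3) v(2) by eventually_elim (auto simp: m mult_ac)
 have "finite ({x : pts V. unif P x ^ n * u x ~= unif P x ^ n * ?w x}
  Un {x : pts V. unif P x = 0})"
  using eventually_near_finite[OF P ev] unif(3)[OF P] by simp
 hence "finite {x : pts V. u x ~= ?w x}"
  by (rule rev_finite_subset) auto
 from regular_agree[OF P u(1) w this] have "u P = ?w P"
  by (rule eventually_near_self[OF P])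
 thus False using u(2) \<open>~ m <= n\<close> unif(2)[OF P] by (simp add: power_0_left)
qed

lemma has_order_unique: "P : pts V ==> has_order P f n ==> has_order P f m ==> n = m"
 by (meson has_order_ge_le has_order_imp_ge le_antisym)

lemma has_order_ex:
 assumes "P : pts V" "f : reg V P" "~ (EV x in near P. f x = 0)"
 obtains n where "has_order P f n"
proof -
 from unif(4)[OF assms(1,2)] assms(3) obtain n u
  where "u : reg V P" "u P ~= 0" "EV x in near P. f x = unif P x ^ n * u x" by (elim disjE exE conjE) simp_all
 hence "has_order P f n" using assms(2) by (auto simp: has_order_def)
 thus thesis by (rule that)
qed

lemma has_order_mult:
 assumes "P : pts V" "has_order P f n" "has_order P g m"
 shows "has_order P (%x. f x * g x) (n + m)"
proof -
 obtain u where u: "u : reg V P" "u P ~= 0" "EV x in near P. f x = unif P x ^ n * u x"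
  using assms by (auto simp: has_order_def)
 obtain v where v: "v : reg V P" "v P ~= 0" "EV x in near P. g x = unif P x ^ m * v x"
  using assms by (auto simp: has_order_def)
 have "EV x in near P. f x * g x = unif P x ^ (n + m) * (u x * v x)"
  using u(3) v(3) by eventually_elim (simp add: power_add mult_ac)
 moreover have "(%x. u x * v x) : reg V P" "u P * v P ~= 0"
  using u v regular_mult[OF assms(1) u(1) v(1)] by auto
 moreover have "(%x. f x * g x) : reg V P"
  by (intro regular_mult has_order_regular[OF assms(2)] has_order_regular[OF assms(3)] assms)
 ultimately show ?thesis unfolding has_order_def by (intro conjI bexI[of _ "%x. u x * v x"])
qed

lemma order_ge_mult:
 assumes "P : pts V" "order_ge P f n" "order_ge P g m"
 shows "order_ge P (%x. f x * g x) (n + m)"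
proof -
 obtain u where u: "u : reg V P" "EV x in near P. f x = unif P x ^ n * u x"
  using assms by (auto simp: order_ge_def)
 obtain v where v: "v : reg V P" "EV x in near P. g x = unif P x ^ m * v x"
  using assms by (auto simp: order_ge_def)
 have "EV x in near P. f x * g x = unif P x ^ (n + m) * (u x * v x)"
  using u(2) v(2) by eventually_elim (simp add: power_add mult_ac)
 moreover have "(%x. u x * v x) : reg V P"
  using u v regular_mult[OF assms(1) u(1) v(1)] by auto
 moreover have "(%x. f x * g x) : reg V P"
  by (intro regular_mult order_ge_regular[OF assms(2)] order_ge_regular[OF assms(3)] assms)
 ultimately show ?thesis unfolding order_ge_def by (intro conjI bexI[of _ "%x. u x * v x"])
qed

lemma order_ge_add:
 assumes "P : pts V" "order_ge P f n" "order_ge P g n"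
 shows "order_ge P (%x. f x + g x) n"
proof -
 obtain u where u: "u : reg V P" "EV x in near P. f x = unif P x ^ n * u x"
  using assms by (auto simp: order_ge_def)
 obtain v where v: "v : reg V P" "EV x in near P. g x = unif P x ^ n * v x"
  using assms by (auto simp: order_ge_def)
 have "EV x in near P. f x + g x = unif P x ^ n * (u x + v x)"
  using u(2) v(2) by eventually_elim (simp add: distrib_left)
 moreover have "(%x. u x + v x) : reg V P"
  by (rule regular_add[OF assms(1) u(1) v(1)])
 moreover have "(%x. f x + g x) : reg V P"
  by (intro regular_add order_ge_regular[OF assms(2)] order_ge_regular[OF assms(3)] assms)
 ultimately show ?thesis unfolding order_ge_def by (intro conjI bexI[of _ "%x. u x + v x"])
qed

lemma order_ge_0: "order_ge P f 0 <-> f : reg V P"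
 by (auto simp: order_ge_def intro: always_eventually)

lemma has_order_0_iff:
 assumes "P : pts V"
 shows "has_order P f 0 <-> f : reg V P & f P ~= 0"
proof
 assume "has_order P f 0"
 then obtain u where "f : reg V P" "u P ~= 0" "EV x in near P. f x = u x" by (auto simp: has_order_def)
 thus "f : reg V P & f P ~= 0" using eventually_near_self[OF assms, of "%x. f x = u x"] by auto
qed (auto simp: has_order_def intro: always_eventually)

lemma has_order_uniformizer: "P : pts V ==> has_order P (unif P) 1"
 unfolding has_order_def
 by (auto simp: unif intro!: bexI[of _ "%_. 1"] regular_const always_eventually)

lemma has_order_power:
 assumes "P : pts V" "has_order P f n"
 shows "has_order P (%x. f x ^ k) (k * n)"
proof (induction k)
 case 0
 show ?case using has_order_0_iff[OF assms(1)] regular_const[OF assms(1), of 1] by simp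
next
 case (Suc k)
 show ?case using has_order_mult[OF assms Suc] by simp
qed

lemma has_order_prod:
 assumes "P : pts V" "finite I" "!!i. i : I ==> has_order P (f i) (n i)"
 shows "has_order P (%x. PROD i:I. f i x) (SUM i:I. n i)"
 using assms(2,3)
proof (induction I)
 case empty
 show ?case using has_order_0_iff[OF assms(1)] regular_const[OF assms(1), of 1] by simp
next
 case (insert i I)
 thus ?case using has_order_mult[OF assms(1), of "f i" "n i"] by simp
qed

lemma order_ge_prod:
 assumes "P : pts V" "finite I" "!!i. i : I ==> order_ge P (f i) (n i)"
 shows "order_ge P (%x. PROD i:I. f i x) (SUM i:I. n i)"
 using assms(2,3)
proof (induction I)
 case empty
 show ?case using order_ge_0 regular_const[OF assms(1), of 1] by simp
next
 case (insert i I)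
 thus ?case using order_ge_mult[OF assms(1), of "f i" "n i"] by simp
qed

lemma has_order_finite_zeros:
 assumes "P : pts V" "has_order P f n"
 shows "finite {x : pts V. f x = 0}"
proof -
 obtain u where u: "u : reg V P" "u P ~= 0" "EV x in near P. f x = unif P x ^ n * u x"
  using assms by (auto simp: has_order_def)
 have "finite ({x : pts V. f x ~= unif P x ^ n * u x} Un {x : pts V. ~ u x ~= 0}
  Un {x : pts V. unif P x = 0})"
  using eventually_near_finite[OF assms(1) u(3)]
  eventually_near_finite[OF assms(1) eventually_nonzero[OF assms(1) u(1,2)]] unif(3)[OF assms(1)]
  by simp
 thus ?thesis by (rule rev_finite_subset) auto
qed

lemma has_order_not_zero: "P : pts V ==> has_order P f n ==> ~ (EV x in near P. f x = 0)"
 using has_order_finite_zeros[of P f n] eventually_near_finite[of P "%x. f x = 0"] infinite_cofinite[of "%x. f x = 0"]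
 by blast

lemma order_ge_divide:
 assumes P: "P : pts V" and f: "has_order P f n" and g: "order_ge P g n"
 obtains u where "u : reg V P" "EV x in near P. g x = f x * u x"
proof -
 obtain u where u: "u : reg V P" "u P ~= 0" "EV x in near P. f x = unif P x ^ n * u x"
  using f by (auto simp: has_order_def)
 obtain v where v: "v : reg V P" "EV x in near P. g x = unif P x ^ n * v x"
  using g by (auto simp: order_ge_def)
 have "(%x. inverse (u x) * v x) : reg V P"
  by (intro regular_mult regular_inverse P u v)
 moreover have "EV x in near P. g x = f x * (inverse (u x) * v x)"
  using u(3) v(2) eventually_nonzero[OF P u(1,2)] by eventually_elim (simp add: field_simps)
 ultimately show thesis by (rule that)
qed

lemma has_order_divide:
 assumes P: "P : pts V" and f: "has_order P f n" and g: "has_order P g (n + m)"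
 obtains u where "has_order P u m" "EV x in near P. g x = f x * u x"
proof -
 obtain u where u: "u : reg V P" "u P ~= 0" "EV x in near P. f x = unif P x ^ n * u x"
  using f by (auto simp: has_order_def)
 obtain v where v: "v : reg V P" "v P ~= 0" "EV x in near P. g x = unif P x ^ (n + m) * v x"
  using g by (auto simp: has_order_def)
 have o: "has_order P (%x. inverse (u x) * v x) 0"
  unfolding has_order_0_iff[OF P] using u v by (auto intro!: regular_mult regular_inverse P)
 have "has_order P (%x. unif P x ^ m * (inverse (u x) * v x)) (m * 1 + 0)"
  by (intro has_order_mult has_order_power o has_order_uniformizer P)
 moreover have "EV x in near P. g x = f x * (unif P x ^ m * (inverse (u x) * v x))"
  using u(3) v(3) eventually_nonzero[OF P u(1,2)]
  by eventually_elim (simp add: field_simps power_add)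
 ultimately show thesis by (intro that) simp_all
qed

lemma has_order_expand:
 assumes P: "P : pts V" and t: "has_order P t 1" and f: "has_order P f n"
 obtains u where "u : reg V P" "u P ~= 0" "EV x in near P. f x = t x ^ n * u x"
proof -
 have tn: "has_order P (%x. t x ^ n) n" using has_order_power[OF P t, of n] by simp
 have f': "has_order P f (n + 0)" using f by simp
 show thesis
 proof (rule has_order_divide[OF P tn f'])
  fix u assume "has_order P u 0" "EV x in near P. f x = t x ^ n * u x"
  thus thesis using that[of u] has_order_0_iff[OF P, of u] by simp
 qed
qed

lemma order_ge_expand:
 assumes P: "P : pts V" and t: "has_order P t 1" and f: "order_ge P f n"
 obtains u where "u : reg V P" "EV x in near P. f x = t x ^ n * u x"
proof -
 have "has_order P (%x. t x ^ n) n" using has_order_power[OF P t, of n] by simp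
 from order_ge_divide[OF P this f] show thesis using that .
qed

lemma order_geI:
 assumes P: "P : pts V" and t: "has_order P t n" and "u : reg V P" "EV x in near P. f x = t x * u x"
 shows "order_ge P f n"
proof -
 have "order_ge P (%x. t x * u x) (n + 0)"
  by (rule order_ge_mult[OF P has_order_imp_ge[OF t]]) (use assms order_ge_0 in auto)
 moreover have "EV x in near P. t x * u x = f x" using assms(4) by eventually_elim simp
 ultimately show ?thesis using order_ge_cong[OF P, of "%x. t x * u x" "n + 0" f] by simp
qed

lemma has_orderI:
 assumes P: "P : pts V" and t: "has_order P t n" and "u : reg V P" "u P ~= 0"
  "EV x in near P. f x = t x * u x"
 shows "has_order P f n"
proof -
 have "has_order P (%x. t x * u x) (n + 0)"
  by (intro has_order_mult P t) (use assms has_order_0_iff in auto)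
 moreover have "EV x in near P. t x * u x = f x" using assms(5) by eventually_elim simp
 ultimately show ?thesis using has_order_cong[OF P, of "%x. t x * u x" "n + 0" f] by simp
qed

lemma has_order_add_ge:
 assumes P: "P : pts V" and f: "has_order P f n" and g: "order_ge P g (Suc n)"
 shows "has_order P (%x. f x + g x) n"
proof -
 obtain u where u: "u : reg V P" "u P ~= 0" "EV x in near P. f x = unif P x ^ n * u x"
  and fr: "f : reg V P" using f by (auto simp: has_order_def)
 obtain v where v: "v : reg V P" "EV x in near P. g x = unif P x ^ Suc n * v x"
  and gr: "g : reg V P" using g by (auto simp: order_ge_def)
 let ?w = "%x. u x + unif P x * v x"
 have ev: "EV x in near P. f x + g x = unif P x ^ n * ?w x"
  using u(3) v(2) by eventually_elim (simp add: algebra_simps)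
 have "?w : reg V P" by (intro regular_add regular_mult unif P u v)
 moreover have "?w P ~= 0" using u(2) unif(2)[OF P] by simp
 ultimately show ?thesis
  unfolding has_order_def using regular_add[OF P fr gr] ev by (intro conjI bexI[of _ ?w])
qed

lemma order_ge_mono:
 assumes P: "P : pts V" and "order_ge P f n" "m <= n"
 shows "order_ge P f m"
proof -
 obtain u where u: "f : reg V P" "u : reg V P" "EV x in near P. f x = unif P x ^ n * u x"
  using assms by (auto simp: order_ge_def)
 have "EV x in near P. f x = unif P x ^ m * (unif P x ^ (n - m) * u x)"
  using u(3) by eventually_elim (use \<open>m <= n\<close> in "simp add: mult.assoc[symmetric] power_add[symmetric]")
 moreover have "(%x. unif P x ^ (n - m) * u x) : reg V P"
  by (intro regular_mult regular_power unif P u)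
 ultimately show ?thesis using u(1) unfolding order_ge_def
  by (intro conjI bexI[of _ "%x. unif P x ^ (n - m) * u x"])
qed

lemma order_ge_zero:
 assumes P: "P : pts V" and "EV x in near P. f x = 0"
 shows "order_ge P f n"
proof -
 have "order_ge P (%_. 0) n"
  unfolding order_ge_def using regular_const[OF P, of 0]
  by (intro conjI bexI[of _ "%_. 0"]) (auto intro: always_eventually)
 moreover have "EV x in near P. 0 = f x" using assms(2) by eventually_elim simp
 ultimately show ?thesis by (rule order_ge_cong[OF P])
qed

lemma order_ge_iff:
 assumes P: "P : pts V" and f: "f : reg V P"
 shows "order_ge P f n <-> (ALL m. has_order P f m --> n <= m)"
proof
 assume "ALL m. has_order P f m --> n <= m"
 thus "order_ge P f n"
  by (cases "EV x in near P. f x = 0")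
  (auto intro: order_ge_zero[OF P] order_ge_mono[OF P] has_order_imp_ge elim!: has_order_ex[OF P f])
qed (use has_order_ge_le[OF P] in blast)

lemma order_ge_1_iff:
 assumes P: "P : pts V" and f: "f : reg V P"
 shows "order_ge P f 1 <-> f P = 0"
proof
 assume "order_ge P f 1"
 then obtain u where "EV x in near P. f x = unif P x ^ 1 * u x" by (auto simp: order_ge_def)
 from eventually_near_self[OF P this] show "f P = 0" using unif(2)[OF P] by simp
next
 assume "f P = 0"
 thus "order_ge P f 1"
  unfolding order_ge_iff[OF P f] using has_order_0_iff[OF P, of f]
  by (metis One_nat_def Suc_leI gr0I)
qed

text \<open>\<open>regular V P / (t ^ n)\<close> has the basis \<open>1, t, ..., t ^ (n - 1)\<close>.\<close>

lemma taylor_expansion: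
 assumes P: "P : pts V" and t: "has_order P t 1" and f: "f : reg V P"
 shows "EX c. order_ge P (%x. f x - (SUM i<n. c i * t x ^ i)) n"
proof (induction n)
 case 0
 thus ?case using f order_ge_0 by simp
next
 case (Suc n)
 then obtain c where c: "order_ge P (%x. f x - (SUM i<n. c i * t x ^ i)) n" by blast
 then obtain u where u: "u : reg V P" "EV x in near P. f x - (SUM i<n. c i * t x ^ i) = t x ^ n * u x"
  by (rule order_ge_expand[OF P t])
 have tn: "has_order P (%x. t x ^ n) n" using has_order_power[OF P t, of n] by simp
 \<comment> \<open>The coefficient of \<open>t ^ n\<close> is the value at \<open>P\<close> of the
   cofactor \<open>u\<close>.\<close>
 have "order_ge P (%x. u x - u P) 1"
  using order_ge_1_iff[OF P regular_diff[OF P u(1) regular_const[OF P]]] by simp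
 from order_ge_mult[OF P has_order_imp_ge[OF tn] this]
 have g: "order_ge P (%x. t x ^ n * (u x - u P)) (Suc n)" by simp
 define c' where "c' = c(n := u P)"
 have c': "(SUM i<Suc n. c' i * t x ^ i) = (SUM i<n. c i * t x ^ i) + u P * t x ^ n" for x
  by (simp add: c'_def)
 have "EV x in near P. t x ^ n * (u x - u P) = f x - (SUM i<Suc n. c' i * t x ^ i)"
  using u(2) unfolding c' by eventually_elim (simp add: algebra_simps)
 from order_ge_cong[OF P g this] show ?case by blast
qed

text \<open>Otherwise the first nonzero coefficient, of index \<open>k < n\<close>, would give the
  sum the exact order \<open>k\<close>.\<close>

lemma taylor_unique:
 assumes P: "P : pts V" and t: "has_order P t 1"
  and c: "order_ge P (%x. SUM i<n. c i * t x ^ i) n" and "i < n"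
 shows "c i = 0"
proof (rule ccontr)
 assume "c i ~= 0"
 define k where "k = (LEAST i. c i ~= 0)"
 have ck: "c k ~= 0" unfolding k_def using \<open>c i ~= 0\<close> by (rule LeastI)
 have ki: "k <= i" unfolding k_def using \<open>c i ~= 0\<close> by (rule Least_le)
 hence kn: "k < n" using \<open>i < n\<close> by simp
 have tr: "t : reg V P" using t by (rule has_order_regular)
 have tP: "t P = 0" using order_ge_1_iff[OF P tr] has_order_imp_ge[OF t] by simp
 let ?w = "%x. SUM i<n - k. c (i + k) * t x ^ i"
 have "(SUM i<n. c i * t x ^ i) = t x ^ k * ?w x" for x
 proof -
  have "(SUM i<n. c i * t x ^ i) = (SUM i:{k..<n}. c i * t x ^ i)"
  by (rule sum.mono_neutral_right) (use not_less_Least[of _ "%i. c i ~= 0", folded k_def] in "auto simp: not_le")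
  also have "... = (SUM i:{0+k..<(n - k) + k}. c i * t x ^ i)" using kn by simp
  also have "... = (SUM i:{0..<n - k}. c (i + k) * t x ^ (i + k))" by (rule sum.shift_bounds_nat_ivl)
  also have "... = t x ^ k * ?w x" by (simp add: sum_distrib_left power_add mult_ac atLeast0LessThan)
  finally show ?thesis .
 qed
 moreover have "has_order P (%x. t x ^ k * ?w x) (k * 1 + 0)"
 proof (intro has_order_mult has_order_power P t)
  have "?w P = (SUM i<n - k. if i = 0 then c k else 0)" unfolding tP by (rule sum.cong) (auto simp: power_0_left)
  also have "... = c k" using kn by simp
  finally show "has_order P ?w 0" unfolding has_order_0_iff[OF P] using ck
  by (auto intro!: regular_sum regular_mult regular_power regular_const P tr)
 qed
 ultimately have "has_order P (%x. SUM i<n. c i * t x ^ i) k" by simp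
 from has_order_ge_le[OF P this c] show False using kn by simp
qed

end

section \<open>Products of two curves\<close>

text \<open>An inductive description of the finite sums in \<open>product_space\<close>: closure
  properties follow by rule induction, and \<open>tensors_iff\<close> returns to indexed
  sums.\<close>

inductive_set tensors ::
  "('p, 'k::field) function_space => ('q, 'k) function_space => 'p => 'q => ('p \<times> 'q => 'k) set"
 for V W P Q where
 zero: "(%_. 0) : tensors V W P Q"
| step: "F : tensors V W P Q ==> a : reg V P ==> b : reg W Q ==>
  (%z. F z + a (fst z) * b (snd z)) : tensors V W P Q"

lemma tensors_iff:
 "F : tensors V W P Q <-> (EX (m::nat) a b. (ALL i<m. a i : reg V P & b i : reg W Q) &
  F = (%z. SUM i<m. a i (fst z) * b i (snd z)))" (is "_ <-> ?R F")
proof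
 assume "F : tensors V W P Q"
 thus "?R F"
 proof induction
  case zero
  show ?case by (rule exI[of _ 0]) simp
 next
  case (step F a b)
  then obtain c d and m :: nat where *: "ALL i<m. c i : reg V P & d i : reg W Q"
  "F = (%z. SUM i<m. c i (fst z) * d i (snd z))" by (elim exE conjE)
  show ?case
  by (rule exI[of _ "Suc m"], rule exI[of _ "c(m := a)"], rule exI[of _ "d(m := b)"])
  (use * step in "auto simp: less_Suc_eq")
 qed
next
 assume "?R F"
 then obtain a b and m :: nat where *: "ALL i<m. a i : reg V P & b i : reg W Q"
  "F = (%z. SUM i<m. a i (fst z) * b i (snd z))" by (elim exE conjE)
 have "n <= m ==> (%z. SUM i<n. a i (fst z) * b i (snd z)) : tensors V W P Q" for n
 proof (induction n)
  case 0
  show ?case using tensors.zero by simp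
 next
  case (Suc n)
  thus ?case using tensors.step[of "%z. SUM i<n. a i (fst z) * b i (snd z)"] * by simp
 qed
 thus "F : tensors V W P Q" using * by simp
qed

lemma tensors_add:
 assumes "F : tensors V W P Q" "G : tensors V W P Q"
 shows "(%z. F z + G z) : tensors V W P Q"
 using assms(2)
proof induction
 case zero
 show ?case using assms(1) by simp
next
 case (step G a b)
 from tensors.step[OF step.IH step.hyps(2,3)] show ?case by (simp add: add.assoc)
qed

lemma tensors_sum:
 "(!!i. i : I ==> F i : tensors V W P Q) ==> (%z. SUM i:I. F i z) : tensors V W P Q"
 by (induction I rule: infinite_finite_induct) (auto intro: tensors.zero tensors_add)

lemma tensors_pure: "a : reg V P ==> b : reg W Q ==> (%z. a (fst z) * b (snd z)) : tensors V W P Q"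
 using tensors.step[OF tensors.zero] by simp

definition product_basis ::
  "('p, 'k::field) function_space => ('q, 'k) function_space => ('p \<times> 'q) set set" where
 "product_basis V W = {{(x, y). x : A & y : B & (SUM i<m. c i x * d i y) ~= 0} | A B (m::nat) c d.
  openin (zariski V) A & openin (zariski W) B &
  (ALL i<m. (ALL x:A. c i : reg V x) & (ALL y:B. d i : reg W y))}"

lemma product_zariski_eq: "product_zariski V W = topology_generated_by (product_basis V W)"
 by (simp only: product_zariski_def product_basis_def)

lemma product_basisI:
 assumes "openin (zariski V) A" "openin (zariski W) B"
  "!!i x. i < m ==> x : A ==> c i : reg V x" "!!i y. i < m ==> y : B ==> d i : reg W y"
 shows "{(x, y). x : A & y : B & (SUM i<(m::nat). c i x * d i y) ~= 0} : product_basis V W"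
 unfolding product_basis_def
 by (rule CollectI, rule exI[of _ A], rule exI[of _ B], rule exI[of _ m], rule exI[of _ c], rule exI[of _ d])
  (use assms in simp)

lemma product_basisE:
 assumes "s : product_basis V W"
 obtains A B c d and m :: nat where "s = {(x, y). x : A & y : B & (SUM i<m. c i x * d i y) ~= 0}"
  "openin (zariski V) A" "openin (zariski W) B"
  "ALL i<m. (ALL x:A. c i : reg V x) & (ALL y:B. d i : reg W y)"
proof -
 from assms have "EX A B (m::nat) c d. s = {(x, y). x : A & y : B & (SUM i<m. c i x * d i y) ~= 0} &
  openin (zariski V) A & openin (zariski W) B &
  (ALL i<m. (ALL x:A. c i : reg V x) & (ALL y:B. d i : reg W y))"
  by (simp only: product_basis_def mem_Collect_eq)
 thus thesis by (elim exE conjE) (rule that)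
qed

locale curve_pair = V: curve V + W: curve W
 for V :: "('p, 'k::field_char_0) function_space" and W :: "('q, 'k) function_space"
begin

abbreviation (input) zar2 where "zar2 == product_zariski V W"
abbreviation (input) tns where "tns == tensors V W"
abbreviation (input) vid where "vid == vanishing_ideal (product_space V W)"
abbreviation (input) pts2 where "pts2 == pts V \<times> pts W"

lemma tensors_mult_pure:
 assumes PQ: "P : pts V" "Q : pts W"
  and "F : tns P Q" "a : reg V P" "b : reg W Q"
 shows "(%z. F z * (a (fst z) * b (snd z))) : tns P Q"
 using assms(3)
proof induction
 case zero
 show ?case using tensors.zero by simp
next
 case (step F c d)
 have "(%z. F z * (a (fst z) * b (snd z)) + (c (fst z) * a (fst z)) * (d (snd z) * b (snd z))) : tns P Q"
  by (rule tensors.step[OF step.IH, of "%x. c x * a x" "%y. d y * b y"])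
  (use step assms V.regular_mult[OF PQ(1)] W.regular_mult[OF PQ(2)] in auto)
 thus ?case by (simp add: algebra_simps)
qed

lemma tensors_mult:
 assumes PQ: "P : pts V" "Q : pts W"
  and "F : tns P Q" "G : tns P Q"
 shows "(%z. F z * G z) : tns P Q"
 using assms(4)
proof induction
 case zero
 show ?case using tensors.zero by simp
next
 case (step G a b)
 show ?case using tensors_add[OF step.IH tensors_mult_pure[OF PQ assms(3) step.hyps(2,3)]]
  by (simp add: distrib_left)
qed

lemma tensors_fst: "P : pts V ==> Q : pts W ==> a : reg V P ==> (%z. a (fst z)) : tns P Q"
 using tensors_pure[of a V P "%_. 1" W Q] W.regular_const[of Q 1] by simp

lemma tensors_snd: "P : pts V ==> Q : pts W ==> b : reg W Q ==> (%z. b (snd z)) : tns P Q"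
 using tensors_pure[of "%_. 1" V P b W Q] V.regular_const[of P 1] by simp

lemma tensors_const: "P : pts V ==> Q : pts W ==> (%_. c) : tns P Q"
 using tensors_fst[of P Q "%_. c"] V.regular_const by simp

lemma topspace_product: "topspace zar2 = pts2"
proof
 show "topspace zar2 <= pts2"
 proof
  fix z assume "z : topspace zar2"
  then obtain s where "s : product_basis V W" "z : s" unfolding product_zariski_eq by auto
  thus "z : pts2"
  proof (elim product_basisE)
  fix A B assume "openin (zariski V) A" "openin (zariski W) B"
  hence "A <= pts V" "B <= pts W" by (auto dest: openin_subset)
  moreover fix c d and m :: nat assume "s = {(x, y). x : A & y : B & (SUM i<m. c i x * d i y) ~= 0}"
  ultimately show ?thesis using \<open>z : s\<close> by auto
  qed
 qed
 have "{(x, y). x : pts V & y : pts W & (SUM i<Suc 0. (%_ _. 1 :: 'k) i x * (%_ _. 1) i y) ~= 0}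
  : product_basis V W"
  by (rule product_basisI) (simp_all add: V.regular_const W.regular_const)
 moreover have "{(x, y). x : pts V & y : pts W & (SUM i<Suc 0. (%_ _. 1 :: 'k) i x * (%_ _. 1) i y) ~= 0}
  = pts2" by auto
 ultimately show "pts2 <= topspace zar2"
  unfolding product_zariski_eq by auto
qed

text \<open>The finite sets \<open>E1\<close> and \<open>E2\<close> stand for the complements of the
  open sets of the factors. \<open>F\<close> has to be a tensor at \<open>(P, Q)\<close> only; the
  finitely many points where its coefficients cease to be regular are removed when an open set is
  recovered in \<open>eventually_near2\<close>.\<close>

definition nbhd2 :: "'p => 'q => ('p \<times> 'q => bool) => bool" where
 "nbhd2 P Q R <-> (EX F E1 E2. F : tns P Q & F (P, Q) ~= 0 & finite E1 & finite E2 & P ~: E1 & Q ~: E2 &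
  (ALL x:pts V - E1. ALL y:pts W - E2. F (x, y) ~= 0 --> R (x, y)))"

lemma nbhd2I:
 "F : tns P Q ==> F (P, Q) ~= 0 ==> finite E1 ==> finite E2 ==> P ~: E1 ==> Q ~: E2 ==>
  (!!x y. x : pts V ==> x ~: E1 ==> y : pts W ==> y ~: E2 ==> F (x, y) ~= 0 ==> R (x, y)) ==> nbhd2 P Q R"
 unfolding nbhd2_def by (intro exI[of _ F] exI[of _ E1] exI[of _ E2]) auto

lemma nbhd2E:
 assumes "nbhd2 P Q R"
 obtains F E1 E2 where "F : tns P Q" "F (P, Q) ~= 0" "finite E1" "finite E2" "P ~: E1" "Q ~: E2"
  "!!x y. x : pts V ==> x ~: E1 ==> y : pts W ==> y ~: E2 ==> F (x, y) ~= 0 ==> R (x, y)"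
 using assms unfolding nbhd2_def by (elim exE conjE) (simp add: Ball_def)

lemma nbhd2_conj:
 assumes PQ: "P : pts V" "Q : pts W" and "nbhd2 P Q R" "nbhd2 P Q S"
 shows "nbhd2 P Q (%z. R z & S z)"
proof (rule nbhd2E[OF assms(3)], rule nbhd2E[OF assms(4)])
 fix F E1 E2 G D1 D2
 assume F: "F : tns P Q" "F (P, Q) ~= 0" "finite E1" "finite E2" "P ~: E1" "Q ~: E2"
  "!!x y. x : pts V ==> x ~: E1 ==> y : pts W ==> y ~: E2 ==> F (x, y) ~= 0 ==> R (x, y)"
  and G: "G : tns P Q" "G (P, Q) ~= 0" "finite D1" "finite D2" "P ~: D1" "Q ~: D2"
  "!!x y. x : pts V ==> x ~: D1 ==> y : pts W ==> y ~: D2 ==> G (x, y) ~= 0 ==> S (x, y)"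
 show ?thesis
  by (rule nbhd2I[OF tensors_mult[OF PQ F(1) G(1)], of "E1 Un D1" "E2 Un D2"]) (use F G in auto)
qed

lemma openin_product_nbhd2:
 assumes "openin zar2 U" "(P, Q) : U"
 shows "P : pts V & Q : pts W & nbhd2 P Q (%z. z : U)"
proof -
 have "generate_topology_on (product_basis V W) U"
  using assms(1) unfolding product_zariski_eq openin_topology_generated_by_iff .
 hence "ALL P Q. (P, Q) : U --> P : pts V & Q : pts W & nbhd2 P Q (%z. z : U)"
 proof induction
  case Empty
  thus ?case by simp
 next
  case (Int a b)
  show ?case
  proof (intro allI impI)
  fix P Q assume "(P, Q) : a Int b"
  hence *: "P : pts V" "Q : pts W" "nbhd2 P Q (%z. z : a)" "nbhd2 P Q (%z. z : b)"
  using Int by auto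
  have "nbhd2 P Q (%z. z : a Int b)" using nbhd2_conj[OF *] by simp
  thus "P : pts V & Q : pts W & nbhd2 P Q (%z. z : a Int b)" using * by simp
  qed
 next
  case (UN K)
  show ?case
  proof (intro allI impI)
  fix P Q assume "(P, Q) : \<Union> K"
  then obtain k where k: "k : K" "(P, Q) : k" by blast
  with UN have *: "P : pts V" "Q : pts W" "nbhd2 P Q (%z. z : k)" by auto
  show "P : pts V & Q : pts W & nbhd2 P Q (%z. z : \<Union> K)"
  proof (intro conjI *, rule nbhd2E[OF *(3)])
  fix F E1 E2
  assume F: "F : tns P Q" "F (P, Q) ~= 0" "finite E1" "finite E2" "P ~: E1" "Q ~: E2"
  "!!x y. x : pts V ==> x ~: E1 ==> y : pts W ==> y ~: E2 ==> F (x, y) ~= 0 ==> (x, y) : k"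
  show "nbhd2 P Q (%z. z : \<Union> K)"
  by (rule nbhd2I[OF F(1-6)]) (use F(7) k in blast)
  qed
  qed
 next
  case (Basis s)
  then obtain A B c d and m :: nat where s: "s = {(x, y). x : A & y : B & (SUM i<m. c i x * d i y) ~= 0}"
  "openin (zariski V) A" "openin (zariski W) B"
  "ALL i<m. (ALL x:A. c i : reg V x) & (ALL y:B. d i : reg W y)" by (rule product_basisE)
  show ?case
  proof (intro allI impI)
  fix P Q assume "(P, Q) : s"
  hence PQ: "P : A" "Q : B" "(SUM i<m. c i P * d i Q) ~= 0" unfolding s by auto
  have AB: "P : pts V" "Q : pts W" "finite (pts V - A)" "finite (pts W - B)"
  using s(2,3) PQ unfolding V.openin_iff W.openin_iff by auto
  have t: "(%z. SUM i<m. c i (fst z) * d i (snd z)) : tns P Q"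
  unfolding tensors_iff using s(4) PQ by (intro exI[of _ m] exI[of _ c] exI[of _ d]) auto
  have "nbhd2 P Q (%z. z : s)"
  by (rule nbhd2I[OF t _ AB(3,4)]) (use PQ s(1) in auto)
  thus "P : pts V & Q : pts W & nbhd2 P Q (%z. z : s)" using AB by simp
  qed
 qed
 thus ?thesis using assms(2) by blast
qed

lemma eventually_near2:
 assumes PQ: "P : pts V" "Q : pts W"
 shows "eventually R (nhdsin zar2 (P, Q)) <-> nbhd2 P Q R"
proof
 assume "eventually R (nhdsin zar2 (P, Q))"
 then obtain U where U: "openin zar2 U" "(P, Q) : U" "ALL z:U. R z"
  using PQ by (auto simp: eventually_nhdsin topspace_product)
 from openin_product_nbhd2[OF U(1,2)] have "nbhd2 P Q (%z. z : U)" by simp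
 thus "nbhd2 P Q R" by (rule nbhd2E) (rule nbhd2I, use U in auto)
next
 assume "nbhd2 P Q R"
 thus "eventually R (nhdsin zar2 (P, Q))"
 proof (rule nbhd2E)
  fix F E1 E2
  assume F: "F : tns P Q" "F (P, Q) ~= 0" "finite E1" "finite E2" "P ~: E1" "Q ~: E2"
  "!!x y. x : pts V ==> x ~: E1 ==> y : pts W ==> y ~: E2 ==> F (x, y) ~= 0 ==> R (x, y)"
  from F(1) obtain m a b where m: "ALL i<m. a i : reg V P & b i : reg W Q"
  "F = (%z. SUM i<(m::nat). a i (fst z) * b i (snd z))" unfolding tensors_iff by (elim exE conjE)
  define A where "A = {x : pts V. x ~: E1 & (ALL i<m. a i : reg V x)}"
  define B where "B = {y : pts W. y ~: E2 & (ALL i<m. b i : reg W y)}"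
  have "EV x in V.near P. x ~: E1 & (ALL i:{..<m}. a i : reg V x)"
  unfolding eventually_conj_iff eventually_ball_finite_distrib[OF finite_lessThan]
  using V.regular_open[OF PQ(1)] m F(3,5) by (auto simp: V.eventually_near_iff[OF PQ(1)] Int_def[symmetric])
  hence *: "P ~: E1" "ALL i<m. a i : reg V P"
  "finite {x : pts V. ~ (x ~: E1 & (ALL i:{..<m}. a i : reg V x))}"
  unfolding V.eventually_near_iff[OF PQ(1)] by auto
  have "pts V - A <= {x : pts V. ~ (x ~: E1 & (ALL i:{..<m}. a i : reg V x))}"
  unfolding A_def by auto
  hence "finite (pts V - A)" using *(3) finite_subset by blast
  hence A: "P : A" "openin (zariski V) A"
  unfolding V.openin_iff using * PQ by (auto simp: A_def)
  have "EV x in W.near Q. x ~: E2 & (ALL i:{..<m}. b i : reg W x)"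
  unfolding eventually_conj_iff eventually_ball_finite_distrib[OF finite_lessThan]
  using W.regular_open[OF PQ(2)] m F(4,6) by (auto simp: W.eventually_near_iff[OF PQ(2)] Int_def[symmetric])
  hence *: "Q ~: E2" "ALL i<m. b i : reg W Q"
  "finite {x : pts W. ~ (x ~: E2 & (ALL i:{..<m}. b i : reg W x))}"
  unfolding W.eventually_near_iff[OF PQ(2)] by auto
  have "pts W - B <= {x : pts W. ~ (x ~: E2 & (ALL i:{..<m}. b i : reg W x))}"
  unfolding B_def by auto
  hence "finite (pts W - B)" using *(3) finite_subset by blast
  hence B: "Q : B" "openin (zariski W) B"
  unfolding W.openin_iff using * PQ by (auto simp: B_def)
  define U where "U = {(x, y). x : A & y : B & (SUM i<m. a i x * b i y) ~= 0}"
  have "openin zar2 U"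
  unfolding product_zariski_eq U_def
  by (rule topology_generated_by_Basis, rule product_basisI) (use A B in "auto simp: A_def B_def")
  moreover have "(P, Q) : U" using A B F(2) m(2) by (simp add: U_def)
  moreover have "ALL z:U. R z" using F(7) m(2) by (auto simp: U_def A_def B_def)
  ultimately show "eventually R (nhdsin zar2 (P, Q))"
  unfolding eventually_nhdsin by blast
 qed
qed

abbreviation near2 :: "'p => 'q => ('p \<times> 'q) filter" where
 "near2 P Q == nhdsin zar2 (P, Q)"

abbreviation reg2 :: "'p => 'q => ('p \<times> 'q => 'k) set" where
 "reg2 P Q == reg (product_space V W) (P, Q)"

lemma near2_self: "P : pts V ==> Q : pts W ==> eventually R (near2 P Q) ==> R (P, Q)"
 by (auto simp: eventually_near2 elim: nbhd2E)

lemma near2_nonzero: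
 assumes "P : pts V" "Q : pts W" "F : tns P Q" "F (P, Q) ~= 0"
 shows "EV z in near2 P Q. F z ~= 0"
 unfolding eventually_near2[OF assms(1,2)] by (rule nbhd2I[OF assms(3,4), of "{}" "{}"]) auto

lemma near2_fstI:
 assumes "P : pts V" "Q : pts W" "eventually R (V.near P)"
 shows "EV z in near2 P Q. R (fst z)"
proof -
 have *: "R P" "finite {x : pts V. ~ R x}" using assms V.eventually_near_iff by auto
 show ?thesis
  unfolding eventually_near2[OF assms(1,2)]
  by (rule nbhd2I[OF tensors_const[OF assms(1,2), of 1] _ *(2), of "{}"]) (use * in auto)
qed

lemma near2_sndI:
 assumes "P : pts V" "Q : pts W" "eventually R (W.near Q)"
 shows "EV z in near2 P Q. R (snd z)"
proof -
 have *: "R Q" "finite {x : pts W. ~ R x}" using assms W.eventually_near_iff by auto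
 show ?thesis
  unfolding eventually_near2[OF assms(1,2)]
  by (rule nbhd2I[OF tensors_const[OF assms(1,2), of 1] _ _ *(2), of "{}"]) (use * in auto)
qed

lemma near2_points: "P : pts V ==> Q : pts W ==> EV z in near2 P Q. z : pts2"
 by (metis eventually_nhdsin openin_topspace topspace_product)

lemma near2_near2:
 assumes "P : pts V" "Q : pts W" "eventually R (near2 P Q)"
 shows "EV z in near2 P Q. eventually R (nhdsin zar2 z)"
proof -
 obtain U where U: "openin zar2 U" "(P, Q) : U" "ALL z:U. R z"
  using assms by (auto simp: eventually_nhdsin topspace_product)
 thus ?thesis unfolding eventually_nhdsin by blast
qed

lemma regular2_iff:
 assumes PQ: "P : pts V" "Q : pts W"
 shows "f : reg2 P Q <-> (EX F:tns P Q. EX G:tns P Q. G (P, Q) ~= 0 &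
  (EV z in near2 P Q. f z = F z / G z))" (is "_ <-> ?R")
proof
 assume "f : reg2 P Q"
 hence "EX (m::nat) a b c d.
  (ALL i<m. a i : reg V P & b i : reg W Q & c i : reg V P & d i : reg W Q) &
  (SUM i<m. c i P * d i Q) ~= 0 &
  (EV (x, y) in near2 P Q. f (x, y) = (SUM i<m. a i x * b i y) / (SUM i<m. c i x * d i y))"
  by (simp add: product_space_def)
 then obtain a b c d and m :: nat where *:
  "ALL i<m. a i : reg V P & b i : reg W Q & c i : reg V P & d i : reg W Q"
  "(SUM i<m. c i P * d i Q) ~= 0"
  "EV (x, y) in near2 P Q. f (x, y) = (SUM i<m. a i x * b i y) / (SUM i<m. c i x * d i y)" by (elim exE conjE)
 let ?F = "%z. SUM i<m. a i (fst z) * b i (snd z)" and ?G = "%z. SUM i<m. c i (fst z) * d i (snd z)"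
 have "?F : tns P Q" unfolding tensors_iff
  by (rule exI[of _ m], rule exI[of _ a], rule exI[of _ b]) (use * in simp)
 moreover have "?G : tns P Q" unfolding tensors_iff
  by (rule exI[of _ m], rule exI[of _ c], rule exI[of _ d]) (use * in simp)
 moreover have "?G (P, Q) ~= 0" using * by simp
 moreover have "EV z in near2 P Q. f z = ?F z / ?G z" using *(3) by (simp add: case_prod_unfold)
 ultimately show ?R by (intro bexI[of _ ?F] bexI[of _ ?G] conjI)
next
 assume ?R
 then obtain F G where F: "F : tns P Q" and G: "G : tns P Q" "G (P, Q) ~= 0"
  and f: "EV z in near2 P Q. f z = F z / G z" by (elim bexE conjE)
 from F obtain m a b where a: "ALL i<m. a i : reg V P & b i : reg W Q"
  "F = (%z. SUM i<(m::nat). a i (fst z) * b i (snd z))" unfolding tensors_iff by (elim exE conjE)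
 from G(1) obtain n c d where c: "ALL i<n. c i : reg V P & d i : reg W Q"
  "G = (%z. SUM i<(n::nat). c i (fst z) * d i (snd z))" unfolding tensors_iff by (elim exE conjE)
 \<comment> \<open>\<open>product_space\<close> uses one number of summands for numerator and
   denominator, so the shorter sum is padded with zeros.\<close>
 define N where "N = max m n"
 define a' where "a' = (%i. if i < m then a i else (%_. 0))"
 define b' where "b' = (%i. if i < m then b i else (%_. 0))"
 define c' where "c' = (%i. if i < n then c i else (%_. 0))"
 define d' where "d' = (%i. if i < n then d i else (%_. 0))"
 have F': "F (x, y) = (SUM i<N. a' i x * b' i y)" for x y
  unfolding a(2) by (simp, rule sum.mono_neutral_cong_left) (auto simp: N_def a'_def b'_def)
 have G': "G (x, y) = (SUM i<N. c' i x * d' i y)" for x y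
  unfolding c(2) by (simp, rule sum.mono_neutral_cong_left) (auto simp: N_def c'_def d'_def)
 have "ALL i<N. a' i : reg V P & b' i : reg W Q & c' i : reg V P & d' i : reg W Q"
  using a(1) c(1) V.regular_const[OF PQ(1), of 0] W.regular_const[OF PQ(2), of 0]
  by (auto simp: a'_def b'_def c'_def d'_def)
 moreover have "(SUM i<N. c' i P * d' i Q) ~= 0" using G(2) G' by simp
 moreover have "EV (x, y) in near2 P Q. f (x, y) = (SUM i<N. a' i x * b' i y) / (SUM i<N. c' i x * d' i y)"
  using f by (simp add: case_prod_unfold F'[symmetric] G'[symmetric])
 ultimately have "EX (m::nat) a b c d.
  (ALL i<m. a i : reg V P & b i : reg W Q & c i : reg V P & d i : reg W Q) &
  (SUM i<m. c i P * d i Q) ~= 0 &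
  (EV (x, y) in near2 P Q. f (x, y) = (SUM i<m. a i x * b i y) / (SUM i<m. c i x * d i y))"
  by (intro exI[of _ N] exI[of _ a'] exI[of _ b'] exI[of _ c'] exI[of _ d'] conjI)
 thus "f : reg2 P Q" by (simp add: product_space_def)
qed

lemma regular2I:
 assumes "P : pts V" "Q : pts W" "F : tns P Q" "G : tns P Q" "G (P, Q) ~= 0"
  "EV z in near2 P Q. f z = F z / G z"
 shows "f : reg2 P Q"
 unfolding regular2_iff[OF assms(1,2)] using assms(3-) by (intro bexI[of _ F] bexI[of _ G] conjI)

lemma regular2E:
 assumes "P : pts V" "Q : pts W" "f : reg2 P Q"
 obtains F G where "F : tns P Q" "G : tns P Q" "G (P, Q) ~= 0"
  "EV z in near2 P Q. f z = F z / G z" "EV z in near2 P Q. G z ~= 0"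
 using assms(3) unfolding regular2_iff[OF assms(1,2)] by (elim bexE conjE) (simp add: near2_nonzero[OF assms(1,2)])

lemma regular2_tensors: "P : pts V ==> Q : pts W ==> F : tns P Q ==> F : reg2 P Q"
 by (rule regular2I[of _ _ F "%_. 1"]) (auto intro: tensors_const always_eventually)

lemma regular2_add:
 assumes "P : pts V" "Q : pts W" "f : reg2 P Q" "g : reg2 P Q"
 shows "(%z. f z + g z) : reg2 P Q"
proof (rule regular2E[OF assms(1-3)], rule regular2E[OF assms(1,2,4)])
 fix F G F' G'
 assume F: "F : tns P Q" "G : tns P Q" "G (P, Q) ~= 0" "EV z in near2 P Q. f z = F z / G z"
  "EV z in near2 P Q. G z ~= 0"
  and F': "F' : tns P Q" "G' : tns P Q" "G' (P, Q) ~= 0" "EV z in near2 P Q. g z = F' z / G' z"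
  "EV z in near2 P Q. G' z ~= 0"
 have ev: "EV z in near2 P Q. f z + g z = (F z * G' z + F' z * G z) / (G z * G' z)"
  using F(4,5) F'(4,5) by eventually_elim (simp add: field_simps)
 show ?thesis
  by (rule regular2I[OF assms(1,2) _ _ _ ev])
  (use F F' in "auto intro!: tensors_add tensors_mult assms")
qed

lemma regular2_mult:
 assumes "P : pts V" "Q : pts W" "f : reg2 P Q" "g : reg2 P Q"
 shows "(%z. f z * g z) : reg2 P Q"
proof (rule regular2E[OF assms(1-3)], rule regular2E[OF assms(1,2,4)])
 fix F G F' G'
 assume F: "F : tns P Q" "G : tns P Q" "G (P, Q) ~= 0" "EV z in near2 P Q. f z = F z / G z"
  and F': "F' : tns P Q" "G' : tns P Q" "G' (P, Q) ~= 0" "EV z in near2 P Q. g z = F' z / G' z"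
 have ev: "EV z in near2 P Q. f z * g z = (F z * F' z) / (G z * G' z)"
  using F(4) F'(4) by eventually_elim simp
 show ?thesis
  by (rule regular2I[OF assms(1,2) _ _ _ ev])
  (use F F' in "auto intro!: tensors_mult assms")
qed

lemma regular2_inverse:
 assumes "P : pts V" "Q : pts W" "f : reg2 P Q" "f (P, Q) ~= 0"
 shows "(%z. inverse (f z)) : reg2 P Q"
proof (rule regular2E[OF assms(1-3)])
 fix F G
 assume F: "F : tns P Q" "G : tns P Q" "G (P, Q) ~= 0" "EV z in near2 P Q. f z = F z / G z"
 have ev: "EV z in near2 P Q. inverse (f z) = G z / F z"
  using F(4) by eventually_elim simp
 have "F (P, Q) ~= 0" using near2_self[OF assms(1,2) F(4)] assms(4) by auto
 thus ?thesis by (rule regular2I[OF assms(1,2) F(2,1) _ ev])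
qed

lemma regular2_const: "P : pts V ==> Q : pts W ==> (%_. c) : reg2 P Q"
 by (intro regular2_tensors tensors_const)

lemma regular2_fst: "P : pts V ==> Q : pts W ==> a : reg V P ==> (%z. a (fst z)) : reg2 P Q"
 by (intro regular2_tensors tensors_fst)

lemma regular2_snd: "P : pts V ==> Q : pts W ==> a : reg W Q ==> (%z. a (snd z)) : reg2 P Q"
 by (intro regular2_tensors tensors_snd)

lemma regular2_diff:
 assumes "P : pts V" "Q : pts W" "f : reg2 P Q" "g : reg2 P Q"
 shows "(%z. f z - g z) : reg2 P Q"
 using regular2_add[OF assms(1-3) regular2_mult[OF assms(1,2) regular2_const[OF assms(1,2), of "- 1"] assms(4)]] by simp

lemma regular2_sum:
 "P : pts V ==> Q : pts W ==> (!!i. i : I ==> f i : reg2 P Q) ==> (%z. SUM i:I. f i z) : reg2 P Q"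
 by (induction I rule: infinite_finite_induct) (auto intro: regular2_add regular2_const)

lemma regular2_power:
 "P : pts V ==> Q : pts W ==> f : reg2 P Q ==> (%z. f z ^ n) : reg2 P Q"
 by (induction n) (auto intro: regular2_mult regular2_const)

lemma regular2_nonzero:
 assumes "P : pts V" "Q : pts W" "f : reg2 P Q" "f (P, Q) ~= 0"
 shows "EV z in near2 P Q. f z ~= 0"
proof (rule regular2E[OF assms(1-3)])
 fix F G
 assume F: "F : tns P Q" "EV z in near2 P Q. f z = F z / G z" "EV z in near2 P Q. G z ~= 0"
 have "F (P, Q) ~= 0" using near2_self[OF assms(1,2) F(2)] assms(4) by auto
 from near2_nonzero[OF assms(1,2) F(1) this] F(2,3) show ?thesis by eventually_elim simp
qed

end

section \<open>Morphisms at a point and pullback of germs\<close>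

definition morphism_at ::
  "('r, 'k::field) function_space => ('p, 'k) function_space => ('r => 'p) => 'r => bool" where
 "morphism_at X V u x <-> x : pts X & u x : pts V &
  (ALL a:reg V (u x). (%y. a (u y)) : reg X x) &
  (ALL R. eventually R (nhdsin (zariski V) (u x)) --> eventually (%y. R (u y)) (nhdsin (zariski X) x))"

lemma morphism_at_eventually:
 "morphism_at X V u x ==> eventually R (nhdsin (zariski V) (u x)) ==>
  EV y in nhdsin (zariski X) x. R (u y)"
 by (auto simp: morphism_at_def)

lemma morphism_at_points: "morphism_at X V u x ==> x : pts X" "morphism_at X V u x ==> u x : pts V"
 by (auto simp: morphism_at_def)

lemma morphism_at_id: "x : pts X ==> morphism_at X X (%y. y) x"
 by (simp add: morphism_at_def)

lemma (in curve) morphism_at_const: "x : pts V ==> P : pts W ==> morphism_at V W (%_. P) x"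
 by (auto simp: morphism_at_def regular_const eventually_nhdsin)

lemma morphism_at_comp:
 "morphism_at X Y u x ==> morphism_at Y Z v (u x) ==> morphism_at X Z (%y. v (u y)) x"
 unfolding morphism_at_def
proof (elim conjE, intro conjI ballI allI impI)
 fix a
 assume "ALL a:reg Y (u x). (%y. a (u y)) : reg X x" "ALL a:reg Z (v (u x)). (%y. a (v y)) : reg Y (u x)"
  "a : reg Z (v (u x))"
 thus "(%y. a (v (u y))) : reg X x" by (auto dest!: bspec)
next
 fix R
 assume "ALL R. eventually R (nhdsin (zariski Y) (u x)) --> (EV y in nhdsin (zariski X) x. R (u y))"
  "ALL R. eventually R (nhdsin (zariski Z) (v (u x))) --> (EV y in nhdsin (zariski Y) (u x). R (v y))"
  "eventually R (nhdsin (zariski Z) (v (u x)))"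
 thus "EV y in nhdsin (zariski X) x. R (v (u y))" by (auto dest!: spec[of _ R] spec[of _ "%y. R (v y)"])
qed auto

context curve_pair
begin

lemma tensors_pullback:
 assumes X: "curve X" and u: "morphism_at X V u x" and v: "morphism_at X W v x" and "F : tns (u x) (v x)"
 shows "(%y. F (u y, v y)) : reg X x"
proof -
 interpret X: curve X by fact
 have x: "x : pts X" using u by (simp add: morphism_at_def)
 show ?thesis using assms(4)
 proof induction
  case zero
  show ?case using X.regular_const[OF x] by simp
 next
  case (step F a b)
  have "(%y. a (u y)) : reg X x" "(%y. b (v y)) : reg X x"
  using u v step by (auto simp: morphism_at_def)
  thus ?case using X.regular_add[OF x step.IH X.regular_mult[OF x]] by simp
 qed
qed

lemma near2_pullback:
 assumes X: "curve X" and u: "morphism_at X V u x" and v: "morphism_at X W v x" and R: "eventually R (near2 (u x) (v x))"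
 shows "EV y in nhdsin (zariski X) x. R (u y, v y)"
proof -
 interpret X: curve X by fact
 have x: "x : pts X" "u x : pts V" "v x : pts W" using u v by (auto simp: morphism_at_def)
 have "nbhd2 (u x) (v x) R" using R eventually_near2[OF x(2,3)] by simp
 thus ?thesis
 proof (rule nbhd2E)
  fix F E1 E2
  assume F: "F : tns (u x) (v x)" "F (u x, v x) ~= 0" "finite E1" "finite E2" "u x ~: E1" "v x ~: E2"
  "!!x y. x : pts V ==> x ~: E1 ==> y : pts W ==> y ~: E2 ==> F (x, y) ~= 0 ==> R (x, y)"
  have 1: "EV y in X.near x. F (u y, v y) ~= 0"
  using X.eventually_nonzero[OF x(1) tensors_pullback[OF X u v F(1)]] F(2) by simp
  have "EV y in V.near (u x). y ~: E1 & y : pts V"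
  using V.near_avoid[OF x(2) F(3,5)] .
  hence 2: "EV y in X.near x. u y ~: E1 & u y : pts V" by (rule morphism_at_eventually[OF u])
  have "EV y in W.near (v x). y ~: E2 & y : pts W"
  using W.near_avoid F(4,6) x by blast
  hence 3: "EV y in X.near x. v y ~: E2 & v y : pts W" by (rule morphism_at_eventually[OF v])
  show ?thesis using 1 2 3 by eventually_elim (simp add: F(7))
 qed
qed

lemma regular2_pullback:
 assumes X: "curve X" and u: "morphism_at X V u x" and v: "morphism_at X W v x" and f: "f : reg2 (u x) (v x)"
 shows "(%y. f (u y, v y)) : reg X x"
proof -
 interpret X: curve X by fact
 have x: "x : pts X" "u x : pts V" "v x : pts W" using u v by (auto simp: morphism_at_def)
 show ?thesis
 proof (rule regular2E[OF x(2,3) f])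
  fix F G
  assume F: "F : tns (u x) (v x)" "G : tns (u x) (v x)" "G (u x, v x) ~= 0"
  "EV z in near2 (u x) (v x). f z = F z / G z"
  have "(%y. F (u y, v y) * inverse (G (u y, v y))) : reg X x"
  by (intro X.regular_mult X.regular_inverse tensors_pullback[OF X u v] x F)
  moreover have "EV y in X.near x. F (u y, v y) * inverse (G (u y, v y)) = f (u y, v y)"
  using near2_pullback[OF X u v F(4)] by eventually_elim (simp add: field_simps)
  ultimately show ?thesis by (rule X.regular_cong[OF x(1)])
 qed
qed

text \<open>Pullback along a product of two maps, from a product of curves to a product of curves;
  \<open>tensors_pullback\<close> concerns the pair \<open>(u, v)\<close> on a single curve.\<close>

lemma tensors_pullback2:
 assumes u: "morphism_at X V u x" and v: "morphism_at Y W v y" and "F : tns (u x) (v y)"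
 shows "(%z. F (u (fst z), v (snd z))) : tensors X Y x y"
 using assms(3)
proof induction
 case zero
 show ?case by (rule tensors.zero)
next
 case (step F a b)
 have "(%y. a (u y)) : reg X x" "(%x. b (v x)) : reg Y y"
  using u v step by (auto simp: morphism_at_def)
 from tensors.step[OF step.IH this] show ?case by simp
qed

lemma near2_pullback2:
 assumes X: "curve X" and Y: "curve Y" and u: "morphism_at X V u x" and v: "morphism_at Y W v y"
  and R: "eventually R (near2 (u x) (v y))"
 shows "EV z in nhdsin (product_zariski X Y) (x, y). R (u (fst z), v (snd z))"
proof -
 interpret X: curve X by fact
 interpret Y: curve Y by fact
 interpret XY: curve_pair X Y ..
 have x: "x : pts X" "u x : pts V" "y : pts Y" "v y : pts W" using u v by (auto simp: morphism_at_def)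
 have "nbhd2 (u x) (v y) R" using R eventually_near2[OF x(2,4)] by simp
 thus ?thesis
 proof (rule nbhd2E)
  fix F E1 E2
  assume F: "F : tns (u x) (v y)" "F (u x, v y) ~= 0" "finite E1" "finite E2" "u x ~: E1" "v y ~: E2"
  "!!x y. x : pts V ==> x ~: E1 ==> y : pts W ==> y ~: E2 ==> F (x, y) ~= 0 ==> R (x, y)"
  have "EV y in V.near (u x). y ~: E1 & y : pts V"
  using V.near_avoid[OF x(2) F(3,5)] .
  hence "EV y in X.near x. u y ~: E1 & u y : pts V" by (rule morphism_at_eventually[OF u])
  hence 2: "finite {y : pts X. ~ (u y ~: E1 & u y : pts V)}" by (rule X.eventually_near_finite[OF x(1)])
  have "EV y in W.near (v y). y ~: E2 & y : pts W"
  using W.near_avoid F(4,6) x by blast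
  hence "EV y in Y.near y. v y ~: E2 & v y : pts W" by (rule morphism_at_eventually[OF v])
  hence 3: "finite {z : pts Y. ~ (v z ~: E2 & v z : pts W)}" by (rule Y.eventually_near_finite[OF x(3)])
  show ?thesis unfolding XY.eventually_near2[OF x(1,3)]
  by (rule XY.nbhd2I[OF tensors_pullback2[OF u v F(1)] _ 2 3]) (use F x in auto)
 qed
qed

lemma regular2_pullback2:
 assumes X: "curve X" and Y: "curve Y" and u: "morphism_at X V u x" and v: "morphism_at Y W v y"
  and f: "f : reg2 (u x) (v y)"
 shows "(%z. f (u (fst z), v (snd z))) : reg (product_space X Y) (x, y)"
proof -
 interpret X: curve X by fact
 interpret Y: curve Y by fact
 interpret XY: curve_pair X Y ..
 have x: "x : pts X" "u x : pts V" "y : pts Y" "v y : pts W" using u v by (auto simp: morphism_at_def)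
 show ?thesis
 proof (rule regular2E[OF x(2,4) f])
  fix F G
  assume F: "F : tns (u x) (v y)" "G : tns (u x) (v y)" "G (u x, v y) ~= 0"
  "EV z in near2 (u x) (v y). f z = F z / G z"
  show ?thesis
  by (rule XY.regular2I[OF x(1,3) tensors_pullback2[OF u v F(1)] tensors_pullback2[OF u v F(2)]])
  (use F(3) near2_pullback2[OF X Y u v F(4)] in auto)
 qed
qed

end

section \<open>Curves of finite type\<close>

text \<open>What is kept of projectivity: functions separating a point from finitely many others,
  germs at \<open>P\<close> that are fractions of germs at any \<open>Q\<close>, and germs that are
  fractions from a finitely generated algebra whose generators separate points off a finite set.
  This is asked of the curve upstairs; the quotient is only shown to be a
  \<open>curve\<close>.\<close>

locale algebraic_curve = curve V for V :: "('p, 'k::field_char_0) function_space" +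
 assumes separation: "P : pts V ==> finite T ==> T <= pts V ==> P ~: T ==>
  EX th:reg V P. th P = 1 & (ALL Q:T. th : reg V Q & th Q = 0)"
  and meromorphic: "P : pts V ==> Q : pts V ==> f : reg V P ==>
  EX a:reg V Q. EX b:reg V Q. ~ (EV x in nhdsin (zariski V) Q. b x = 0) &
  finite {x : pts V. f x * b x ~= a x}"
  and chart: "P : pts V ==> EX X. finite X & X <= reg V P &
  (ALL f:reg V P. EX A:fun_alg X. EX B:fun_alg X. B P ~= 0 &
  (EV x in nhdsin (zariski V) P. f x * B x = A x)) &
  (EX E. finite E & P ~: E &
  (ALL x:pts V - E. ALL y:pts V - E. (ALL xi:X. xi x = xi y) --> x = y))"
begin

sublocale VV: curve_pair V V ..

text \<open>A germ at \<open>P\<close> may have poles on \<open>T\<close>. A high power of a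
  function that is 1 at \<open>P\<close> and 0 on \<open>T\<close> removes them; the power is
  returned as \<open>th\<close>, so that the change made to \<open>f\<close> is known.\<close>

lemma semilocal:
 assumes P: "P : pts V" and f: "f : reg V P" and T: "finite T" "T <= pts V" "P ~: T"
 shows "EX c th. c : reg V P & th : reg V P & th P = 1 & (EV x in near P. c x = th x * f x) &
  (ALL Q:T. c : reg V Q & c Q = 0 & th : reg V Q & th Q = 0)"
proof -
 obtain th0 where th0: "th0 : reg V P" "th0 P = 1" "!!Q. Q : T ==> th0 : reg V Q & th0 Q = 0"
  using separation[OF P T] by auto
 define K where "K = (%Q n a b. a : reg V Q & has_order Q b n & finite {x : pts V. f x * b x ~= a x})"
 have "EX n a b. K Q n a b" if "Q : T" for Q
 proof -
  have Q: "Q : pts V" using that T by auto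
  from meromorphic[OF P Q f] obtain a b where ab: "a : reg V Q" "b : reg V Q"
  "~ (EV x in near Q. b x = 0)" "finite {x : pts V. f x * b x ~= a x}" by (elim bexE conjE)
  from has_order_ex[OF Q ab(2,3)] obtain n where "has_order Q b n" .
  hence "K Q n a b" using ab by (simp add: K_def)
  thus ?thesis by (intro exI)
 qed
 then obtain n a b where "!!Q. Q : T ==> K Q (n Q) (a Q) (b Q)" by metis
 hence nab: "!!Q. Q : T ==> a Q : reg V Q" "!!Q. Q : T ==> has_order Q (b Q) (n Q)"
  "!!Q. Q : T ==> finite {x : pts V. f x * b Q x ~= a Q x}"
  unfolding K_def by simp_all
 \<comment> \<open>\<open>n Q\<close> bounds the pole order of \<open>f\<close> at \<open>Q\<close>;
   the additional 1 makes the product vanish on \<open>T\<close>.\<close>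
 define N where "N = Suc (SUM Q:T. n Q)"
 have nN: "n Q < N" if "Q : T" for Q
  using member_le_sum[of Q T n] that T(1) by (simp add: N_def)
 \<comment> \<open>Functions are total and the values of \<open>f\<close> on \<open>T\<close> are
   arbitrary, so the product is set to 0 there by hand.\<close>
 define c where "c = (%x. if x : T then 0 else th0 x ^ N * f x)"
 have evP: "EV x in near P. th0 x ^ N * f x = c x"
  using near_avoid[OF P T(1,3)] by eventually_elim (simp add: c_def)
 have cP: "c : reg V P"
  by (rule regular_cong[OF P _ evP]) (intro regular_mult regular_power P th0 f)
 have cQ: "c : reg V Q" if Q: "Q : T" for Q
 proof -
  have QV: "Q : pts V" using that T by auto
  have thQ: "order_ge Q th0 1" using order_ge_1_iff[OF QV] th0(3)[OF Q] by blast
  have "order_ge Q (%x. PROD i<n Q. th0 x) (SUM i<n Q. 1)"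
  by (rule order_ge_prod[OF QV]) (use thQ in auto)
  hence "order_ge Q (%x. th0 x ^ n Q) (n Q)" by simp
  from order_ge_mult[OF QV this, of "a Q" 0] nab(1)[OF Q]
  have "order_ge Q (%x. th0 x ^ n Q * a Q x) (n Q)" by (simp add: order_ge_0)
  from order_ge_divide[OF QV nab(2)[OF Q] this] obtain w where
  w: "w : reg V Q" "EV x in near Q. th0 x ^ n Q * a Q x = b Q x * w x" .
  define u where "u = (%x. w x * th0 x ^ (N - n Q))"
  have ur: "u : reg V Q"
  unfolding u_def using th0(3)[OF Q] by (intro regular_mult regular_power QV w) auto
  have uQ: "u Q = 0" using th0(3)[OF Q] nN[OF Q] by (simp add: u_def power_0_left)
  have pw: "th0 x ^ N = th0 x ^ n Q * th0 x ^ (N - n Q)" for x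
  using nN[OF Q] by (simp add: power_add[symmetric])
  have "finite ({x : pts V. f x * b Q x ~= a Q x} Un {x : pts V. b Q x = 0} Un T Un 
  {x : pts V. ~ th0 x ^ n Q * a Q x = b Q x * w x})"
  using nab(3)[OF Q] has_order_finite_zeros[OF QV nab(2)[OF Q]] T(1) eventually_near_finite[OF QV w(2)] by simp
  hence "finite {x : pts V. ~ u x = c x}"
  proof (rule rev_finite_subset, safe)
  fix x assume x: "x : pts V" "u x ~= c x" "b Q x ~= 0" "x ~: T"
  "th0 x ^ n Q * a Q x = b Q x * w x" "f x * b Q x = a Q x"
  have "b Q x * u x = (b Q x * w x) * th0 x ^ (N - n Q)" by (simp add: u_def mult_ac)
  also have "... = (th0 x ^ n Q * (f x * b Q x)) * th0 x ^ (N - n Q)" unfolding x(5)[symmetric] x(6) ..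
  also have "... = b Q x * c x" using x(4) by (simp add: c_def pw mult_ac)
  finally have "b Q x * u x = b Q x * c x" .
  thus False using x by simp
  qed
  moreover have "u Q = c Q" using uQ Q by (simp add: c_def)
  ultimately have "EV x in near Q. u x = c x" using QV by (simp add: eventually_near_iff)
  thus ?thesis by (rule regular_cong[OF QV ur])
 qed
 define th where "th = (%x. th0 x ^ N)"
 have "th : reg V Q & th Q = 0" if "Q : T" for Q
  using th0(3)[OF that] T(2) that unfolding th_def by (auto simp: N_def intro!: regular_mult regular_power)
 moreover have "th : reg V P" "th P = 1" unfolding th_def using th0 by (auto intro!: regular_power P)
 moreover have "EV x in near P. c x = th x * f x" using evP unfolding th_def by eventually_elim simp
 moreover have "c Q = 0" if "Q : T" for Q using that by (simp add: c_def)
 ultimately show ?thesis using cP cQ by (intro exI[of _ c] exI[of _ th]) auto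
qed

lemma local_parameter:
 assumes P: "P : pts V" and T: "finite T" "T <= pts V" "P ~: T"
 shows "EX ta. has_order P ta 1 & (ALL Q:T. ta : reg V Q & ta Q = 1)"
proof -
 obtain c th where c: "c : reg V P" "th : reg V P" "th P = 1"
  "EV x in near P. c x = th x * unif P x"
  "ALL Q:T. c : reg V Q & c Q = 0 & th : reg V Q & th Q = 0"
  using semilocal[OF P unif(1)[OF P] T] by (elim exE conjE)
 \<comment> \<open>At \<open>P\<close> the square has order at least 2 and leaves the order 1 of
   \<open>c\<close> intact; on \<open>T\<close> both \<open>c\<close> and \<open>th\<close> are 0,
   so the value is 1.\<close>
 let ?ta = "%x. c x + (1 - th x) * (1 - th x)"
 have 1: "(%x. 1 - th x) : reg V P" by (intro regular_diff regular_const P c)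
 have c1: "has_order P c 1"
 proof (rule has_orderI[OF P has_order_uniformizer[OF P] c(2)])
  show "EV x in near P. c x = unif P x * th x" using c(4) by eventually_elim (simp add: mult.commute)
 qed (use c(3) in simp)
 have "order_ge P (%x. 1 - th x) 1" using order_ge_1_iff[OF P 1] c(3) by simp
 from order_ge_mult[OF P this this] have "order_ge P (%x. (1 - th x) * (1 - th x)) (Suc 1)" by simp
 from has_order_add_ge[OF P c1 this] have "has_order P ?ta 1" .
 moreover have "?ta : reg V Q & ?ta Q = 1" if "Q : T" for Q
  using c(5) that T(2) by (auto intro!: regular_add regular_mult regular_diff regular_const)
 ultimately show ?thesis by (intro exI[of _ ?ta]) simp
qed

text \<open>A form of Nakayama's lemma: generators of an ideal of the local ring at \<open>(P, P)\<close> which satisfy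
 \<open>D xi \<in> (T) + \<mm> (D et | et \<in> X)\<close> are multiples of \<open>T\<close>.\<close>

lemma nakayama:
 assumes P: "P : pts V" and X: "finite X"
  and D: "!!xi. xi : X ==> EX v m. v : VV.reg2 P P & (ALL et:X. m et : VV.reg2 P P & m et (P, P) = 0) &
  (EV z in VV.near2 P P. D xi z = T z * v z + (SUM et:X. m et z * D et z))"
 shows "ALL xi:X. EX v:VV.reg2 P P. EV z in VV.near2 P P. D xi z = T z * v z"
 using X D
proof (induction X rule: finite_induct)
 let ?A = "VV.reg2 P P" and ?B = "VV.near2 P P"
 case (insert x X)
 note reg = VV.regular2_mult[OF P P] VV.regular2_add[OF P P] VV.regular2_diff[OF P P] VV.regular2_const[OF P P]
  VV.regular2_inverse[OF P P] VV.regular2_sum[OF P P]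
 from insert.prems[OF insertI1] obtain v m where vm: "v : ?A"
  "ALL et:insert x X. m et : ?A & m et (P, P) = 0"
  "EV z in ?B. D x z = T z * v z + (SUM et:insert x X. m et z * D et z)"
  by (elim exE conjE)
 \<comment> \<open>\<open>m x\<close> vanishes at \<open>(P, P)\<close>, so \<open>1 - m x\<close>
   is a unit there. The relation is solved for \<open>D x\<close>, which is then eliminated from the
   relations of the other generators.\<close>
 define w where "w = (%z. inverse (1 - m x z))"
 have m1: "(%z. 1 - m x z) : ?A" "1 - m x (P, P) ~= 0" using vm(2) by (auto intro!: reg)
 have w: "w : ?A" unfolding w_def by (rule VV.regular2_inverse[OF P P m1])
 have Dx: "EV z in ?B. D x z = T z * (w z * v z) + (SUM et:X. (w z * m et z) * D et z)"
  using vm(3) VV.regular2_nonzero[OF P P m1]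
 proof eventually_elim
  case (elim z)
  hence "(1 - m x z) * D x z = T z * v z + (SUM et:X. m et z * D et z)"
  using insert.hyps by (simp add: algebra_simps)
  hence "D x z = w z * (T z * v z + (SUM et:X. m et z * D et z))"
  using elim(2) by (simp add: w_def field_simps)
  thus ?case by (simp add: algebra_simps sum_distrib_left)
 qed
 have IH: "ALL xi:X. EX v:?A. EV z in ?B. D xi z = T z * v z"
 proof (rule insert.IH)
  fix xi assume "xi : X"
  from insert.prems[OF insertI2[OF this]] obtain v' m' where vm': "v' : ?A"
  "ALL et:insert x X. m' et : ?A & m' et (P, P) = 0"
  "EV z in ?B. D xi z = T z * v' z + (SUM et:insert x X. m' et z * D et z)"
  by (elim exE conjE)
  let ?v = "%z. v' z + m' x z * (w z * v z)"
  let ?m = "%et z. m' et z + m' x z * (w z * m et z)"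
  have "?v : ?A" using vm vm' w by (auto intro!: reg)
  moreover have "ALL et:X. ?m et : ?A & ?m et (P, P) = 0" using vm vm' w by (auto intro!: reg)
  moreover have "EV z in ?B. D xi z = T z * ?v z + (SUM et:X. ?m et z * D et z)"
  using Dx vm'(3)
  proof eventually_elim
  case (elim z)
  have "D xi z = T z * v' z + m' x z * D x z + (SUM et:X. m' et z * D et z)"
  using elim(2) insert.hyps by simp
  also have "m' x z * D x z = T z * (m' x z * (w z * v z)) + (SUM et:X. (m' x z * (w z * m et z)) * D et z)"
  unfolding elim(1) by (simp add: algebra_simps sum_distrib_left)
  finally show ?case by (simp add: algebra_simps sum.distrib)
  qed
  ultimately show "EX v m. v : ?A & (ALL et:X. m et : ?A & m et (P, P) = 0) &
  (EV z in ?B. D xi z = T z * v z + (SUM et:X. m et z * D et z))"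
  by (intro exI[of _ ?v] exI[of _ ?m] conjI)
 qed
 from bchoice[OF IH[unfolded Bex_def]] obtain u
  where u': "ALL xi:X. u xi : ?A & (EV z in ?B. D xi z = T z * u xi z)" ..
 hence u: "!!xi. xi : X ==> u xi : ?A"
  "!!xi. xi : X ==> EV z in ?B. D xi z = T z * u xi z" by simp_all
 have all: "EV z in ?B. ALL xi:X. D xi z = T z * u xi z"
  by (rule eventually_ball_finite[OF insert.hyps(1)]) (simp add: u(2))
 let ?v = "%z. w z * v z + (SUM et:X. w z * m et z * u et z)"
 have "?v : ?A" using vm w u by (auto intro!: reg)
 moreover have "EV z in ?B. D x z = T z * ?v z"
  using Dx all by eventually_elim (simp add: algebra_simps sum_distrib_left)
 ultimately have "EX v:?A. EV z in ?B. D x z = T z * v z"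
  by (intro bexI[of _ ?v])
 thus ?case using IH by simp
qed simp

text \<open>The ideal of the diagonal is generated by \<open>1 \<otimes> t - t \<otimes> 1\<close> at \<open>(P, P)\<close> for every local parameter \<open>t\<close>.\<close>

theorem difference_divisible:
 assumes P: "P : pts V" and t: "has_order P t 1" and f: "f : reg V P"
 shows "EX bt:VV.reg2 P P. EV z in VV.near2 P P. f (snd z) - f (fst z) = (t (snd z) - t (fst z)) * bt z"
proof -
 let ?A = "VV.reg2 P P" and ?B = "VV.near2 P P"
 obtain X where X: "finite X" "X <= reg V P"
  and X': "ALL f:reg V P. EX A:fun_alg X. EX B:fun_alg X. B P ~= 0 & (EV x in near P. f x * B x = A x)"
  using chart[OF P] by (elim exE conjE) (rule that)
 note XP = bspec[OF X']
 note reg = VV.regular2_mult[OF P P] VV.regular2_add[OF P P] VV.regular2_diff[OF P P] VV.regular2_const[OF P P]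
  VV.regular2_inverse[OF P P] VV.regular2_sum[OF P P] VV.regular2_fst[OF P P] VV.regular2_snd[OF P P]
 define D where "D = (%(f :: 'p => 'k) z. f (snd z) - f (fst z))"
 have XA: "f : reg V P" if "f : fun_alg X" for f
  using that by induction (use X in "auto intro: regular_const regular_add regular_mult P")
 \<comment> \<open>\<open>D\<close> obeys a product rule, so differences of polynomials in
   \<open>X\<close> are combinations of the differences of the generators.\<close>
 have alg: "EX w. (ALL et:X. w et : ?A) & (ALL z. D f z = (SUM et:X. w et z * D et z))" if "f : fun_alg X" for f
  using that
 proof induction
  case (const c)
  show ?case by (rule exI[of _ "%_ _. 0"]) (auto intro: reg simp: D_def)
 next
  case (gen f)
  have "D f z = (SUM et:X. (if et = f then 1 else 0) * D et z)" for z
  using gen X(1) by (simp add: if_distrib[where f="%z. z * _"] cong: if_cong)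
  thus ?case
  by (intro exI[of _ "%et z. if et = f then 1 else 0"]) (auto intro: reg)
 next
  case (add f g)
  then obtain v w where v: "ALL et:X. v et : ?A" "ALL z. D f z = (SUM et:X. v et z * D et z)"
  and w: "ALL et:X. w et : ?A" "ALL z. D g z = (SUM et:X. w et z * D et z)" by (elim exE conjE)
  have "D (%x. f x + g x) z = D f z + D g z" for z by (simp add: D_def)
  hence "D (%x. f x + g x) z = (SUM et:X. (v et z + w et z) * D et z)" for z
  using v(2) w(2) by (simp add: distrib_right sum.distrib)
  thus ?case using v(1) w(1) by (intro exI[of _ "%et z. v et z + w et z"]) (auto intro: reg)
 next
  case (mult f g)
  then obtain v w where v: "ALL et:X. v et : ?A" "ALL z. D f z = (SUM et:X. v et z * D et z)"
  and w: "ALL et:X. w et : ?A" "ALL z. D g z = (SUM et:X. w et z * D et z)" by (elim exE conjE)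
  have "D (%x. f x * g x) z = g (snd z) * D f z + f (fst z) * D g z" for z by (simp add: D_def algebra_simps)
  hence "D (%x. f x * g x) z = (SUM et:X. (g (snd z) * v et z + f (fst z) * w et z) * D et z)" for z
  using v(2) w(2) by (simp add: distrib_right sum.distrib sum_distrib_left mult.assoc)
  thus ?case using v(1) w(1) XA[OF mult.hyps(1)] XA[OF mult.hyps(2)]
  by (intro exI[of _ "%et z. g (snd z) * v et z + f (fst z) * w et z"]) (auto intro!: reg)
 qed
 have gen: "EX w. (ALL et:X. w et : ?A) & (EV z in ?B. D f z = (SUM et:X. w et z * D et z))"
  if f: "f : reg V P" for f
 proof -
  from XP[OF f] obtain A B where AB: "A : fun_alg X" "B : fun_alg X" "B P ~= 0" "EV x in near P. f x * B x = A x"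
  by (elim bexE conjE)
  from alg[OF AB(1)] obtain v where v: "ALL et:X. v et : ?A" "ALL z. D A z = (SUM et:X. v et z * D et z)"
  by (elim exE conjE)
  from alg[OF AB(2)] obtain w where w: "ALL et:X. w et : ?A" "ALL z. D B z = (SUM et:X. w et z * D et z)"
  by (elim exE conjE)
  have B: "B : reg V P" by (rule XA[OF AB(2)])
  let ?w = "%et z. inverse (B (snd z)) * (v et z - f (fst z) * w et z)"
  have "EV z in ?B. D f z = (SUM et:X. ?w et z * D et z)"
  using VV.near2_fstI[OF P P AB(4)] VV.near2_sndI[OF P P AB(4)]
  VV.near2_sndI[OF P P eventually_nonzero[OF P B AB(3)]]
  proof eventually_elim
  case (elim z)
  have "(SUM et:X. ?w et z * D et z) = inverse (B (snd z)) * (D A z - f (fst z) * D B z)"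
  unfolding v(2)[rule_format] w(2)[rule_format] by (simp add: algebra_simps sum_distrib_left sum_subtractf)
  also have "D A z - f (fst z) * D B z = B (snd z) * D f z"
  unfolding D_def elim(1,2)[symmetric] by (simp add: algebra_simps)
  finally show ?case using elim(3) by simp
  qed
  moreover have "ALL et:X. ?w et : ?A"
  using v(1) w(1) f VV.regular2_snd[OF P P regular_inverse[OF P B AB(3)]] by (auto intro!: reg(1,3,7))
  ultimately show ?thesis by (intro exI[of _ ?w] conjI)
 qed
 have tr: "t : reg V P" using t by (rule has_order_regular)
 have tP: "t P = 0" using order_ge_1_iff[OF P tr] has_order_imp_ge[OF t] by simp
 have "ALL xi:X. EX v:?A. EV z in ?B. D xi z = D t z * v z"
 proof (rule nakayama[OF P X(1)])
  fix xi assume "xi : X"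
  hence xi: "xi : reg V P" using X by auto
  have "order_ge P (%x. xi x - xi P) 1"
  using order_ge_1_iff[OF P regular_diff[OF P xi regular_const[OF P]]] by simp
  from order_ge_expand[OF P t this] obtain u where
  u: "u : reg V P" "EV x in near P. xi x - xi P = t x ^ 1 * u x" .
  from gen[OF u(1)] obtain w where w: "ALL et:X. w et : ?A"
  "EV z in ?B. D u z = (SUM et:X. w et z * D et z)" by (elim exE conjE)
  \<comment> \<open>Product rule for \<open>xi - xi P = t * u\<close>: the second term carries the
    factor \<open>t (fst z)\<close>, which vanishes at \<open>(P, P)\<close> as
    \<open>nakayama\<close> requires.\<close>
  have "EV z in ?B. D xi z = D t z * u (snd z) + (SUM et:X. (t (fst z) * w et z) * D et z)"
  using VV.near2_fstI[OF P P u(2)] VV.near2_sndI[OF P P u(2)] w(2)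
  proof eventually_elim
  case (elim z)
  have "D xi z = (xi (snd z) - xi P) - (xi (fst z) - xi P)" by (simp add: D_def)
  also have "... = D t z * u (snd z) + t (fst z) * D u z" unfolding elim(1,2) by (simp add: D_def algebra_simps)
  finally show ?case unfolding elim(3) by (simp add: sum_distrib_left mult.assoc)
  qed
  moreover have "ALL et:X. (%z. t (fst z) * w et z) : ?A & t (fst (P, P)) * w et (P, P) = 0"
  using w(1) tr tP by (auto intro!: reg)
  moreover have "(%z. u (snd z)) : ?A" using u by (intro reg)
  ultimately show "EX v m. v : ?A & (ALL et:X. m et : ?A & m et (P, P) = 0) &
  (EV z in ?B. D xi z = D t z * v z + (SUM et:X. m et z * D et z))"
  by (intro exI[of _ "%z. u (snd z)"] exI[of _ "%et z. t (fst z) * w et z"] conjI)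
 qed
 from bchoice[OF this[unfolded Bex_def]] obtain v
  where "ALL xi:X. v xi : ?A & (EV z in ?B. D xi z = D t z * v xi z)" ..
 hence v: "!!xi. xi : X ==> v xi : ?A"
  "!!xi. xi : X ==> EV z in ?B. D xi z = D t z * v xi z" by simp_all
 have all: "EV z in ?B. ALL xi:X. D xi z = D t z * v xi z"
  by (rule eventually_ball_finite[OF X(1)]) (simp add: v(2))
 from gen[OF f] obtain w where w: "ALL et:X. w et : ?A"
  "EV z in ?B. D f z = (SUM et:X. w et z * D et z)" by (elim exE conjE)
 let ?bt = "%z. SUM et:X. w et z * v et z"
 have "EV z in ?B. D f z = D t z * ?bt z"
  using w(2) all by eventually_elim (simp add: sum_distrib_left mult_ac)
 moreover have "?bt : ?A" using w(1) v(1) by (auto intro!: reg)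
 ultimately show ?thesis unfolding D_def by (intro bexI[of _ ?bt])
qed

end

section \<open>Smooth projective curves\<close>

definition monom_eval :: "(nat \<Rightarrow>\<^sub>0 nat) => (nat => 'k::comm_ring_1) => 'k" where
 "monom_eval m x = (PROD i:keys m. x i ^ lookup m i)"

definition monom_degree :: "(nat \<Rightarrow>\<^sub>0 nat) => nat" where
 "monom_degree m = (SUM i:keys m. lookup m i)"

lemma monom_eval_superset:
 "finite I ==> keys m <= I ==> monom_eval m x = (PROD i:I. x i ^ lookup m i)"
 unfolding monom_eval_def by (rule prod.mono_neutral_left) (auto simp: in_keys_iff)

lemma monom_degree_superset:
 "finite I ==> keys m <= I ==> monom_degree m = (SUM i:I. lookup m i)"
 unfolding monom_degree_def by (rule sum.mono_neutral_left) (auto simp: in_keys_iff)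

lemma monom_eval_add: "monom_eval (m + m') x = monom_eval m x * monom_eval m' x"
proof -
 let ?I = "keys m Un keys m'"
 have "keys (m + m') <= ?I" by (rule keys_add)
 thus ?thesis
  by (simp add: monom_eval_superset[of ?I] lookup_add power_add prod.distrib)
qed

lemma monom_degree_add: "monom_degree (m + m') = monom_degree m + monom_degree m'"
proof -
 let ?I = "keys m Un keys m'"
 have "keys (m + m') <= ?I" by (rule keys_add)
 thus ?thesis
  by (simp add: monom_degree_superset[of ?I] lookup_add sum.distrib)
qed

lemma mpoly_eval_eq: "mpoly_eval p x = (SUM m:keys p. lookup p m * monom_eval m x)"
 by (simp add: mpoly_eval_def monom_eval_def)

lemma mpoly_eval_superset:
 "finite M ==> keys p <= M ==> mpoly_eval p x = (SUM m:M. lookup p m * monom_eval m x)"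
 unfolding mpoly_eval_eq by (rule sum.mono_neutral_left) (auto simp: in_keys_iff)

lemma mpoly_eval_add: "mpoly_eval (p + q) x = mpoly_eval p x + mpoly_eval q x"
proof -
 let ?M = "keys p Un keys q"
 have "keys (p + q) <= ?M" by (rule keys_add)
 thus ?thesis
  by (simp add: mpoly_eval_superset[of ?M] lookup_add distrib_right sum.distrib)
qed

lemma mpoly_eval_0: "mpoly_eval 0 x = 0"
 by (simp add: mpoly_eval_eq)

lemma mpoly_eval_sum: "mpoly_eval (SUM i:I. p i) x = (SUM i:I. mpoly_eval (p i) x)"
 by (induction I rule: infinite_finite_induct) (auto simp: mpoly_eval_add mpoly_eval_0)

lemma mpoly_eval_single: "mpoly_eval (Poly_Mapping.single m c) x = c * monom_eval m x"
 by (simp add: mpoly_eval_superset[of "{m}"])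

lemma mpoly_expansion:
 "p = (SUM m:keys p. Poly_Mapping.single m (lookup p m))"
 by (rule poly_mapping_eqI) (auto simp: lookup_sum lookup_single when_def in_keys_iff)

lemma mpoly_eval_mult: "mpoly_eval (p * q) x = mpoly_eval p x * mpoly_eval q x"
proof -
 have "p * q = (SUM m:keys p. SUM m':keys q.
  Poly_Mapping.single (m + m') (lookup p m * lookup q m'))"
  by (subst mpoly_expansion[of p], subst mpoly_expansion[of q]) (simp add: sum_product mult_single)
 thus ?thesis
  by (simp add: mpoly_eval_sum mpoly_eval_single monom_eval_add)
  (simp add: mpoly_eval_eq sum_product mult_ac)
qed

text \<open>Only the function defined by a homogeneous polynomial matters below; working with these
  functions allows pointwise notation for sums and products of forms.\<close>

definition forms :: "nat => ((nat => 'k::field) => 'k) set" where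
 "forms d = mpoly_eval ` {F. homogeneous_mpoly d F}"

lemma homogeneous_iff: "homogeneous_mpoly d p <-> (ALL m:keys p. monom_degree m = d)"
 by (simp add: homogeneous_mpoly_def monom_degree_def)

lemma forms_add:
 assumes "F : forms d" "G : forms d"
 shows "(%x. F x + G x) : forms d"
proof -
 obtain p q where pq: "F = mpoly_eval p" "homogeneous_mpoly d p" "G = mpoly_eval q" "homogeneous_mpoly d q"
  using assms unfolding forms_def by auto
 have "homogeneous_mpoly d (p + q)"
  using pq keys_add[of p q] unfolding homogeneous_iff by blast
 moreover have "(%x. F x + G x) = mpoly_eval (p + q)" unfolding pq by (simp add: mpoly_eval_add fun_eq_iff)
 ultimately show ?thesis unfolding forms_def by blast
qed

lemma forms_mult:
 assumes "F : forms d" "G : forms e"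
 shows "(%x. F x * G x) : forms (d + e)"
proof -
 obtain p q where pq: "F = mpoly_eval p" "homogeneous_mpoly d p" "G = mpoly_eval q" "homogeneous_mpoly e q"
  using assms unfolding forms_def by auto
 have "homogeneous_mpoly (d + e) (p * q)"
  using pq keys_mult[of p q] unfolding homogeneous_iff by (fastforce simp: monom_degree_add)
 moreover have "(%x. F x * G x) = mpoly_eval (p * q)" unfolding pq by (simp add: mpoly_eval_mult fun_eq_iff)
 ultimately show ?thesis unfolding forms_def by blast
qed

lemma forms_zero: "(%_. 0) : forms d"
proof -
 have "homogeneous_mpoly d 0" by (simp add: homogeneous_iff)
 moreover have "(%_. 0) = mpoly_eval 0" by (simp add: mpoly_eval_0 fun_eq_iff)
 ultimately show ?thesis unfolding forms_def by blast
qed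

lemma forms_const: "(%_. c) : forms 0"
proof -
 have "homogeneous_mpoly 0 (Poly_Mapping.single 0 c)"
  unfolding homogeneous_iff by (auto simp: monom_degree_def)
 moreover have "(%_. c) = mpoly_eval (Poly_Mapping.single 0 c)"
  by (simp add: mpoly_eval_single monom_eval_def fun_eq_iff)
 ultimately show ?thesis unfolding forms_def by blast
qed

lemma forms_coordinate: "(%x. x i) : forms 1"
proof -
 have "homogeneous_mpoly 1 (Poly_Mapping.single (Poly_Mapping.single i 1) 1)"
  unfolding homogeneous_iff by (auto simp: monom_degree_def)
 moreover have "(%x. x i) = mpoly_eval (Poly_Mapping.single (Poly_Mapping.single i 1) 1)"
  by (simp add: mpoly_eval_single monom_eval_def fun_eq_iff)
 ultimately show ?thesis unfolding forms_def by blast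
qed

lemma forms_scale: "F : forms d ==> (%x. c * F x) : forms d"
 using forms_mult[OF forms_const] by fastforce

lemma forms_diff: "F : forms d ==> G : forms d ==> (%x. F x - G x) : forms d"
 using forms_add[of F d, OF _ forms_scale[of G d "- 1"]] by simp

lemma forms_sum: "(!!i. i : I ==> F i : forms d) ==> (%x. SUM i:I. F i x) : forms d"
 by (induction I rule: infinite_finite_induct) (auto intro: forms_zero forms_add)

lemma forms_power: "F : forms d ==> (%x. F x ^ n) : forms (n * d)"
proof (induction n)
 case 0
 show ?case using forms_const by simp
next
 case (Suc n)
 thus ?case using forms_mult[of F d] by simp
qed

lemma forms_prod:
 "finite I ==> (!!i. i : I ==> F i : forms (d i)) ==> (%x. PROD i:I. F i x) : forms (SUM i:I. d i)"
proof (induction I rule: finite_induct)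
 case empty
 show ?case using forms_const by simp
next
 case (insert i I)
 thus ?case using forms_mult[of "F i" "d i"] by simp
qed

text \<open>On \<open>proj_space N\<close> the coordinates of index above \<open>N\<close> vanish, so finitely many coordinate functions suffice.\<close>

lemma mpoly_eval_fun_alg:
 assumes u: "!!x i. x : S ==> i > N ==> u i x = 0"
 shows "EX A:fun_alg (u ` {..N}). ALL x:S. mpoly_eval p (%i. u i x) = A x"
proof -
 let ?X = "u ` {..N}"
 have gen: "EX A:fun_alg ?X. ALL x:S. u i x = A x" for i
 proof (cases "i <= N")
  case True
  thus ?thesis by (intro bexI[of _ "u i"] fun_alg.gen) auto
 next
  case False
  thus ?thesis using u by (intro bexI[of _ "%_. 0"] fun_alg.const) auto
 qed
 have pow: "EX A:fun_alg ?X. ALL x:S. u i x ^ n = A x" for i n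
 proof (induction n)
  case 0
  show ?case by (intro bexI[of _ "%_. 1"] fun_alg.const) auto
 next
  case (Suc n)
  obtain A where A: "A : fun_alg ?X" "ALL x:S. u i x ^ n = A x" using Suc by (elim bexE)
  obtain B where B: "B : fun_alg ?X" "ALL x:S. u i x = B x" using gen[of i] by (elim bexE)
  show ?case by (intro bexI[of _ "%x. B x * A x"] fun_alg.mult A B) (use A B in auto)
 qed
 have prd: "EX A:fun_alg ?X. ALL x:S. (PROD i:I. u i x ^ e i) = A x" for I e
 proof (induction I rule: infinite_finite_induct)
  case (insert i I)
  obtain A where A: "A : fun_alg ?X" "ALL x:S. (PROD i:I. u i x ^ e i) = A x" using insert by (elim bexE)
  obtain B where B: "B : fun_alg ?X" "ALL x:S. u i x ^ e i = B x" using pow[of i "e i"] by (elim bexE)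
  show ?case by (intro bexI[of _ "%x. B x * A x"] fun_alg.mult A B) (use A B insert in auto)
 qed (auto intro!: bexI[of _ "%_. 1"] fun_alg.const)
 have "EX A:fun_alg ?X. ALL x:S. (SUM m:M. lookup p m * monom_eval m (%i. u i x)) = A x" for M
 proof (induction M rule: infinite_finite_induct)
  case (insert m M)
  obtain A where A: "A : fun_alg ?X" "ALL x:S. (SUM m:M. lookup p m * monom_eval m (%i. u i x)) = A x"
  using insert by (elim bexE)
  obtain B where B: "B : fun_alg ?X" "ALL x:S. monom_eval m (%i. u i x) = B x"
  using prd[where I = "keys m" and e = "lookup m"] unfolding monom_eval_def by (elim bexE)
  show ?case by (intro bexI[of _ "%x. lookup p m * B x + A x"] fun_alg.mult fun_alg.add fun_alg.const A B)
  (use A B insert in auto)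
 qed (auto intro!: bexI[of _ "%_. 0"] fun_alg.const)
 thus ?thesis unfolding mpoly_eval_eq .
qed

text \<open>Dehomogenisation: a monomial of degree \<open>d\<close> divided by
  \<open>lf x ^ d\<close> is the same monomial in the quotients \<open>x i / lf x\<close>.\<close>

lemma forms_fun_alg:
 assumes "F : forms d" "!!x i. x : S ==> i > N ==> x i = 0"
 obtains A where "A : fun_alg ((%i x. x i / lf x) ` {..N})"
  "!!x. x : S ==> lf x ~= 0 ==> F x / lf x ^ d = A x"
proof -
 obtain p where p: "F = mpoly_eval p" "homogeneous_mpoly d p" using assms(1) by (auto simp: forms_def)
 obtain A where A: "A : fun_alg ((%i x. x i / lf x) ` {..N})" "ALL x:S. mpoly_eval p (%i. x i / lf x) = A x"
  using mpoly_eval_fun_alg[of S N "%i x. x i / lf x" p] assms(2) by auto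
 have "F x / lf x ^ d = A x" if "x : S" "lf x ~= 0" for x
 proof -
  have pm: "monom_eval m (%i. x i / lf x) = monom_eval m x / lf x ^ d" if "m : keys p" for m
  proof -
  have "monom_degree m = d" using that p(2) by (auto simp: homogeneous_iff)
  hence "lf x ^ d = (PROD i:keys m. lf x ^ lookup m i)"
  by (auto simp: monom_degree_def power_sum)
  thus ?thesis by (simp add: monom_eval_def power_divide prod_dividef)
  qed
  have "A x = (SUM m:keys p. lookup p m * (monom_eval m x / lf x ^ d))"
  unfolding bspec[OF A(2) that(1), symmetric] mpoly_eval_eq by (rule sum.cong[OF refl]) (simp only: pm)
  thus ?thesis by (simp add: p(1) mpoly_eval_eq sum_divide_distrib)
 qed
 thus thesis using A(1) that by blast
qed

lemma proj_space_above: "x : proj_space N ==> i > N ==> x i = 0"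
 by (simp add: proj_space_def)

lemma proj_space_nonzero:
 assumes "x : proj_space N" shows "EX i<=N. x i ~= 0"
 using assms by (auto simp: proj_space_def)

text \<open>The first nonzero entry of both vectors is 1 and sits at the same index, so the factor
  \<open>c\<close> is 1.\<close>

lemma proj_space_proportional:
 assumes x: "x : proj_space N" and y: "y : proj_space N" and "!!i. x i = c * y i"
 shows "x = y"
proof -
 obtain i where i: "x i = 1" "ALL j<i. x j = 0" using x by (auto simp: proj_space_def)
 obtain k where k: "y k = 1" "ALL j<k. y j = 0" using y by (auto simp: proj_space_def)
 have eq: "x i = c * y i" "x k = c * y k" by (rule assms(3))+
 hence "c ~= 0" using i(1) by auto
 have "~ i < k" using eq(1) i(1) k(2) by auto
 moreover have "~ k < i" using eq(2) i(2) k(1) \<open>c ~= 0\<close> by auto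
 ultimately have "i = k" by simp
 hence "c = 1" using eq(1) i(1) k(1) by simp
 show ?thesis
 proof (rule ext)
  fix i show "x i = y i" using assms(3)[of i] \<open>c = 1\<close> by simp
 qed
qed

text \<open>With \<open>Q k\<close> nonzero, the minors \<open>Q k * P i - Q i * P k\<close> cannot
  all vanish, for \<open>P\<close> would be proportional to \<open>Q\<close>. A nonzero one, with
  \<open>P\<close> made variable, is the form.\<close>

lemma separating_form:
 assumes P: "P : proj_space N" and Q: "Q : proj_space N" and "P ~= Q"
 shows "EX m:forms 1. m Q = 0 & m P ~= 0"
proof -
 obtain k where k: "Q k ~= 0" using proj_space_nonzero[OF Q] by blast
 have "EX i. P i ~= (P k / Q k) * Q i"
 proof (rule ccontr)
  assume "\<nexists>i. P i ~= (P k / Q k) * Q i"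
  hence "!!i. P i = (P k / Q k) * Q i" by blast
  from proj_space_proportional[OF P Q this] show False using \<open>P ~= Q\<close> by simp
 qed
 then obtain i where i: "P i ~= (P k / Q k) * Q i" by blast
 have f: "(%x. Q k * x i - Q i * x k) : forms 1"
  by (intro forms_diff forms_scale forms_coordinate)
 have "Q k * P i - Q i * P k ~= 0"
 proof
  assume "Q k * P i - Q i * P k = 0"
  hence "P i * Q k = P k * Q i" by (simp add: mult.commute)
  hence "P i = (P k * Q i) / Q k" using k by (simp only: eq_divide_eq) simp
  with i show False by (simp only: times_divide_eq_left) simp
 qed
 thus ?thesis by (intro bexI[OF _ f]) simp
qed

text \<open>Among the forms with coefficients \<open>c ^ i\<close>, each point of \<open>T\<close>
  excludes only the roots \<open>c\<close> of one nonzero polynomial, and the field is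
  infinite.\<close>

lemma nonvanishing_form:
 fixes T :: "(nat => 'k::field_char_0) set"
 assumes T: "finite T" "T <= proj_space N"
 shows "EX lf:forms 1. ALL P:T. lf P ~= 0"
proof -
 define p where "p = (%P. SUM i<=N. Polynomial.monom (P i) i :: 'k poly)"
 have pP: "p P ~= 0" if "P : T" for P
 proof -
  have "P : proj_space N" using T that by auto
  from proj_space_nonzero[OF this] obtain i where "i <= N" "P i ~= 0" by (elim exE conjE)
  moreover have "Polynomial.coeff (p P) i = P i" using \<open>i <= N\<close> by (simp add: p_def coeff_sum)
  ultimately show ?thesis by auto
 qed
 have fin: "finite (UN P:T. {c. poly (p P) c = 0})" 
 proof (rule finite_UN_I[OF T(1)])
  fix P assume "P : T"
  thus "finite {c. poly (p P) c = 0}" by (intro poly_roots_finite pP)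
 qed
 from ex_new_if_finite[OF infinite_UNIV_char_0 this]
 obtain c where c: "c ~: (UN P:T. {c. poly (p P) c = 0})" ..
 have f: "(%x. SUM i<=N. c ^ i * x i) : forms 1" by (intro forms_sum forms_scale forms_coordinate)
 have e: "poly (p P) c = (SUM i<=N. c ^ i * P i)" for P by (simp add: p_def poly_sum poly_monom mult.commute)
 have "(SUM i<=N. c ^ i * P i) ~= 0" if "P : T" for P
  unfolding e[symmetric] using c that by blast
 thus ?thesis by (intro bexI[OF _ f] ballI)
qed

lemma irreducible_closedD:
 "irreducible_closed T C ==> closedin T A ==> closedin T B ==> C <= A Un B ==> C <= A | C <= B"
 unfolding irreducible_closed_def by simp

lemma dimension_oneD:
 "dimension_one T ==> irreducible_closed T A ==> irreducible_closed T B ==> A \<subset> B ==> ~ B \<subset> topspace T"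
 unfolding dimension_one_def by blast

section \<open>Topology and local rings of a smooth projective curve\<close>

locale smooth_projective =
 fixes N :: nat and S :: "(nat => 'k::field_char_0) set"
 assumes smooth_projective: "smooth_projective_curve N S"
begin

abbreviation "Z == proj_variety S"
abbreviation "T == proj_zariski S"

lemma S_proj: "S <= proj_space N"
 using smooth_projective unfolding smooth_projective_curve_def proj_closed_def by blast

lemma proj_zariski_forms:
 "proj_zariski S = topology_generated_by {{x : S. F x ~= 0} | F. EX d. F : forms d}"
proof -
 have "{{x : S. mpoly_eval F x ~= 0} | F. EX d. homogeneous_mpoly d F} = {{x : S. F x ~= 0} | F. EX d. F : forms d}"
  unfolding forms_def by blast
 thus ?thesis by (simp only: proj_zariski_def)
qed

lemma openin_basic: "F : forms d ==> openin T {x : S. F x ~= 0}"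
 unfolding proj_zariski_forms by (rule topology_generated_by_Basis) blast

lemma points_eq: "topspace T = S"
proof
 show "topspace T <= S" unfolding proj_zariski_forms by auto
 have "openin T {x : S. (%_. 1) x ~= (0::'k)}" by (rule openin_basic[OF forms_const])
 from openin_subset[OF this] show "S <= topspace T" by simp
qed

lemma points_Z: "pts Z = S"
 by (simp add: proj_variety_def points_eq)

lemma openin_form:
 assumes "openin T U" "P : U"
 shows "EX d. EX F:forms d. F P ~= 0 & (ALL x:S. F x ~= 0 --> x : U)"
proof -
 define nb where "nb = (%P U. EX d. EX F:forms d. F P ~= 0 & (ALL x:S. F x ~= 0 --> x : U))"
 have nbI: "nb P U" if "F : forms d" "F P ~= 0" "ALL x:S. F x ~= 0 --> x : U" for F d P U
  unfolding nb_def using that by (intro exI[of _ d] bexI[of _ F] conjI)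
 have nb_mono: "nb P V" if nb: "nb P U" and UV: "U <= V" for P U V
 proof -
  from nb obtain d F where F: "F : forms d" "F P ~= 0" "ALL x:S. F x ~= 0 --> x : U"
  unfolding nb_def by (elim exE bexE conjE)
  show ?thesis by (rule nbI[OF F(1,2)]) (use F(3) UV in auto)
 qed
 have nb_Int: "nb P (U Int V)" if nb: "nb P U" "nb P V" for P U V
 proof -
  from nb(1) obtain d F where F: "F : forms d" "F P ~= 0" "ALL x:S. F x ~= 0 --> x : U"
  unfolding nb_def by (elim exE bexE conjE)
  from nb(2) obtain e G where G: "G : forms e" "G P ~= 0" "ALL x:S. G x ~= 0 --> x : V"
  unfolding nb_def by (elim exE bexE conjE)
  show ?thesis by (rule nbI[OF forms_mult[OF F(1) G(1)]]) (use F(2,3) G(2,3) in auto)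
 qed
 have "generate_topology_on {{x : S. F x ~= 0} | F. EX d. F : forms d} U"
  using assms(1) unfolding proj_zariski_forms openin_topology_generated_by_iff .
 hence "ALL P:U. nb P U"
 proof induction
  case (UN K)
  show ?case
  proof
  fix P assume "P : \<Union> K"
  then obtain k where k: "k : K" "P : k" by blast
  hence "nb P k" using UN by blast
  thus "nb P (\<Union> K)" by (rule nb_mono) (use k in blast)
  qed
 next
  case (Basis s)
  then obtain F d where F: "s = {x : S. F x ~= 0}" "F : forms d" by (elim CollectE exE conjE)
  show ?case by (intro ballI nbI[OF F(2)]) (simp_all add: F(1))
 qed (simp_all add: nb_Int)
 thus ?thesis using assms(2) unfolding nb_def by (rule bspec)
qed

text \<open>Choose functions \<open>A n\<close> vanishing on \<open>E (Suc n)\<close> but not at a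
  point \<open>p n\<close> of \<open>E n\<close>. Expressing \<open>A n\<close> by earlier ones
  would give \<open>A n (p n) = 0\<close>, because \<open>p n\<close> lies in
  \<open>E (Suc k)\<close> for all \<open>k < n\<close>. Since points are normalised vectors, forms
  are functions in a finitely generated algebra and the Noetherian property applies.\<close>

lemma no_descending_chain:
 fixes E :: "nat => (nat => 'k) set"
 assumes "!!n. closedin T (E n)" "!!n. E (Suc n) \<subset> E n"
 shows False
proof -
 have mono: "E m <= E n" if "n <= m" for n m
  using lift_Suc_antimono_le[of E, OF _ that] assms(2) by blast
 have "EX p. p : E n & p ~: E (Suc n)" for n using assms(2)[of n] by blast
 then obtain p where p: "!!n. p n : E n" "!!n. p n ~: E (Suc n)" by metis
 have pS: "p n : S" for n using p(1)[of n] closedin_subset[OF assms(1)[of n]] points_eq by auto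
 let ?X = "(%i x. x i :: 'k) ` {..N}"
 have fin: "finite ?X" by simp
 have alg: "EX A:fun_alg ?X. A (p n) ~= 0 & (ALL x:E (Suc n). A x = 0)" for n
 proof -
  have "openin T (S - E (Suc n))" using assms(1)[of "Suc n"] by (simp add: closedin_def points_eq)
  moreover have "p n : S - E (Suc n)" using p pS by auto
  ultimately have "EX d. EX F:forms d. F (p n) ~= 0 & (ALL x:S. F x ~= 0 --> x : S - E (Suc n))"
  by (rule openin_form)
  then
  obtain d F where F: "F : forms d" "F (p n) ~= 0" "ALL x:S. F x ~= 0 --> x : S - E (Suc n)"
  by (elim exE bexE conjE)
  obtain q where q: "F = mpoly_eval q" using F(1) by (auto simp: forms_def)
  have "EX A:fun_alg ?X. ALL x:S. mpoly_eval q (%i. x i) = A x"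
  by (rule mpoly_eval_fun_alg) (use proj_space_above S_proj in auto)
  then obtain A where A: "A : fun_alg ?X" "ALL x:S. F x = A x" unfolding q by (elim bexE)
  have "E (Suc n) <= S" using closedin_subset[OF assms(1)[of "Suc n"]] points_eq by simp
  thus ?thesis by (intro bexI[OF _ A(1)]) (use A(2) F pS in auto)
 qed
 define K where "K = (%n A. A : fun_alg ?X & A (p n) ~= 0 & (ALL x:E (Suc n). A x = 0))"
 have "ALL n. EX A. K n A" using alg unfolding K_def Bex_def by simp
 then obtain A where "ALL n. K n (A n)" by metis
 hence A: "!!n. A n : fun_alg ?X" "!!n. A n (p n) ~= 0" "!!n x. x : E (Suc n) ==> A n x = 0"
  unfolding K_def by auto
 have "range A <= fun_alg ?X" using A(1) by auto
 from noetherian_sequence[OF subring_fun_alg noetherian_fun_alg[OF fin] this]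
 obtain n c where c: "A n = (SUM k<n. c k * A k)" by (elim exE conjE)
 have "(SUM k<n. c k * A k) x = (SUM k<n. c k x * A k x)" for x :: "nat => 'k" and n
  by (induction n) (auto simp: plus_fun_def times_fun_def zero_fun_def)
 hence "A n (p n) = (SUM k<n. c k (p n) * A k (p n))" using c by simp
 also have "... = 0"
 proof (rule sum.neutral, rule ballI)
  fix k assume "k : {..<n}"
  hence "p n : E (Suc k)" using mono[of "Suc k" n] p(1)[of n] by auto
  thus "c k (p n) * A k (p n) = 0" using A(3) by simp
 qed
 finally show False using A(2) by simp
qed

lemma closedin_singleton: "P : S ==> closedin T {P}"
proof -
 assume P: "P : S"
 have "openin T (S - {P})"
 proof (subst openin_subopen, intro ballI)
  fix Q assume Q: "Q : S - {P}"
  then obtain m where m: "m : forms 1" "m P = 0" "m Q ~= 0"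
  using bexE[OF separating_form[of Q N P]] P S_proj by auto
  show "EX U. openin T U & Q : U & U <= S - {P}"
  by (rule exI[of _ "{x : S. m x ~= 0}"]) (use m Q openin_basic[OF m(1)] in auto)
 qed
 thus ?thesis using P by (simp add: closedin_def points_eq)
qed

lemma closedin_finite:
 assumes "finite E" "E <= S" shows "closedin T E"
proof -
 have "closedin T (UN P:E. {P})" by (rule closedin_Union) (use assms closedin_singleton in auto)
 thus ?thesis by simp
qed

lemma irreducible: "irreducible_closed T S"
 and dimension_one: "dimension_one T"
 using smooth_projective points_eq unfolding smooth_projective_curve_def smooth_curve_def
 by (simp_all add: proj_variety_def)

lemma infinite_S: "infinite S"
proof
 assume fin: "finite S"
 obtain A where A: "irreducible_closed T A" "A \<subset> S"
  using dimension_one points_eq unfolding dimension_one_def by auto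
 then obtain P where P: "P : A" by (auto simp: irreducible_closed_def)
 have "closedin T {P}" "closedin T (S - {P})" using closedin_finite A P fin by auto
 hence "S <= {P} | S <= S - {P}"
  by (rule irreducible_closedD[OF irreducible]) blast
 thus False using A P by auto
qed

lemma irreducible_singleton: "P : S ==> irreducible_closed T {P}"
 unfolding irreducible_closed_def using closedin_singleton by (simp add: subset_singleton_iff)

text \<open>A minimal infinite proper closed set would be irreducible and lie strictly between a
  point and the whole curve, contrary to dimension one. Hence every such set contains a smaller one,
  and iteration gives a forbidden descending chain.\<close>

lemma closedin_proper_finite:
 assumes "closedin T E" "E ~= S"
 shows "finite E"
proof (rule ccontr)
 assume inf: "infinite E"
 define B where "B = (%E. closedin T E & infinite E & E \<subset> S)"
 have "EX E'. B E' & E' \<subset> E" if E: "B E" for E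
 proof (rule ccontr)
  assume min: "\<nexists>E'. B E' & E' \<subset> E"
  have "irreducible_closed T E"
  unfolding irreducible_closed_def
  proof (intro conjI allI impI)
  show "closedin T E" "E ~= {}" using E by (auto simp: B_def)
  fix C D assume CD: "closedin T C & closedin T D & E <= C Un D"
  show "E <= C | E <= D"
  proof (rule ccontr)
  assume n: "~ (E <= C | E <= D)"
  have cl: "closedin T E" "E \<subset> S" using E by (auto simp: B_def)
  have fin: "finite (E Int A)" if A: "closedin T A" "~ E <= A" for A
  proof (rule ccontr)
  assume "infinite (E Int A)"
  moreover have "closedin T (E Int A)" using cl(1) A(1) by (rule closedin_Int)
  moreover have "E Int A \<subset> E" using A(2) by auto
  moreover have "E Int A \<subset> S" using cl(2) by auto
  ultimately have "B (E Int A)" by (simp add: B_def)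
  with \<open>E Int A \<subset> E\<close> min show False by (metis)
  qed
  have "finite (E Int C Un E Int D)" using fin[of C] fin[of D] CD n by simp
  moreover have "E = E Int C Un E Int D" using CD by blast
  ultimately have "finite E" by simp
  thus False using E by (simp add: B_def)
  qed
  qed
  note irrE = this
  have infE: "infinite E" and ES: "E \<subset> S" using E by (auto simp: B_def)
  then obtain P where P: "P : E" using infinite_imp_nonempty by auto
  have "E ~= {P}" using infE by auto
  hence "{P} \<subset> E" using P by auto
  moreover have "irreducible_closed T {P}" using ES P by (intro irreducible_singleton) auto
  ultimately show False using dimension_oneD[OF dimension_one _ irrE] ES points_eq by simp
 qed
 hence "ALL E. EX E'. B E --> B E' & E' \<subset> E" by simp
 from choice[OF this] obtain f where "ALL E. B E --> B (f E) & f E \<subset> E" by (elim exE)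
 hence f: "!!E. B E ==> B (f E) & f E \<subset> E" by simp
 have BE: "B E" using assms inf closedin_subset[OF assms(1)] points_eq by (auto simp: B_def)
 have B: "B ((f ^^ n) E)" for n by (induction n) (use BE f in auto)
 show False
  by (rule no_descending_chain[of "%n. (f ^^ n) E"]) (use B f in "auto simp: B_def")
qed

lemma openin_iff': "openin T U <-> U <= S & (U = {} | finite (S - U))"
proof
 assume U: "openin T U"
 hence "U <= S" using openin_subset points_eq by auto
 moreover have "closedin T (S - U)" using U by (metis openin_closedin_eq points_eq)
 ultimately show "U <= S & (U = {} | finite (S - U))" using closedin_proper_finite[of "S - U"] by blast
next
 assume U: "U <= S & (U = {} | finite (S - U))"
 then consider "U = {}" | "closedin T (S - U)" using closedin_finite[of "S - U"] by blast
 thus "openin T U"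
 proof cases
  case 2
  thus ?thesis using U by (simp add: openin_closedin_eq points_eq)
 qed simp
qed

lemma eventually_iff:
 assumes "P : S"
 shows "eventually Q (nhdsin T P) <-> Q P & finite {x : S. ~ Q x}"
proof
 assume "eventually Q (nhdsin T P)"
 then obtain U where U: "openin T U" "P : U" "ALL x:U. Q x" using assms points_eq by (auto simp: eventually_nhdsin)
 hence "finite (S - U)" using openin_iff'[of U] by auto
 hence "finite {x : S. ~ Q x}" by (rule rev_finite_subset) (use U in auto)
 thus "Q P & finite {x : S. ~ Q x}" using U by simp
next
 assume R: "Q P & finite {x : S. ~ Q x}"
 have "S - {x : S. Q x} = {x : S. ~ Q x}" by auto
 hence "openin T {x : S. Q x}" unfolding openin_iff' using R by auto
 moreover have "P : {x : S. Q x}" "ALL x:{x : S. Q x}. Q x" using R assms by auto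
 ultimately show "eventually Q (nhdsin T P)" unfolding eventually_nhdsin by (intro disjI2 exI conjI)
qed

lemma form_zeros:
 assumes "F : forms d"
 shows "(ALL x:S. F x = 0) | finite {x : S. F x = 0}"
proof -
 have "{x : S. F x ~= 0} = {} | finite (S - {x : S. F x ~= 0})"
  using openin_basic[OF assms] unfolding openin_iff' by blast
 moreover have "S - {x : S. F x ~= 0} = {x : S. F x = 0}" by auto
 ultimately show ?thesis by auto
qed

lemma form_eventually_nonzero:
 assumes "P : S" "F : forms d" "F P ~= 0"
 shows "EV x in nhdsin T P. F x ~= 0"
 unfolding eventually_iff[OF assms(1)] using form_zeros[OF assms(2)] assms by auto

lemma regularI:
 assumes "F : forms d" "G : forms d" "G P ~= 0" "EV x in nhdsin T P. f x = F x / G x"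
 shows "f : reg Z P"
proof -
 obtain p q where pq: "F = mpoly_eval p" "homogeneous_mpoly d p" "G = mpoly_eval q" "homogeneous_mpoly d q"
  using assms(1,2) by (auto simp: forms_def)
 hence "EX d F G. homogeneous_mpoly d F & homogeneous_mpoly d G &
  mpoly_eval G P ~= 0 & (EV x in nhdsin T P. f x = mpoly_eval F x / mpoly_eval G x)"
  using assms(3,4) by (intro exI[of _ d] exI[of _ p] exI[of _ q]) simp
 thus ?thesis by (simp add: proj_variety_def)
qed

lemma regularE:
 assumes "f : reg Z P"
 obtains d F G where "F : forms d" "G : forms d" "G P ~= 0" "EV x in nhdsin T P. f x = F x / G x"
proof -
 have "EX d F G. homogeneous_mpoly d F & homogeneous_mpoly d G &
  mpoly_eval G P ~= 0 & (EV x in nhdsin T P. f x = mpoly_eval F x / mpoly_eval G x)"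
  using assms by (simp add: proj_variety_def)
 then obtain d p q where "homogeneous_mpoly d p" "homogeneous_mpoly d q"
  "mpoly_eval q P ~= 0" "EV x in nhdsin T P. f x = mpoly_eval p x / mpoly_eval q x" by (elim exE conjE)
 thus thesis by (intro that[of "mpoly_eval p" d "mpoly_eval q"]) (auto simp: forms_def)
qed

lemma regularE':
 assumes "P : S" "f : reg Z P"
 obtains d F G where "F : forms d" "G : forms d" "G P ~= 0" "EV x in nhdsin T P. f x = F x / G x"
  "EV x in nhdsin T P. G x ~= 0"
proof (rule regularE[OF assms(2)])
 fix d F G assume *: "F : forms d" "G : forms d" "G P ~= 0" "EV x in nhdsin T P. f x = F x / G x"
 show thesis by (rule that[OF * form_eventually_nonzero[OF assms(1) *(2,3)]])
qed

lemma regular_quotient: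
 assumes "F : forms d" "G : forms d" "G P ~= 0"
 shows "(%x. F x / G x) : reg Z P"
 by (rule regularI[OF assms]) simp

sublocale cofinite_space Z
proof
 show "openin (zariski Z) U <-> U <= pts Z & (U = {} | finite (pts Z - U))" for U
  using openin_iff' points_eq by (simp add: proj_variety_def)
 show "infinite (pts Z)" using infinite_S points_Z by simp
 have zz: "zariski Z = T" by (simp add: proj_variety_def)
 fix P assume "P : pts Z"
 hence P: "P : S" using points_Z by simp
 show "(%_. c) : reg Z P" for c
  by (rule regularI[of "%_. c" 0 "%_. 1"]) (auto intro: forms_const)
 fix f assume f: "f : reg Z P"
 obtain d F G where F: "F : forms d" "G : forms d" "G P ~= 0" "EV x in nhdsin T P. f x = F x / G x"
  "EV x in nhdsin T P. G x ~= 0" using f by (rule regularE'[OF P])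
 show "g : reg Z P" if "EV x in nhdsin (zariski Z) P. f x = g x" for g
 proof (rule regularI[OF F(1-3)])
  show "EV x in nhdsin T P. g x = F x / G x" using F(4) that unfolding zz by eventually_elim simp
 qed
 show "(%x. inverse (f x)) : reg Z P" if "f P ~= 0"
 proof (rule regularI[OF F(2,1)])
  have "f P = F P / G P" using F(4)[unfolded eventually_iff[OF P]] by simp
  thus "F P ~= 0" using that by auto
  show "EV x in nhdsin T P. inverse (f x) = G x / F x" using F(4) by eventually_elim simp
 qed
 show "EV Q in nhdsin (zariski Z) P. f : reg Z Q"
 proof -
  have "P : topspace T" using P points_eq by simp
  then obtain U where U: "openin T U" "P : U" "ALL x:U. f x = F x / G x & G x ~= 0"
  using eventually_conj[OF F(4,5)] unfolding eventually_nhdsin by (elim disjE exE conjE) simp_all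
  have "f : reg Z Q" if "Q : U" for Q
  proof (rule regularI[OF F(1,2)])
  show "G Q ~= 0" using U that by simp
  show "EV x in nhdsin T Q. f x = F x / G x"
  unfolding eventually_nhdsin by (intro disjI2 exI[of _ U] conjI U that) (use U in simp)
  qed
  thus ?thesis unfolding zz eventually_nhdsin by (intro disjI2 exI[of _ U] conjI U ballI)
 qed
 show "(EV x in nhdsin (zariski Z) P. f x = 0) | finite {x : pts Z. f x = 0}"
  using form_zeros[OF F(1)]
 proof
  assume "ALL x:S. F x = 0"
  hence "EV x in nhdsin T P. F x = 0" unfolding eventually_iff[OF P] using P by (simp cong: conj_cong)
  hence "EV x in nhdsin T P. f x = 0" using F(4) by eventually_elim simp
  thus ?thesis unfolding zz by simp
 next
  assume "finite {x : S. F x = 0}"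
  hence "finite ({x : S. F x = 0} Un {x : S. ~ f x = F x / G x} Un {x : S. ~ G x ~= 0})"
  using F(4,5)[unfolded eventually_iff[OF P]] by simp
  hence "finite {x : S. f x = 0}" by (rule rev_finite_subset) auto
  thus ?thesis unfolding points_Z by simp
 qed
 fix g assume g: "g : reg Z P"
 obtain e A B where A: "A : forms e" "B : forms e" "B P ~= 0" "EV x in nhdsin T P. g x = A x / B x"
  "EV x in nhdsin T P. B x ~= 0" using g by (rule regularE'[OF P])
 show "(%x. f x * g x) : reg Z P"
 proof (rule regularI[OF forms_mult[OF F(1) A(1)] forms_mult[OF F(2) A(2)]])
  show "EV x in nhdsin T P. f x * g x = F x * A x / (G x * B x)"
  using F(4) A(4) by eventually_elim simp
 qed (use F A in simp)
 show "(%x. f x + g x) : reg Z P"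
 proof (rule regularI[OF forms_add[OF forms_mult[OF F(1) A(2)] forms_mult[OF F(2) A(1)]] forms_mult[OF F(2) A(2)]])
  show "EV x in nhdsin T P. f x + g x = (F x * B x + G x * A x) / (G x * B x)"
  using F(4,5) A(4,5) by eventually_elim (simp add: field_simps)
 qed (use F A in simp)
qed

end

context smooth_projective
begin

lemma zariski_Z: "zariski Z = T"
 by (simp add: proj_variety_def)

lemma form_finite_zeros:
 assumes "P : S" "F : forms d" "F P ~= 0"
 shows "finite {x : pts Z. F x = 0}"
 using form_zeros[OF assms(2)] assms points_Z by auto

lemma regular_finite_form:
 assumes "P : pts Z" "f : reg Z P"
 obtains d F G where "F : forms d" "G : forms d" "G P ~= 0" "EV x in near P. f x = F x / G x"
  "EV x in near P. G x ~= 0"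
proof -
 have "P : S" using assms points_Z by simp
 thus thesis
 proof (rule regularE'[OF _ assms(2)])
  fix d F G assume "F : forms d" "G : forms d" "G P ~= 0" "EV x in nhdsin T P. f x = F x / G x"
  "EV x in nhdsin T P. G x ~= 0"
  thus thesis by (intro that[of F d G]) (simp_all add: zariski_Z)
 qed
qed

lemma nonzero_coordinate: "P : pts Z ==> EX i<=N. P i ~= 0"
 using proj_space_nonzero[of P N] S_proj points_Z by auto

lemma separation_Z:
 assumes P: "P : pts Z" and E: "finite E" "E <= pts Z" "P ~: E"
 shows "EX th:reg Z P. th P = 1 & (ALL Q:E. th : reg Z Q & th Q = 0)"
proof -
 have "ALL Q:E. EX m. m : forms 1 & m Q = 0 & m P ~= 0"
 proof
  fix Q assume "Q : E"
  hence "Q : proj_space N" "P : proj_space N" "P ~= Q" using P E S_proj points_Z by auto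
  from separating_form[OF this(2,1,3)] show "EX m. m : forms 1 & m Q = 0 & m P ~= 0" unfolding Bex_def by simp
 qed
 from bchoice[OF this] obtain m where m: "ALL Q:E. m Q : forms 1 & m Q Q = 0 & m Q P ~= 0" ..
 have "finite (insert P E)" "insert P E <= proj_space N" using P E S_proj points_Z by auto
 from nonvanishing_form[OF this] obtain l where l: "l : forms 1" "ALL Q:insert P E. l Q ~= 0" ..
 define F where "F = (%x. PROD Q:E. m Q x)"
 have F: "F : forms (card E * 1)" unfolding F_def using forms_prod[OF E(1), of m "%_. 1"] m by simp
 have FP: "F P ~= 0" unfolding F_def using m E by simp
 have FQ: "F Q = 0" if "Q : E" for Q
  unfolding F_def using E(1) that m by (auto intro!: prod_zero)
 define c where "c = l P ^ card E / F P"
 have G: "(%x. l x ^ card E) : forms (card E * 1)" by (rule forms_power[OF l(1)])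
 have cF: "(%x. c * F x) : forms (card E * 1)" by (rule forms_scale[OF F])
 let ?th = "%x. c * F x / l x ^ card E"
 have "?th : reg Z Q" if "Q : insert P E" for Q
  by (rule regular_quotient[OF cF G]) (use l that in auto)
 moreover have "?th P = 1" using FP l by (simp add: c_def)
 moreover have "?th Q = 0" if "Q : E" for Q using FQ[OF that] by simp
 ultimately show ?thesis by (intro bexI[of _ ?th]) simp_all
qed

lemma meromorphic_Z:
 assumes P: "P : pts Z" and Q: "Q : pts Z" and f: "f : reg Z P"
 shows "EX a:reg Z Q. EX b:reg Z Q. ~ (EV x in near Q. b x = 0) &
  finite {x : pts Z. f x * b x ~= a x}"
proof (rule regular_finite_form[OF P f])
 fix d F G assume F: "F : forms d" "G : forms d" "G P ~= 0" "EV x in near P. f x = F x / G x"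
  "EV x in near P. G x ~= 0"
 obtain i where i: "Q i ~= 0" using nonzero_coordinate[OF Q] by auto
 have l: "(%x. x i ^ d) : forms d" using forms_power[OF forms_coordinate, of i d] by simp
 let ?a = "%x. F x / x i ^ d" and ?b = "%x. G x / x i ^ d"
 have a: "?a : reg Z Q" by (rule regular_quotient[OF F(1) l]) (use i in simp)
 have b: "?b : reg Z Q" by (rule regular_quotient[OF F(2) l]) (use i in simp)
 have "finite ({x : pts Z. ~ f x = F x / G x} Un {x : pts Z. ~ G x ~= 0})"
  using eventually_near_finite[OF P F(4)] eventually_near_finite[OF P F(5)] by simp
 hence 1: "finite {x : pts Z. f x * ?b x ~= ?a x}" by (rule rev_finite_subset) auto
 have Gz: "finite {x : pts Z. G x = 0}" using form_finite_zeros[OF _ F(2,3)] P points_Z by simp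
 have "~ (EV x in near Q. ?b x = 0)"
 proof
  assume "EV x in near Q. ?b x = 0"
  from eventually_near_finite[OF Q this] have A: "finite {x : pts Z. ~ ?b x = 0}" .
  have "finite {x : pts Z. x i = 0}"
  using form_finite_zeros[OF _ forms_coordinate, of Q i] i Q points_Z by simp
  hence "finite ({x : pts Z. ~ ?b x = 0} Un {x : pts Z. G x = 0} Un {x : pts Z. x i = 0})"
  using A Gz by simp
  hence "finite (pts Z)" by (rule rev_finite_subset) auto
  thus False using infinite_points by simp
 qed
 thus ?thesis using 1 a b by (intro bexI[OF _ a] bexI[OF _ b] conjI)
qed

lemma chart_Z:
 assumes P: "P : pts Z"
 shows "EX X. finite X & X <= reg Z P &
  (ALL f:reg Z P. EX A:fun_alg X. EX B:fun_alg X. B P ~= 0 &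
  (EV x in near P. f x * B x = A x)) &
  (EX E. finite E & P ~: E &
  (ALL x:pts Z - E. ALL y:pts Z - E. (ALL xi:X. xi x = xi y) --> x = y))"
proof -
 obtain k where k: "P k ~= 0" using nonzero_coordinate[OF P] by auto
 define X where "X = (%i (x :: nat => 'k). x i / x k) ` {..N}"
 define E where "E = {x : pts Z. x k = 0}"
 have E: "finite E" "P ~: E"
  using form_finite_zeros[OF _ forms_coordinate, of P k] k P points_Z by (simp_all add: E_def)
 have above: "x i = 0" if "x : pts Z" "i > N" for x i
  using proj_space_above[of x N i] that S_proj points_Z by auto
 have "finite X" by (simp add: X_def)
 moreover have "X <= reg Z P"
 proof
  fix xi assume "xi : X"
  then obtain i where "xi = (%x. x i / x k)" by (auto simp: X_def)
  thus "xi : reg Z P" using regular_quotient[OF forms_coordinate forms_coordinate, of P k i] k by simp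
 qed
 moreover have "ALL f:reg Z P. EX A:fun_alg X. EX B:fun_alg X. B P ~= 0 & (EV x in near P. f x * B x = A x)"
 proof
  fix f assume f: "f : reg Z P"
  show "EX A:fun_alg X. EX B:fun_alg X. B P ~= 0 & (EV x in near P. f x * B x = A x)"
  proof (rule regular_finite_form[OF P f])
  fix d F G assume F: "F : forms d" "G : forms d" "G P ~= 0" "EV x in near P. f x = F x / G x"
  "EV x in near P. G x ~= 0"
  obtain A where A: "A : fun_alg X" "!!x. x : pts Z ==> x k ~= 0 ==> F x / x k ^ d = A x"
  using forms_fun_alg[OF F(1), of "pts Z" N "%x. x k"] above unfolding X_def by auto
  obtain B where B: "B : fun_alg X" "!!x. x : pts Z ==> x k ~= 0 ==> G x / x k ^ d = B x"
  using forms_fun_alg[OF F(2), of "pts Z" N "%x. x k"] above unfolding X_def by auto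
  have "EV x in near P. f x * B x = A x"
  using F(4,5) near_avoid[OF P E]
  proof eventually_elim
  case (elim x)
  hence "x : pts Z" "x k ~= 0" by (auto simp: E_def)
  thus ?case using elim(1,2) A(2)[of x, symmetric] B(2)[of x, symmetric] by simp
  qed
  moreover have "B P ~= 0" using B(2)[OF P k, symmetric] F(3) k by simp
  ultimately show ?thesis by (intro bexI[OF _ A(1)] bexI[OF _ B(1)] conjI)
  qed
 qed
 moreover have "ALL x:pts Z - E. ALL y:pts Z - E. (ALL xi:X. xi x = xi y) --> x = y"
 proof (intro ballI impI)
  fix x y assume x: "x : pts Z - E" and y: "y : pts Z - E" and eq: "ALL xi:X. xi x = xi y"
  have nz: "x k ~= 0" "y k ~= 0" using x y by (auto simp: E_def)
  have "x i = (x k / y k) * y i" for i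
  proof (cases "i <= N")
  case True
  hence "x i / x k = y i / y k" using eq by (auto simp: X_def)
  thus ?thesis using nz by (simp add: field_simps)
  next
  case False
  thus ?thesis using above[of x i] above[of y i] x y by auto
  qed
  moreover have "x : proj_space N" "y : proj_space N" using x y S_proj points_Z by auto
  ultimately show "x = y" using proj_space_proportional by blast
 qed
 ultimately show ?thesis using E by (intro exI[of _ X] exI[of _ E] conjI)
qed

lemma sum_fun_apply: "(SUM i:I. f i) x = (SUM i:I. f i (x :: 'a) :: 'b::comm_monoid_add)"
 by (induction I rule: infinite_finite_induct) (auto simp: plus_fun_def zero_fun_def)

text \<open>Smoothness provides only a generator \<open>t\<close> of the maximal ideal. That a germ
  divisible by all powers of \<open>t\<close> is zero is Krull's intersection theorem, obtained here
  from one linear relation in a Noetherian algebra.\<close>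

lemma ex_uniformizer_Z:
 assumes P: "P : pts Z"
 shows "EX t:reg Z P. t P = 0 & finite {x : pts Z. t x = 0} &
  (ALL f:reg Z P. (EV x in near P. f x = 0) |
  (EX n u. u : reg Z P & u P ~= 0 & (EV x in near P. f x = t x ^ n * u x)))"
proof -
 have PS: "P : S" using P points_Z by simp
 have "EX t. generates Z P (vanishing_ideal Z P {P}) t"
  using smooth_projective P unfolding smooth_projective_curve_def smooth_curve_def by blast
 then obtain t where t: "generates Z P (vanishing_ideal Z P {P}) t" ..
 have vi: "f : vanishing_ideal Z P {P} <-> f : reg Z P & f P = 0" for f
 proof -
  have "{x : pts Z. ~ (x : {P} --> f x = 0)} <= {P}" by auto
  hence "finite {x : pts Z. ~ (x : {P} --> f x = 0)}" by (rule finite_subset) simp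
  thus ?thesis unfolding vanishing_ideal_def mem_Collect_eq eventually_near_iff[OF P] by simp
 qed
 have tr: "t : reg Z P" and tP: "t P = 0" using t vi unfolding generates_def by auto
 have gen: "EX u. u : reg Z P & (EV x in near P. f x = t x * u x)" if "f : reg Z P" "f P = 0" for f
  using t that vi unfolding generates_def Bex_def by simp
 \<comment> \<open>A form through \<open>P\<close> but not through \<open>Q\<close> has finitely
   many zeros on the curve, and \<open>t\<close> divides it near \<open>P\<close>; so
   \<open>t\<close> has finitely many zeros.\<close>
 obtain Q where Q: "Q : S" "Q ~= P" using infinite_S by (metis finite.emptyI finite_insert insertI1 rev_finite_subset subsetI)
 obtain m where m: "m : forms 1" "m P = 0" "m Q ~= 0"
  using bexE[OF separating_form[of Q N P]] Q PS S_proj by auto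
 obtain k where k: "P k ~= 0" using nonzero_coordinate[OF P] by auto
 let ?f = "%x. m x / x k"
 have "?f : reg Z P" by (rule regular_quotient[OF m(1) forms_coordinate]) (rule k)
 from gen[OF this] m(2) obtain u where u: "u : reg Z P" "EV x in near P. ?f x = t x * u x" by auto
 have tfin: "finite {x : pts Z. t x = 0}"
 proof -
  have "finite ({x : pts Z. ~ ?f x = t x * u x} Un {x : pts Z. m x = 0} Un {x : pts Z. x k = 0})"
  using eventually_near_finite[OF P u(2)] form_finite_zeros[OF Q(1) m(1,3)]
  form_finite_zeros[OF PS forms_coordinate k] by simp
  thus ?thesis by (rule rev_finite_subset) auto
 qed
 have "(EV x in near P. f x = 0) |
  (EX n u. u : reg Z P & u P ~= 0 & (EV x in near P. f x = t x ^ n * u x))"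
  if f: "f : reg Z P" for f
 proof (rule disjCI)
  assume no: "\<nexists>n u. u : reg Z P & u P ~= 0 & (EV x in near P. f x = t x ^ n * u x)"
  \<comment> \<open>Without a factorisation every cofactor vanishes at \<open>P\<close> and can be
    divided by \<open>t\<close> again; iteration gives germs \<open>g n\<close> with
    \<open>f = t ^ n * g n\<close>.\<close>
  define K where "K = (%n u. u : reg Z P & (EV x in near P. f x = t x ^ n * u x))"
  define L where "L = (%u v. EV x in near P. u x = t x * v x)"
  have K0: "EX u. K 0 u" unfolding K_def using f by (intro exI[of _ f]) simp
  have KS: "EX v. K (Suc n) v & L u v" if "K n u" for n u
  proof -
  have u: "u : reg Z P" "EV x in near P. f x = t x ^ n * u x" using that by (auto simp: K_def)
  have "u P = 0"
  proof (rule ccontr)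
  assume "u P ~= 0"
  hence "EX n u. u : reg Z P & u P ~= 0 & (EV x in near P. f x = t x ^ n * u x)"
  using u by (intro exI[of _ n] exI[of _ u] conjI)
  thus False using no by (rule notE[rotated])
  qed
  from gen[OF u(1) this] obtain v where v: "v : reg Z P" "EV x in near P. u x = t x * v x" by (elim exE conjE)
  have "EV x in near P. f x = t x ^ Suc n * v x" using u(2) v(2) by eventually_elim simp
  hence "K (Suc n) v & L u v" using v by (simp add: K_def L_def)
  thus ?thesis by (intro exI[of _ v])
  qed
  have "EX f. ALL n. K n (f n) & L (f n) (f (Suc n))" by (rule dependent_nat_choice[OF K0 KS])
  then obtain g where "ALL n. K n (g n) & L (g n) (g (Suc n))" ..
  hence g: "!!n. K n (g n)" "!!n. L (g n) (g (Suc n))" by simp_all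
  have gr: "g n : reg Z P" for n using g(1) by (simp add: K_def)
  have gk: "EV x in near P. g k x = t x ^ j * g (k + j) x" for k j
  proof (induction j)
  case (Suc j)
  show ?case using Suc g(2)[of "k + j", unfolded L_def] by eventually_elim simp
  qed simp
  obtain X where X: "finite X" "X <= reg Z P"
  and X': "ALL f:reg Z P. EX A:fun_alg X. EX B:fun_alg X. B P ~= 0 & (EV x in near P. f x * B x = A x)"
  using chart_Z[OF P] by (elim exE conjE) (rule that)
  have XA: "h : reg Z P" if "h : fun_alg X" for h
  using that by induction (use X in "auto intro: regular_const regular_add regular_mult P")
  define M where "M = (%n A B. A : fun_alg X & B : fun_alg X & B P ~= 0 & (EV x in near P. g n x * B x = A x))"
  have "EX A B. M n A B" for n
  proof -
  from bspec[OF X' gr[of n]] obtain A B where "A : fun_alg X" "B : fun_alg X" "B P ~= 0"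
  "EV x in near P. g n x * B x = A x" by (elim bexE conjE)
  hence "M n A B" by (simp add: M_def)
  thus ?thesis by (intro exI)
  qed
  then obtain A B where "!!n. M n (A n) (B n)" by metis
  hence AB: "!!n. A n : fun_alg X" "!!n. B n : fun_alg X" "!!n. B n P ~= 0"
  "!!n. EV x in near P. g n x * B n x = A n x" by (simp_all add: M_def)
  have "range A <= fun_alg X" using AB(1) by auto
  from noetherian_sequence[OF subring_fun_alg noetherian_fun_alg[OF X(1)] this]
  obtain n c where c: "ALL k<n. c k : fun_alg X" "A n = (SUM k<n. c k * A k)" by (elim exE conjE)
  have A: "A n x = (SUM k<n. c k x * A k x)" for x
  unfolding c(2) sum_fun_apply by (simp add: times_fun_def)
  have allk: "EV x in near P. ALL k:{..<n}. A k x = t x ^ (n - k) * g n x * B k x"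
  proof (rule eventually_ball_finite[OF finite_lessThan], rule ballI)
  fix k assume "k : {..<n}"
  hence kn: "k + (n - k) = n" by simp
  show "EV x in near P. A k x = t x ^ (n - k) * g n x * B k x"
  using AB(4)[of k] gk[of k "n - k", unfolded kn] by eventually_elim simp
  qed
  \<comment> \<open>The relation between the numerators reads \<open>g n * B n = g n * ?W\<close>.
    As \<open>?W\<close> vanishes at \<open>P\<close> and \<open>B n\<close> does not,
    \<open>?D\<close> is a unit and \<open>g n\<close> is zero near \<open>P\<close>.\<close>
  let ?W = "%x. SUM k<n. c k x * (t x ^ (n - k) * B k x)"
  let ?D = "%x. B n x - ?W x"
  have Wr: "?W : reg Z P"
  by (intro regular_sum regular_mult regular_power P tr) (use c(1) XA AB in auto)
  have Dr: "?D : reg Z P" by (intro regular_diff P XA AB Wr)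
  have "?W P = 0" by (rule sum.neutral) (simp add: tP)
  hence DP: "?D P ~= 0" using AB(3) by simp
  have "EV x in near P. g n x = 0"
  using AB(4)[of n] allk eventually_nonzero[OF P Dr DP]
  proof eventually_elim
  case (elim x)
  have "g n x * B n x = (SUM k<n. c k x * (t x ^ (n - k) * g n x * B k x))"
  using elim(1,2) A by simp
  also have "... = g n x * ?W x" by (simp add: sum_distrib_left mult_ac)
  finally have "g n x * ?D x = 0" by (simp add: algebra_simps)
  thus ?case using elim(3) by simp
  qed
  moreover have "EV x in near P. f x = t x ^ n * g n x" using g(1)[of n] by (simp add: K_def)
  ultimately show "EV x in near P. f x = 0" by eventually_elim simp
 qed
 thus ?thesis using tr tP tfin by (intro bexI[OF _ tr] conjI ballI)
qed

end

sublocale smooth_projective < algebraic_curve "proj_variety S"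
proof (unfold_locales, goal_cases)
 case (1 P) thus ?case by (rule ex_uniformizer_Z)
next
 case (2 P T) thus ?case by (rule separation_Z)
next
 case (3 P Q f) thus ?case by (rule meromorphic_Z)
next
 case (4 P) thus ?case by (rule chart_Z)
qed

section \<open>Finite group actions on curves\<close>

lemma card_roots_of_unity_le:
 fixes R :: "'k::field set"
 assumes "!!x. x : R ==> x ^ n = 1" "n > 0"
 shows "card R <= n"
proof -
 let ?p = "Polynomial.monom 1 n - 1 :: 'k poly"
 have "Polynomial.coeff ?p n = 1" using assms(2) by simp
 hence "?p ~= 0" by (metis Polynomial.coeff_0 zero_neq_one)
 have "degree ?p <= n" by (rule degree_diff_le) (simp_all add: degree_monom_le)
 have "card R <= card {x. poly ?p x = 0}"
  using assms(1) \<open>?p ~= 0\<close> by (intro card_mono poly_roots_finite) (auto simp: poly_monom)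
 also have "... <= degree ?p" using \<open>?p ~= 0\<close> by (rule card_poly_roots_bound)
 finally show ?thesis using \<open>degree ?p <= n\<close> by simp
qed

locale curve_action = algebraic_curve V + group G
 for V :: "('p, 'k::field_char_0) function_space" and G :: "('g, 'm) monoid_scheme" (structure) +
 fixes ph :: "'g => 'p => 'p"
 assumes finite_G: "finite (cr G)"
  and acts: "acts_faithfully_on G ph V"
begin

abbreviation (input) stab where "stab == stabilizer G ph"

sublocale A: faithful_action G "pts V" ph
 using acts by (simp add: acts_faithfully_on_def)

lemma act_closed: "g : cr G ==> z : pts V ==> ph g z : pts V"
 using A.element_image by blast

lemma act_mult: "g : cr G ==> h : cr G ==> z : pts V ==> ph (g *. h) z = ph g (ph h z)"
 using A.composition_rule by blast

lemma act_one: "z : pts V ==> ph \<one> z = z"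
 using A.id_eq_one by (metis restrict_apply')

lemma act_inv: "g : cr G ==> z : pts V ==> ph (inv g) (ph g z) = z"
 using act_mult[of "inv g" g z] act_one by simp

lemma act_inv': "g : cr G ==> z : pts V ==> ph g (ph (inv g) z) = z"
 using act_mult[of g "inv g" z] act_one by simp

lemma act_regular:
 "g : cr G ==> P : pts V ==> f : reg V (ph g P) ==> (%x. f (ph g x)) : reg V P"
 using acts by (simp add: acts_faithfully_on_def)

lemma act_eventually:
 assumes g: "g : cr G" and P: "P : pts V" and R: "eventually R (near (ph g P))"
 shows "EV x in near P. R (ph g x)"
proof -
 have R': "R (ph g P)" "finite {x : pts V. ~ R x}" using R act_closed[OF g P] by (simp_all add: eventually_near_iff)
 have "{x : pts V. ~ R (ph g x)} <= ph (inv g) ` {x : pts V. ~ R x}"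
 proof
  fix x assume "x : {x : pts V. ~ R (ph g x)}"
  thus "x : ph (inv g) ` {x : pts V. ~ R x}"
  using act_inv[OF g, of x] act_closed[OF g, of x] by (intro image_eqI[of _ _ "ph g x"]) auto
 qed
 hence "finite {x : pts V. ~ R (ph g x)}" using R'(2) finite_surj by blast
 thus ?thesis using R'(1) P by (simp add: eventually_near_iff)
qed

lemma act_morphism: "g : cr G ==> P : pts V ==> morphism_at V V (ph g) P"
 unfolding morphism_at_def using act_closed act_regular act_eventually by simp

text \<open>The pulled back parameter vanishes at \<open>P\<close>, so its order is at least 1;
  pulling \<open>unif P\<close> back by \<open>inv g\<close> shows that it divides
  \<open>unif P\<close>, so its order is at most 1.\<close>

lemma act_order_aux:
 assumes g: "g : cr G" and P: "P : pts V"
 shows "has_order P (%x. unif (ph g P) (ph g x)) 1"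
proof -
 let ?Q = "ph g P" and ?ta = "%x. unif (ph g P) (ph g x)"
 have Q: "?Q : pts V" by (rule act_closed[OF g P])
 have ta: "?ta : reg V P" by (rule act_regular[OF g P unif(1)[OF Q]])
 have ge: "order_ge P ?ta 1" unfolding order_ge_1_iff[OF P ta] by (rule unif(2)[OF Q])
 have gi: "inv g : cr G" using g by simp
 have PQ: "ph (inv g) ?Q = P" by (rule act_inv[OF g P])
 let ?s = "%x. unif P (ph (inv g) x)"
 have s: "?s : reg V ?Q" by (rule act_regular[OF gi Q]) (use PQ unif(1)[OF P] in simp)
 have "order_ge ?Q ?s 1" unfolding order_ge_1_iff[OF Q s] using PQ unif(2)[OF P] by simp
 then obtain u where u: "u : reg V ?Q" "EV x in near ?Q. ?s x = unif ?Q x ^ 1 * u x"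
  by (auto simp: order_ge_def)
 have ur: "(%x. u (ph g x)) : reg V P" by (rule act_regular[OF g P u(1)])
 have eq: "EV x in near P. unif P x = ?ta x * u (ph g x)"
  using act_eventually[OF g P u(2)] eventually_near_points[of P]
  by eventually_elim (simp add: act_inv[OF g])
 have nz: "~ (EV x in near P. ?ta x = 0)"
 proof
  assume "EV x in near P. ?ta x = 0"
  hence "EV x in near P. unif P x = 0" using eq by eventually_elim simp
  thus False using has_order_not_zero[OF P has_order_uniformizer[OF P]] by simp
 qed
 show ?thesis
 proof (rule has_order_ex[OF P ta nz])
  fix k assume k: "has_order P ?ta k"
  have "1 <= k" by (rule has_order_ge_le[OF P k ge])
  moreover have "order_ge P (unif P) k" by (rule order_geI[OF P k ur eq])
  hence "k <= 1" by (rule has_order_ge_le[OF P has_order_uniformizer[OF P]])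
  ultimately show ?thesis using k by simp
 qed
qed

lemma act_has_order:
 assumes g: "g : cr G" and P: "P : pts V" and f: "has_order (ph g P) f n"
 shows "has_order P (%x. f (ph g x)) n"
proof -
 obtain u where u: "u : reg V (ph g P)" "u (ph g P) ~= 0"
  "EV x in near (ph g P). f x = unif (ph g P) x ^ n * u x" using f by (auto simp: has_order_def)
 have t: "has_order P (%x. unif (ph g P) (ph g x) ^ n) n"
  using has_order_power[OF P act_order_aux[OF g P], of n] by simp
 show ?thesis
  by (rule has_orderI[OF P t act_regular[OF g P u(1)] u(2) act_eventually[OF g P u(3)]])
qed

lemma stabilizerD: "sg : stab P ==> sg : cr G" "sg : stab P ==> ph sg P = P"
 by (simp_all add: stabilizer_def)

text \<open>The character by which the stabilizer of \<open>P\<close> acts on the cotangent space at \<open>P\<close>.\<close>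

definition zeta :: "'p => 'g => 'k" where
 "zeta P sg = (SOME u. u : reg V P & (EV x in near P. unif P (ph sg x) = unif P x * u x)) P"

lemma zeta_ex:
 assumes P: "P : pts V" and sg: "sg : stab P"
 obtains u where "u : reg V P" "u P = zeta P sg" "zeta P sg ~= 0"
  "EV x in near P. unif P (ph sg x) = unif P x * u x"
proof -
 note s = stabilizerD[OF sg]
 have "has_order (ph sg P) (unif P) 1" using has_order_uniformizer[OF P] s by simp
 from act_has_order[OF s(1) P this] have o: "has_order P (%x. unif P (ph sg x)) 1" .
 from has_order_expand[OF P has_order_uniformizer[OF P] o] obtain v where
  v: "v : reg V P" "v P ~= 0" "EV x in near P. unif P (ph sg x) = unif P x ^ 1 * v x" .
 define K where "K = (%u. u : reg V P & (EV x in near P. unif P (ph sg x) = unif P x * u x))"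
 have "K v" using v by (simp add: K_def)
 hence "K (SOME u. K u)" using someI[of K v] by simp
 then obtain u where u: "K u" "u P = zeta P sg" unfolding zeta_def K_def by blast
 hence u': "u : reg V P" "EV x in near P. unif P (ph sg x) = unif P x * u x"
  by (simp_all add: K_def)
 have "u P ~= 0"
 proof
  assume "u P = 0"
  hence "order_ge P u 1" using order_ge_1_iff[OF P u'(1)] by simp
  from order_ge_mult[OF P has_order_imp_ge[OF has_order_uniformizer[OF P]] this]
  have "order_ge P (%x. unif P x * u x) 2" by (simp add: numeral_2_eq_2)
  moreover have "EV x in near P. unif P x * u x = unif P (ph sg x)"
  using u'(2) by eventually_elim simp
  ultimately have "order_ge P (%x. unif P (ph sg x)) 2" by (rule order_ge_cong[OF P])
  from has_order_ge_le[OF P o this] show False by simp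
 qed
 thus thesis using that[OF u'(1) u(2) _ u'(2)] u(2) by simp
qed

lemma zeta_unique:
 assumes P: "P : pts V" and sg: "sg : stab P" and v: "v : reg V P"
  "EV x in near P. unif P (ph sg x) = unif P x * v x"
 shows "zeta P sg = v P"
proof (rule zeta_ex[OF P sg])
 fix u assume u: "u : reg V P" "u P = zeta P sg" "EV x in near P. unif P (ph sg x) = unif P x * u x"
 have ev: "EV x in near P. unif P x * u x = unif P x * v x"
  using u(3) v(2) by eventually_elim auto
 have "finite ({x : pts V. unif P x * u x ~= unif P x * v x} Un {x : pts V. unif P x = 0})"
  using eventually_near_finite[OF P ev] unif(3)[OF P] by simp
 hence "finite {x : pts V. u x ~= v x}" by (rule rev_finite_subset) auto
 from regular_agree[OF P u(1) v(1) this] have "u P = v P" by (rule eventually_near_self[OF P])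
 thus ?thesis using u by simp
qed

lemma stabilizer_mult:
 "P : pts V ==> sg : stab P ==> ta : stab P ==> sg *. ta : stab P"
 by (auto simp: stabilizer_def act_mult)

lemma stabilizer_inv: "P : pts V ==> sg : stab P ==> inv sg : stab P"
 using act_inv by (fastforce simp: stabilizer_def)

lemma stabilizer_one: "P : pts V ==> \<one> : stab P"
 by (auto simp: stabilizer_def act_one)

lemma zeta_mult:
 assumes P: "P : pts V" and sg: "sg : stab P" and ta: "ta : stab P"
 shows "zeta P (sg *. ta) = zeta P sg * zeta P ta"
proof (rule zeta_ex[OF P sg], rule zeta_ex[OF P ta])
 fix u v assume u: "u : reg V P" "u P = zeta P sg" "EV x in near P. unif P (ph sg x) = unif P x * u x"
  and v: "v : reg V P" "v P = zeta P ta" "EV x in near P. unif P (ph ta x) = unif P x * v x"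
 note s = stabilizerD[OF sg] stabilizerD[OF ta]
 have ur: "(%x. u (ph ta x)) : reg V P" using act_regular[OF s(3) P, of u] u(1) s(4) by simp
 have "eventually (%x. unif P (ph sg x) = unif P x * u x) (near (ph ta P))" using u(3) s(4) by simp
 from act_eventually[OF s(3) P this] v(3) eventually_near_points[of P]
 have "EV x in near P. unif P (ph (sg *. ta) x) = unif P x * (v x * u (ph ta x))"
  by eventually_elim (simp add: act_mult s mult.assoc)
 hence "zeta P (sg *. ta) = v P * u (ph ta P)"
  by (intro zeta_unique[OF P stabilizer_mult[OF P sg ta], of "%x. v x * u (ph ta x)"] regular_mult[OF P v(1) ur])
 thus ?thesis using u v s by (simp add: mult.commute)
qed

lemma zeta_one: "P : pts V ==> zeta P \<one> = 1"
 using zeta_mult[of P \<one> \<one>] stabilizer_one[of P] zeta_ex[of P \<one>] by (metis mult_cancel_left1 r_one one_closed)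

lemma zeta_power:
 assumes P: "P : pts V" and sg: "sg : stab P"
 shows "sg [^] n : stab P & zeta P (sg [^] n) = zeta P sg ^ (n :: nat)"
proof (induction n)
 case 0
 show ?case using zeta_one[OF P] stabilizer_one[OF P] by simp
next
 case (Suc n)
 thus ?case using zeta_mult[OF P _ sg, of "sg [^] n"] stabilizer_mult[OF P _ sg, of "sg [^] n"]
  by (simp add: mult.commute)
qed

lemma act_order_quotient:
 assumes P: "P : pts V" and sg: "sg : stab P" and f: "has_order P f n"
 obtains v where "v : reg V P" "v P = zeta P sg ^ n" "EV x in near P. f (ph sg x) = f x * v x"
proof (rule zeta_ex[OF P sg])
 fix u assume u: "u : reg V P" "u P = zeta P sg" "EV x in near P. unif P (ph sg x) = unif P x * u x"
 note s = stabilizerD[OF sg]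
 obtain w where w: "w : reg V P" "w P ~= 0" "EV x in near P. f x = unif P x ^ n * w x"
  using f by (auto simp: has_order_def)
 let ?v = "%x. u x ^ n * w (ph sg x) * inverse (w x)"
 have ws: "(%x. w (ph sg x)) : reg V P" using act_regular[OF s(1) P, of w] w(1) s(2) by simp
 have vr: "?v : reg V P" by (intro regular_mult regular_power regular_inverse P u ws w)
 have vP: "?v P = zeta P sg ^ n" using u(2) w(2) s by simp
 have "eventually (%x. f x = unif P x ^ n * w x) (near (ph sg P))" using w(3) s by simp
 from act_eventually[OF s(1) P this] w(3) u(3) eventually_nonzero[OF P w(1,2)]
 have "EV x in near P. f (ph sg x) = f x * ?v x"
  by eventually_elim (simp add: power_mult_distrib)
 thus thesis by (rule that[OF vr vP])
qed

text \<open>The translate of \<open>f\<close> is \<open>f * v\<close> with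
  \<open>v P = zeta P sg ^ n\<close>, so the difference is \<open>f\<close> times the unit
  \<open>1 - v\<close>.\<close>

lemma has_order_difference:
 assumes P: "P : pts V" and sg: "sg : stab P" and f: "has_order P f n" and "zeta P sg ^ n ~= 1"
 shows "has_order P (%x. f x - f (ph sg x)) n"
proof (rule act_order_quotient[OF P sg f])
 fix v assume v: "v : reg V P" "v P = zeta P sg ^ n" "EV x in near P. f (ph sg x) = f x * v x"
 show ?thesis
 proof (rule has_orderI[OF P f])
  show "(%x. 1 - v x) : reg V P" by (intro regular_diff regular_const P v)
  show "EV x in near P. f x - f (ph sg x) = f x * (1 - v x)" using v(3) by eventually_elim (simp add: algebra_simps)
 qed (use v assms in simp)
qed

text \<open>If \<open>sg\<close> acts trivially on the cotangent space, the average of a local parameter over the powers of \<open>sg\<close> is a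
 \<open>sg\<close>-invariant local parameter, and then all functions are invariant because differences of functions are
 divisible by differences of the parameter.\<close>

lemma zeta_eq_one:
 assumes P: "P : pts V" and sg: "sg : stab P" and z: "zeta P sg = 1"
 shows "sg = \<one>"
proof -
 note s = stabilizerD[OF sg]
 define m where "m = order G"
 have m: "m > 0" using order_gt_0_iff_finite finite_G by (simp add: m_def)
 let ?t = "unif P"
 define t' where "t' = (%x. SUM i<m. ?t (ph (sg [^] i) x))"
 have "EX u. u : reg V P & u P = 1 & (EV x in near P. ?t (ph (sg [^] i) x) = ?t x * u x)" for i :: nat
 proof (rule zeta_ex[OF P])
  show "sg [^] i : stab P" using zeta_power[OF P sg] by simp
  fix u assume u: "u : reg V P" "u P = zeta P (sg [^] i)" "EV x in near P. ?t (ph (sg [^] i) x) = ?t x * u x"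
  hence "u P = 1" using zeta_power[OF P sg, of i] z by simp
  thus ?thesis using u by (intro exI[of _ u] conjI)
 qed
 hence "ALL i. EX u. u : reg V P & u P = 1 & (EV x in near P. ?t (ph (sg [^] (i :: nat)) x) = ?t x * u x)" ..
 from choice[OF this] obtain u where u0: "ALL i. u i : reg V P & u i P = 1 &
  (EV x in near P. ?t (ph (sg [^] (i :: nat)) x) = ?t x * u i x)" ..
 hence u: "!!i. u i : reg V P" "!!i. u i P = 1"
  "!!i. EV x in near P. ?t (ph (sg [^] (i :: nat)) x) = ?t x * u i x" by simp_all
 have "EV x in near P. ALL i:{..<m}. ?t (ph (sg [^] i) x) = ?t x * u i x"
  by (rule eventually_ball_finite) (use u(3) in simp_all)
 hence ev: "EV x in near P. t' x = ?t x * (SUM i<m. u i x)"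
  by eventually_elim (simp add: t'_def sum_distrib_left)
 have t'1: "has_order P t' 1"
  by (rule has_orderI[OF P has_order_uniformizer[OF P] _ _ ev])
  (use u m in "auto intro!: regular_sum P")
 have inv: "t' (ph sg x) = t' x" if x: "x : pts V" for x
 proof -
  have "t' (ph sg x) = (SUM i<m. ?t (ph (sg [^] Suc i) x))"
  unfolding t'_def by (rule sum.cong) (simp_all add: act_mult s x)
  also have "... + ?t (ph (sg [^] (0::nat)) x) = (SUM i<Suc m. ?t (ph (sg [^] i) x))"
  unfolding sum.lessThan_Suc_shift by (rule add.commute)
  also have "... = t' x + ?t (ph (sg [^] m) x)" by (simp add: t'_def)
  also have "sg [^] m = \<one>" unfolding m_def by (rule pow_order_eq_1[OF s(1)])
  finally show ?thesis by simp
 qed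
 have fix_f: "EV x in near P. f (ph sg x) = f x" if f: "f : reg V P" for f
 proof -
  \<comment> \<open>Restricted to the graph of \<open>sg\<close>, the factor
    \<open>t' (snd z) - t' (fst z)\<close> is zero by invariance, hence so is the difference of
    \<open>f\<close>.\<close>
  from difference_divisible[OF P t'1 f] obtain bt where bt: "bt : VV.reg2 P P"
  "EV z in VV.near2 P P. f (snd z) - f (fst z) = (t' (snd z) - t' (fst z)) * bt z" ..
  have "eventually (%z. f (snd z) - f (fst z) = (t' (snd z) - t' (fst z)) * bt z) (VV.near2 P (ph sg P))"
  using bt(2) s by simp
  from VV.near2_pullback[OF curve_axioms morphism_at_id[OF P] act_morphism[OF s(1) P] this]
  show ?thesis using eventually_near_points[of P] by eventually_elim (simp add: inv)
 qed
 obtain X E where X: "finite X" "X <= reg V P" and E: "finite E" "P ~: E"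
  "ALL x:pts V - E. ALL y:pts V - E. (ALL xi:X. xi x = xi y) --> x = y"
  using chart[OF P] by (elim exE conjE) (rule that)
 have allX: "EV x in near P. ALL xi:X. xi (ph sg x) = xi x"
  by (rule eventually_ball_finite[OF X(1)]) (use X(2) fix_f in auto)
 have avoid: "EV x in near (ph sg P). x ~: E & x : pts V" using near_avoid[OF P E(1,2)] s by simp
 have "EV x in near P. ph sg x = x"
  using allX near_avoid[OF P E(1,2)] act_eventually[OF s(1) P avoid]
  by eventually_elim (use E(3) in auto)
 from eventually_near_finite[OF P this] have cof: "finite {x : pts V. ph sg x ~= x}" .
 \<comment> \<open>So far \<open>sg\<close> fixes all but finitely many points. At a point moved by
   it, a separating function \<open>th\<close> and its translate would agree off a finite set and
   still differ at \<open>Q\<close>.\<close>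
 have "ph sg Q = Q" if Q: "Q : pts V" for Q
 proof (rule ccontr)
  assume ne: "ph sg Q ~= Q"
  have sQ: "ph sg Q : pts V" by (rule act_closed[OF s(1) Q])
  have "{Q} <= pts V" "ph sg Q ~: {Q}" using Q ne by auto
  from separation[OF sQ _ this] obtain th where th: "th : reg V (ph sg Q)" "th (ph sg Q) = 1" "th : reg V Q" "th Q = 0"
  by auto
  have "finite {x : pts V. th (ph sg x) ~= th x}" by (rule finite_subset[OF _ cof]) auto
  from regular_agree[OF Q act_regular[OF s(1) Q th(1)] th(3) this]
  have "th (ph sg Q) = th Q" by (rule eventually_near_self[OF Q])
  thus False using th by simp
 qed
 hence "ph sg x = ph \<one> x" for x
  using act_one A.bij_prop0[OF s(1)] A.bij_prop0[OF one_closed]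
  by (cases "x : pts V") (auto simp: Bij_def extensional_def)
 hence "ph sg = ph \<one>" by (rule ext)
 thus ?thesis using A.faithful s(1) one_closed by (auto dest: inj_onD)
qed

lemma zeta_inj:
 assumes P: "P : pts V" shows "inj_on (zeta P) (stab P)"
proof (rule inj_onI)
 fix sg ta assume sg: "sg : stab P" and ta: "ta : stab P" and eq: "zeta P sg = zeta P ta"
 have tai: "inv ta : stab P" by (rule stabilizer_inv[OF P ta])
 have "zeta P (sg *. inv ta) = zeta P (ta *. inv ta)" using zeta_mult[OF P _ tai] sg ta eq by simp
 also have "... = 1" using zeta_one[OF P] stabilizerD(1)[OF ta] by simp
 finally have "sg *. inv ta = \<one>" by (intro zeta_eq_one[OF P stabilizer_mult[OF P sg tai]])
 thus "sg = ta" using stabilizerD(1)[OF ta] stabilizerD(1)[OF sg] by (metis inv_equality inv_inv inv_closed)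
qed

lemma stabilizer_subgroup_power:
 assumes K: "subgroup K G" and sg: "sg : K"
 shows "sg [^] card K = \<one>"
proof -
 interpret K: group "G\<lparr>carrier := K\<rparr>" by (rule subgroup.subgroup_is_group[OF K is_group])
 have "sg [^]\<^bsub>G\<lparr>carrier := K\<rparr>\<^esub> order (G\<lparr>carrier := K\<rparr>) = \<one>\<^bsub>G\<lparr>carrier := K\<rparr>\<^esub>"
  by (rule K.pow_order_eq_1) (use sg in simp)
 thus ?thesis by (simp add: order_def nat_pow_consistent[symmetric])
qed

lemma stabilizer_Int_subgroup:
 assumes H: "subgroup H G" and P: "P : pts V"
 shows "subgroup (H Int stab P) G"
 using subgroups_Inter_pair[OF H A.stabilizer_subgroup[OF P]] .

text \<open>The injective character already maps \<open>H Int stab P\<close> onto as many roots of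
  unity of exponent \<open>card (H Int stab P)\<close> as a field can contain; an element
  \<open>sg\<close> outside \<open>H\<close> would add one more.\<close>

lemma zeta_root_of_unity_mem:
 assumes H: "subgroup H G" and P: "P : pts V" and sg: "sg : stab P"
  and z: "zeta P sg ^ card (H Int stab P) = 1"
 shows "sg : H"
proof (rule ccontr)
 assume nH: "sg ~: H"
 let ?K = "H Int stab P"
 have K: "subgroup ?K G" by (rule stabilizer_Int_subgroup[OF H P])
 have fK: "finite ?K" using finite_G subgroup.subset[OF H] by (auto intro: finite_subset)
 have pos: "card ?K > 0" using subgroup.one_closed[OF K] fK by (auto simp: card_gt_0_iff)
 have "card (zeta P ` (insert sg ?K)) <= card ?K"
 proof (rule card_roots_of_unity_le[OF _ pos])
  fix x assume "x : zeta P ` insert sg ?K"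
  thus "x ^ card ?K = 1"
  using z zeta_power[OF P, of _ "card ?K"] stabilizer_subgroup_power[OF K] zeta_one[OF P] by fastforce
 qed
 moreover have "card (zeta P ` (insert sg ?K)) = card (insert sg ?K)"
  by (rule card_image) (rule inj_on_subset[OF zeta_inj[OF P]], use sg in auto)
 ultimately show False using nH fK by simp
qed

text \<open>By invariance the difference of \<open>f\<close> and its translate is zero, so
  \<open>zeta P sg ^ n\<close> must be 1. All values of the character on \<open>H Int stab P\<close>
  are then roots of unity whose exponent is the gcd of \<open>n\<close> and the group order, and
  counting them forces that gcd to be the group order.\<close>

lemma invariant_order_dvd:
 assumes H: "subgroup H G" and P: "P : pts V" and f: "has_order P f n"
  and inv: "!!h x. h : H ==> x : pts V ==> f (ph h x) = f x"
 shows "card (H Int stab P) dvd n"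
proof -
 let ?K = "H Int stab P"
 have K: "subgroup ?K G" by (rule stabilizer_Int_subgroup[OF H P])
 have fK: "finite ?K" using finite_G subgroup.subset[OF H] by (auto intro: finite_subset)
 have pos: "card ?K > 0" using subgroup.one_closed[OF K] fK by (auto simp: card_gt_0_iff)
 have zn: "zeta P sg ^ n = 1" if sg: "sg : ?K" for sg
 proof (rule ccontr)
  assume ne: "zeta P sg ^ n ~= 1"
  have "has_order P (%x. f x - f (ph sg x)) n" by (rule has_order_difference[OF P _ f ne]) (use sg in simp)
  moreover have "EV x in near P. f x - f (ph sg x) = 0"
  using eventually_near_points[of P] by eventually_elim (use inv sg in simp)
  ultimately show False using has_order_not_zero[OF P] by blast
 qed
 define d where "d = gcd n (card ?K)"
 have d: "d > 0" "d dvd n" "d dvd card ?K" using pos by (auto simp: d_def)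
 have "card (zeta P ` ?K) <= d"
 proof (rule card_roots_of_unity_le[OF _ d(1)])
  fix x assume "x : zeta P ` ?K"
  then obtain sg where sg: "sg : ?K" "x = zeta P sg" by auto
  have xn: "x ^ n = 1" using zn sg by simp
  have xe: "x ^ card ?K = 1"
  using zeta_power[OF P, of sg "card ?K"] stabilizer_subgroup_power[OF K sg(1)] zeta_one[OF P] sg by simp
  show "x ^ d = 1"
  proof (cases "n = 0")
  case True
  thus ?thesis using xe by (simp add: d_def)
  next
  case False
  then obtain a b where ab: "n * a = card ?K * b + d" using bezout_nat[of n "card ?K"] unfolding d_def by metis
  have "x ^ (n * a) = 1" using xn by (simp add: power_mult)
  moreover have "x ^ (card ?K * b + d) = x ^ d" using xe by (simp add: power_add power_mult)
  ultimately show ?thesis using ab by simp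
  qed
 qed
 moreover have "card (zeta P ` ?K) = card ?K"
  by (rule card_image) (rule inj_on_subset[OF zeta_inj[OF P]], auto)
 moreover have "d <= card ?K" using d(3) pos by (rule dvd_imp_le)
 ultimately have "d = card ?K" by simp
 thus ?thesis using d(2) by simp
qed

end

section \<open>The quotient of a curve by a finite group\<close>

locale curve_quotient = curve_action V G ph
 for V :: "('p, 'k::field_char_0) function_space" and G :: "('g, 'm) monoid_scheme" (structure) and ph +
 fixes H :: "'g set"
 assumes subgroup_H: "subgroup H G"
begin

definition pr :: "'p => 'p set" where "pr = orbit (G\<lparr>carrier := H\<rparr>) ph"

definition X :: "('p set, 'k) function_space" where "X = quotient_space (G\<lparr>carrier := H\<rparr>) ph V"

definition ramif :: "'p => nat" where "ramif z = card (H Int stab z)"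

lemma H_carrier: "h : H ==> h : cr G"
 using subgroup.subset[OF subgroup_H] by auto

lemma H_one: "\<one> : H"
 and H_mult: "h : H ==> k : H ==> h *. k : H"
 and H_inv: "h : H ==> inv h : H"
 using subgroup_H by (auto simp: subgroup_def)

lemma finite_H: "finite H"
 using finite_G subgroup.subset[OF subgroup_H] by (rule rev_finite_subset)

lemma pr_eq: "pr z = (%h. ph h z) ` H"
 by (auto simp: pr_def orbit_def)

lemma finite_pr: "finite (pr z)"
 unfolding pr_eq using finite_H by simp

lemma pr_self: "z : pts V ==> z : pr z"
 unfolding pr_eq using H_one act_one by (force intro: image_eqI[of _ _ "\<one>"])

lemma pr_subset: "z : pts V ==> pr z <= pts V"
 unfolding pr_eq using act_closed H_carrier by auto

lemma pr_act:
 assumes h: "h : H" and z: "z : pts V"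
 shows "pr (ph h z) = pr z"
proof
 show "pr (ph h z) <= pr z"
 proof
  fix x assume "x : pr (ph h z)"
  then obtain k where k: "k : H" "x = ph k (ph h z)" by (auto simp: pr_eq)
  hence "x = ph (k *. h) z" using act_mult H_carrier h z by simp
  thus "x : pr z" unfolding pr_eq using H_mult[OF k(1) h] by blast
 qed
 show "pr z <= pr (ph h z)"
 proof
  fix x assume "x : pr z"
  then obtain k where k: "k : H" "x = ph k z" by (auto simp: pr_eq)
  have hc: "h : cr G" "inv h : cr G" using H_carrier[OF h] by auto
  have "ph (k *. inv h) (ph h z) = ph k (ph (inv h) (ph h z))"
  by (rule act_mult[OF H_carrier[OF k(1)] hc(2) act_closed[OF hc(1) z]])
  hence "x = ph (k *. inv h) (ph h z)" using act_inv[OF hc(1) z] k by simp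
  thus "x : pr (ph h z)" unfolding pr_eq using H_mult[OF k(1) H_inv[OF h]] by blast
 qed
qed

lemma pr_mem_eq:
 assumes z: "z : pts V" and w: "w : pr z"
 shows "pr w = pr z"
proof -
 obtain h where h: "h : H" "w = ph h z" using w unfolding pr_eq by (elim imageE)
 show ?thesis unfolding h(2) by (rule pr_act[OF h(1) z])
qed

lemma pr_eq_iff:
 assumes z: "z : pts V" and w: "w : pts V"
 shows "pr w = pr z <-> (EX h:H. w = ph h z)"
proof
 assume "pr w = pr z"
 hence "w : pr z" using pr_self[OF w] by simp
 thus "EX h:H. w = ph h z" unfolding pr_eq by (elim imageE) (rule bexI)
next
 assume "EX h:H. w = ph h z"
 thus "pr w = pr z" using pr_act z by (elim bexE) simp
qed

lemma points_X_aux: "orbits (G\<lparr>carrier := H\<rparr>) (pts V) ph = pr ` pts V"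
 by (auto simp: orbits_def pr_def)

lemma Union_pr_vimage:
 assumes "U <= pr ` pts V" shows "\<Union> U = {z : pts V. pr z : U}"
proof
 show "\<Union> U <= {z : pts V. pr z : U}"
 proof
  fix z assume "z : \<Union> U"
  then obtain y where y: "y : U" "z : y" by blast
  then obtain w where w: "w : pts V" "y = pr w" using assms by blast
  hence "z : pts V" "pr z = y" using y pr_mem_eq[of w z] pr_subset[of w] by auto
  thus "z : {z : pts V. pr z : U}" using y by simp
 qed
 show "{z : pts V. pr z : U} <= \<Union> U"
 proof
  fix z assume "z : {z : pts V. pr z : U}"
  thus "z : \<Union> U" using pr_self[of z] by (intro UnionI[of "pr z"]) auto
 qed
qed

lemma openin_X_basic:
 "U <= pr ` pts V ==> openin (zariski V) (\<Union> U) <-> U = {} | finite (pr ` pts V - U)"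
proof -
 assume U: "U <= pr ` pts V"
 have e: "pts V - \<Union> U = {z : pts V. pr z : pr ` pts V - U}"
  unfolding Union_pr_vimage[OF U] by auto
 have "finite {z : pts V. pr z : pr ` pts V - U} <-> finite (pr ` pts V - U)"
 proof
  assume "finite {z : pts V. pr z : pr ` pts V - U}"
  moreover have "pr ` pts V - U = pr ` {z : pts V. pr z : pr ` pts V - U}" by auto
  ultimately show "finite (pr ` pts V - U)" by simp
 next
  assume f: "finite (pr ` pts V - U)"
  have "{z : pts V. pr z : pr ` pts V - U} <= \<Union> (pr ` pts V - U)"
  proof
  fix z assume "z : {z : pts V. pr z : pr ` pts V - U}"
  thus "z : \<Union> (pr ` pts V - U)" using pr_self[of z] by (intro UnionI[of "pr z"]) auto
  qed
  moreover have "finite (\<Union> (pr ` pts V - U))" using f finite_pr by auto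
  ultimately show "finite {z : pts V. pr z : pr ` pts V - U}" by (rule finite_subset)
 qed
 moreover have "\<Union> U = {} <-> U = {}"
 proof
  assume e: "\<Union> U = {}"
  show "U = {}"
  proof (rule ccontr)
  assume "U ~= {}"
  then obtain z where "z : pts V" "pr z : U" using U by blast
  thus False using pr_self[of z] e by blast
  qed
 qed simp
 moreover have "\<Union> U <= pts V" unfolding Union_pr_vimage[OF U] by auto
 ultimately show ?thesis unfolding openin_iff e by auto
qed

lemma openin_X: "openin (zariski X) U <-> U <= pr ` pts V & (U = {} | finite (pr ` pts V - U))"
proof -
 let ?B = "{U. U <= pr ` pts V & openin (zariski V) (\<Union>U)}"
 have B: "?B = {U. U <= pr ` pts V & (U = {} | finite (pr ` pts V - U))}"
  using openin_X_basic by blast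
 have zX: "zariski X = topology_generated_by ?B"
  by (simp add: X_def quotient_space_def points_X_aux)
 show ?thesis
 proof
  assume "openin (zariski X) U"
  hence "generate_topology_on ?B U" unfolding zX openin_topology_generated_by_iff .
  hence "U : ?B"
  proof induction
  case Empty
  show ?case by simp
  next
  case (Int a b)
  have s: "a <= pr ` pts V" "b <= pr ` pts V" "a Int b <= pr ` pts V" using Int by auto
  have "\<Union> (a Int b) = \<Union> a Int \<Union> b"
  unfolding Union_pr_vimage[OF s(1)] Union_pr_vimage[OF s(2)] Union_pr_vimage[OF s(3)] by auto
  moreover have "openin (zariski V) (\<Union> a Int \<Union> b)" by (rule openin_Int) (use Int in auto)
  ultimately show ?case using s(3) by simp
  next
  case (UN K)
  have "\<Union> (\<Union> K) = \<Union> ((%k. \<Union> k) ` K)" by blast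
  moreover have "openin (zariski V) (\<Union> ((%k. \<Union> k) ` K))" by (rule openin_Union) (use UN in auto)
  moreover have "\<Union> K <= pr ` pts V" by (rule Union_least) (use UN in auto)
  ultimately show ?case by simp
  next
  case (Basis s)
  thus ?case .
  qed
  thus "U <= pr ` pts V & (U = {} | finite (pr ` pts V - U))" unfolding B by simp
 next
  assume "U <= pr ` pts V & (U = {} | finite (pr ` pts V - U))"
  hence "U : ?B" unfolding B by simp
  thus "openin (zariski X) U" unfolding zX by (rule topology_generated_by_Basis)
 qed
qed

lemma points_X: "pts X = pr ` pts V"
proof
 show "pts X <= pr ` pts V" using openin_X[of "pts X"] by simp
 have "openin (zariski X) (pr ` pts V)" unfolding openin_X by simp
 thus "pr ` pts V <= pts X" by (rule openin_subset)
qed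

lemma finite_pr_vimage: "finite {x : pts X. ~ R x} <-> finite {z : pts V. ~ R (pr z)}"
proof
 assume f: "finite {x : pts X. ~ R x}"
 have "{z : pts V. ~ R (pr z)} <= \<Union> {x : pts X. ~ R x}" using pr_self by (auto simp: points_X)
 moreover have "finite (\<Union> {x : pts X. ~ R x})" using f finite_pr by (auto simp: points_X)
 ultimately show "finite {z : pts V. ~ R (pr z)}" by (rule finite_subset)
next
 assume "finite {z : pts V. ~ R (pr z)}"
 moreover have "{x : pts X. ~ R x} = pr ` {z : pts V. ~ R (pr z)}" by (auto simp: points_X)
 ultimately show "finite {x : pts X. ~ R x}" by simp
qed

lemma eventually_X:
 assumes z: "z : pts V"
 shows "eventually R (nhdsin (zariski X) (pr z)) <-> (EV w in near z. R (pr w))"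
proof -
 have x: "pr z : pts X" using z by (simp add: points_X)
 have "eventually R (nhdsin (zariski X) (pr z)) <-> R (pr z) & finite {x : pts X. ~ R x}"
 proof
  assume "eventually R (nhdsin (zariski X) (pr z))"
  then obtain S where S: "openin (zariski X) S" "pr z : S" "ALL x:S. R x"
  using x by (auto simp: eventually_nhdsin)
  hence "finite (pts X - S)" using openin_X[of S] points_X by auto
  hence "finite {x : pts X. ~ R x}" by (rule rev_finite_subset) (use S in auto)
  thus "R (pr z) & finite {x : pts X. ~ R x}" using S by simp
 next
  assume R: "R (pr z) & finite {x : pts X. ~ R x}"
  have "pts X - {x : pts X. R x} = {x : pts X. ~ R x}" by auto
  hence "openin (zariski X) {x : pts X. R x}" unfolding openin_X points_X[symmetric] using R by auto
  thus "eventually R (nhdsin (zariski X) (pr z))"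
  unfolding eventually_nhdsin by (intro disjI2 exI[of _ "{x : pts X. R x}"]) (use R x in auto)
 qed
 thus ?thesis unfolding eventually_near_iff[OF z] finite_pr_vimage .
qed

lemma invariant_regular:
 assumes z: "z : pts V" and inv: "!!h x. h : H ==> x : pts V ==> F (ph h x) = F x"
  and F: "F : reg V z" and w: "w : pr z"
 shows "F : reg V w"
proof -
 obtain h where h: "h : H" "w = ph h z" using w by (auto simp: pr_eq)
 have hc: "h : cr G" "inv h : cr G" using H_carrier[OF h(1)] by auto
 have wV: "w : pts V" using act_closed[OF hc(1) z] h by simp
 have "ph (inv h) w = z" using act_inv[OF hc(1) z] h by simp
 hence "(%x. F (ph (inv h) x)) : reg V w" using act_regular[OF hc(2) wV, of F] F by simp
 moreover have "EV x in near w. F (ph (inv h) x) = F x"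
  using eventually_near_points[of w] by eventually_elim (rule inv[OF H_inv[OF h(1)]])
 ultimately show ?thesis by (rule regular_cong[OF wV])
qed

lemma pr_invariant: "h : H ==> x : pts V ==> f (pr (ph h x)) = f (pr x)"
 by (simp add: pr_act)

lemma regular_X:
 assumes z: "z : pts V"
 shows "f : reg X (pr z) <-> (%w. f (pr w)) : reg V z"
proof -
 have "f : reg X (pr z) <-> (ALL w:pr z. (%x. f (pr x)) : reg V w)"
  by (simp add: X_def quotient_space_def pr_def)
 also have "... <-> (%w. f (pr w)) : reg V z"
  using pr_self[OF z] invariant_regular[OF z, of "%w. f (pr w)", OF pr_invariant] by blast
 finally show ?thesis .
qed

lemma pr_morphism: "z : pts V ==> morphism_at V X pr z"
 unfolding morphism_at_def by (simp add: points_X regular_X eventually_X)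

lemma ramif_pos: "z : pts V ==> ramif z > 0"
 unfolding ramif_def using finite_H H_one stabilizer_one by (auto simp: card_gt_0_iff)

lemma card_hits:
 assumes z: "z : pts V" and w: "w : pr z"
 shows "card {h : H. ph h z = w} = ramif z"
proof -
 obtain k where k: "k : H" "w = ph k z" using w by (auto simp: pr_eq)
 have kc: "k : cr G" by (rule H_carrier[OF k(1)])
 have "bij_betw (%h. k *. h) (H Int stab z) {h : H. ph h z = w}"
 proof (rule bij_betw_byWitness[of _ "%h. inv k *. h"])
  show "ALL a:H Int stab z. inv k *. (k *. a) = a"
  using kc H_carrier by (auto simp: m_assoc[symmetric])
  show "ALL a:{h : H. ph h z = w}. k *. (inv k *. a) = a"
  using kc H_carrier by (auto simp: m_assoc[symmetric])
  show "(%h. k *. h) ` (H Int stab z) <= {h : H. ph h z = w}"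
  using k kc H_mult act_mult z by (auto simp: stabilizer_def)
  show "(%h. inv k *. h) ` {h : H. ph h z = w} <= H Int stab z"
  using k kc H_mult[OF H_inv[OF k(1)]] act_mult[of "inv k" _ z] act_inv[OF kc z] z H_carrier by (auto simp: stabilizer_def)
 qed
 thus ?thesis unfolding ramif_def by (metis bij_betw_same_card)
qed

lemma invariant_parameter:
 assumes w: "w : pts V" and A: "finite A" "A <= pts V"
 obtains s where "has_order w s (ramif w)" "!!h x. h : H ==> x : pts V ==> s (ph h x) = s x"
  "!!Q. Q : A ==> s : reg V Q" "!!Q. Q : A ==> Q ~: pr w ==> s Q = 1" "s w = 0"
proof -
 define T where "T = (UN Q:insert w A. pr Q) - {w}"
 have T: "finite T" "T <= pts V" "w ~: T" using A w finite_pr pr_subset by (auto simp: T_def)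
 obtain ta where ta: "has_order w ta 1" "ALL Q:T. ta : reg V Q & ta Q = 1"
  using local_parameter[OF w T] by (elim exE conjE)
 have tar: "ta : reg V Q" if "Q : insert w T" for Q
  using that ta has_order_regular by auto
 have taw: "ta w = 0"
  using order_ge_1_iff[OF w has_order_regular[OF ta(1)]] has_order_imp_ge[OF ta(1)] by simp
 define s where "s = (%x. PROD h:H. ta (ph h x))"
 have hT: "ph h Q : insert w T" if "h : H" "Q : insert w A" for h Q
  using that unfolding T_def pr_eq by blast
 have sr: "s : reg V Q" if Q: "Q : insert w A" for Q
 proof -
  have QV: "Q : pts V" using Q A w by auto
  show ?thesis unfolding s_def
  by (rule regular_prod[OF QV]) (use act_regular[OF H_carrier QV] tar[OF hT[OF _ Q]] in blast)
 qed
 have "has_order w s (SUM h:H. if ph h w = w then 1 else 0)"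
  unfolding s_def
 proof (rule has_order_prod[OF w finite_H])
  fix h assume h: "h : H"
  have hc: "h : cr G" by (rule H_carrier[OF h])
  show "has_order w (%x. ta (ph h x)) (if ph h w = w then 1 else 0)"
  proof (cases "ph h w = w")
  case True
  thus ?thesis using act_has_order[OF hc w, of ta 1] ta(1) by simp
  next
  case False
  hence "ph h w : T" using hT[OF h, of w] by simp
  hence "has_order (ph h w) ta 0" using ta(2) has_order_0_iff[OF act_closed[OF hc w]] by simp
  thus ?thesis using act_has_order[OF hc w] False by simp
  qed
 qed
 moreover have "(SUM h:H. if ph h w = w then 1 else 0) = ramif w"
 proof -
  have "H Int {h. ph h w = w} = H Int stab w" using H_carrier by (auto simp: stabilizer_def)
  thus ?thesis using finite_H by (simp add: sum.If_cases ramif_def)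
 qed
 ultimately have 1: "has_order w s (ramif w)" by simp
 have 2: "s (ph h x) = s x" if h: "h : H" and x: "x : pts V" for h x
 proof -
  have "s (ph h x) = (PROD k:H. ta (ph (k *. h) x))"
  unfolding s_def by (rule prod.cong) (simp_all add: act_mult H_carrier h x)
  also have "... = s x"
  unfolding s_def
  proof (rule prod.reindex_bij_witness[of _ "%k. k *. inv h" "%k. k *. h"])
  qed (use H_carrier h H_mult H_inv in "auto simp: m_assoc")
  finally show ?thesis .
 qed
 have 4: "s Q = 1" if Q: "Q : A" "Q ~: pr w" for Q
 proof -
  have "ta (ph h Q) = 1" if h: "h : H" for h
  proof -
  have QV: "Q : pts V" using Q A by auto
  have "ph h Q ~= w"
  proof
  assume "ph h Q = w"
  hence "w : pr Q" using h by (auto simp: pr_eq)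
  hence "pr w = pr Q" by (rule pr_mem_eq[OF QV])
  thus False using pr_self[OF QV] Q by simp
  qed
  hence "ph h Q : T" using hT[OF h, of Q] Q by simp
  thus ?thesis using ta(2) by simp
  qed
  thus ?thesis by (simp add: s_def)
 qed
 have "s w = 0"
  unfolding s_def using finite_H H_one taw act_one[OF w] by (auto intro!: prod_zero bexI[of _ \<one>])
 thus thesis using 1 2 sr 4 by (intro that[of s]) auto
qed

definition desc :: "('p => 'k) => 'p set => 'k" where "desc F y = F (SOME z. z : y)"

lemma desc_pr:
 assumes "z : pts V" "!!h x. h : H ==> x : pts V ==> F (ph h x) = F x"
 shows "desc F (pr z) = F z"
proof -
 have "(SOME w. w : pr z) : pr z" using pr_self[OF assms(1)] by (rule someI)
 thus ?thesis unfolding desc_def using assms by (auto simp: pr_eq)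
qed

lemma desc_regular:
 assumes z: "z : pts V" and inv: "!!h x. h : H ==> x : pts V ==> F (ph h x) = F x"
  and F: "F : reg V z"
 shows "desc F : reg X (pr z)"
 unfolding regular_X[OF z]
proof (rule regular_cong[OF z F])
 show "EV x in near z. F x = desc F (pr x)"
  using eventually_near_points[of z] by eventually_elim (simp add: desc_pr[OF _ inv])
qed

text \<open>The axiom with content is the existence of a parameter: it is the descent of an
  invariant function of order \<open>ramif\<close>, and functions pulled back from the quotient have
  orders divisible by that number.\<close>

sublocale X: curve X
proof
 show "openin (zariski X) U <-> U <= pts X & (U = {} | finite (pts X - U))" for U
  using openin_X points_X by simp
 show "infinite (pts X)"
 proof
  assume f: "finite (pts X)"
  have "pts V <= \<Union> (pts X)" using pr_self by (auto simp: points_X)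
  moreover have "finite (\<Union> (pts X))" using f finite_pr by (auto simp: points_X)
  ultimately show False using infinite_points finite_subset by blast
 qed
 fix P assume "P : pts X"
 then obtain z where z: "z : pts V" "P = pr z" by (auto simp: points_X)
 note R = regular_X[OF z(1)] and E = eventually_X[OF z(1)]
 show "(%_. c) : reg X P" for c unfolding z(2) R by (rule regular_const[OF z(1)])
 show "EX t:reg X P. t P = 0 & finite {x : pts X. t x = 0} &
  (ALL f:reg X P. (EV x in nhdsin (zariski X) P. f x = 0) |
  (EX n u. u : reg X P & u P ~= 0 & (EV x in nhdsin (zariski X) P. f x = t x ^ n * u x)))"
 proof (rule invariant_parameter[OF z(1), of "{}"])
  fix s assume s: "has_order z s (ramif z)" "!!h x. h : H ==> x : pts V ==> s (ph h x) = s x" "s z = 0"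
  let ?t = "desc s"
  have tpr: "?t (pr x) = s x" if "x : pts V" for x by (rule desc_pr[OF that s(2)])
  have t: "?t : reg X P" unfolding z(2) by (rule desc_regular[OF z(1) s(2) has_order_regular[OF s(1)]])
  have t0: "?t P = 0" using tpr[OF z(1)] s(3) z(2) by simp
  have sfin: "finite {x : pts V. s x = 0}" by (rule has_order_finite_zeros[OF z(1) s(1)])
  hence "finite {x : pts V. ~ (?t (pr x) ~= 0)}" by (rule rev_finite_subset) (auto simp: tpr)
  hence tfin: "finite {x : pts X. ?t x = 0}" using finite_pr_vimage[of "%x. ?t x ~= 0"] by simp
  have "(EV x in nhdsin (zariski X) P. f x = 0) |
  (EX n u. u : reg X P & u P ~= 0 & (EV x in nhdsin (zariski X) P. f x = ?t x ^ n * u x))"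
  if f: "f : reg X P" for f
  proof (rule disj_imp[THEN iffD2], rule impI)
  let ?F = "%w. f (pr w)"
  assume "~ (EV x in nhdsin (zariski X) P. f x = 0)"
  hence nz: "~ (EV x in near z. ?F x = 0)" unfolding z(2) E .
  have F: "?F : reg V z" using f unfolding z(2) R .
  obtain n where n: "has_order z ?F n" by (rule has_order_ex[OF z(1) F nz])
  have "ramif z dvd n" unfolding ramif_def
  by (rule invariant_order_dvd[OF subgroup_H z(1) n]) (rule pr_invariant)
  then obtain k where k: "n = k * ramif z + 0" by (metis add_0_right dvd_def mult.commute)
  have sk: "has_order z (%x. s x ^ k) (k * ramif z)" by (rule has_order_power[OF z(1) s(1)])
  show "EX n u. u : reg X P & u P ~= 0 & (EV x in nhdsin (zariski X) P. f x = ?t x ^ n * u x)"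
  proof (rule has_order_divide[OF z(1) sk n[unfolded k]])
  fix u assume u: "has_order z u 0" "EV x in near z. f (pr x) = s x ^ k * u x"
  have u': "u : reg V z" "u z ~= 0" using u(1) has_order_0_iff[OF z(1)] by auto
  \<comment> \<open>\<open>f / t ^ k\<close> is meaningless at \<open>P\<close>, where
    \<open>t\<close> vanishes; the value there is taken from the unit \<open>u\<close> found on
    \<open>V\<close>.\<close>
  define g where "g = (%y. if y = P then u z else f y / ?t y ^ k)"
  have "finite (pr z - {z})" "z ~: pr z - {z}" using finite_pr by auto
  from near_avoid[OF z(1) this]
  have av: "EV x in near z. x ~: pr z - {z} & x : pts V" .
  have "finite ({x : pts V. s x = 0} - {z})" "z ~: {x : pts V. s x = 0} - {z}" using sfin by auto
  from near_avoid[OF z(1) this] av u(2)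
  have gu: "EV x in near z. u x = g (pr x)"
  proof eventually_elim
  case (elim x)
  show ?case
  proof (cases "x = z")
  case True
  thus ?thesis by (simp add: g_def z(2))
  next
  case False
  hence "x ~: pr z" "s x ~= 0" using elim by auto
  moreover have "pr x ~= pr z" using \<open>x ~: pr z\<close> pr_self[of x] elim by auto
  ultimately show ?thesis using elim by (simp add: g_def z(2) tpr)
  qed
  qed
  have "g : reg X P" unfolding z(2) R by (rule regular_cong[OF z(1) u'(1) gu])
  moreover have "g P ~= 0" using u' by (simp add: g_def)
  moreover have "EV x in nhdsin (zariski X) P. f x = ?t x ^ k * g x"
  unfolding z(2) E using u(2) gu av by eventually_elim (simp add: tpr)
  ultimately show ?thesis by (intro exI[of _ k] exI[of _ g] conjI)
  qed
  qed
  thus ?thesis using t t0 tfin by (intro bexI[OF _ t] conjI ballI)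
 qed auto
 fix f assume f: "f : reg X P"
 hence F: "(%w. f (pr w)) : reg V z" unfolding z(2) R .
 show "g : reg X P" if "EV x in nhdsin (zariski X) P. f x = g x" for g
  unfolding z(2) R using that unfolding z(2) E by (rule regular_cong[OF z(1) F])
 show "(%x. inverse (f x)) : reg X P" if "f P ~= 0"
  unfolding z(2) R by (rule regular_inverse[OF z(1) F]) (use that z(2) in simp)
 show "EV Q in nhdsin (zariski X) P. f : reg X Q"
  unfolding z(2) E using regular_open[OF z(1) F] eventually_near_points[of z]
  by eventually_elim (simp add: regular_X)
 show "(EV x in nhdsin (zariski X) P. f x = 0) | finite {x : pts X. f x = 0}"
  unfolding z(2) E using zero_or_finite[OF z(1) F] finite_pr_vimage[of "%x. f x ~= 0"] by simp
 fix g assume "g : reg X P"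
 hence Gr: "(%w. g (pr w)) : reg V z" unfolding z(2) R .
 show "(%x. f x + g x) : reg X P" unfolding z(2) R by (rule regular_add[OF z(1) F Gr])
 show "(%x. f x * g x) : reg X P" unfolding z(2) R by (rule regular_mult[OF z(1) F Gr])
qed

lemma has_order_X_imp:
 assumes z: "z : pts V" and f: "X.has_order (pr z) f n"
 shows "has_order z (%w. f (pr w)) (n * ramif z)"
proof -
 let ?P = "pr z" and ?t = "X.unif (pr z)"
 have P: "?P : pts X" using z by (simp add: points_X)
 have pull: "has_order z (%w. g (pr w)) (m * k)"
  if g: "X.has_order ?P g m" and t: "has_order z (%w. ?t (pr w)) k" for g m k
 proof -
  obtain u where u: "u : reg X ?P" "u ?P ~= 0" "EV x in X.near ?P. g x = ?t x ^ m * u x"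
  using g by (auto simp: X.has_order_def)
  show ?thesis
  by (rule has_orderI[OF z has_order_power[OF z t] u(1)[unfolded regular_X[OF z]] u(2) u(3)[unfolded eventually_X[OF z]]])
 qed
 obtain k where k: "has_order z (%w. ?t (pr w)) k"
 proof (rule has_order_ex[OF z])
  show "(%w. ?t (pr w)) : reg V z" using X.unif(1)[OF P] regular_X[OF z] by simp
  show "~ (EV w in near z. ?t (pr w) = 0)"
  using X.has_order_not_zero[OF P X.has_order_uniformizer[OF P]] eventually_X[OF z, of "%x. ?t x = 0"] by simp
 qed
 have "ramif z dvd k" unfolding ramif_def
  by (rule invariant_order_dvd[OF subgroup_H z k]) (rule pr_invariant)
 then obtain j where j: "k = j * ramif z" by (metis dvd_def mult.commute)
 \<comment> \<open>\<open>ramif z\<close> divides the order \<open>k\<close> of the pulled back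
   parameter. Conversely the descent of an invariant parameter has some order \<open>m\<close> on
   the quotient, and \<open>m * k = ramif z\<close>.\<close>
 have "k = ramif z"
 proof (rule invariant_parameter[OF z, of "{}"])
  fix s assume s: "has_order z s (ramif z)" "!!h x. h : H ==> x : pts V ==> s (ph h x) = s x"
  have dr: "desc s : reg X ?P" by (rule desc_regular[OF z s(2) has_order_regular[OF s(1)]])
  have eq: "EV w in near z. s w = desc s (pr w)"
  using eventually_near_points[of z] by eventually_elim (simp add: desc_pr[OF _ s(2)])
  have so: "has_order z (%w. desc s (pr w)) (ramif z)" by (rule has_order_cong[OF z s(1) eq])
  have "~ (EV x in X.near ?P. desc s x = 0)"
  using has_order_not_zero[OF z so] eventually_X[OF z, of "%x. desc s x = 0"] by simp
  then obtain m where m: "X.has_order ?P (desc s) m" by (rule X.has_order_ex[OF P dr])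
  have "m * k = ramif z" by (rule has_order_unique[OF z pull[OF m k] so])
  hence "m * j * ramif z = 1 * ramif z" using j by simp
  hence "m * j = 1" using ramif_pos[OF z] by simp
  thus "k = ramif z" using j by simp
 qed auto
 thus ?thesis using pull[OF f k] by simp
qed

lemma has_order_X_iff:
 assumes z: "z : pts V" and f: "f : reg X (pr z)"
 shows "X.has_order (pr z) f n <-> has_order z (%w. f (pr w)) (n * ramif z)"
proof
 assume o: "has_order z (%w. f (pr w)) (n * ramif z)"
 have P: "pr z : pts X" using z by (simp add: points_X)
 have "~ (EV x in X.near (pr z). f x = 0)"
  using has_order_not_zero[OF z o] eventually_X[OF z, of "%x. f x = 0"] by simp
 then obtain m where m: "X.has_order (pr z) f m" by (rule X.has_order_ex[OF P f])
 have "m * ramif z = n * ramif z" by (rule has_order_unique[OF z has_order_X_imp[OF z m] o])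
 thus "X.has_order (pr z) f n" using m ramif_pos[OF z] by simp
qed (rule has_order_X_imp[OF z])

lemma order_ge_X:
 assumes z: "z : pts V" and f: "f : reg X (pr z)" and o: "order_ge z (%w. f (pr w)) (n * ramif z)"
 shows "X.order_ge (pr z) f n"
proof -
 have P: "pr z : pts X" using z by (simp add: points_X)
 show ?thesis unfolding X.order_ge_iff[OF P f]
 proof (intro allI impI)
  fix m assume "X.has_order (pr z) f m"
  from has_order_ge_le[OF z has_order_X_imp[OF z this] o] show "n <= m" using ramif_pos[OF z] by simp
 qed
qed

end

section \<open>Local intersection numbers on a product of curves\<close>

text \<open>Two bases of the same quotient space give mutually inverse transition matrices; comparing traces in
 characteristic 0 shows that they have the same length.\<close>

lemma codim_at_eqI:
 fixes S :: "('p, 'k::field_char_0) function_space"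
 assumes sub: "!!f g. f : I ==> g : I ==> (%x. f x + g x) : I" "!!c f. f : I ==> (%x. c * f x) : I"
  and e: "ALL i<n. e i : reg S P"
  "ALL f:reg S P. EX! c. c : {..<n} \<rightarrow>\<^sub>E UNIV & (%x. f x - (SUM i<n. c i * e i x)) : I"
 shows "codim_at S P I = n"
 unfolding codim_at_def
proof (rule the_equality)
 let ?U = "%(a::nat) u. ALL f:reg S P. EX! c. c : {..<a} \<rightarrow>\<^sub>E UNIV & (%x. f x - (SUM i<a. c i * u i x)) : I"
 show "EX e. (ALL i<n. e i : reg S P) &
  ?U n e"
  using e by (intro exI[of _ e] conjI)
 fix n' :: nat
 assume "EX e. (ALL i<n'. e i : reg S P) &
  ?U n' e"
 then obtain d where d: "ALL i<n'. d i : reg S P"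
  "?U n' d"
  by (elim exE conjE)
 \<comment> \<open>Closure under sums and multiples says nothing about the empty sum, hence
   \<open>0 < m\<close>.\<close>
 have sub_sum: "(%x. SUM i<m. c i * f i x) : I" if "0 < m" "!!i. i < m ==> f i : I" for c f and m :: nat
  using that
 proof (induction m rule: nat_induct_non_zero)
  case 1
  thus ?case using sub(2) by simp
 next
  case (Suc m)
  thus ?case using sub(1)[of "%x. SUM i<m. c i * f i x" "%x. c m * f m x"] sub(2) by simp
 qed
 have main: "(SUM j<b. B i j * A j i) = 1"
  if u: "ALL i<a. u i : reg S P"
  "?U a u"
  and A: "!!j. j < b ==> (%x. v j x - (SUM i<a. A j i * u i x)) : I"
  and B: "!!i. i < a ==> (%x. u i x - (SUM j<b. B i j * v j x)) : I"
  and i: "i < a" for a b :: nat and u v :: "nat => 'p => 'k" and A B :: "nat => nat => 'k" and i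
 proof -
  let ?C = "%k. SUM j<b. B i j * A j k"
  have eq: "u i x - (SUM k<a. ?C k * u k x)
  = (u i x - (SUM j<b. B i j * v j x)) + (SUM j<b. B i j * (v j x - (SUM k<a. A j k * u k x)))" for x
  proof -
  have "(SUM k<a. ?C k * u k x) = (SUM k<a. SUM j<b. B i j * A j k * u k x)" by (simp add: sum_distrib_right)
  also have "... = (SUM j<b. SUM k<a. B i j * A j k * u k x)" by (rule sum.swap)
  finally show ?thesis by (simp add: right_diff_distrib sum_subtractf sum_distrib_left mult.assoc)
  qed
  have "(%x. u i x - (SUM k<a. ?C k * u k x)) : I"
  proof (cases "b = 0")
  case True
  thus ?thesis using B[OF i] by simp
  next
  case False
  thus ?thesis unfolding eq using sub(1)[OF B[OF i] sub_sum[OF _ A]] by simp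
  qed
  moreover have "(%x. u i x - (SUM k<a. (if k = i then 1 else 0) * u k x)) : I"
  proof -
  have z: "(%_. 0) : I" using sub(2)[OF B[OF i], of 0] by simp
  have "(SUM k<a. (if k = i then 1 else 0) * u k x) = u i x" for x
  using i by (simp add: if_distrib[where f="%z. z * _"] cong: if_cong)
  thus ?thesis using z by simp
  qed
  moreover have cong: "(SUM k<a. restrict c {..<a} k * u k x) = (SUM k<a. c k * u k x)" for c x
  by (rule sum.cong) auto
  ultimately have 12: "restrict ?C {..<a} : {..<a} \<rightarrow>\<^sub>E UNIV & (%x. u i x - (SUM k<a. restrict ?C {..<a} k * u k x)) : I"
  "restrict (%k. if k = i then 1 else 0) {..<a} : {..<a} \<rightarrow>\<^sub>E UNIV &
  (%x. u i x - (SUM k<a. restrict (%k. if k = i then 1 else 0) {..<a} k * u k x)) : I"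
  unfolding cong by simp_all
  have "u i : reg S P" using u(1) i by simp
  note ex1 = bspec[OF u(2) this]
  let ?Pr = "%c. c : {..<a} \<rightarrow>\<^sub>E UNIV & (%x. u i x - (SUM k<a. c k * u k x)) : I"
  have "restrict ?C {..<a} = restrict (%k. if k = i then 1 else 0) {..<a}"
  using the1_equality[of ?Pr, OF ex1 12(1)] the1_equality[of ?Pr, OF ex1 12(2)] by (rule trans[OF sym])
  from fun_cong[OF this, of i] show ?thesis using i by simp
 qed
 have ex: "EX A. ALL j<b. (%x. v j x - (SUM i<a. A j i * u i x)) : I"
  if v: "ALL i<b. v i : reg S P"
  and u: "?U a u"
  for a b :: nat and u v :: "nat => 'p => 'k"
 proof -
  have "ALL j. EX c. j < b --> (%x. v j x - (SUM i<a. c i * u i x)) : I"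
  proof
  fix j
  show "EX c. j < b --> (%x. v j x - (SUM i<a. c i * u i x)) : I"
  proof (cases "j < b")
  case True
  hence "v j : reg S P" using v by simp
  from bspec[OF u this] obtain c where "(%x. v j x - (SUM i<a. c i * u i x)) : I" by (elim ex1E conjE)
  thus ?thesis by (intro exI[of _ c] impI)
  qed simp
  qed
  from choice[OF this] show ?thesis by (elim exE) (rule exI)
 qed
 obtain A where A: "ALL j<n'. (%x. d j x - (SUM i<n. A j i * e i x)) : I" using ex[where a = n and b = n' and u = e and v = d, OF d(1) e(2)] ..
 obtain B where B: "ALL i<n. (%x. e i x - (SUM j<n'. B i j * d j x)) : I" using ex[where a = n' and b = n and u = d and v = e, OF e(1) d(2)] ..
 have "(of_nat n :: 'k) = (SUM i<n. SUM j<n'. B i j * A j i)"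
  using main[where a = n and b = n' and u = e and v = d and A = A and B = B, OF e] A B by simp
 also have "... = (SUM j<n'. SUM i<n. A j i * B i j)" by (subst sum.swap) (simp add: mult.commute)
 also have "... = of_nat n'" using main[where a = n' and b = n and u = d and v = e and A = B and B = A, OF d] A B by simp
 finally show "n' = n" by simp
qed

text \<open>\<open>I\<close> is the preimage, under restriction along \<open>io\<close>, of the
  functions of order at least \<open>N\<close>, and the \<open>e i\<close> restrict to powers of a
  parameter; so Taylor coefficients of the restriction are coordinates in the quotient.\<close>

lemma (in curve) codim_at_eq_order:
 assumes Q: "Q : pts V" and t: "has_order Q t 1"
  and add: "!!f g. f : reg S P ==> g : reg S P ==> (%x. f x + g x) : reg S P"
  and scale: "!!c f. f : reg S P ==> (%x. c * f x) : reg S P"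
  and pull: "!!f. f : reg S P ==> (%y. f (io y)) : reg V Q"
  and e: "!!i. e i : reg S P" "!!i y. e i (io y) = t y ^ i"
  and I: "!!f. f : I <-> f : reg S P & order_ge Q (%y. f (io y)) N"
 shows "codim_at S P I = N"
proof (rule codim_at_eqI)
 show "(%x. f x + g x) : I" if "f : I" "g : I" for f g
  using that add order_ge_add[OF Q] unfolding I by blast
 show "(%x. c * f x) : I" if "f : I" for c f
 proof -
  have "order_ge Q (%y. c * f (io y)) (0 + N)"
  using that unfolding I by (intro order_ge_mult[OF Q]) (auto simp: order_ge_0 regular_const[OF Q])
  thus ?thesis using that scale unfolding I by simp
 qed
 show "ALL i<N. e i : reg S P" using e by simp
 show "ALL f:reg S P. EX! c. c : {..<N} \<rightarrow>\<^sub>E UNIV & (%x. f x - (SUM i<N. c i * e i x)) : I"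
 proof
  fix f assume f: "f : reg S P"
  have es: "(%x. SUM i<n. c i * e i x) : reg S P" for c and n :: nat
  proof (induction n)
  case 0
  show ?case using scale[OF e(1)[of 0], of 0] by simp
  next
  case (Suc n)
  show ?case using add[OF Suc scale[OF e(1)[of n], of "c n"]] by simp
  qed
  have fe: "(%x. f x - (SUM i<N. c i * e i x)) : reg S P" for c
  using add[OF f es[of "%i. - c i" N]] by (simp add: sum_negf)
  have mem: "(%x. f x - (SUM i<N. c i * e i x)) : I <-> order_ge Q (%y. f (io y) - (SUM i<N. c i * t y ^ i)) N" for c
  unfolding I using fe by (simp add: e(2))
  from taylor_expansion[OF Q t pull[OF f], of N] obtain c where
  c: "order_ge Q (%y. f (io y) - (SUM i<N. c i * t y ^ i)) N" ..
  have "(SUM i<N. restrict c {..<N} i * t y ^ i) = (SUM i<N. c i * t y ^ i)" for y by (rule sum.cong) auto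
  hence "(%x. f x - (SUM i<N. restrict c {..<N} i * e i x)) : I" unfolding mem using c by simp
  moreover have "restrict c {..<N} : {..<N} \<rightarrow>\<^sub>E UNIV" by auto
  moreover have "b = restrict c {..<N}"
  if "b : {..<N} \<rightarrow>\<^sub>E UNIV & (%x. f x - (SUM i<N. b i * e i x)) : I" for b
  proof -
  have b: "order_ge Q (%y. f (io y) - (SUM i<N. b i * t y ^ i)) N" using that mem by simp
  have "order_ge Q (%y. - 1 * (f (io y) - (SUM i<N. c i * t y ^ i))) (0 + N)"
  by (rule order_ge_mult[OF Q _ c]) (auto simp: order_ge_0 regular_const[OF Q])
  hence c': "order_ge Q (%y. - 1 * (f (io y) - (SUM i<N. c i * t y ^ i))) N" by simp
  have "(f (io y) - (SUM i<N. b i * t y ^ i)) + - 1 * (f (io y) - (SUM i<N. c i * t y ^ i))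
  = (SUM i<N. (c i - b i) * t y ^ i)" for y
  by (simp add: left_diff_distrib sum_subtractf)
  hence "order_ge Q (%y. SUM i<N. (c i - b i) * t y ^ i) N" using order_ge_add[OF Q b c'] by simp
  from taylor_unique[OF Q t this] have "b i = c i" if "i < N" for i using that by fastforce
  thus ?thesis using that by (auto simp: PiE_def extensional_def fun_eq_iff)
  qed
  ultimately show "EX! c. c : {..<N} \<rightarrow>\<^sub>E UNIV & (%x. f x - (SUM i<N. c i * e i x)) : I"
  by (intro ex1I[of _ "restrict c {..<N}"] conjI)
 qed
qed

context curve_pair
begin

lemma mem_vanishing_ideal:
 "f : vid (P, Q) C <->
  f : reg2 P Q & (EV z in near2 P Q. z : C --> f z = 0)"
 by (simp add: vanishing_ideal_def product_space_def)

text \<open>Intersection multiplicity of \<open>C\<close> with the graph \<open>{(u y, y)}\<close> of a morphism \<open>u\<close>: the smallest order of the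
 restrictions to the graph of functions vanishing on \<open>C\<close>.\<close>

lemma local_intersection_graph:
 assumes Q: "Q : pts W" and u: "morphism_at W V u Q"
  and C': "!!f. f : reg2 (u Q) Q ==>
  (EV z in near2 (u Q) Q. z : C' --> f z = 0) <-> (EV y in W.near Q. f (u y, y) = 0)"
  and L: "!!f. f : vid (u Q, Q) C ==> W.order_ge Q (%y. f (u y, y)) N"
  and f0: "f0 : vid (u Q, Q) C" "W.has_order Q (%y. f0 (u y, y)) N"
 shows "local_intersection (product_space V W) (u Q, Q) C C' = N"
proof -
 let ?A = "reg2 (u Q) Q"
 let ?S = "product_space V W" and ?P = "(u Q, Q)"
 have P: "u Q : pts V" using u by (rule morphism_at_points)
 have idQ: "morphism_at W W (%y. y) Q" by (rule morphism_at_id[OF Q])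
 have pull: "(%y. f (u y, y)) : reg W Q" if "f : ?A" for f
  by (rule regular2_pullback[OF W.curve_axioms u idQ that])
 let ?I = "{(%x. f x + g x) | f g. f : vanishing_ideal ?S ?P C & g : vanishing_ideal ?S ?P C'}"
 have I: "f : ?I <-> f : ?A & W.order_ge Q (%y. f (u y, y)) N" for f
 proof
  assume "f : ?I"
  then obtain f1 g where fg: "f = (%x. f1 x + g x)" "f1 : vanishing_ideal ?S ?P C" "g : vanishing_ideal ?S ?P C'"
  by (elim CollectE exE conjE)
  have g: "g : ?A" "EV z in near2 (u Q) Q. z : C' --> g z = 0"
  using fg(3) unfolding mem_vanishing_ideal by blast+
  have f1: "f1 : ?A" using fg(2) unfolding mem_vanishing_ideal by blast
  have "EV y in W.near Q. g (u y, y) = 0" using C'[OF g(1)] g(2) by simp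
  hence "W.order_ge Q (%y. g (u y, y)) N" by (rule W.order_ge_zero[OF Q])
  from W.order_ge_add[OF Q L[OF fg(2)] this]
  show "f : ?A & W.order_ge Q (%y. f (u y, y)) N"
  unfolding fg(1) using regular2_add[OF P Q f1 g(1)] by simp
 next
  assume f: "f : ?A & W.order_ge Q (%y. f (u y, y)) N"
  obtain v where v: "v : reg W Q" "EV y in W.near Q. f (u y, y) = f0 (u y, y) * v y"
  using W.order_ge_divide[OF Q f0(2)] f by blast
  have v2: "(%z. v (snd z)) : ?A" by (rule regular2_snd[OF P Q v(1)])
  have f0': "f0 : ?A" "EV z in near2 (u Q) Q. z : C --> f0 z = 0"
  using f0(1) unfolding mem_vanishing_ideal by blast+
  \<comment> \<open>\<open>f0\<close> attains the minimal order on the graph, so the restriction of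
    \<open>f\<close> is a multiple of that of \<open>f0\<close>. Lifting the factor through the
    second coordinate leaves a remainder that vanishes on the graph.\<close>
  let ?f1 = "%z. f0 z * v (snd z)" and ?g = "%z. f z - f0 z * v (snd z)"
  have f1r: "?f1 : ?A" by (rule regular2_mult[OF P Q f0'(1) v2])
  have f1: "?f1 : vanishing_ideal ?S ?P C"
  unfolding mem_vanishing_ideal using f1r f0'(2) by (auto elim: eventually_mono)
  have gr: "?g : ?A" using f regular2_diff[OF P Q _ f1r] by simp
  have "EV y in W.near Q. ?g (u y, y) = 0" using v(2) by eventually_elim simp
  hence "?g : vanishing_ideal ?S ?P C'" unfolding mem_vanishing_ideal using gr C'[OF gr] by simp
  moreover have "f = (%x. ?f1 x + ?g x)" by simp
  ultimately show "f : ?I" unfolding mem_Collect_eq using f1 by (intro exI[of _ ?f1] exI[of _ ?g] conjI)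
 qed
 show ?thesis unfolding local_intersection_def
 proof (rule W.codim_at_eq_order[OF Q W.has_order_uniformizer[OF Q], of ?S ?P "%y. (u y, y)" "%i z. W.unif Q (snd z) ^ i"])
  show "(%x. f x + g x) : ?A" if "f : ?A" "g : ?A" for f g
  by (rule regular2_add[OF P Q that])
  show "(%x. c * f x) : ?A" if "f : ?A" for c f
  by (rule regular2_mult[OF P Q regular2_const[OF P Q] that])
  show "(%z. W.unif Q (snd z) ^ i) : ?A" for i
  by (rule regular2_power[OF P Q regular2_snd[OF P Q W.unif(1)[OF Q]]])
 qed (use pull I in simp_all)
qed

lemma vanishing_fibre:
 assumes P: "P : pts V" and Q: "Q : pts W"
 shows "(EV z in near2 P Q. z : {P} \<times> pts W --> f z = 0) <-> (EV y in W.near Q. f (P, y) = 0)"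
proof
 assume "EV z in near2 P Q. z : {P} \<times> pts W --> f z = 0"
 from near2_pullback[OF W.curve_axioms W.morphism_at_const[OF Q P] morphism_at_id[OF Q] this] W.eventually_near_points[of Q]
 show "EV y in W.near Q. f (P, y) = 0" by eventually_elim simp
next
 assume "EV y in W.near Q. f (P, y) = 0"
 from near2_sndI[OF P Q this] show "EV z in near2 P Q. z : {P} \<times> pts W --> f z = 0"
  by eventually_elim auto
qed

lemma local_intersection_fibre:
 assumes P: "P : pts V" and Q: "Q : pts W"
  and L: "!!f. f : vid (P, Q) C ==> W.order_ge Q (%y. f (P, y)) N"
  and f0: "f0 : vid (P, Q) C" "W.has_order Q (%y. f0 (P, y)) N"
 shows "local_intersection (product_space V W) (P, Q) C ({P} \<times> pts W) = N"
 by (rule local_intersection_graph[OF Q W.morphism_at_const[OF Q P] vanishing_fibre[OF P Q] L f0])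

lemma local_intersection_fibre_notin:
 assumes P: "P : pts V" and Q: "Q : pts W" and C: "closedin zar2 C" "(P, Q) ~: C"
 shows "local_intersection (product_space V W) (P, Q) C ({P} \<times> pts W) = 0"
proof (rule local_intersection_fibre[OF P Q, of _ _ "%_. 1"])
 have "openin zar2 (pts2 - C)" using C(1) by (simp add: closedin_def topspace_product)
 hence "EV z in near2 P Q. z : pts2 - C"
  using P Q C(2) unfolding eventually_nhdsin by (intro disjI2 exI[of _ "pts2 - C"]) auto
 hence "EV z in near2 P Q. z : C --> (1::'k) = 0" by eventually_elim simp
 thus "(%_. 1) : vid (P, Q) C"
  unfolding mem_vanishing_ideal using regular2_const[OF P Q] by simp
 show "W.has_order Q (%y. 1) 0" unfolding W.has_order_0_iff[OF Q] using W.regular_const[OF Q] by simp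
 fix f assume "f : vid (P, Q) C"
 hence "f : reg2 P Q" unfolding mem_vanishing_ideal by simp
 from regular2_pullback[OF W.curve_axioms W.morphism_at_const[OF Q P] morphism_at_id[OF Q] this]
 show "W.order_ge Q (%y. f (P, y)) 0" by (simp add: W.order_ge_0)
qed

text \<open>The number is the least order of a restriction to the fibre. It is not 0, because
  functions that vanish on \<open>C\<close> near \<open>(P, Q)\<close> vanish at
  \<open>(P, Q)\<close>.\<close>

lemma local_intersection_fibre_pos:
 assumes P: "P : pts V" and Q: "Q : pts W" and C: "(P, Q) : C"
  and f: "f : vid (P, Q) C" "~ (EV y in W.near Q. f (P, y) = 0)"
 shows "local_intersection (product_space V W) (P, Q) C ({P} \<times> pts W) > 0"
proof -
 let ?I = "vid (P, Q) C"
 have reg: "(%y. f (P, y)) : reg W Q" if "f : ?I" for f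
 proof -
  have "f : reg2 P Q" using that unfolding mem_vanishing_ideal by simp
  from regular2_pullback[OF W.curve_axioms W.morphism_at_const[OF Q P] morphism_at_id[OF Q] this] show ?thesis .
 qed
 define K where "K = (%n. EX f:?I. W.has_order Q (%y. f (P, y)) n)"
 obtain n where "W.has_order Q (%y. f (P, y)) n" by (rule W.has_order_ex[OF Q reg[OF f(1)] f(2)])
 hence "K n" unfolding K_def using f(1) by (intro bexI[of _ f])
 hence KN: "K (LEAST n. K n)" by (rule LeastI)
 define N where "N = (LEAST n. K n)"
 obtain f0 where f0: "f0 : ?I" "W.has_order Q (%y. f0 (P, y)) N" using KN unfolding K_def N_def by blast
 have "W.order_ge Q (%y. f (P, y)) N" if "f : ?I" for f
  unfolding W.order_ge_iff[OF Q reg[OF that]]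
 proof (intro allI impI)
  fix m assume "W.has_order Q (%y. f (P, y)) m"
  hence "K m" unfolding K_def using that by (intro bexI[of _ f])
  thus "N <= m" unfolding N_def by (rule Least_le)
 qed
 from local_intersection_fibre[OF P Q this f0]
 have li: "local_intersection (product_space V W) (P, Q) C ({P} \<times> pts W) = N" by simp
 have "N ~= 0"
 proof
  assume "N = 0"
  hence "f0 (P, Q) ~= 0" using f0(2) W.has_order_0_iff[OF Q] by auto
  moreover have "EV z in near2 P Q. z : C --> f0 z = 0" using f0(1) unfolding mem_vanishing_ideal by simp
  from near2_self[OF P Q this] have "f0 (P, Q) = 0" using C by simp
  ultimately show False by simp
 qed
 thus ?thesis using li by simp
qed

section \<open>Irreducible closed subsets of a product of curves\<close>

lemma irreducible_image:
 assumes Y: "curve Y" and u: "!!y. y : pts Y ==> morphism_at Y V u y" and v: "!!y. y : pts Y ==> morphism_at Y W v y"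
  and C: "C = (%y. (u y, v y)) ` pts Y" "closedin zar2 C"
 shows "irreducible_closed zar2 C"
proof -
 interpret Y: curve Y by fact
 \<comment> \<open>The preimage in \<open>Y\<close> of a closed set that does not contain
   \<open>C\<close> is proper and closed, hence finite; two finite sets do not cover
   \<open>Y\<close>.\<close>
 have fin: "finite {y : pts Y. (u y, v y) : A}" if A: "closedin zar2 A" "~ C <= A" for A
 proof -
  obtain y where y: "y : pts Y" "(u y, v y) ~: A" using A(2) C(1) by auto
  have op: "openin zar2 (pts2 - A)" using A(1) by (simp add: closedin_def topspace_product)
  have "u y : pts V" "v y : pts W" using u[OF y(1)] v[OF y(1)] by (auto simp: morphism_at_def)
  hence "EV z in near2 (u y) (v y). z : pts2 - A"
  using y(2) op unfolding eventually_nhdsin by (intro disjI2 exI[of _ "pts2 - A"]) auto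
  from Y.eventually_near_finite[OF y(1) near2_pullback[OF Y u[OF y(1)] v[OF y(1)] this]]
  show ?thesis by (rule rev_finite_subset) auto
 qed
 show ?thesis unfolding irreducible_closed_def
 proof (intro conjI allI impI C(2))
  have "pts Y ~= {}" using Y.infinite_points by auto
  thus "C ~= {}" unfolding C(1) by auto
  fix A B assume AB: "closedin zar2 A & closedin zar2 B & C <= A Un B"
  show "C <= A | C <= B"
  proof (rule ccontr)
  assume "~ (C <= A | C <= B)"
  hence "finite ({y : pts Y. (u y, v y) : A} Un {y : pts Y. (u y, v y) : B})"
  using fin[of A] fin[of B] AB by simp
  moreover have "pts Y <= {y : pts Y. (u y, v y) : A} Un {y : pts Y. (u y, v y) : B}"
  using AB unfolding C(1) by auto
  ultimately have "finite (pts Y)" by (rule rev_finite_subset)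
  thus False using Y.infinite_points by simp
  qed
 qed
qed

lemma closedin_fibre:
 assumes P: "P : pts V" shows "closedin zar2 ({P} \<times> pts W)"
proof -
 have "openin zar2 (pts2 - {P} \<times> pts W)"
 proof (subst openin_subopen, intro ballI)
  fix z assume z: "z : pts2 - {P} \<times> pts W"
  then obtain x y where xy: "z = (x, y)" "x : pts V" "x ~= P" "y : pts W" by auto
  have "nbhd2 x y (%z. z : pts2 - {P} \<times> pts W)"
  by (rule nbhd2I[OF tensors_const[OF xy(2,4), of 1], of "{P}" "{}"]) (use xy in auto)
  hence "EV z in near2 x y. z : pts2 - {P} \<times> pts W" unfolding eventually_near2[OF xy(2,4)] .
  thus "EX T. openin zar2 T & z : T & T <= pts2 - {P} \<times> pts W"
  unfolding eventually_nhdsin using xy by (auto simp: topspace_product)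
 qed
 thus ?thesis using P by (auto simp: closedin_def topspace_product)
qed

lemma closedin_fibre':
 assumes Q: "Q : pts W" shows "closedin zar2 (pts V \<times> {Q})"
proof -
 have "openin zar2 (pts2 - pts V \<times> {Q})"
 proof (subst openin_subopen, intro ballI)
  fix z assume z: "z : pts2 - pts V \<times> {Q}"
  then obtain x y where xy: "z = (x, y)" "x : pts V" "y ~= Q" "y : pts W" by auto
  have "nbhd2 x y (%z. z : pts2 - pts V \<times> {Q})"
  by (rule nbhd2I[OF tensors_const[OF xy(2,4), of 1], of "{}" "{Q}"]) (use xy in auto)
  hence "EV z in near2 x y. z : pts2 - pts V \<times> {Q}" unfolding eventually_near2[OF xy(2,4)] .
  thus "EX T. openin zar2 T & z : T & T <= pts2 - pts V \<times> {Q}"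
  unfolding eventually_nhdsin using xy by (auto simp: topspace_product)
 qed
 thus ?thesis using Q by (auto simp: closedin_def topspace_product)
qed

lemma irreducible_fibre: "P : pts V ==> irreducible_closed zar2 ({P} \<times> pts W)"
 by (rule irreducible_image[OF W.curve_axioms W.morphism_at_const morphism_at_id _ closedin_fibre]) auto

lemma irreducible_fibre': "Q : pts W ==> irreducible_closed zar2 (pts V \<times> {Q})"
 by (rule irreducible_image[OF V.curve_axioms morphism_at_id V.morphism_at_const _ closedin_fibre']) auto

text \<open>A point \<open>(x0, y0)\<close> off \<open>C\<close> yields a tensor \<open>F\<close>
  that vanishes on \<open>C\<close> away from finitely many fibres. Discarding also the zeros of
  \<open>F (x, y0)\<close> in \<open>x\<close> makes \<open>F\<close> nonzero on each remaining
  fibre over \<open>x\<close>.\<close>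

lemma proper_closed_function:
 assumes C: "closedin zar2 C" "C ~= pts2"
 obtains E1 E2 where "finite E1" "finite E2"
  "!!x y. (x, y) : C ==> x ~: E1 ==> y ~: E2 ==>
  EX f:vid (x, y) C. ~ (EV y' in W.near y. f (x, y') = 0)"
proof -
 have sub: "C <= pts2" using closedin_subset[OF C(1)] by (simp add: topspace_product)
 then obtain x0 y0 where xy0: "x0 : pts V" "y0 : pts W" "(x0, y0) ~: C" using C(2) by auto
 have "openin zar2 (pts2 - C)" using C(1) by (simp add: closedin_def topspace_product)
 from openin_product_nbhd2[OF this, of x0 y0] have "nbhd2 x0 y0 (%z. z : pts2 - C)" using xy0 by simp
 thus thesis
 proof (rule nbhd2E)
  fix F E1 E2
  assume F: "F : tns x0 y0" "F (x0, y0) ~= 0" "finite E1" "finite E2" "x0 ~: E1" "y0 ~: E2"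
  "!!x y. x : pts V ==> x ~: E1 ==> y : pts W ==> y ~: E2 ==> F (x, y) ~= 0 ==> (x, y) : pts2 - C"
  from F(1) obtain a b and m :: nat where ab: "ALL i<m. a i : reg V x0 & b i : reg W y0"
  "F = (%z. SUM i<m. a i (fst z) * b i (snd z))" unfolding tensors_iff by (elim exE conjE)
  have Fx: "(%x. F (x, y0)) : reg V x0"
  unfolding ab(2) using ab(1) by (auto intro!: V.regular_sum V.regular_mult V.regular_const xy0)
  define D1 where "D1 = E1 Un {x : pts V. ~ F (x, y0) ~= 0} Un (UN i<m. {x : pts V. a i ~: reg V x})"
  define D2 where "D2 = E2 Un (UN i<m. {y : pts W. b i ~: reg W y})"
  have "finite {x : pts V. ~ F (x, y0) ~= 0}"
  by (rule V.eventually_near_finite[OF xy0(1) V.eventually_nonzero[OF xy0(1) Fx F(2)]])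
  moreover have "finite {x : pts V. a i ~: reg V x}" if "i < m" for i
  using V.eventually_near_finite[OF xy0(1) V.regular_open[OF xy0(1)]] ab(1) that by blast
  ultimately have fD1: "finite D1" unfolding D1_def using F(3) by auto
  have "finite {y : pts W. b i ~: reg W y}" if "i < m" for i
  using W.eventually_near_finite[OF xy0(2) W.regular_open[OF xy0(2)]] ab(1) that by blast
  hence fD2: "finite D2" unfolding D2_def using F(4) by auto
  show thesis
  proof (rule that[OF fD1 fD2])
  fix x y assume xyC: "(x, y) : C" and xD: "x ~: D1" and yD: "y ~: D2"
  have xy: "x : pts V" "y : pts W" using xyC sub by auto
  have ar: "a i : reg V x" "b i : reg W y" if "i < m" for i
  using xD yD xy that unfolding D1_def D2_def by auto
  have Ft: "F : tns x y" unfolding tensors_iff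
  by (rule exI[of _ m], rule exI[of _ a], rule exI[of _ b]) (use ar ab(2) in simp)
  have "nbhd2 x y (%z. z : C --> F z = 0)"
  by (rule nbhd2I[OF tensors_const[OF xy, of 1] _ F(3,4)]) (use xD yD F(7) in "auto simp: D1_def D2_def")
  hence FI: "F : vid (x, y) C"
  unfolding mem_vanishing_ideal eventually_near2[OF xy] using regular2_tensors[OF xy Ft] by simp
  have "(%y. F (x, y)) : reg W y0"
  unfolding ab(2) using ab(1) by (auto intro!: W.regular_sum W.regular_mult W.regular_const xy0)
  moreover have "F (x, y0) ~= 0" using xD xy by (auto simp: D1_def)
  ultimately have "EV y in W.near y0. F (x, y) ~= 0" by (rule W.eventually_nonzero[OF xy0(2)])
  from W.eventually_near_finite[OF xy0(2) this] have "infinite {y : pts W. ~ F (x, y) = 0}"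
  by (intro W.infinite_cofinite) simp
  hence "~ (EV y' in W.near y. F (x, y') = 0)"
  using W.eventually_near_finite[OF xy(2), of "%y'. F (x, y') = 0"] by blast
  thus "EX f:vid (x, y) C. ~ (EV y' in W.near y. f (x, y') = 0)"
  by (intro bexI[OF _ FI])
  qed
 qed
qed

end

lemma irreducible_finite_Union:
 assumes "irreducible_closed T C" "finite F" "!!A. A : F ==> closedin T A" "C <= \<Union> F"
 shows "EX A:F. C <= A"
 using assms(2-4)
proof (induction F rule: finite_induct)
 case empty
 thus ?case using assms(1) by (auto simp: irreducible_closed_def)
next
 case (insert A F)
 have "closedin T (\<Union> F)" by (rule closedin_Union) (use insert in auto)
 hence "C <= A | C <= \<Union> F"
  using irreducible_closedD[OF assms(1), of A "\<Union> F"] insert by simp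
 thus ?case using insert by auto
qed

lemma irreducible_not_subset_Union:
 assumes "irreducible_closed T C" "finite F" "!!A. A : F ==> closedin T A" "!!A. A : F ==> ~ C <= A"
 shows "~ C <= \<Union> F"
 using irreducible_finite_Union[OF assms(1-3)] assms(4) by blast

section \<open>Divisors on the square of a curve\<close>

locale curve_square = curve V for V :: "('p, 'k::field_char_0) function_space"
begin

sublocale sq: curve_pair V V ..

lemma zariski_product: "zariski (product_space V V) = product_zariski V V"
 by (simp add: product_space_def)

lemma prime_divisor_iff:
 "prime_divisor (product_space V V) C <-> irreducible_closed (product_zariski V V) C & C \<subset> pts V \<times> pts V &
  ~ (EX B. irreducible_closed (product_zariski V V) B & C \<subset> B & B \<subset> pts V \<times> pts V)"
 unfolding prime_divisor_def zariski_product sq.topspace_product ..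

lemma fibre_proper: "P : pts V ==> {P} \<times> pts V \<subset> pts V \<times> pts V" "P : pts V ==> pts V \<times> {P} \<subset> pts V \<times> pts V"
proof -
 assume P: "P : pts V"
 have "infinite (pts V - {P})" using infinite_points by simp
 hence "pts V - {P} ~= {}" by (metis finite.emptyI)
 then obtain Q where "Q : pts V" "Q ~= P" by auto
 thus "{P} \<times> pts V \<subset> pts V \<times> pts V" "pts V \<times> {P} \<subset> pts V \<times> pts V" using P by auto
qed

lemma prime_divisor_maximal:
 assumes "prime_divisor (product_space V V) C" "irreducible_closed (product_zariski V V) B" "B \<subset> pts V \<times> pts V"
  "C <= B"
 shows "C = B"
 using assms unfolding prime_divisor_iff by blast

lemma prime_divisor_in_fibre:
 assumes C: "prime_divisor (product_space V V) C" and P: "P : pts V"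
 shows "C <= {P} \<times> pts V ==> C = {P} \<times> pts V" "C <= pts V \<times> {P} ==> C = pts V \<times> {P}"
 using prime_divisor_maximal[OF C sq.irreducible_fibre[OF P] fibre_proper(1)[OF P]]
  prime_divisor_maximal[OF C sq.irreducible_fibre'[OF P] fibre_proper(2)[OF P]] by simp_all

lemma prime_divisor_subset:
 assumes "prime_divisor (product_space V V) C" "prime_divisor (product_space V V) D" "C <= D"
 shows "C = D"
 using prime_divisor_maximal[OF assms(1) _ _ assms(3)] assms(2) unfolding prime_divisor_iff by blast

text \<open>At a point \<open>(x, y)\<close> on \<open>C\<close> and on no other component, where in
  addition some function vanishing on \<open>C\<close> is nonzero on the fibre over
  \<open>x\<close>, only \<open>C\<close> contributes to the value, and with positive multiplicity.
  So the value determines the coefficient of \<open>C\<close>.\<close>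

lemma correspondence_unique:
 assumes D: "D : divisors (product_space V V)" "ALL x:pts V. {x} \<times> pts V ~: keys D"
  and E: "E : divisors (product_space V V)" "ALL x:pts V. {x} \<times> pts V ~: keys E"
  and val: "!!x y. x : pts V ==> y : pts V ==> correspondence_value V D x y = correspondence_value V E x y"
 shows "D = E"
proof (rule poly_mapping_eqI)
 fix C
 let ?K = "keys D Un keys E"
 let ?S = "product_space V V"
 show "lookup D C = lookup E C"
 proof (cases "C : ?K")
  case False
  thus ?thesis by (simp add: in_keys_iff)
 next
  case True
  have prime: "prime_divisor ?S A" if "A : ?K" for A using that D(1) E(1) unfolding divisors_def by auto
  note pC = prime[OF True]
  have closed: "closedin (product_zariski V V) A" if "A : ?K" for A
  using prime[OF that] unfolding prime_divisor_iff irreducible_closed_def by blast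
  have Csub: "C \<subset> pts V \<times> pts V" and Cirr: "irreducible_closed (product_zariski V V) C"
  using pC unfolding prime_divisor_iff by blast+
  have not_in: "~ C <= A" if "A : ?K - {C}" for A
  proof
  assume "C <= A"
  moreover have "A : ?K" "A ~= C" using that by auto
  ultimately show False using prime_divisor_subset[OF pC prime[of A]] by simp
  qed
  have Cfib: "~ C <= {x} \<times> pts V" if "x : pts V" for x
  proof
  assume "C <= {x} \<times> pts V"
  hence "C = {x} \<times> pts V" by (rule prime_divisor_in_fibre(1)[OF pC that])
  thus False using True D(2) E(2) that by auto
  qed
  obtain x y f where xy: "(x, y) : C" "ALL A:?K - {C}. (x, y) ~: A"
  and f: "f : vanishing_ideal ?S (x, y) C" "~ (EV y' in near y. f (x, y') = 0)"
  \<comment> \<open>A horizontal fibre gets its own function, since it might be among the fibres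
    excluded by \<open>proper_closed_function\<close>.\<close>
  proof (cases "EX y1:pts V. C = pts V \<times> {y1}")
  case True
  then obtain y1 where y1: "y1 : pts V" "C = pts V \<times> {y1}" by blast
  have "~ C <= \<Union> (?K - {C})"
  by (rule irreducible_not_subset_Union[OF Cirr _ closed not_in]) auto
  then obtain x where x: "(x, y1) : C" "ALL A:?K - {C}. (x, y1) ~: A" using y1(2) by auto
  have xV: "x : pts V" using x y1 by auto
  let ?f = "%z. unif y1 (snd z)"
  have "EV z in sq.near2 x y1. z : C --> ?f z = 0"
  by (rule always_eventually) (use y1 unif(2) in auto)
  hence fI: "?f : vanishing_ideal ?S (x, y1) C"
  unfolding sq.mem_vanishing_ideal using sq.regular2_snd[OF xV y1(1) unif(1)[OF y1(1)]] by simp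
  have "~ (EV y' in near y1. ?f (x, y') = 0)"
  using has_order_not_zero[OF y1(1) has_order_uniformizer[OF y1(1)]] by simp
  thus thesis by (rule that[OF x fI])
  next
  case False
  have "C ~= pts V \<times> pts V" using Csub by blast
  thus thesis
  proof (rule sq.proper_closed_function[OF closed[OF \<open>C : ?K\<close>]])
  fix E1 E2 assume E12: "finite E1" "finite E2" "!!x y. (x, y) : C ==> x ~: E1 ==> y ~: E2 ==>
  EX f:vanishing_ideal ?S (x, y) C. ~ (EV y' in near y. f (x, y') = 0)"
  let ?F = "(?K - {C}) Un (%x. {x} \<times> pts V) ` (E1 Int pts V) Un (%y. pts V \<times> {y}) ` (E2 Int pts V)"
  have "~ C <= \<Union> ?F"
  proof (rule irreducible_not_subset_Union[OF Cirr])
  show "finite ?F" using E12 by simp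
  show "closedin (product_zariski V V) A" if "A : ?F" for A
  using that by (elim UnE imageE) (auto intro: closed sq.closedin_fibre sq.closedin_fibre')
  show "~ C <= A" if "A : ?F" for A
  using that
  proof (elim UnE imageE)
  assume "A : ?K - {C}"
  thus ?thesis by (rule not_in)
  next
  fix x assume "A = {x} \<times> pts V" "x : E1 Int pts V"
  thus ?thesis using Cfib[of x] by simp
  next
  fix y assume y: "A = pts V \<times> {y}" "y : E2 Int pts V"
  show ?thesis
  proof
  assume "C <= A"
  hence "C = pts V \<times> {y}" using prime_divisor_in_fibre(2)[OF pC, of y] y by simp
  thus False using False y by blast
  qed
  qed
  qed
  then obtain z where z: "z : C" "z ~: \<Union> ?F" by blast
  obtain x y where xy: "z = (x, y)" by (cases z)
  have V: "x : pts V" "y : pts V" using z(1) xy Csub by auto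
  have "x ~: E1" "y ~: E2" using z(2) V xy by auto
  from E12(3)[OF z(1)[unfolded xy] this] obtain f where
  f: "f : vanishing_ideal ?S (x, y) C" "~ (EV y' in near y. f (x, y') = 0)" ..
  have "ALL A:?K - {C}. (x, y) ~: A" using z(2) xy by blast
  from that[OF z(1)[unfolded xy] this f] show thesis .
  qed
  qed
  have V: "x : pts V" "y : pts V" using xy(1) Csub by auto
  let ?li = "%A. int (local_intersection ?S (x, y) A ({x} \<times> pts V))"
  have pos: "?li C > 0" using sq.local_intersection_fibre_pos[OF V xy(1) f] by simp
  have zero: "?li A = 0" if "A : ?K - {C}" for A
  using sq.local_intersection_fibre_notin[OF V closed, of A] that xy(2) by simp
  have val_eq: "correspondence_value V M x y = lookup M C * ?li C" if M: "keys M <= ?K" for M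
  proof -
  have "correspondence_value V M x y = (SUM A:?K. lookup M A * ?li A)"
  unfolding correspondence_value_def
  by (rule sum.mono_neutral_left) (use M in "auto simp: in_keys_iff")
  also have "... = (SUM A:{C}. lookup M A * ?li A)"
  by (rule sum.mono_neutral_right) (use True zero in auto)
  finally show ?thesis by simp
  qed
  have "lookup D C * ?li C = lookup E C * ?li C"
  using val[OF V] val_eq[of D] val_eq[of E] by simp
  thus ?thesis using pos by simp
 qed
qed

lemma correspondence_of_eqI:
 assumes "D : divisors (product_space V V)" "ALL x:pts V. {x} \<times> pts V ~: keys D"
  "ALL x:pts V. ALL y:pts V. correspondence_value V D x y = lookup (ps x) y"
 shows "correspondence_of V ps = D"
 unfolding correspondence_of_def
proof (rule the_equality)
 show "D : divisors (product_space V V) & (ALL x:pts V. {x} \<times> pts V ~: keys D) &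
  (ALL x:pts V. ALL y:pts V. correspondence_value V D x y = lookup (ps x) y)"
  using assms by blast
 fix E assume "E : divisors (product_space V V) & (ALL x:pts V. {x} \<times> pts V ~: keys E) &
  (ALL x:pts V. ALL y:pts V. correspondence_value V E x y = lookup (ps x) y)"
 thus "E = D" using assms by (intro correspondence_unique) auto
qed

end

section \<open>The curves attached to double cosets\<close>

context curve_action
begin

text \<open>As the numerator vanishes on the graph, it is the sum of the terms
  \<open>a i (fst p) * (b i (snd p) - b i (ph gm (fst p)))\<close>, and each difference is a
  multiple of that of \<open>t\<close> by \<open>difference_divisible\<close>, pulled back along
  \<open>gm\<close> in the first coordinate.\<close>

lemma graph_divide:
 assumes z: "z : pts V" and gm: "gm : cr G" and t: "has_order (ph gm z) t 1"
  and F: "F : VV.reg2 z (ph gm z)" and zero: "EV x in near z. F (x, ph gm x) = 0"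
 shows "EX F':VV.reg2 z (ph gm z). EV p in VV.near2 z (ph gm z). F p = (t (snd p) - t (ph gm (fst p))) * F' p"
proof -
 let ?w = "ph gm z"
 have w: "?w : pts V" by (rule act_closed[OF gm z])
 note reg = VV.regular2_mult[OF z w] VV.regular2_sum[OF z w] VV.regular2_fst[OF z w] VV.regular2_inverse[OF z w]
 show ?thesis
 proof (rule VV.regular2E[OF z w F])
  fix A B assume A: "A : tensors V V z ?w" and B: "B : tensors V V z ?w" "B (z, ?w) ~= 0"
  and FAB: "EV p in VV.near2 z ?w. F p = A p / B p" and Bnz: "EV p in VV.near2 z ?w. B p ~= 0"
  from A obtain a b and m :: nat where ab: "ALL i<m. a i : reg V z & b i : reg V ?w"
  "A = (%p. SUM i<m. a i (fst p) * b i (snd p))" unfolding tensors_iff by (elim exE conjE)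
  have "ALL i. EX bt. i < m --> bt : VV.reg2 z ?w &
  (EV p in VV.near2 z ?w. b i (snd p) - b i (ph gm (fst p)) = (t (snd p) - t (ph gm (fst p))) * bt p)"
  proof
  fix i
  show "EX bt. i < m --> bt : VV.reg2 z ?w &
  (EV p in VV.near2 z ?w. b i (snd p) - b i (ph gm (fst p)) = (t (snd p) - t (ph gm (fst p))) * bt p)"
  proof (cases "i < m")
  case True
  hence "b i : reg V ?w" using ab(1) by simp
  from difference_divisible[OF w t this] obtain bt where bt: "bt : VV.reg2 ?w ?w"
  "EV p in VV.near2 ?w ?w. b i (snd p) - b i (fst p) = (t (snd p) - t (fst p)) * bt p" ..
  note m = curve_axioms curve_axioms act_morphism[OF gm z] morphism_at_id[OF w]
  have "(%p. bt (ph gm (fst p), snd p)) : VV.reg2 z ?w" by (rule VV.regular2_pullback2[OF m bt(1)])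
  moreover have "EV p in VV.near2 z ?w. b i (snd p) - b i (ph gm (fst p))
  = (t (snd p) - t (ph gm (fst p))) * bt (ph gm (fst p), snd p)"
  using VV.near2_pullback2[OF m bt(2)] by simp
  ultimately show ?thesis by (intro exI[of _ "%p. bt (ph gm (fst p), snd p)"] impI conjI)
  qed simp
  qed
  from choice[OF this] obtain bt where bt: "ALL i. i < m --> bt i : VV.reg2 z ?w &
  (EV p in VV.near2 z ?w. b i (snd p) - b i (ph gm (fst p)) = (t (snd p) - t (ph gm (fst p))) * bt i p)" ..
  have all: "EV p in VV.near2 z ?w. ALL i:{..<m}. b i (snd p) - b i (ph gm (fst p)) = (t (snd p) - t (ph gm (fst p))) * bt i p"
  by (rule eventually_ball_finite) (use bt in simp_all)
  have Ag: "EV x in near z. A (x, ph gm x) = 0"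
  using zero VV.near2_pullback[OF curve_axioms morphism_at_id[OF z] act_morphism[OF gm z] FAB]
  VV.near2_pullback[OF curve_axioms morphism_at_id[OF z] act_morphism[OF gm z] Bnz]
  by eventually_elim simp
  let ?F' = "%p. inverse (B p) * (SUM i<m. a i (fst p) * bt i p)"
  have "?F' : VV.reg2 z ?w"
  using ab(1) bt B VV.regular2_tensors[OF z w B(1)] by (intro reg) auto
  moreover have "EV p in VV.near2 z ?w. F p = (t (snd p) - t (ph gm (fst p))) * ?F' p"
  using FAB all VV.near2_fstI[OF z w Ag]
  proof eventually_elim
  case (elim p)
  have "A p = A p - A (fst p, ph gm (fst p))" using elim(3) by simp
  also have "... = (SUM i<m. a i (fst p) * (b i (snd p) - b i (ph gm (fst p))))"
  unfolding ab(2) by (simp add: sum_subtractf right_diff_distrib)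
  also have "... = (SUM i<m. a i (fst p) * ((t (snd p) - t (ph gm (fst p))) * bt i p))"
  by (rule sum.cong) (use elim(2) in auto)
  also have "... = (t (snd p) - t (ph gm (fst p))) * (SUM i<m. a i (fst p) * bt i p)"
  by (simp add: sum_distrib_left mult_ac)
  finally show ?case unfolding elim(1) by (simp add: divide_inverse mult_ac)
  qed
  ultimately show ?thesis by (intro bexI[of _ ?F'])
 qed
qed

text \<open>Two elements that agree at \<open>z\<close> differ by a nontrivial element of its
  stabilizer, which acts nontrivially on the cotangent space; the difference therefore has order
  exactly 1 at \<open>z\<close>.\<close>

lemma parameter_difference_nonzero:
 assumes z: "z : pts V" and gm: "gm : cr G" "gm' : cr G" "gm ~= gm'" and e: "ph gm z = ph gm' z"
  and t: "has_order (ph gm z) t 1"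
 shows "finite {x : pts V. t (ph gm x) - t (ph gm' x) = 0}"
proof -
 let ?sg = "inv gm *. gm'"
 have sg: "?sg : stab z"
  unfolding stabilizer_def using gm e[symmetric] by (simp add: act_mult z act_inv)
 have ne: "?sg ~= \<one>" using gm by (metis inv_equality inv_inv inv_closed)
 hence zt: "zeta z ?sg ^ 1 ~= 1" using zeta_eq_one[OF z sg] by auto
 have "has_order z (%x. t (ph gm x)) 1" by (rule act_has_order[OF gm(1) z t])
 from has_order_difference[OF z sg this zt]
 have "has_order z (%x. t (ph gm x) - t (ph gm (ph ?sg x))) 1" .
 from has_order_finite_zeros[OF z this]
 have "finite {x : pts V. t (ph gm x) - t (ph gm (ph ?sg x)) = 0}" .
 moreover have "ph gm (ph ?sg x) = ph gm' x" if "x : pts V" for x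
  using gm that by (simp add: act_mult act_inv' act_closed)
 ultimately show ?thesis by (simp cong: conj_cong)
qed

text \<open>A function vanishing on the graphs of several group elements through one point is divisible by the product of
 their equations.\<close>

lemma graphs_divide:
 assumes z: "z : pts V" and w: "w : pts V" and M: "finite M" "M <= cr G" "!!gm. gm : M ==> ph gm z = w"
  and t: "has_order w t 1" and F: "F : VV.reg2 z w" and zero: "!!gm. gm : M ==> EV x in near z. F (x, ph gm x) = 0"
 shows "EX F':VV.reg2 z w. EV p in VV.near2 z w. F p = (PROD gm:M. t (snd p) - t (ph gm (fst p))) * F' p"
 using M zero
proof (induction M rule: finite_induct)
 case empty
 thus ?case using F by (intro bexI[of _ F]) auto
next
 case (insert gm M)
 then obtain F' where F': "F' : VV.reg2 z w"
  "EV p in VV.near2 z w. F p = (PROD gm:M. t (snd p) - t (ph gm (fst p))) * F' p" by auto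
 have gm: "gm : cr G" "ph gm z = w" using insert by auto
 have mor: "morphism_at V V (ph gm) z" by (rule act_morphism[OF gm(1) z])
 have near2: "eventually (%p. F p = (PROD gm:M. t (snd p) - t (ph gm (fst p))) * F' p) (VV.near2 z (ph gm z))"
  using F'(2) gm(2) by simp
 have ev: "EV x in near z. F (x, ph gm x) = (PROD gm':M. t (ph gm x) - t (ph gm' x)) * F' (x, ph gm x)"
  using VV.near2_pullback[OF curve_axioms morphism_at_id[OF z] mor near2] by simp
 have "F (x, ph gm x) = 0 ==> True" for x by simp
 have zF: "EV x in near z. F (x, ph gm x) = 0" using insert.prems(3)[of gm] by simp
 have fz: "finite {x : pts V. t (ph gm x) - t (ph gm' x) = 0}" if "gm' : M" for gm'
  by (rule parameter_difference_nonzero[OF z gm(1)]) (use that insert gm t in auto)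
 \<comment> \<open>On the graph of \<open>gm\<close> the function \<open>F\<close> is zero while the
   equations of the other graphs are nonzero off a finite set. So the cofactor \<open>F'\<close>
   vanishes there and \<open>graph_divide\<close> applies to it.\<close>
 have "finite ({x : pts V. ~ F (x, ph gm x) = (PROD gm':M. t (ph gm x) - t (ph gm' x)) * F' (x, ph gm x)} Un 
  {x : pts V. ~ F (x, ph gm x) = 0} Un (UN gm':M. {x : pts V. t (ph gm x) - t (ph gm' x) = 0}))"
  using eventually_near_finite[OF z ev] eventually_near_finite[OF z zF] fz insert.hyps(1) by simp
 hence "finite {x : pts V. F' (x, ph gm x) ~= 0}"
  by (rule rev_finite_subset) (use insert.hyps(1) in auto)
 moreover have "(%x. F' (x, ph gm x)) : reg V z"
  using VV.regular2_pullback[OF curve_axioms morphism_at_id[OF z] mor] F'(1) gm(2) by simp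
 ultimately have "EV x in near z. F' (x, ph gm x) = 0"
  by (intro regular_agree[OF z _ regular_const[OF z]])
 with graph_divide[OF z gm(1), of t F'] t F'(1) gm(2)
 obtain F'' where F'': "F'' : VV.reg2 z w" "EV p in VV.near2 z w. F' p = (t (snd p) - t (ph gm (fst p))) * F'' p"
  by auto
 have "EV p in VV.near2 z w. F p = (PROD gm:insert gm M. t (snd p) - t (ph gm (fst p))) * F'' p"
  using F'(2) F''(2) by eventually_elim (use insert.hyps in "simp add: mult_ac")
 thus ?case using F''(1) by (intro bexI[of _ F''])
qed

end

sublocale curve_quotient < X2: curve_square X ..

text \<open>The \<open>c j\<close> represent the cosets \<open>H c j\<close> inside
  \<open>H g H\<close>. For an \<open>H\<close>-invariant function the value at \<open>c j z\<close>
  depends only on the coset, so products over \<open>J\<close> behave like norms.\<close>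

locale double_coset_curve = curve_quotient V G ph H
 for V :: "('p, 'k::field_char_0) function_space" and G :: "('g, 'm) monoid_scheme" (structure) and ph and H +
 fixes g :: 'g and J :: "nat set" and c :: "nat => 'g"
 assumes g_carrier: "g : cr G" and finite_J: "finite J" and c_carrier: "j : J ==> c j : cr G"
  and cosets: "{h *. g *. k | h k. h : H & k : H} = {h *. c j | h j. h : H & j : J}"
  and coset_unique: "h : H ==> k : H ==> i : J ==> j : J ==> h *. c i = k *. c j ==> i = j"
begin

definition D :: "'g set" where "D = {h *. g *. k | h k. h : H & k : H}"

definition Gam :: "('p set \<times> 'p set) set" where "Gam = (%z. (pr z, pr (ph g z))) ` pts V"

text \<open>The coefficient of \<open>pr w\<close> in the divisor that the double coset attaches to
  \<open>pr z\<close>, the sum of the points \<open>pr (ph (c j) z)\<close>.\<close>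

definition mult :: "'p => 'p => nat" where "mult z w = card {j : J. pr (ph (c j) z) = pr w}"

lemma DI: "h : H ==> k : H ==> h *. g *. k : D"
 by (auto simp: D_def)

lemma DE:
 assumes "gm : D" obtains h k where "h : H" "k : H" "gm = h *. g *. k"
 using assms by (auto simp: D_def)

lemma D_cosetI: "h : H ==> j : J ==> h *. c j : D"
 unfolding D_def cosets by auto

lemma D_cosetE:
 assumes "gm : D" obtains h j where "h : H" "j : J" "gm = h *. c j"
 using assms unfolding D_def cosets by auto

lemma D_carrier: "gm : D ==> gm : cr G"
 by (elim DE) (simp add: H_carrier g_carrier)

lemma finite_D: "finite D"
 using D_carrier finite_G by (meson finite_subset subsetI)

lemma g_D: "g : D"
 using DI[OF H_one H_one] g_carrier by simp

lemma c_D: "j : J ==> c j : D"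
 using D_cosetI[OF H_one] c_carrier by simp

lemma D_left: "h : H ==> gm : D ==> h *. gm : D"
proof (elim DE)
 fix k l assume "h : H" "k : H" "l : H" "gm = k *. g *. l"
 thus "h *. gm : D" using DI[of "h *. k" l] H_mult by (simp add: H_carrier g_carrier m_assoc)
qed

lemma D_right: "h : H ==> gm : D ==> gm *. h : D"
proof (elim DE)
 fix k l assume "h : H" "k : H" "l : H" "gm = k *. g *. l"
 thus "gm *. h : D" using DI[of k "l *. h"] H_mult by (simp add: H_carrier g_carrier m_assoc)
qed

lemma mem_GamE:
 assumes z: "z : pts V" and w: "w : pts V" and "(pr z, pr w) : Gam"
 obtains gm where "gm : D" "ph gm z = w"
proof -
 obtain x where x: "x : pts V" "pr z = pr x" "pr w = pr (ph g x)" using assms(3) by (auto simp: Gam_def)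
 obtain h where h: "h : H" "x = ph h z" using x pr_eq_iff[OF z x(1)] by auto
 obtain k where k: "k : H" "w = ph k (ph g x)" using x pr_eq_iff[OF act_closed[OF g_carrier x(1)] w] by auto
 have "w = ph (k *. g *. h) z"
  unfolding k(2) h(2) using z H_carrier[OF h(1)] H_carrier[OF k(1)] g_carrier by (simp add: act_mult act_closed)
 thus thesis using that[OF DI[OF k(1) h(1)]] by simp
qed

lemma mem_GamI:
 assumes z: "z : pts V" and gm: "gm : D"
 shows "(pr z, pr (ph gm z)) : Gam"
proof (rule DE[OF gm])
 fix h k assume hk: "h : H" "k : H" "gm = h *. g *. k"
 have x: "ph k z : pts V" by (rule act_closed[OF H_carrier[OF hk(2)] z])
 have "ph gm z = ph h (ph g (ph k z))"
  unfolding hk(3) using z H_carrier[OF hk(1)] H_carrier[OF hk(2)] g_carrier by (simp add: act_mult act_closed)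
 hence "pr (ph gm z) = pr (ph g (ph k z))" using pr_act[OF hk(1) act_closed[OF g_carrier x]] by simp
 moreover have "pr (ph k z) = pr z" by (rule pr_act[OF hk(2) z])
 ultimately show ?thesis unfolding Gam_def using x by (intro image_eqI[of _ _ "ph k z"]) simp_all
qed

lemma ramif_eq:
 assumes z: "z : pts V" and w: "w : pr z"
 shows "ramif w = ramif z"
proof -
 have wV: "w : pts V" using pr_subset[OF z] w by auto
 have "z : pr w" using pr_mem_eq[OF z w] pr_self[OF z] by simp
 have "bij_betw (%h. inv h) {h : H. ph h z = w} {h : H. ph h w = z}"
 proof (rule bij_betw_byWitness[of _ "%h. inv h"])
  show "ALL h:{h : H. ph h z = w}. inv (inv h) = h" "ALL h:{h : H. ph h w = z}. inv (inv h) = h" by (simp_all add: H_carrier)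
  show "(%h. inv h) ` {h : H. ph h z = w} <= {h : H. ph h w = z}"
  by (rule image_subsetI) (auto simp: H_inv act_inv[OF H_carrier z])
  show "(%h. inv h) ` {h : H. ph h w = z} <= {h : H. ph h z = w}"
  by (rule image_subsetI) (auto simp: H_inv act_inv[OF H_carrier wV])
 qed
 from bij_betw_same_card[OF this] show ?thesis unfolding card_hits[OF z w] card_hits[OF wV \<open>z : pr w\<close>] by (rule sym)
qed

text \<open>Each of the \<open>mult z w\<close> cosets that carry \<open>z\<close> into the orbit of
  \<open>w\<close> contains as many elements carrying \<open>z\<close> to \<open>w\<close> itself as
  the stabilizer of \<open>w\<close> in \<open>H\<close> has.\<close>

lemma card_transporters:
 assumes z: "z : pts V" and w: "w : pts V"
 shows "card {gm : D. ph gm z = w} = mult z w * ramif w"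
proof -
 let ?J = "{j : J. pr (ph (c j) z) = pr w}"
 let ?K = "%j. {h : H. ph h (ph (c j) z) = w}"
 have eq: "{gm : D. ph gm z = w} = (UN j:?J. (%h. h *. c j) ` ?K j)"
 proof
  show "{gm : D. ph gm z = w} <= (UN j:?J. (%h. h *. c j) ` ?K j)"
  proof
  fix gm assume "gm : {gm : D. ph gm z = w}"
  hence gm: "gm : D" "ph gm z = w" by auto
  show "gm : (UN j:?J. (%h. h *. c j) ` ?K j)"
  proof (rule D_cosetE[OF gm(1)])
  fix h j assume hj: "h : H" "j : J" "gm = h *. c j"
  have cz: "ph (c j) z : pts V" by (rule act_closed[OF c_carrier[OF hj(2)] z])
  have *: "ph h (ph (c j) z) = w" using gm(2) unfolding hj(3) act_mult[OF H_carrier[OF hj(1)] c_carrier[OF hj(2)] z] .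
  hence "pr (ph (c j) z) = pr w" using pr_act[OF hj(1) cz] by simp
  thus ?thesis using * hj by blast
  qed
  qed
  show "(UN j:?J. (%h. h *. c j) ` ?K j) <= {gm : D. ph gm z = w}"
  using D_cosetI act_mult H_carrier c_carrier z by auto
 qed
 have card_K: "card ((%h. h *. c j) ` ?K j) = ramif w" if j: "j : ?J" for j
 proof -
  have cj: "c j : cr G" using c_carrier j by simp
  have cz: "ph (c j) z : pts V" by (rule act_closed[OF cj z])
  have "inj_on (%h. h *. c j) (?K j)"
  by (rule inj_onI) (use cj H_carrier in auto)
  hence "card ((%h. h *. c j) ` ?K j) = card (?K j)" by (rule card_image)
  also have "... = ramif (ph (c j) z)" by (rule card_hits[OF cz]) (use j pr_self[OF w] in simp)
  also have "... = ramif w" using ramif_eq[OF w] pr_self[OF cz] j by simp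
  finally show ?thesis .
 qed
 have "card {gm : D. ph gm z = w} = (SUM j:?J. card ((%h. h *. c j) ` ?K j))"
  unfolding eq
 proof (rule card_UN_disjoint)
  show "finite ?J" using finite_J by simp
  show "ALL j:?J. finite ((%h. h *. c j) ` ?K j)" using finite_H by simp
  show "ALL i:?J. ALL j:?J. i ~= j --> (%h. h *. c i) ` ?K i Int (%h. h *. c j) ` ?K j = {}"
  using coset_unique by fastforce
 qed
 thus ?thesis using card_K by (simp add: mult_def)
qed

text \<open>Right multiplication by an element of \<open>H\<close> permutes the cosets
  \<open>H c j\<close> of the double coset.\<close>

lemma coset_prod:
 assumes f: "!!h gm. h : H ==> gm : D ==> f (h *. gm) = (f gm :: 'b::comm_monoid_mult)" and h0: "h0 : H"
 shows "(PROD j:J. f (c j *. h0)) = (PROD j:J. f (c j))"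
proof -
 have "ALL j. EX i. j : J --> i : J & (EX h:H. c j *. h0 = h *. c i)"
 proof
  fix j
  show "EX i. j : J --> i : J & (EX h:H. c j *. h0 = h *. c i)"
  proof (cases "j : J")
  case True
  from D_right[OF h0 c_D[OF True]] show ?thesis by (elim D_cosetE) blast
  qed simp
 qed
 from choice[OF this] obtain p where p: "!!j. j : J ==> p j : J & (EX h:H. c j *. h0 = h *. c (p j))" by blast
 have inj: "inj_on p J"
 proof (rule inj_onI)
  fix i j assume ij: "i : J" "j : J" "p i = p j"
  obtain h where h: "h : H" "c i *. h0 = h *. c (p i)" using p[OF ij(1)] by blast
  obtain k where k: "k : H" "c j *. h0 = k *. c (p j)" using p[OF ij(2)] by blast
  note car = H_carrier[OF h(1)] H_carrier[OF k(1)] H_carrier[OF h0] c_carrier[OF ij(1)] c_carrier[OF ij(2)]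
  have cp: "c (p j) : cr G" using p[OF ij(2)] c_carrier by blast
  have "inv h *. (c i *. h0) = inv k *. (c j *. h0)"
  unfolding h(2) k(2) ij(3) using car cp by (simp add: m_assoc[symmetric])
  hence "(inv h *. c i) *. h0 = (inv k *. c j) *. h0" using car by (simp add: m_assoc)
  hence "inv h *. c i = inv k *. c j" using car by simp
  thus "i = j" by (rule coset_unique[OF H_inv[OF h(1)] H_inv[OF k(1)] ij(1,2)])
 qed
 have "p ` J <= J" using p by blast
 hence bij: "bij_betw p J J" using inj endo_inj_surj[OF finite_J] by (simp add: bij_betw_def)
 have "(PROD j:J. f (c j *. h0)) = (PROD j:J. f (c (p j)))"
 proof (rule prod.cong[OF refl])
  fix j assume j: "j : J"
  obtain h where h: "h : H" "c j *. h0 = h *. c (p j)" using p[OF j] by blast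
  show "f (c j *. h0) = f (c (p j))" unfolding h(2) by (rule f[OF h(1) c_D]) (use p[OF j] in blast)
 qed
 also have "... = (PROD j:J. f (c j))" by (rule prod.reindex_bij_betw[OF bij])
 finally show ?thesis .
qed

text \<open>The product over the cosets is invariant under \<open>H\<close> in the first argument, so averaging over \<open>H\<close> the coefficients of
 its expansion in powers of \<open>s w\<close> exhibits it as a sum of products of functions on the quotient.\<close>

lemma norm_function:
 assumes s: "!!h x. h : H ==> x : pts V ==> s (ph h x) = s x"
 obtains F where "!!z w. z : pts V ==> w : pts V ==> F (pr z, pr w) = (PROD j:J. s w - s (ph (c j) z))"
  "!!z w. z : pts V ==> w : pts V ==> s : reg V w ==> (!!gm. gm : D ==> s : reg V (ph gm z)) ==>
  F : tensors X X (pr z) (pr w)"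
proof -
 \<comment> \<open>In the expansion of the product, \<open>A\<close> is the set of factors from
   which \<open>s w\<close> is taken; \<open>rh A\<close> averages the complementary product over
   \<open>H\<close>.\<close>
 define rh where "rh = (%A z. inverse (of_nat (card H)) * (SUM h:H. PROD j:J - A. - s (ph (c j) (ph h z))))"
 define F where "F = (%p. SUM A:Pow J. desc (rh A) (fst p) * desc (%w. s w ^ card A) (snd p))"
 have card_H: "of_nat (card H) ~= (0 :: 'k)" using finite_H H_one by auto
 have rh_inv: "rh A (ph k x) = rh A x" if k: "k : H" and x: "x : pts V" for A k x
 proof -
  have "(SUM h:H. PROD j:J - A. - s (ph (c j) (ph h (ph k x)))) = (SUM h:H. PROD j:J - A. - s (ph (c j) (ph (h *. k) x)))"
  by (rule sum.cong) (simp_all add: act_mult H_carrier k x)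
  also have "... = (SUM h:H. PROD j:J - A. - s (ph (c j) (ph h x)))"
  by (rule sum.reindex_bij_witness[of _ "%h. h *. inv k" "%h. h *. k"])
  (use H_carrier k H_mult H_inv in "auto simp: m_assoc")
  finally show ?thesis by (simp add: rh_def)
 qed
 have sc: "s (ph (h *. gm) x) = s (ph gm x)" if "h : H" "gm : D" "x : pts V" for h gm x
  using that act_mult[OF H_carrier D_carrier] s act_closed D_carrier by simp
 have val: "F (pr z, pr w) = (PROD j:J. s w - s (ph (c j) z))" if z: "z : pts V" and w: "w : pts V" for z w
 proof -
  have d1: "desc (rh A) (pr z) = rh A z" for A by (rule desc_pr[OF z]) (rule rh_inv)
  have d2: "desc (%w. s w ^ card A) (pr w) = s w ^ card A" for A by (rule desc_pr[OF w]) (simp add: s)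
  have "F (pr z, pr w) = (SUM A:Pow J. rh A z * s w ^ card A)"
  unfolding F_def by (simp add: d1 d2)
  also have "... = inverse (of_nat (card H)) * (SUM A:Pow J. SUM h:H. (PROD j:A. s w) * (PROD j:J - A. - s (ph (c j) (ph h z))))"
  by (simp add: rh_def sum_distrib_left sum_distrib_right mult_ac)
  also have "(SUM A:Pow J. SUM h:H. (PROD j:A. s w) * (PROD j:J - A. - s (ph (c j) (ph h z))))
  = (SUM h:H. PROD j:J. s w + - s (ph (c j) (ph h z)))"
  by (subst sum.swap) (simp only: prod_add[OF finite_J])
  also have "... = (SUM h:H. PROD j:J. s w - s (ph (c j) z))"
  proof (rule sum.cong[OF refl])
  fix h assume h: "h : H"
  have "(PROD j:J. s w + - s (ph (c j) (ph h z))) = (PROD j:J. s w - s (ph (c j *. h) z))"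
  by (rule prod.cong) (simp_all add: act_mult c_carrier H_carrier h z)
  also have "... = (PROD j:J. s w - s (ph (c j) z))"
  by (rule coset_prod[of "%gm. s w - s (ph gm z)"]) (simp_all add: sc z h)
  finally show "(PROD j:J. s w + - s (ph (c j) (ph h z))) = (PROD j:J. s w - s (ph (c j) z))" .
  qed
  finally show ?thesis using card_H by simp
 qed
 have ten: "F : tensors X X (pr z) (pr w)"
  if z: "z : pts V" and w: "w : pts V" and sw: "s : reg V w" and sz: "!!gm. gm : D ==> s : reg V (ph gm z)" for z w
  unfolding F_def
 proof (rule tensors_sum, rule tensors_pure)
  fix A assume "A : Pow J"
  have "(%x. s (ph (c j) (ph h x))) : reg V z" if j: "j : J - A" and h: "h : H" for j h
  proof -
  have cj: "c j : cr G" using c_carrier j by simp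
  have hz: "ph h z : pts V" by (rule act_closed[OF H_carrier[OF h] z])
  have "s : reg V (ph (c j) (ph h z))"
  using sz[OF D_right[OF h c_D[of j]]] j unfolding act_mult[OF cj H_carrier[OF h] z] by simp
  from act_regular[OF cj hz this] have "(%x. s (ph (c j) x)) : reg V (ph h z)" .
  from act_regular[OF H_carrier[OF h] z this] show ?thesis .
  qed
  hence r: "rh A : reg V z"
  unfolding rh_def by (intro regular_mult regular_const regular_sum regular_prod regular_minus z) auto
  show "desc (rh A) : reg X (pr z)" by (rule desc_regular[OF z _ r]) (rule rh_inv)
  show "desc (%w. s w ^ card A) : reg X (pr w)"
  by (rule desc_regular[OF w]) (use s regular_power[OF w sw] in simp_all)
 qed
 show thesis by (rule that[OF val ten])
qed

lemma norm_function_Gam: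
 fixes s :: "'p => 'k"
 assumes F: "!!z w. z : pts V ==> w : pts V ==> F (pr z, pr w) = (PROD j:J. s w - s (ph (c j) z))"
  and s: "!!h x. h : H ==> x : pts V ==> s (ph h x) = s x" and "p : Gam"
 shows "F p = 0"
proof -
 obtain z where z: "z : pts V" "p = (pr z, pr (ph g z))" using assms(3) by (auto simp: Gam_def)
 show ?thesis
 proof (rule D_cosetE[OF g_D])
  fix h j assume hj: "h : H" "j : J" "g = h *. c j"
  have "s (ph g z) = s (ph (c j) z)"
  unfolding hj(3) act_mult[OF H_carrier[OF hj(1)] c_carrier[OF hj(2)] z(1)]
  by (rule s[OF hj(1) act_closed[OF c_carrier[OF hj(2)] z(1)]])
  hence "EX j:J. s (ph g z) - s (ph (c j) z) = 0" using hj(2) by (intro bexI[of _ j]) simp_all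
  hence "(PROD j:J. s (ph g z) - s (ph (c j) z)) = 0" by (intro prod_zero finite_J)
  thus ?thesis unfolding z(2) F[OF z(1) act_closed[OF g_carrier z(1)]] .
 qed
qed

lemma orbit_parameter:
 assumes z: "z : pts V" and w: "w : pts V"
 obtains s where "has_order w s (ramif w)" "!!h x. h : H ==> x : pts V ==> s (ph h x) = s x"
  "!!gm. gm : cr G ==> s : reg V (ph gm z)"
  "!!gm. gm : cr G ==> pr (ph gm z) ~= pr w ==> s (ph gm z) = 1" "s w = 0"
  "!!x. x : pts V ==> pr x = pr w ==> s x = 0"
proof (rule invariant_parameter[OF w, of "(%gm. ph gm z) ` cr G"])
 show "finite ((%gm. ph gm z) ` cr G)" using finite_G by simp
 show "(%gm. ph gm z) ` cr G <= pts V" using act_closed z by auto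
 fix s assume s: "has_order w s (ramif w)" "!!h x. h : H ==> x : pts V ==> s (ph h x) = s x"
  "!!Q. Q : (%gm. ph gm z) ` cr G ==> s : reg V Q"
  "!!Q. Q : (%gm. ph gm z) ` cr G ==> Q ~: pr w ==> s Q = 1" "s w = 0"
 show thesis
 proof (rule that[OF s(1,2) _ _ s(5)])
  show "s : reg V (ph gm z)" if "gm : cr G" for gm using s(3) that by simp
  show "s (ph gm z) = 1" if "gm : cr G" "pr (ph gm z) ~= pr w" for gm
  proof (rule s(4))
  show "ph gm z ~: pr w" using that(2) pr_mem_eq[OF w] by blast
  qed (use that in simp)
  show "s x = 0" if "x : pts V" "pr x = pr w" for x
  using pr_eq_iff[OF w that(1)] that(2) s(2)[OF _ w] s(5) by auto
 qed
qed

text \<open>Off \<open>Gam\<close> no \<open>c j\<close> carries \<open>z\<close> into the orbit of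
  \<open>w\<close>, so an invariant parameter at \<open>w\<close> can be 1 at all
  \<open>ph (c j) z\<close>. Its norm is then a product of factors -1 at the given point and 0 on
  \<open>Gam\<close>.\<close>

lemma separating_function:
 assumes z: "z : pts V" and w: "w : pts V" and "(pr z, pr w) ~: Gam"
 obtains F E where "F : tensors X X (pr z) (pr w)" "F (pr z, pr w) ~= 0" "!!p. p : Gam ==> F p = 0" "finite E"
  "!!z w. z : pts V ==> w : pts V ==> w ~: E ==> (!!gm. gm : D ==> ph gm z ~: E) ==> F : tensors X X (pr z) (pr w)"
proof (rule orbit_parameter[OF z w])
 fix s assume s: "has_order w s (ramif w)" "!!h x. h : H ==> x : pts V ==> s (ph h x) = s x"
  "!!gm. gm : cr G ==> s : reg V (ph gm z)"
  "!!gm. gm : cr G ==> pr (ph gm z) ~= pr w ==> s (ph gm z) = 1" "s w = 0"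
 show thesis
 proof (rule norm_function[OF s(2)])
  fix F assume F: "!!z w. z : pts V ==> w : pts V ==> F (pr z, pr w) = (PROD j:J. s w - s (ph (c j) z))"
  "!!z w. z : pts V ==> w : pts V ==> s : reg V w ==> (!!gm. gm : D ==> s : reg V (ph gm z)) ==>
  F : tensors X X (pr z) (pr w)"
  define E where "E = {x : pts V. s ~: reg V x}"
  have fE: "finite E" unfolding E_def
  using eventually_near_finite[OF w regular_open[OF w has_order_regular[OF s(1)]]] .
  have s1: "s (ph (c j) z) = 1" if j: "j : J" for j
  proof (rule s(4)[OF c_carrier[OF j]])
  show "pr (ph (c j) z) ~= pr w" using mem_GamI[OF z c_D[OF j]] assms(3) by auto
  qed
  have "F (pr z, pr w) ~= 0" unfolding F(1)[OF z w] using s1 s(5) finite_J by simp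
  moreover have "F : tensors X X (pr z) (pr w)"
  by (rule F(2)[OF z w has_order_regular[OF s(1)]]) (rule s(3)[OF D_carrier])
  ultimately show thesis
  proof (intro that[of F E] fE)
  show "F p = 0" if "p : Gam" for p by (rule norm_function_Gam[OF F(1) s(2) that])
  fix z w assume "z : pts V" "w : pts V" "w ~: E" "!!gm. gm : D ==> ph gm z ~: E"
  thus "F : tensors X X (pr z) (pr w)"
  using act_closed D_carrier by (intro F(2)) (auto simp: E_def)
  qed
 qed
qed

lemma Gam_subset: "Gam <= pts X \<times> pts X"
 unfolding Gam_def points_X using act_closed[OF g_carrier] by auto

lemma closedin_Gam: "closedin (product_zariski X X) Gam"
proof -
 have "openin (product_zariski X X) (pts X \<times> pts X - Gam)"
 proof (subst openin_subopen, intro ballI)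
  fix p assume p: "p : pts X \<times> pts X - Gam"
  then obtain z w where zw: "z : pts V" "w : pts V" "p = (pr z, pr w)" by (auto simp: points_X)
  have XP: "pr z : pts X" "pr w : pts X" using zw by (auto simp: points_X)
  show "EX T. openin (product_zariski X X) T & p : T & T <= pts X \<times> pts X - Gam"
  proof (rule separating_function[OF zw(1,2)])
  show "(pr z, pr w) ~: Gam" using p zw by simp
  fix F assume F: "F : tensors X X (pr z) (pr w)" "F (pr z, pr w) ~= 0" "!!p. p : Gam ==> F p = 0"
  have "EV q in X2.sq.near2 (pr z) (pr w). q : pts X \<times> pts X - Gam"
  using X2.sq.near2_nonzero[OF XP F(1,2)] X2.sq.near2_points[OF XP] by eventually_elim (use F(3) in auto)
  thus ?thesis unfolding eventually_nhdsin zw(3) using XP by (auto simp: X2.sq.topspace_product)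
  qed
 qed
 thus ?thesis using Gam_subset by (simp add: closedin_def X2.sq.topspace_product)
qed

lemma irreducible_Gam: "irreducible_closed (product_zariski X X) Gam"
proof (rule X2.sq.irreducible_image[OF curve_axioms pr_morphism _ Gam_def closedin_Gam])
 fix y assume y: "y : pts V"
 thus "y : pts V" .
 show "morphism_at V X (%z. pr (ph g z)) y"
  by (rule morphism_at_comp[OF act_morphism[OF g_carrier y] pr_morphism[OF act_closed[OF g_carrier y]]])
qed

text \<open>Pulled back to the square of \<open>V\<close>, a function vanishing on
  \<open>Gam\<close> vanishes on the graph of every element of the double coset; those through
  \<open>(z, w)\<close> give the factors. Both lower bounds for orders come from this.\<close>

lemma vanishing_pullback:
 assumes z: "z : pts V" and w: "w : pts V"
  and f: "f : vanishing_ideal (product_space X X) (pr z, pr w) Gam"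
  and t: "has_order w t 1"
 obtains F where "F : VV.reg2 z w"
  "EV p in VV.near2 z w. f (pr (fst p), pr (snd p)) = (PROD gm:{gm:D. ph gm z = w}. t (snd p) - t (ph gm (fst p))) * F p"
proof -
 have f': "f : X2.sq.reg2 (pr z) (pr w)" "EV p in X2.sq.near2 (pr z) (pr w). p : Gam --> f p = 0"
  using f unfolding X2.sq.mem_vanishing_ideal by blast+
 have "(%p. f (pr (fst p), pr (snd p))) : VV.reg2 z w"
  by (rule X2.sq.regular2_pullback2[OF curve_axioms curve_axioms pr_morphism[OF z] pr_morphism[OF w] f'(1)])
 moreover have "EV x in near z. f (pr x, pr (ph gm x)) = 0" if gm: "gm : D" "ph gm z = w" for gm
 proof -
  have m: "morphism_at V X (%x. pr (ph gm x)) z"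
  by (rule morphism_at_comp[OF act_morphism[OF D_carrier[OF gm(1)] z] pr_morphism]) (use gm w in simp)
  have "eventually (%p. p : Gam --> f p = 0) (X2.sq.near2 (pr z) (pr (ph gm z)))" using f'(2) gm(2) by simp
  from X2.sq.near2_pullback[OF curve_axioms pr_morphism[OF z] m this] eventually_near_points[of z]
  show ?thesis by eventually_elim (simp add: mem_GamI gm(1))
 qed
 ultimately have "EX F:VV.reg2 z w. EV p in VV.near2 z w. f (pr (fst p), pr (snd p)) =
  (PROD gm:{gm:D. ph gm z = w}. t (snd p) - t (ph gm (fst p))) * F p"
  using finite_D D_carrier by (intro graphs_divide[OF z w _ _ _ t]) auto
 thus thesis using that by (elim bexE)
qed

lemma Gam_fibre_order:
 assumes z: "z : pts V" and w: "w : pts V"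
  and f: "f : vanishing_ideal (product_space X X) (pr z, pr w) Gam"
 shows "X.order_ge (pr w) (%y. f (pr z, y)) (mult z w)"
proof (rule order_ge_X[OF w])
 have XP: "pr z : pts X" "pr w : pts X" using z w by (auto simp: points_X)
 have "f : X2.sq.reg2 (pr z) (pr w)" using f unfolding X2.sq.mem_vanishing_ideal by blast
 from X2.sq.regular2_pullback[OF X.curve_axioms X.morphism_at_const[OF XP(2,1)] morphism_at_id[OF XP(2)] this]
 show "(%y. f (pr z, y)) : reg X (pr w)" .
 let ?t = "unif w" and ?M = "{gm : D. ph gm z = w}"
 show "order_ge w (%y. f (pr z, pr y)) (mult z w * ramif w)"
 proof (rule vanishing_pullback[OF z w f has_order_uniformizer[OF w]])
  fix F assume F: "F : VV.reg2 z w" "EV p in VV.near2 z w. f (pr (fst p), pr (snd p))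
  = (PROD gm:?M. ?t (snd p) - ?t (ph gm (fst p))) * F p"
  note m = curve_axioms morphism_at_const[OF w z] morphism_at_id[OF w]
  have Fr: "(%y. F (z, y)) : reg V w" by (rule VV.regular2_pullback[OF m F(1)])
  have "EV y in near w. f (pr z, pr y) = (PROD gm:?M. ?t y - ?t (ph gm z)) * F (z, y)"
  using VV.near2_pullback[OF m F(2)] by simp
  hence ev: "EV y in near w. f (pr z, pr y) = ?t y ^ card ?M * F (z, y)"
  by eventually_elim (simp add: unif(2)[OF w])
  have "has_order w (%y. ?t y ^ card ?M) (card ?M)"
  using has_order_power[OF w has_order_uniformizer[OF w], of "card ?M"] by simp
  from order_geI[OF w this Fr ev] show ?thesis unfolding card_transporters[OF z w] .
 qed
qed

text \<open>On the diagonal each factor becomes \<open>t y - t (ph gm y)\<close> with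
  \<open>ph gm z = z\<close> and vanishes at \<open>z\<close>. There are
  \<open>mult z z * ramif z\<close> factors, and passing to the quotient divides the order by
  \<open>ramif z\<close>.\<close>

lemma Gam_diagonal_order:
 assumes z: "z : pts V" and f: "f : vanishing_ideal (product_space X X) (pr z, pr z) Gam"
 shows "X.order_ge (pr z) (%y. f (y, y)) (mult z z)"
proof (rule order_ge_X[OF z])
 have XP: "pr z : pts X" using z by (auto simp: points_X)
 have "f : X2.sq.reg2 (pr z) (pr z)" using f unfolding X2.sq.mem_vanishing_ideal by blast
 from X2.sq.regular2_pullback[OF X.curve_axioms morphism_at_id[OF XP] morphism_at_id[OF XP] this]
 show "(%y. f (y, y)) : reg X (pr z)" .
 let ?t = "unif z" and ?M = "{gm : D. ph gm z = z}"
 show "order_ge z (%y. f (pr y, pr y)) (mult z z * ramif z)"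
 proof (rule vanishing_pullback[OF z z f has_order_uniformizer[OF z]])
  fix F assume F: "F : VV.reg2 z z" "EV p in VV.near2 z z. f (pr (fst p), pr (snd p))
  = (PROD gm:?M. ?t (snd p) - ?t (ph gm (fst p))) * F p"
  note m = curve_axioms morphism_at_id[OF z] morphism_at_id[OF z]
  have Fr: "(%y. F (y, y)) : reg V z" by (rule VV.regular2_pullback[OF m F(1)])
  have ev: "EV y in near z. (PROD gm:?M. ?t y - ?t (ph gm y)) * F (y, y) = f (pr y, pr y)"
  using VV.near2_pullback[OF m F(2)] by eventually_elim simp
  have "order_ge z (%y. PROD gm:?M. ?t y - ?t (ph gm y)) (SUM gm:?M. 1)"
  proof (rule order_ge_prod[OF z])
  show "finite ?M" using finite_D by simp
  fix gm assume gm: "gm : ?M"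
  hence "(%y. ?t (ph gm y)) : reg V z"
  using act_regular[OF D_carrier z, of gm ?t] unif(1)[OF z] by simp
  hence "(%y. ?t y - ?t (ph gm y)) : reg V z" by (intro regular_diff z unif)
  thus "order_ge z (%y. ?t y - ?t (ph gm y)) 1"
  using order_ge_1_iff[OF z] gm by simp
  qed
  from order_ge_mult[OF z this, of "%y. F (y, y)" 0] Fr
  have "order_ge z (%y. (PROD gm:?M. ?t y - ?t (ph gm y)) * F (y, y)) (card ?M)" by (simp add: order_ge_0)
  from order_ge_cong[OF z this ev] show ?thesis unfolding card_transporters[OF z z] .
 qed
qed

text \<open>The lower bounds are attained by the norm of a local parameter of the quotient.\<close>

lemma Gam_order_attained:
 assumes z: "z : pts V" and w: "w : pts V"
 obtains f where "f : vanishing_ideal (product_space X X) (pr z, pr w) Gam"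
  "X.has_order (pr w) (%y. f (pr z, y)) (mult z w)"
  "z = w ==> g ~: H ==> X.has_order (pr w) (%y. f (y, y)) (mult z w)"
proof (rule orbit_parameter[OF z w])
 fix s assume s: "has_order w s (ramif w)" "!!h x. h : H ==> x : pts V ==> s (ph h x) = s x"
  "!!gm. gm : cr G ==> s : reg V (ph gm z)"
  "!!gm. gm : cr G ==> pr (ph gm z) ~= pr w ==> s (ph gm z) = 1" "s w = 0"
  "!!x. x : pts V ==> pr x = pr w ==> s x = 0"
 have XP: "pr z : pts X" "pr w : pts X" using z w by (auto simp: points_X)
 let ?J = "{j : J. pr (ph (c j) z) = pr w}"
 have sumJ: "(SUM j:J. if pr (ph (c j) z) = pr w then ramif w else 0) = mult z w * ramif w"
  using finite_J by (simp add: sum.If_cases mult_def Int_def)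
 have sr: "s : reg V w" using s(1) by (rule has_order_regular)
 show thesis
 proof (rule norm_function[OF s(2)])
  fix F assume F: "!!z w. z : pts V ==> w : pts V ==> F (pr z, pr w) = (PROD j:J. s w - s (ph (c j) z))"
  "!!z w. z : pts V ==> w : pts V ==> s : reg V w ==> (!!gm. gm : D ==> s : reg V (ph gm z)) ==>
  F : tensors X X (pr z) (pr w)"
  have "F : tensors X X (pr z) (pr w)" by (rule F(2)[OF z w sr s(3)[OF D_carrier]])
  hence Fr: "F : X2.sq.reg2 (pr z) (pr w)" by (rule X2.sq.regular2_tensors[OF XP])
  have FI: "F : vanishing_ideal (product_space X X) (pr z, pr w) Gam"
  unfolding X2.sq.mem_vanishing_ideal using Fr norm_function_Gam[OF F(1) s(2)] by (simp add: always_eventually)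
  have "(%y. F (pr z, y)) : reg X (pr w)"
  by (rule X2.sq.regular2_pullback[OF X.curve_axioms X.morphism_at_const[OF XP(2,1)] morphism_at_id[OF XP(2)] Fr])
  note iff1 = has_order_X_iff[OF w this]
  have "has_order w (%y. PROD j:J. s y - s (ph (c j) z)) (SUM j:J. if pr (ph (c j) z) = pr w then ramif w else 0)"
  proof (rule has_order_prod[OF w finite_J])
  fix j assume j: "j : J"
  show "has_order w (%y. s y - s (ph (c j) z)) (if pr (ph (c j) z) = pr w then ramif w else 0)"
  proof (cases "pr (ph (c j) z) = pr w")
  case True
  hence "s (ph (c j) z) = 0" using s(6) act_closed[OF c_carrier[OF j] z] by simp
  thus ?thesis using True s(1) by simp
  next
  case False
  hence "s (ph (c j) z) = 1" using s(4)[OF c_carrier[OF j]] by simp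
  thus ?thesis using False s(5) has_order_0_iff[OF w] regular_diff[OF w sr regular_const[OF w, of 1]] by simp
  qed
  qed
  moreover have "EV y in near w. (PROD j:J. s y - s (ph (c j) z)) = F (pr z, pr y)"
  using eventually_near_points[of w] by eventually_elim (simp add: F(1)[OF z])
  ultimately have "has_order w (%y. F (pr z, pr y)) (mult z w * ramif w)"
  unfolding sumJ by (rule has_order_cong[OF w])
  hence 1: "X.has_order (pr w) (%y. F (pr z, y)) (mult z w)" unfolding iff1 .
  have 2: "X.has_order (pr w) (%y. F (y, y)) (mult z w)" if zw: "z = w" and gH: "g ~: H"
  proof -
  have "(%y. F (y, y)) : reg X (pr w)"
  using X2.sq.regular2_pullback[OF X.curve_axioms morphism_at_id[OF XP(2)] morphism_at_id[OF XP(2)]] Fr zw by simp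
  note iff2 = has_order_X_iff[OF w this]
  have DH: "gm ~: H" if "gm : D" for gm
  proof
  assume gmH: "gm : H"
  show False
  proof (rule DE[OF that])
  fix h k assume hk: "h : H" "k : H" "gm = h *. g *. k"
  have "g = inv h *. gm *. inv k"
  unfolding hk(3) using H_carrier[OF hk(1)] H_carrier[OF hk(2)] g_carrier
  by (metis inv_closed inv_solve_left inv_solve_right m_assoc m_closed)
  thus False using gH H_mult[OF H_mult[OF H_inv[OF hk(1)] gmH] H_inv[OF hk(2)]] by simp
  qed
  qed
  have "has_order w (%y. PROD j:J. s y - s (ph (c j) y)) (SUM j:J. if pr (ph (c j) z) = pr w then ramif w else 0)"
  proof (rule has_order_prod[OF w finite_J])
  fix j assume j: "j : J"
  have cj: "c j : cr G" by (rule c_carrier[OF j])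
  have cw: "ph (c j) w : pts V" by (rule act_closed[OF cj w])
  show "has_order w (%y. s y - s (ph (c j) y)) (if pr (ph (c j) z) = pr w then ramif w else 0)"
  proof (cases "pr (ph (c j) z) = pr w")
  case True
  then obtain h where h: "h : H" "w = ph h (ph (c j) w)" using pr_eq_iff[OF cw w] zw by auto
  let ?sg = "h *. c j"
  have sg: "?sg : stab w"
  unfolding stabilizer_def using h cj H_carrier[OF h(1)] w by (simp add: act_mult)
  \<comment> \<open>This element fixes \<open>w\<close> without lying in \<open>H\<close>, so the
    \<open>ramif w\<close>-th power of its cotangent character is not 1; the difference of
    \<open>s\<close> and its translate therefore keeps the order of \<open>s\<close>.\<close>
  have "?sg ~: H" by (rule DH[OF D_cosetI[OF h(1) j]])
  hence "zeta w ?sg ^ ramif w ~= 1" using zeta_root_of_unity_mem[OF subgroup_H w sg] by (auto simp: ramif_def)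
  from has_order_difference[OF w sg s(1) this]
  have o: "has_order w (%y. s y - s (ph ?sg y)) (ramif w)" .
  have "EV y in near w. s y - s (ph ?sg y) = s y - s (ph (c j) y)"
  using eventually_near_points[of w]
  by eventually_elim (simp add: act_mult[OF H_carrier[OF h(1)] cj] s(2)[OF h(1)] act_closed[OF cj])
  from has_order_cong[OF w o this] show ?thesis using True by simp
  next
  case False
  have "s (ph (c j) w) = 1" using s(4)[OF cj False] zw by simp
  moreover have "(%y. s (ph (c j) y)) : reg V w" using act_regular[OF cj w] s(3)[OF cj] zw by simp
  ultimately show ?thesis using False s(5) has_order_0_iff[OF w] regular_diff[OF w sr] by simp
  qed
  qed
  moreover have "EV y in near w. (PROD j:J. s y - s (ph (c j) y)) = F (pr y, pr y)"
  using eventually_near_points[of w] by eventually_elim (simp add: F(1))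
  ultimately have "has_order w (%y. F (pr y, pr y)) (mult z w * ramif w)"
  unfolding sumJ by (rule has_order_cong[OF w])
  thus ?thesis unfolding iff2 .
  qed
  show thesis by (rule that[OF FI 1 2])
 qed
qed

lemma local_intersection_Gam_fibre:
 assumes z: "z : pts V" and w: "w : pts V"
 shows "local_intersection (product_space X X) (pr z, pr w) Gam ({pr z} \<times> pts X) = mult z w"
proof (rule Gam_order_attained[OF z w])
 fix f assume f: "f : vanishing_ideal (product_space X X) (pr z, pr w) Gam"
  "X.has_order (pr w) (%y. f (pr z, y)) (mult z w)"
 have XP: "pr z : pts X" "pr w : pts X" using z w by (auto simp: points_X)
 show ?thesis by (rule X2.sq.local_intersection_fibre[OF XP Gam_fibre_order[OF z w] f])
qed

lemma local_intersection_Gam_diagonal: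
 assumes z: "z : pts V" and gH: "g ~: H"
 shows "local_intersection (product_space X X) (pr z, pr z) Gam {(x, x) | x. x : pts X} = mult z z"
proof (rule Gam_order_attained[OF z z])
 fix f assume f: "f : vanishing_ideal (product_space X X) (pr z, pr z) Gam"
  "z = z ==> g ~: H ==> X.has_order (pr z) (%y. f (y, y)) (mult z z)"
 have P: "pr z : pts X" using z by (auto simp: points_X)
 have o: "X.has_order (pr z) (%y. f (y, y)) (mult z z)" using f(2) gH by simp
 have van: "(EV q in X2.sq.near2 (pr z) (pr z). q : {(x, x) | x. x : pts X} --> f q = 0) <->
  (EV y in X.near (pr z). f (y, y) = 0)" for f :: "_ => 'k"
 proof
  assume "EV q in X2.sq.near2 (pr z) (pr z). q : {(x, x) | x. x : pts X} --> f q = 0"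
  from X2.sq.near2_pullback[OF X.curve_axioms morphism_at_id[OF P] morphism_at_id[OF P] this] X.eventually_near_points[of "pr z"]
  show "EV y in X.near (pr z). f (y, y) = 0" by eventually_elim simp
 next
  assume "EV y in X.near (pr z). f (y, y) = 0"
  from X2.sq.near2_fstI[OF P P this]
  show "EV q in X2.sq.near2 (pr z) (pr z). q : {(x, x) | x. x : pts X} --> f q = 0"
  by eventually_elim auto
 qed
 show ?thesis
  by (rule X2.sq.local_intersection_graph[OF P morphism_at_id[OF P] van Gam_diagonal_order[OF z] f(1) o])
qed

end

section \<open>Maximality\<close>

context curve_pair
begin

lemma tensors_open:
 assumes PQ: "P : pts V" "Q : pts W" and F: "F : tns P Q"
 shows "EV p in near2 P Q. F : tns (fst p) (snd p)"
proof -
 from F obtain a b and m :: nat where ab: "ALL i<m. a i : reg V P & b i : reg W Q"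
  "F = (%z. SUM i<m. a i (fst z) * b i (snd z))" unfolding tensors_iff by (elim exE conjE)
 have "EV x in V.near P. ALL i:{..<m}. a i : reg V x"
  by (rule eventually_ball_finite) (use ab(1) V.regular_open[OF PQ(1)] in auto)
 note a = near2_fstI[OF PQ this]
 have "EV x in W.near Q. ALL i:{..<m}. b i : reg W x"
  by (rule eventually_ball_finite) (use ab(1) W.regular_open[OF PQ(2)] in auto)
 note b = near2_sndI[OF PQ this]
 from a b show ?thesis
 proof eventually_elim
  case (elim p)
  thus ?case unfolding tensors_iff
  by (intro exI[of _ m] exI[of _ a] exI[of _ b] conjI ab(2)) simp
 qed
qed

lemma regular2_nonzero_near:
 assumes PQ: "P : pts V" "Q : pts W" and F: "F : reg2 P Q"
 shows "EV p in near2 P Q. F p ~= 0 --> eventually (%q. F q ~= 0) (nhdsin zar2 p)"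
proof (rule regular2E[OF PQ F])
 fix A B assume A: "A : tns P Q" and B: "B : tns P Q"
  and FAB: "EV p in near2 P Q. F p = A p / B p" and Bnz: "EV p in near2 P Q. B p ~= 0"
 from near2_points[OF PQ] tensors_open[OF PQ A] near2_near2[OF PQ FAB] near2_near2[OF PQ Bnz] FAB
 show ?thesis
 proof eventually_elim
  case (elim p)
  obtain x y where p: "p = (x, y)" by (cases p)
  have xy: "x : pts V" "y : pts W" using elim(1) p by auto
  show ?case
  proof
  assume "F p ~= 0"
  hence "A (x, y) ~= 0" using elim(5) p by auto
  moreover have "A : tns x y" using elim(2) p by simp
  ultimately have nz: "EV q in near2 x y. A q ~= 0" by (intro near2_nonzero[OF xy])
  show "eventually (%q. F q ~= 0) (nhdsin zar2 p)"
  using nz elim(3,4) unfolding p by eventually_elim simp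
  qed
 qed
qed

end

context algebraic_curve
begin

text \<open>One multiplier \<open>th\<close> serves all \<open>f i\<close>, so that an expression
  linear in the whole family changes by a common factor.\<close>

lemma semilocal_family:
 fixes m :: nat
 assumes P: "P : pts V" and T: "finite T" "T <= pts V" "P ~: T" and f: "ALL i<m. f i : reg V P"
 shows "EX c th. th : reg V P & th P = 1 & (ALL Q:T. th : reg V Q & th Q = 0) &
  (ALL i<m. (ALL Q:insert P T. c i : reg V Q) & finite {x : pts V. c i x ~= th x * f i x} &
  (ALL Q:T. c i Q = 0) & c i P = f i P)"
 using f
proof (induction m)
 case 0
 from separation[OF P T] show ?case by blast
next
 case (Suc m)
 have "EX c th. th : reg V P & th P = 1 & (ALL Q:T. th : reg V Q & th Q = 0) &
  (ALL i<m. (ALL Q:insert P T. c i : reg V Q) & finite {x : pts V. c i x ~= th x * f i x} &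
  (ALL Q:T. c i Q = 0) & c i P = f i P)"
  by (rule Suc.IH) (use Suc.prems in simp)
 then obtain c th where c: "th : reg V P" "th P = 1" "ALL Q:T. th : reg V Q & th Q = 0"
  "ALL i<m. (ALL Q:insert P T. c i : reg V Q) & finite {x : pts V. c i x ~= th x * f i x} &
  (ALL Q:T. c i Q = 0) & c i P = f i P" by (elim exE conjE)
 have fm: "f m : reg V P" using Suc.prems by simp
 from semilocal[OF P fm T] obtain e et where e: "e : reg V P" "et : reg V P" "et P = 1"
  "EV x in near P. e x = et x * f m x" "ALL Q:T. e : reg V Q & e Q = 0 & et : reg V Q & et Q = 0"
  by (elim exE conjE)
 define c' where "c' = (%i x. if i = m then e x * th x else c i x * et x)"
 have TV: "!!Q. Q : T ==> Q : pts V" using T by auto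
 have "(ALL Q:insert P T. c' i : reg V Q) & finite {x : pts V. c' i x ~= th x * et x * f i x} &
  (ALL Q:T. c' i Q = 0) & c' i P = f i P" if i: "i < Suc m" for i
 proof (cases "i = m")
  case True
  have c': "c' i = (%x. e x * th x)" using True by (simp add: c'_def)
  have "finite {x : pts V. c' i x ~= th x * et x * f i x}"
  by (rule rev_finite_subset[OF eventually_near_finite[OF P e(4)]]) (use True in "auto simp: c'_def")
  moreover have "e P = et P * f m P" using e(4) P by (simp add: eventually_near_iff)
  ultimately show ?thesis unfolding c' using True c e TV P by (auto intro!: regular_mult)
 next
  case False
  hence im: "i < m" using i by simp
  have c': "c' i = (%x. c i x * et x)" using False by (simp add: c'_def)
  have fin: "finite {x : pts V. c i x ~= th x * f i x}" using c(4) im by blast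
  have "finite {x : pts V. c' i x ~= th x * et x * f i x}"
  by (rule rev_finite_subset[OF fin]) (auto simp: c')
  moreover have "ALL Q:insert P T. c i : reg V Q" "ALL Q:T. c i Q = 0" "c i P = f i P" using c(4) im by blast+
  ultimately show ?thesis unfolding c' using c e TV P by (auto intro!: regular_mult)
 qed
 moreover have "(%x. th x * et x) : reg V P" "ALL Q:T. (%x. th x * et x) : reg V Q"
  using c e TV P by (auto intro!: regular_mult)
 ultimately show ?case using c(2,3) e(3)
  by (intro exI[of _ c'] exI[of _ "%x. th x * et x"]) simp
qed

text \<open>Near the point the differences of the chart coordinates are multiples of the difference
  of \<open>t\<close>, and the coordinates separate points off a finite set.\<close>

lemma parameter_separates:
 assumes P: "P : pts V" and t: "has_order P t 1"
 shows "EV p in VV.near2 P P. t (snd p) = t (fst p) --> snd p = fst p"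
proof -
 from chart[OF P] obtain Xi E where Xi: "finite Xi" "Xi <= reg V P" and E: "finite E" "P ~: E"
  "ALL x:pts V - E. ALL y:pts V - E. (ALL xi:Xi. xi x = xi y) --> x = y" by (elim exE conjE)
 have "EV p in VV.near2 P P. t (snd p) = t (fst p) --> xi (snd p) = xi (fst p)" if xi: "xi : Xi" for xi
 proof -
  have "xi : reg V P" using xi Xi(2) by auto
  from difference_divisible[OF P t this] obtain bt where
  "EV p in VV.near2 P P. xi (snd p) - xi (fst p) = (t (snd p) - t (fst p)) * bt p" ..
  thus ?thesis by eventually_elim auto
 qed
 hence all: "EV p in VV.near2 P P. ALL xi:Xi. t (snd p) = t (fst p) --> xi (snd p) = xi (fst p)"
  by (intro eventually_ball_finite Xi(1)) blast
 have nE: "EV x in near P. x ~: E" using near_avoid[OF P E(1,2)] by eventually_elim simp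
 show ?thesis
  using all VV.near2_fstI[OF P P nE] VV.near2_sndI[OF P P nE] VV.near2_points[OF P P]
 proof eventually_elim
  case (elim p)
  hence "fst p : pts V - E" "snd p : pts V - E" by auto
  thus ?case using elim(1) E(3) by simp
 qed
qed

end

section \<open>Averaging over the group and openness of the quotient map on products\<close>

context curve_quotient
begin

lemma sum_act:
 assumes k: "k : H" and x: "x : pts V"
 shows "(SUM h:H. f (ph h (ph k x))) = (SUM h:H. f (ph h x))"
proof -
 have "(SUM h:H. f (ph h (ph k x))) = (SUM h:H. f (ph (h *. k) x))"
  by (rule sum.cong) (simp_all add: act_mult H_carrier k x)
 also have "... = (SUM h:H. f (ph h x))"
  by (rule sum.reindex_bij_witness[of _ "%h. h *. inv k" "%h. h *. k"])
  (use H_carrier k H_mult H_inv in "auto simp: m_assoc")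
 finally show ?thesis .
qed

text \<open>An open set around a point is cut out by a function that can be arranged to vanish at the other points of the
 orbit, so that averaging it over the group does not destroy its value at the point.\<close>

lemma orbit_family:
 fixes m :: nat
 assumes z: "z : pts V" and a: "ALL i<m. a i : reg V z" and E: "finite E" "z ~: E"
 obtains c D where "!!i h x. i < m ==> h : H ==> x : pts V ==> c i (ph h x) = c i x"
  "!!i. i < m ==> c i : reg V z" "!!i. i < m ==> c i z = of_nat (ramif z) * a i z"
  "finite D" "z ~: \<Union> D" "D <= pts X"
  "!!x i. x : pts V ==> pr x ~: D ==> EX th. (ALL i<m. c i x = (SUM h:H. th h * a i (ph h x))) & (ALL h:H. ph h x : E --> th h = 0)"
proof -
 let ?T = "pr z - {z}"
 have T: "finite ?T" "?T <= pts V" "z ~: ?T" using finite_pr pr_subset[OF z] by auto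
 from semilocal_family[OF z T a] obtain c th where c: "th : reg V z" "th z = 1"
  "ALL Q:?T. th : reg V Q & th Q = 0"
  "ALL i<m. (ALL Q:insert z ?T. c i : reg V Q) & finite {x : pts V. c i x ~= th x * a i x} &
  (ALL Q:?T. c i Q = 0) & c i z = a i z" by (elim exE conjE)
 have orb: "insert z ?T = pr z" using pr_self[OF z] by auto
 define C where "C = (%i x. SUM h:H. c i (ph h x))"
 define B where "B = (E Int pts V) Un (UN i<m. {x : pts V. c i x ~= th x * a i x})"
 have "finite {x : pts V. c i x ~= th x * a i x}" if "i < m" for i using c(4) that by blast
 hence fB: "finite B" unfolding B_def using E by simp
 define D where "D = pr ` B - {pr z}"
 have BV: "B <= pts V" by (auto simp: B_def)
 show thesis
 proof (rule that[of C D])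
  show "C i (ph h x) = C i x" if "h : H" "x : pts V" for i h x
  unfolding C_def by (rule sum_act[OF that])
  show "C i : reg V z" if "i < m" for i
  unfolding C_def
  proof (rule regular_sum[OF z])
  fix h assume h: "h : H"
  have "ph h z : insert z ?T" using h by (auto simp: pr_eq)
  hence "c i : reg V (ph h z)" using c(4) that by blast
  thus "(%x. c i (ph h x)) : reg V z" by (rule act_regular[OF H_carrier[OF h] z])
  qed
  show "C i z = of_nat (ramif z) * a i z" if i: "i < m" for i
  proof -
  have "C i z = (SUM h:H. if ph h z = z then a i z else 0)"
  unfolding C_def
  proof (rule sum.cong[OF refl])
  fix h assume h: "h : H"
  have "ph h z : pr z" using h by (auto simp: pr_eq)
  thus "c i (ph h z) = (if ph h z = z then a i z else 0)" using c(4) i by auto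
  qed
  also have "... = of_nat (card {h : H. ph h z = z}) * a i z"
  using finite_H by (simp add: sum.If_cases Int_def)
  also have "card {h : H. ph h z = z} = ramif z" by (rule card_hits[OF z pr_self[OF z]])
  finally show ?thesis .
  qed
  show "finite D" unfolding D_def using fB by simp
  show "D <= pts X" unfolding D_def points_X using BV by auto
  show "z ~: \<Union> D"
  proof
  assume "z : \<Union> D"
  then obtain x where x: "x : B" "pr x ~= pr z" "z : pr x" by (auto simp: D_def)
  thus False using pr_mem_eq[of x z] BV by auto
  qed
  fix x assume x: "x : pts V" "pr x ~: D"
  \<comment> \<open>At the other points of the orbit of \<open>z\<close> the values of
    \<open>a i\<close> are arbitrary while \<open>c i\<close> is 0, so the weight is set to 0
    there.\<close>
  define et where "et = (%h. if ph h x : ?T then 0 else th (ph h x))"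
  show "EX th. (ALL i<m. C i x = (SUM h:H. th h * a i (ph h x))) & (ALL h:H. ph h x : E --> th h = 0)"
  proof (intro exI[of _ et] conjI allI impI ballI)
  have hx: "ph h x : pts V" "pr (ph h x) = pr x" if "h : H" for h
  using act_closed[OF H_carrier[OF that] x(1)] pr_act[OF that x(1)] by auto
  have case1: "ph h x : insert z ?T" if h: "h : H" and "ph h x : B" for h
  proof -
  have "pr (ph h x) = pr z" using that(2) x(2) hx[OF h] unfolding D_def by (metis DiffI imageI singletonD)
  thus ?thesis using pr_self[OF hx(1)[OF h]] orb by simp
  qed
  show "C i x = (SUM h:H. et h * a i (ph h x))" if i: "i < m" for i
  unfolding C_def
  proof (rule sum.cong[OF refl])
  fix h assume h: "h : H"
  show "c i (ph h x) = et h * a i (ph h x)"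
  proof (cases "ph h x : B")
  case True
  hence "ph h x : insert z ?T" by (rule case1[OF h])
  thus ?thesis using c(2,4) i by (auto simp: et_def)
  next
  case False
  hence e: "c i (ph h x) = th (ph h x) * a i (ph h x)" using i hx(1)[OF h] by (auto simp: B_def)
  show ?thesis
  proof (cases "ph h x : ?T")
  case True
  thus ?thesis using c(4) i by (auto simp: et_def)
  qed (use e in "auto simp: et_def")
  qed
  qed
  show "et h = 0" if h: "h : H" and "ph h x : E" for h
  proof -
  have "ph h x : B" using that(2) hx(1)[OF h] by (auto simp: B_def)
  hence "ph h x : insert z ?T" by (rule case1[OF h])
  moreover have "ph h x ~= z" using that(2) E(2) by auto
  ultimately show ?thesis by (auto simp: et_def)
  qed
  qed
 qed
qed

text \<open>The tensor \<open>F\<close> cutting out the neighbourhood is averaged in both variables.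
  The average \<open>K\<close> is invariant, its value at \<open>(z, w)\<close> is a positive
  integer multiple of that of \<open>F\<close>, and wherever it is nonzero some translate
  \<open>(ph h x, ph k y)\<close> lies in the given neighbourhood.\<close>

lemma pr_open:
 assumes z: "z : pts V" and w: "w : pts V"
  and R: "EV p in VV.near2 z w. R (pr (fst p), pr (snd p))"
 shows "EV p in X2.sq.near2 (pr z) (pr w). R p"
proof -
 have XP: "pr z : pts X" "pr w : pts X" using z w by (auto simp: points_X)
 show ?thesis
 proof (rule VV.nbhd2E[OF R[unfolded VV.eventually_near2[OF z w]]])
  fix F E1 E2
  assume F: "F : tensors V V z w" "F (z, w) ~= 0" "finite E1" "finite E2" "z ~: E1" "w ~: E2"
  "!!x y. x : pts V ==> x ~: E1 ==> y : pts V ==> y ~: E2 ==> F (x, y) ~= 0 ==> R (pr (fst (x, y)), pr (snd (x, y)))"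
  from F(1) obtain a b and m :: nat where ab: "ALL i<m. a i : reg V z & b i : reg V w"
  "F = (%z. SUM i<m. a i (fst z) * b i (snd z))" unfolding tensors_iff by (elim exE conjE)
  show ?thesis
  proof (rule orbit_family[where m = m and a = a, OF z _ F(3,5)])
  show "ALL i<m. a i : reg V z" using ab(1) by simp
  fix c D
  assume c: "!!i h x. i < m ==> h : H ==> x : pts V ==> c i (ph h x) = c i x"
  "!!i. i < m ==> c i : reg V z" "!!i. i < m ==> c i z = of_nat (ramif z) * a i z"
  "finite D" "z ~: \<Union> D" "D <= pts X"
  "!!x i. x : pts V ==> pr x ~: D ==> EX th. (ALL i<m. c i x = (SUM h:H. th h * a i (ph h x))) & (ALL h:H. ph h x : E1 --> th h = 0)"
  show ?thesis
  proof (rule orbit_family[where m = m and a = b, OF w _ F(4,6)])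
  show "ALL i<m. b i : reg V w" using ab(1) by simp
  fix e D'
  assume e: "!!i h x. i < m ==> h : H ==> x : pts V ==> e i (ph h x) = e i x"
  "!!i. i < m ==> e i : reg V w" "!!i. i < m ==> e i w = of_nat (ramif w) * b i w"
  "finite D'" "w ~: \<Union> D'" "D' <= pts X"
  "!!x i. x : pts V ==> pr x ~: D' ==> EX th. (ALL i<m. e i x = (SUM h:H. th h * b i (ph h x))) & (ALL h:H. ph h x : E2 --> th h = 0)"
  define K where "K = (%p. SUM i<m. desc (c i) (fst p) * desc (e i) (snd p))"
  have rc: "desc (c i) : reg X (pr z)" if "i < m" for i
  by (rule desc_regular[where F = "c i", OF z c(1)[OF that] c(2)[OF that]])
  have re: "desc (e i) : reg X (pr w)" if "i < m" for i
  by (rule desc_regular[where F = "e i", OF w e(1)[OF that] e(2)[OF that]])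
  have Kt: "K : tensors X X (pr z) (pr w)"
  unfolding tensors_iff K_def
  by (rule exI[of _ m], rule exI[of _ "%i. desc (c i)"], rule exI[of _ "%i. desc (e i)"])
  (simp add: rc re)
  have val: "K (pr x, pr y) = (SUM i<m. c i x * e i y)" if "x : pts V" "y : pts V" for x y
  proof -
  have "desc (c i) (pr x) = c i x" if i: "i < m" for i
  by (rule desc_pr[where F = "c i", OF \<open>x : points V\<close> c(1)[OF i]])
  moreover have "desc (e i) (pr y) = e i y" if i: "i < m" for i
  by (rule desc_pr[where F = "e i", OF \<open>y : points V\<close> e(1)[OF i]])
  ultimately show ?thesis unfolding K_def by simp
  qed
  have "K (pr z, pr w) = of_nat (ramif z) * of_nat (ramif w) * F (z, w)"
  unfolding val[OF z w] ab(2) by (simp add: c(3) e(3) sum_distrib_left mult_ac)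
  hence K0: "K (pr z, pr w) ~= 0" using F(2) ramif_pos[OF z] ramif_pos[OF w] by simp
  have zD: "pr z ~: D" "pr w ~: D'" using c(5) e(5) pr_self z w by auto
  show ?thesis
  unfolding X2.sq.eventually_near2[OF XP]
  proof (rule X2.sq.nbhd2I[OF Kt K0 c(4) e(4) zD])
  fix P Q assume PQ: "P : pts X" "P ~: D" "Q : pts X" "Q ~: D'" "K (P, Q) ~= 0"
  then obtain x y where xy: "x : pts V" "P = pr x" "y : pts V" "Q = pr y" by (auto simp: points_X)
  from c(7)[OF xy(1)] PQ(2) xy(2) obtain th where th: "ALL i<m. c i x = (SUM h:H. th h * a i (ph h x))"
  "ALL h:H. ph h x : E1 --> th h = 0" by auto
  from e(7)[OF xy(3)] PQ(4) xy(4) obtain et where et: "ALL i<m. e i y = (SUM h:H. et h * b i (ph h y))"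
  "ALL h:H. ph h y : E2 --> et h = 0" by auto
  have "K (P, Q) = (SUM i<m. SUM h:H. SUM k:H. th h * et k * (a i (ph h x) * b i (ph k y)))"
  unfolding xy val[OF xy(1,3)]
  proof (rule sum.cong[OF refl])
  fix i assume "i : {..<m}"
  hence "c i x * e i y = (SUM h:H. th h * a i (ph h x)) * (SUM k:H. et k * b i (ph k y))"
  using th(1) et(1) by simp
  also have "... = (SUM h:H. SUM k:H. th h * et k * (a i (ph h x) * b i (ph k y)))"
  unfolding sum_product by (intro sum.cong refl) (simp add: mult_ac)
  finally show "c i x * e i y = (SUM h:H. SUM k:H. th h * et k * (a i (ph h x) * b i (ph k y)))" .
  qed
  also have "... = (SUM h:H. SUM i<m. SUM k:H. th h * et k * (a i (ph h x) * b i (ph k y)))" by (rule sum.swap)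
  also have "... = (SUM h:H. SUM k:H. SUM i<m. th h * et k * (a i (ph h x) * b i (ph k y)))"
  by (rule sum.cong[OF refl], rule sum.swap)
  also have "... = (SUM h:H. SUM k:H. th h * et k * F (ph h x, ph k y))"
  by (simp add: ab(2) sum_distrib_left)
  finally have "(SUM h:H. SUM k:H. th h * et k * F (ph h x, ph k y)) ~= 0" using PQ(5) by simp
  then obtain h where h: "h : H" "(SUM k:H. th h * et k * F (ph h x, ph k y)) ~= 0"
  by (rule sum.not_neutral_contains_not_neutral)
  from h(2) obtain k where k: "k : H" "th h * et k * F (ph h x, ph k y) ~= 0"
  by (rule sum.not_neutral_contains_not_neutral)
  have "ph h x : pts V" "ph k y : pts V" using act_closed H_carrier h k xy by auto
  moreover have "ph h x ~: E1" "ph k y ~: E2" using th(2) et(2) h k by auto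
  ultimately have "R (pr (fst (ph h x, ph k y)), pr (snd (ph h x, ph k y)))" using k(2) by (intro F(7)) auto
  thus "R (P, Q)" using pr_act[OF h(1) xy(1)] pr_act[OF k(1) xy(3)] xy by simp
  qed
  qed
  qed
 qed
qed

end

section \<open>The curve of a double coset as a maximal irreducible closed set\<close>

context double_coset_curve
begin

lemma finite_pr_preimage:
 assumes "finite E"
 shows "finite {z : pts V. pr z : E}"
proof (rule rev_finite_subset)
 show "finite (\<Union> (E Int pts X))" using assms finite_pr by (auto simp: points_X)
 show "{z : pts V. pr z : E} <= \<Union> (E Int pts X)" using pr_self by (auto simp: points_X)
qed

text \<open>On the fibre over \<open>z\<close> the equation of the graph restricts to
  \<open>t\<close>, of order 1; each division lowers the order on that fibre, so it can be repeated
  only finitely often.\<close>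

lemma factor_off_graph:
 assumes z: "z : pts V" and F: "F : VV.reg2 z (ph g z)" and t: "has_order (ph g z) t 1"
  and n: "has_order (ph g z) (%y. F (z, y)) n"
 shows "EX m F'. F' : VV.reg2 z (ph g z) & ~ (EV x in near z. F' (x, ph g x) = 0) &
  (EV p in VV.near2 z (ph g z). F p = (t (snd p) - t (ph g (fst p))) ^ m * F' p)"
 using F n
proof (induction n arbitrary: F rule: less_induct)
 case (less n)
 let ?w = "ph g z"
 have w: "?w : pts V" by (rule act_closed[OF g_carrier z])
 show ?case
 proof (cases "EV x in near z. F (x, ph g x) = 0")
  case False
  thus ?thesis using less.prems by (intro exI[of _ "0 :: nat"] exI[of _ F]) simp
 next
  case True
  from graph_divide[OF z g_carrier t less.prems(1) True] obtain F1 where F1: "F1 : VV.reg2 z ?w"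
  "EV p in VV.near2 z ?w. F p = (t (snd p) - t (ph g (fst p))) * F1 p" ..
  note m = curve_axioms morphism_at_const[OF w z] morphism_at_id[OF w]
  have "EV y in near ?w. F (z, y) = (t y - t ?w) * F1 (z, y)" using VV.near2_pullback[OF m F1(2)] by simp
  moreover have "t ?w = 0" using order_ge_1_iff[OF w has_order_regular[OF t]] has_order_imp_ge[OF t] by simp
  ultimately have ev: "EV y in near ?w. F (z, y) = t y * F1 (z, y)" by simp
  have r: "(%y. F1 (z, y)) : reg V ?w" by (rule VV.regular2_pullback[OF m F1(1)])
  have "~ (EV y in near ?w. F1 (z, y) = 0)"
  proof
  assume "EV y in near ?w. F1 (z, y) = 0"
  with ev have "EV y in near ?w. F (z, y) = 0" by eventually_elim simp
  thus False using has_order_not_zero[OF w less.prems(2)] by simp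
  qed
  from has_order_ex[OF w r this] obtain k where k: "has_order ?w (%y. F1 (z, y)) k" .
  have "has_order ?w (%y. t y * F1 (z, y)) (1 + k)" by (rule has_order_mult[OF w t k])
  moreover have "EV y in near ?w. t y * F1 (z, y) = F (z, y)" using ev by eventually_elim simp
  ultimately have "has_order ?w (%y. F (z, y)) (1 + k)" by (rule has_order_cong[OF w])
  from has_order_unique[OF w less.prems(2) this] have "k < n" by simp
  from less.IH[OF this F1(1) k] obtain l F' where F': "F' : VV.reg2 z ?w" "~ (EV x in near z. F' (x, ph g x) = 0)"
  "EV p in VV.near2 z ?w. F1 p = (t (snd p) - t (ph g (fst p))) ^ l * F' p" by (elim exE conjE)
  have "EV p in VV.near2 z ?w. F p = (t (snd p) - t (ph g (fst p))) ^ Suc l * F' p"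
  using F1(2) F'(3) by eventually_elim simp
  thus ?thesis using F' by (intro exI[of _ "Suc l"] exI[of _ F']) simp
 qed
qed

text \<open>A function that vanishes on \<open>B\<close> but not on a fibre is freed of all factors
  belonging to the graph of \<open>g\<close>. The remaining cofactor is nonzero at some point of the
  graph, and near such a point vanishing of the function means lying on the graph.\<close>

lemma closed_near_Gam:
 assumes B: "closedin (product_zariski X X) B" "B ~= pts X \<times> pts X" "Gam <= B"
 obtains x where "x : pts V" "EV p in VV.near2 x (ph g x). (pr (fst p), pr (snd p)) : B --> (pr (fst p), pr (snd p)) : Gam"
proof (rule X2.sq.proper_closed_function[OF B(1,2)])
 fix E1 E2 assume E: "finite E1" "finite E2" "!!x y. (x, y) : B ==> x ~: E1 ==> y ~: E2 ==>
  EX f:vanishing_ideal (product_space X X) (x, y) B. ~ (EV y' in X.near y. f (x, y') = 0)"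
 have "finite ({z : pts V. pr z : E1} Un (%z. ph (inv g) z) ` {z : pts V. pr z : E2})"
  using finite_pr_preimage E by simp
 from Diff_infinite_finite[OF this infinite_points]
 have "pts V - ({z : pts V. pr z : E1} Un (%z. ph (inv g) z) ` {z : pts V. pr z : E2}) ~= {}"
  by (metis finite.emptyI)
 then obtain z where z: "z : pts V" "pr z ~: E1"
  "z ~: (%z. ph (inv g) z) ` {z : pts V. pr z : E2}" by blast
 let ?w = "ph g z"
 have w: "?w : pts V" by (rule act_closed[OF g_carrier z(1)])
 have "pr ?w ~: E2"
 proof
  assume "pr ?w : E2"
  hence "ph (inv g) ?w : (%z. ph (inv g) z) ` {z : pts V. pr z : E2}" using w by blast
  thus False using z(3) act_inv[OF g_carrier z(1)] by simp
 qed
 moreover have "(pr z, pr ?w) : B" using mem_GamI[OF z(1) g_D] B(3) by auto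
 ultimately obtain f where f: "f : vanishing_ideal (product_space X X) (pr z, pr ?w) B"
  "~ (EV y' in X.near (pr ?w). f (pr z, y') = 0)" using E(3) z(2) by blast
 have f': "f : X2.sq.reg2 (pr z) (pr ?w)" "EV p in X2.sq.near2 (pr z) (pr ?w). p : B --> f p = 0"
  using f(1) unfolding X2.sq.mem_vanishing_ideal by blast+
 define F where "F = (%p. f (pr (fst p), pr (snd p)))"
 note mm = curve_axioms curve_axioms pr_morphism[OF z(1)] pr_morphism[OF w]
 have Fr: "F : VV.reg2 z ?w" unfolding F_def by (rule X2.sq.regular2_pullback2[OF mm f'(1)])
 have F0: "EV p in VV.near2 z ?w. (pr (fst p), pr (snd p)) : B --> F p = 0"
  unfolding F_def by (rule X2.sq.near2_pullback2[OF mm f'(2)])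
 have "(%y. F (z, y)) : reg V ?w"
  by (rule VV.regular2_pullback[OF curve_axioms morphism_at_const[OF w z(1)] morphism_at_id[OF w] Fr])
 moreover have "~ (EV y in near ?w. F (z, y) = 0)"
  using f(2) eventually_X[OF w, of "%y. f (pr z, y) = 0"] by (simp add: F_def)
 ultimately obtain n where n: "has_order ?w (%y. F (z, y)) n" by (rule has_order_ex[OF w])
 obtain t where t: "has_order ?w t 1" using has_order_uniformizer[OF w] by blast
 from factor_off_graph[OF z(1) Fr t n] obtain m F' where F': "F' : VV.reg2 z ?w"
  "~ (EV x in near z. F' (x, ph g x) = 0)"
  "EV p in VV.near2 z ?w. F p = (t (snd p) - t (ph g (fst p))) ^ m * F' p" by (elim exE conjE)
 have "EV p in VV.near2 z ?w. t (snd p) = t (ph g (fst p)) --> snd p = ph g (fst p)"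
  using VV.near2_pullback2[OF curve_axioms curve_axioms act_morphism[OF g_carrier z(1)] morphism_at_id[OF w]
  parameter_separates[OF w t]] by simp
 with F0 F'(3) VV.near2_points[OF z(1) w] have "EV p in VV.near2 z ?w. F' p ~= 0 -->
  (pr (fst p), pr (snd p)) : B --> (pr (fst p), pr (snd p)) : Gam"
 proof eventually_elim
  case (elim p)
  have "(pr (fst p), pr (ph g (fst p))) : Gam" using elim(3) mem_GamI[OF _ g_D] by auto
  thus ?case using elim(1,2,4) by auto
 qed
 from VV.near2_pullback[OF curve_axioms morphism_at_id[OF z(1)] act_morphism[OF g_carrier z(1)] VV.near2_near2[OF z(1) w this]]
 have 1: "EV x in near z. EV p in VV.near2 x (ph g x). F' p ~= 0 -->
  (pr (fst p), pr (snd p)) : B --> (pr (fst p), pr (snd p)) : Gam" .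
 from VV.near2_pullback[OF curve_axioms morphism_at_id[OF z(1)] act_morphism[OF g_carrier z(1)] VV.regular2_nonzero_near[OF z(1) w F'(1)]]
 have 2: "EV x in near z. F' (x, ph g x) ~= 0 --> (EV p in VV.near2 x (ph g x). F' p ~= 0)" .
 show thesis
 proof (rule ccontr)
  assume no: "~ thesis"
  have "EV x in near z. F' (x, ph g x) = 0"
  using 1 2 eventually_near_points[of z]
  proof eventually_elim
  case (elim x)
  show ?case
  proof (rule ccontr)
  assume "F' (x, ph g x) ~= 0"
  hence "EV p in VV.near2 x (ph g x). F' p ~= 0" using elim(2) by simp
  with elim(1) have "EV p in VV.near2 x (ph g x). (pr (fst p), pr (snd p)) : B --> (pr (fst p), pr (snd p)) : Gam"
  by eventually_elim blast
  thus False using no that[OF elim(3)] by blast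
  qed
  qed
  thus False using F'(2) by simp
 qed
qed

text \<open>Openness of the quotient map gives an open \<open>U\<close> that meets
  \<open>Gam\<close> and inside which \<open>B\<close> is contained in \<open>Gam\<close>. The
  closed set \<open>Gam\<close> and the complement of \<open>U\<close> cover the irreducible
  \<open>B\<close>, and the complement does not contain it.\<close>

lemma Gam_maximal:
 assumes B: "irreducible_closed (product_zariski X X) B" "B ~= pts X \<times> pts X" "Gam <= B"
 shows "B = Gam"
proof -
 have cB: "closedin (product_zariski X X) B" using B(1) by (simp add: irreducible_closed_def)
 show ?thesis
 proof (rule closed_near_Gam[OF cB B(2,3)])
  fix x assume x: "x : pts V"
  "EV p in VV.near2 x (ph g x). (pr (fst p), pr (snd p)) : B --> (pr (fst p), pr (snd p)) : Gam"
  have gx: "ph g x : pts V" by (rule act_closed[OF g_carrier x(1)])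
  have XP: "pr x : pts X" "pr (ph g x) : pts X" using x(1) gx by (auto simp: points_X)
  from pr_open[OF x(1) gx, of "%p. p : B --> p : Gam", OF x(2)]
  obtain U where U: "openin (product_zariski X X) U" "(pr x, pr (ph g x)) : U" "ALL p:U. p : B --> p : Gam"
  using XP by (auto simp: eventually_nhdsin X2.sq.topspace_product)
  have "closedin (product_zariski X X) (pts X \<times> pts X - U)"
  using openin_closedin_eq[of "product_zariski X X" U] U(1) by (simp add: X2.sq.topspace_product)
  moreover have "B <= Gam Un (pts X \<times> pts X - U)"
  using closedin_subset[OF cB] U(3) by (auto simp: X2.sq.topspace_product)
  ultimately have "B <= Gam | B <= pts X \<times> pts X - U"
  using irreducible_closedD[OF B(1) closedin_Gam] by simp
  moreover have "(pr x, pr (ph g x)) : B" using B(3) mem_GamI[OF x(1) g_D] by auto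
  ultimately show ?thesis using U(2) B(3) by auto
 qed
qed

end

section \<open>The Kanev correspondence\<close>

context curve_action
begin

lemma finite_fixed_points:
 assumes sg: "sg : cr G" "sg ~= \<one>"
 shows "finite {x : pts V. ph sg x = x}"
proof (cases "{x : pts V. ph sg x = x} = {}")
 case False
 then obtain z where z: "z : pts V" "ph sg z = z" by auto
 have e: "ph \<one> z = ph sg z" using z by (simp add: act_one)
 have "has_order (ph \<one> z) (unif z) 1" using has_order_uniformizer[OF z(1)] by (simp add: act_one z(1))
 from parameter_difference_nonzero[OF z(1) one_closed sg(1) sg(2)[symmetric] e this]
 show ?thesis by (rule rev_finite_subset) (auto simp: act_one)
qed (simp only: finite.emptyI)

lemma free_point_ex:
 obtains z where "z : pts V" "!!sg. sg : cr G ==> ph sg z = z ==> sg = \<one>"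
proof -
 have "finite (UN sg:cr G - {\<one>}. {x : pts V. ph sg x = x})"
  using finite_G finite_fixed_points by simp
 from Diff_infinite_finite[OF this infinite_points]
 have "pts V - (UN sg:cr G - {\<one>}. {x : pts V. ph sg x = x}) ~= {}" by (metis finite.emptyI)
 then obtain z where "z : pts V" "z ~: (UN sg:cr G - {\<one>}. {x : pts V. ph sg x = x})" by blast
 thus thesis by (intro that) auto
qed

end

context curve_quotient
begin

lemma card_pr:
 assumes z: "z : pts V"
 shows "card (pr z) * ramif z = card H"
proof -
 have "card H = card (UN w:pr z. {h : H. ph h z = w})"
  by (rule arg_cong[of _ _ card]) (auto simp: pr_eq)
 also have "... = (SUM w:pr z. card {h : H. ph h z = w})"
  by (rule card_UN_disjoint) (use finite_pr finite_H in auto)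
 also have "... = (SUM w:pr z. ramif z)" by (rule sum.cong) (simp_all add: card_hits[OF z])
 finally show ?thesis by simp
qed

end

section \<open>The curve as a prime divisor and its intersection with the diagonal\<close>

context double_coset_curve
begin

lemma D_not_H:
 assumes gH: "g ~: H" and gm: "gm : D" shows "gm ~: H"
proof
 assume gmH: "gm : H"
 show False
 proof (rule DE[OF gm])
  fix h k assume hk: "h : H" "k : H" "gm = h *. g *. k"
  note c = H_carrier[OF hk(1)] H_carrier[OF hk(2)] g_carrier
  have "g = inv h *. gm *. inv k" unfolding hk(3) using c by (simp add: m_assoc inv_solve_left)
  thus False using gH H_mult[OF H_mult[OF H_inv[OF hk(1)] gmH] H_inv[OF hk(2)]] by simp
 qed
qed

lemma D_eq:
 assumes gm: "gm : D" shows "D = {h *. gm *. k | h k. h : H & k : H}"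
proof (rule DE[OF gm])
 fix a b assume ab: "a : H" "b : H" "gm = a *. g *. b"
 note c = H_carrier[OF ab(1)] H_carrier[OF ab(2)] g_carrier
 show ?thesis
 proof
  show "{h *. gm *. k | h k. h : H & k : H} <= D" using D_left D_right gm by auto
  show "D <= {h *. gm *. k | h k. h : H & k : H}"
  proof
  fix x assume "x : D"
  thus "x : {h *. gm *. k | h k. h : H & k : H}"
  proof (rule DE)
  fix h k assume hk: "h : H" "k : H" "x = h *. g *. k"
  have kc: "h : cr G" "k : cr G" using H_carrier hk by auto
  have "inv a *. (a *. y) = y" if "y : cr G" for y using c that by (simp add: m_assoc[symmetric])
  moreover have "b *. (inv b *. k) = k" using c kc by (simp add: m_assoc[symmetric])
  ultimately have "x = (h *. inv a) *. gm *. (inv b *. k)"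
  unfolding hk(3) ab(3) using c kc by (simp add: m_assoc)
  thus ?thesis using H_mult[OF hk(1) H_inv[OF ab(1)]] H_mult[OF H_inv[OF ab(2)] hk(2)] by blast
  qed
  qed
 qed
qed

lemma prime_divisor_Gam: "prime_divisor (product_space X X) Gam"
 unfolding X2.prime_divisor_iff
proof (intro conjI)
 obtain z where z: "z : pts V" using infinite_points by (metis finite.emptyI ex_in_conv)
 have "Gam ~= pts X \<times> pts X"
 proof
  assume eq: "Gam = pts X \<times> pts X"
  have "pts X <= (%gm. pr (ph gm z)) ` D"
  proof
  fix y assume "y : pts X"
  then obtain w where w: "w : pts V" "y = pr w" by (auto simp: points_X)
  hence "(pr z, pr w) : Gam" using eq z by (auto simp: points_X)
  thus "y : (%gm. pr (ph gm z)) ` D" using w by (elim mem_GamE[OF z w(1)]) auto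
  qed
  thus False using finite_D X.infinite_points finite_subset by blast
 qed
 thus "Gam \<subset> pts X \<times> pts X" using Gam_subset by blast
 show "irreducible_closed (product_zariski X X) Gam" by (rule irreducible_Gam)
 show "~ (EX B. irreducible_closed (product_zariski X X) B & Gam \<subset> B & B \<subset> pts X \<times> pts X)"
  using Gam_maximal by blast
qed

lemma Gam_not_fibre: "Gam ~= {x} \<times> pts X"
proof
 assume eq: "Gam = {x} \<times> pts X"
 have "pts X <= {x}"
 proof
  fix y assume "y : pts X"
  then obtain w where "w : pts V" "y = pr w" by (auto simp: points_X)
  thus "y : {x}" using mem_GamI[OF _ g_D] eq by auto
 qed
 thus False using X.infinite_points finite_subset by blast
qed

text \<open>Over \<open>x = pr z\<close> there are \<open>card (pr z)\<close> points, each fixed by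
  \<open>mult z z * ramif z\<close> elements, and \<open>card (pr z) * ramif z\<close> is
  \<open>card H\<close>. So \<open>x\<close> accounts for \<open>card H\<close> times its local
  number among the pairs counted on the right.\<close>

lemma sum_local_intersection_diagonal:
 assumes gH: "g ~: H"
 shows "card H * (SUM p:Gam Int {(x, x) | x. x : pts X}. local_intersection (product_space X X) p Gam {(x, x) | x. x : pts X})
  = (SUM gm:D. card {z : pts V. ph gm z = z})"
proof -
 let ?De = "{(x, x) | x. x : pts X}"
 let ?li = "%x. local_intersection (product_space X X) (x, x) Gam ?De"
 define S where "S = {x : pts X. (x, x) : Gam}"
 define Q where "Q = {z : pts V. pr z : S}"
 have D1: "gm ~= \<one>" if "gm : D" for gm using D_not_H[OF gH that] H_one by blast
 have fixQ: "{z : pts V. ph gm z = z} <= Q" if "gm : D" for gm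
 proof
  fix z assume z: "z : {z : pts V. ph gm z = z}"
  hence "(pr z, pr z) : Gam" using mem_GamI[of z, OF _ that] by simp
  thus "z : Q" using z unfolding Q_def S_def points_X by simp
 qed
 have Qfin: "finite Q"
 proof (rule finite_subset)
  show "Q <= (UN gm:D. {z : pts V. ph gm z = z})"
  proof
  fix z assume "z : Q"
  hence z: "z : pts V" "(pr z, pr z) : Gam" by (auto simp: Q_def S_def)
  show "z : (UN gm:D. {z : pts V. ph gm z = z})"
  proof (rule mem_GamE[OF z(1) z(1) z(2)])
  fix gm assume "gm : D" "ph gm z = z"
  thus ?thesis using z(1) by simp blast
  qed
  qed
  show "finite (UN gm:D. {z : pts V. ph gm z = z})"
  by (rule finite_UN_I[OF finite_D finite_fixed_points[OF D_carrier D1]])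
 qed
 have SQ: "S = pr ` Q" unfolding Q_def S_def points_X by auto
 have Sfin: "finite S" unfolding SQ using Qfin by simp
 have "(SUM p:Gam Int ?De. local_intersection (product_space X X) p Gam ?De) = (SUM x:S. ?li x)"
  by (rule sum.reindex_cong[of "%x. (x, x)"]) (auto simp: S_def inj_on_def)
 hence "card H * (SUM p:Gam Int ?De. local_intersection (product_space X X) p Gam ?De) = (SUM x:S. card H * ?li x)"
  by (simp add: sum_distrib_left)
 also have "... = (SUM x:S. SUM z:{z : Q. pr z = x}. card {gm : D. ph gm z = z})"
 proof (rule sum.cong[OF refl])
  fix x assume x: "x : S"
  then obtain z where z: "z : pts V" "x = pr z" by (auto simp: S_def points_X)
  have fib: "{z : Q. pr z = x} = pr z"
  proof
  show "{w : Q. pr w = x} <= pr z" using pr_self z by (auto simp: Q_def)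
  show "pr z <= {w : Q. pr w = x}" using pr_mem_eq[OF z(1)] pr_subset[OF z(1)] x z(2) by (auto simp: Q_def)
  qed
  have "card {gm : D. ph gm w = w} = ?li x * ramif z" if w: "w : pr z" for w
  proof -
  have wV: "w : pts V" using pr_subset[OF z(1)] w by auto
  have "?li x = mult w w" using local_intersection_Gam_diagonal[OF wV gH] pr_mem_eq[OF z(1) w] z(2) by simp
  thus ?thesis using card_transporters[OF wV wV] ramif_eq[OF z(1) w] by simp
  qed
  hence "(SUM w:pr z. card {gm : D. ph gm w = w}) = card (pr z) * (?li x * ramif z)" by simp
  also have "... = card H * ?li x" by (simp add: card_pr[OF z(1), symmetric])
  finally show "card H * ?li x = (SUM z:{z : Q. pr z = x}. card {gm : D. ph gm z = z})" unfolding fib by simp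
 qed
 also have "... = (SUM z:Q. card {gm : D. ph gm z = z})"
  by (rule sum.group[OF Qfin Sfin]) (simp add: SQ)
 also have "... = (SUM z:Q. SUM gm:D. if ph gm z = z then 1 else 0)"
  using finite_D by (simp add: sum.If_cases Int_def)
 also have "... = (SUM gm:D. SUM z:Q. if ph gm z = z then 1 else 0)" by (rule sum.swap)
 also have "... = (SUM gm:D. card {z : pts V. ph gm z = z})"
 proof (rule sum.cong[OF refl])
  fix gm assume gm: "gm : D"
  have "Q Int {z. ph gm z = z} = {z : pts V. ph gm z = z}" using fixQ[OF gm] by (auto simp: Q_def)
  thus "(SUM z:Q. if ph gm z = z then 1 else 0) = card {z : pts V. ph gm z = z}"
  using Qfin by (simp add: sum.If_cases)
 qed
 finally show ?thesis .
qed

end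

section \<open>Correspondences spanned by all double cosets\<close>

locale hecke_curve = curve_quotient V G ph H
 for V :: "('p, 'k::field_char_0) function_space" and G :: "('g, 'm) monoid_scheme" (structure) and ph and H +
 fixes d :: nat and n :: "nat => nat" and g :: "nat => nat => 'g"
 assumes reps: "double_coset_reps G H d n g"
begin

lemma double_coset_eq:
 assumes "a : cr G" shows "double_coset G H a K = {h *. a *. k | h k. h : H & k : K}"
 unfolding double_coset_def set_mult_def r_coset_def by auto

lemma g_carrier: "i : {1..d} ==> j : {1..n i} ==> g i j : cr G"
 using reps unfolding double_coset_reps_def by simp

lemma n_pos: "i : {1..d} ==> 1 : {1..n i}"
 using reps unfolding double_coset_reps_def by simp

lemma d_pos: "1 : {1..d}" and g_one: "g 1 1 = \<one>"
 using reps unfolding double_coset_reps_def by simp_all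

lemma double_coset_curve: 
 assumes i: "i : {1..d}"
 shows "double_coset_curve V G ph H (g i 1) {1..n i} (g i)"
proof unfold_locales
 have *: "double_coset G H (g i 1) H = (UN j:{1..n i}. H #> g i j)"
  "disjoint_family_on (%j. H #> g i j) {1..n i}"
  using reps i unfolding double_coset_reps_def by blast+
 show gc: "g i 1 : cr G" by (rule g_carrier[OF i n_pos[OF i]])
 show "finite {1..n i}" by simp
 show "g i j : cr G" if "j : {1..n i}" for j by (rule g_carrier[OF i that])
 show "{h *. g i 1 *. k | h k. h : H & k : H} = {h *. g i j | h j. h : H & j : {1..n i}}"
 proof -
  have "{h *. g i j | h j. h : H & j : {1..n i}} = (UN j:{1..n i}. H #> g i j)" unfolding r_coset_def by blast
  thus ?thesis using *(1) unfolding double_coset_eq[OF gc] by simp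
 qed
 show "j = l" if "h : H" "k : H" "j : {1..n i}" "l : {1..n i}" "h *. g i j = k *. g i l" for h k j l
 proof (rule ccontr)
  assume "j ~= l"
  hence "(H #> g i j) Int (H #> g i l) = {}" using *(2) that unfolding disjoint_family_on_def by blast
  moreover have "h *. g i j : H #> g i j" using that(1) unfolding r_coset_def by blast
  moreover have "h *. g i j : H #> g i l" unfolding that(5) using that(2) unfolding r_coset_def by blast
  ultimately show False by blast
 qed
qed

abbreviation dcoset :: "nat => 'g set" where "dcoset i == double_coset_curve.D G H (g i 1)"

abbreviation Gam :: "nat => ('p set \<times> 'p set) set" where "Gam i == double_coset_curve.Gam V G ph H (g i 1)"

abbreviation mult :: "nat => 'p => 'p => nat" where "mult i == double_coset_curve.mult G ph H {1..n i} (g i)"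

lemma dcoset_eq:
 assumes i: "i : {1..d}" shows "dcoset i = double_coset G H (g i 1) H"
 unfolding double_coset_curve.D_def[OF double_coset_curve[OF i]] double_coset_eq[OF g_carrier[OF i n_pos[OF i]]] ..

lemma dcoset_inj:
 assumes "i : {1..d}" "j : {1..d}" "gm : dcoset i" "gm : dcoset j"
 shows "i = j"
proof -
 interpret i: double_coset_curve V G ph H "g i 1" "{1..n i}" "g i" by (rule double_coset_curve[OF assms(1)])
 interpret j: double_coset_curve V G ph H "g j 1" "{1..n j}" "g j" by (rule double_coset_curve[OF assms(2)])
 have "i.D = j.D" using i.D_eq[OF assms(3)] j.D_eq[OF assms(4)] by simp
 hence "double_coset G H (g i 1) H = double_coset G H (g j 1) H" using dcoset_eq assms by simp
 moreover have "inj_on (%i. double_coset G H (g i 1) H) {1..d}"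
  using reps unfolding double_coset_reps_def bij_betw_def by blast
 ultimately show ?thesis using assms(1,2) by (auto dest: inj_onD)
qed

lemma dcoset_cover: "cr G = (UN i:{1..d}. dcoset i)"
proof
 have img: "(%i. double_coset G H (g i 1) H) ` {1..d} = double_cosets G H H"
  using reps unfolding double_coset_reps_def bij_betw_def by blast
 show "cr G <= (UN i:{1..d}. dcoset i)"
 proof
  fix x assume x: "x : cr G"
  hence "double_coset G H x H : (%i. double_coset G H (g i 1) H) ` {1..d}" unfolding img double_cosets_def by blast
  then obtain i where i: "i : {1..d}" "double_coset G H x H = dcoset i" using dcoset_eq by auto
  have "\<one> *. x *. \<one> : double_coset G H x H" unfolding double_coset_eq[OF x] using H_one by blast
  thus "x : (UN i:{1..d}. dcoset i)" using i x by auto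
 qed
 show "(UN i:{1..d}. dcoset i) <= cr G"
  using double_coset_curve.D_carrier[OF double_coset_curve] by blast
qed

lemma dcoset_1: "dcoset 1 = H"
proof -
 have "dcoset 1 = double_coset G H \<one> H" using dcoset_eq[OF d_pos] unfolding g_one .
 also have "... = {h *. \<one> *. k | h k. h : H & k : H}" by (rule double_coset_eq[OF one_closed])
 also have "... = H"
 proof
  show "{h *. \<one> *. k | h k. h : H & k : H} <= H" using H_mult H_carrier by auto
  show "H <= {h *. \<one> *. k | h k. h : H & k : H}"
  proof
  fix h assume h: "h : H"
  hence "h = h *. \<one> *. \<one>" using H_carrier by simp
  thus "h : {h *. \<one> *. k | h k. h : H & k : H}" using h H_one by blast
  qed
 qed
 finally show ?thesis .
qed

lemma g_not_H:
 assumes "i : {2..d}" shows "g i 1 ~: H"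
proof
 assume "g i 1 : H"
 hence "g i 1 : dcoset 1" unfolding dcoset_1 .
 moreover have i: "i : {1..d}" using assms by auto
 moreover have "g i 1 : dcoset i" by (rule double_coset_curve.g_D[OF double_coset_curve[OF i]])
 ultimately have "i = 1" using dcoset_inj d_pos by blast
 thus False using assms by simp
qed

lemma Gam_1: "Gam 1 = {(x, x) | x. x : pts X}"
proof -
 have "Gam 1 = (%z. (pr z, pr (ph (g 1 1) z))) ` pts V"
  by (rule double_coset_curve.Gam_def[OF double_coset_curve[OF d_pos]])
 also have "... = {(x, x) | x. x : pts X}" unfolding g_one points_X by (auto simp: act_one)
 finally show ?thesis .
qed

text \<open>At a point with trivial stabilizer an element of the group is determined by the image of
  the point; a common curve then yields a common element of the two double cosets.\<close>

lemma Gam_inj: "inj_on Gam {1..d}"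
proof (rule inj_onI)
 fix i j assume ij: "i : {1..d}" "j : {1..d}" "Gam i = Gam j"
 interpret i: double_coset_curve V G ph H "g i 1" "{1..n i}" "g i" by (rule double_coset_curve[OF ij(1)])
 interpret j: double_coset_curve V G ph H "g j 1" "{1..n j}" "g j" by (rule double_coset_curve[OF ij(2)])
 show "i = j"
 proof (rule free_point_ex)
  fix z assume z: "z : pts V" "!!sg. sg : cr G ==> ph sg z = z ==> sg = \<one>"
  let ?g = "g i 1"
  have "(pr z, pr (ph ?g z)) : j.Gam" using i.mem_GamI[OF z(1) i.g_D] ij(3) by simp
  thus "i = j"
  proof (rule j.mem_GamE[OF z(1) act_closed[OF i.g_carrier z(1)]])
  fix gm assume gm: "gm : j.D" "ph gm z = ph ?g z"
  have gmc: "gm : cr G" by (rule j.D_carrier[OF gm(1)])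
  have "ph (inv ?g *. gm) z = z" using gm gmc i.g_carrier z(1) by (simp add: act_mult act_inv)
  hence "inv ?g *. gm = \<one>" using z(2) gmc i.g_carrier by simp
  hence "gm = ?g" using gmc i.g_carrier by (metis inv_closed inv_equality inv_inv)
  thus "i = j" using dcoset_inj[OF ij(1,2) i.g_D] gm(1) by simp
  qed
 qed
qed

definition correspondence :: "(nat => int) => ('p set \<times> 'p set) set \<Rightarrow>\<^sub>0 int" where
 "correspondence c = (SUM i=1..d. frag_cmul (c i) (frag_of (Gam i)))"

lemma lookup_correspondence:
 "lookup (correspondence c) A = (SUM i=1..d. if A = Gam i then c i else 0)"
 unfolding correspondence_def lookup_sum by (rule sum.cong) auto

lemma lookup_correspondence_Gam:
 assumes i: "i : {1..d}" shows "lookup (correspondence c) (Gam i) = c i"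
proof -
 have "lookup (correspondence c) (Gam i) = (SUM j=1..d. if j = i then c j else 0)"
  unfolding lookup_correspondence by (rule sum.cong) (use inj_onD[OF Gam_inj] i in auto)
 thus ?thesis using i by simp
qed

lemma keys_correspondence: "keys (correspondence c) <= Gam ` {1..d}"
proof
 fix A assume "A : keys (correspondence c)"
 hence "(SUM i=1..d. if A = Gam i then c i else 0) ~= 0"
  unfolding lookup_correspondence[symmetric] by (simp add: in_keys_iff)
 thus "A : Gam ` {1..d}" by (rule sum.not_neutral_contains_not_neutral) (auto split: if_splits)
qed

lemma sum_correspondence:
 "(SUM A:keys (correspondence c). lookup (correspondence c) A * f A) = (SUM i=1..d. c i * f (Gam i))"
proof -
 have "(SUM A:keys (correspondence c). lookup (correspondence c) A * f A)
  = (SUM A:Gam ` {1..d}. lookup (correspondence c) A * f A)"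
  by (rule sum.mono_neutral_left) (use keys_correspondence in "auto simp: in_keys_iff")
 also have "... = (SUM i=1..d. c i * f (Gam i))"
  unfolding sum.reindex[OF Gam_inj] by (rule sum.cong) (simp_all add: lookup_correspondence_Gam del: One_nat_def)
 finally show ?thesis .
qed

lemma lookup_double_coset_map:
 assumes z: "z : pts V"
 shows "lookup (double_coset_map G H ph d n g c (pr z)) (pr w)
  = (SUM i=1..d. c i * int (mult i (SOME y. y : pr z) w))"
proof -
 let ?z = "SOME y. y : pr z"
 have "lookup (double_coset_map G H ph d n g c (pr z)) (pr w)
  = (SUM i=1..d. c i * (SUM j=1..n i. if pr w = pr (ph (g i j) ?z) then 1 else 0))"
  unfolding double_coset_map_def Let_def by (simp add: lookup_sum pr_def del: One_nat_def)
 also have "... = (SUM i=1..d. c i * int (mult i ?z w))"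
 proof (rule sum.cong[OF refl])
  fix i assume i: "i : {1..d}"
  have "(SUM j=1..n i. if pr w = pr (ph (g i j) ?z) then 1 else 0) = int (card {j : {1..n i}. pr (ph (g i j) ?z) = pr w})"
  proof -
  have "{1..n i} Int {j. pr w = pr (ph (g i j) ?z)} = {j : {1..n i}. pr (ph (g i j) ?z) = pr w}" by auto
  thus ?thesis by (simp add: sum.If_cases del: One_nat_def)
  qed
  thus "c i * (SUM j=1..n i. if pr w = pr (ph (g i j) ?z) then 1 else 0) = c i * int (mult i ?z w)"
  unfolding double_coset_curve.mult_def[OF double_coset_curve[OF i]] by simp
 qed
 finally show ?thesis .
qed

lemma correspondence_of_double_coset_map: "correspondence_of X (double_coset_map G H ph d n g c) = correspondence c"
proof (rule X2.correspondence_of_eqI)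
 let ?A = "correspondence c"
 show "?A : divisors (product_space X X)"
  unfolding divisors_def using keys_correspondence[of c] double_coset_curve.prime_divisor_Gam[OF double_coset_curve] by blast
 show "ALL x:pts X. {x} \<times> pts X ~: keys (?A)"
  using keys_correspondence[of c] double_coset_curve.Gam_not_fibre[OF double_coset_curve] by blast
 show "ALL x:pts X. ALL y:pts X. correspondence_value X (?A) x y
  = lookup (double_coset_map G H ph d n g c x) y"
 proof (intro ballI)
  fix x y assume "x : pts X" "y : pts X"
  then obtain z w where zw: "z : pts V" "x = pr z" "w : pts V" "y = pr w" by (auto simp: points_X)
  \<comment> \<open>The preimage chosen inside \<open>double_coset_map\<close>. Multiplicities
    computed with it are local intersection numbers, which depend on \<open>pr z\<close>
    only.\<close>
  let ?z = "SOME y. y : pr z"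
  have "?z : pr z" using pr_self[OF zw(1)] by (rule someI)
  hence z: "?z : pts V" "pr ?z = pr z" using pr_subset[OF zw(1)] pr_mem_eq[OF zw(1)] by auto
  have "correspondence_value X (?A) (pr z) (pr w)
  = (SUM i=1..d. c i * int (local_intersection (product_space X X) (pr z, pr w) (Gam i) ({pr z} \<times> pts X)))"
  unfolding correspondence_value_def by (rule sum_correspondence)
  also have "... = (SUM i=1..d. c i * int (mult i ?z w))"
  by (rule sum.cong[OF refl])
  (simp only: double_coset_curve.local_intersection_Gam_fibre[OF double_coset_curve z(1) zw(3), unfolded z(2)])
  finally show "correspondence_value X (?A) x y = lookup (double_coset_map G H ph d n g c x) y"
  unfolding zw lookup_double_coset_map[OF zw(1)] .
 qed
qed

text \<open>At the diagonal the contributions \<open>b\<close>, \<open>- c 1\<close> and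
  \<open>c 1 - b\<close> cancel; at the other curves \<open>- c i\<close> and \<open>c 1 - b\<close>
  remain. The computation is coefficientwise, so it also covers a vanishing gcd.\<close>

lemma kanev_correspondence_eq:
 "kanev_correspondence G H ph V d n g c = correspondence (%i. if i = 1 then 0 else (c 1 - c i - kanev_gcd d c) div kanev_gcd d c)"
  (is "_ = correspondence ?k")
proof (rule poly_mapping_eqI)
 fix A
 let ?b = "kanev_gcd d c"
 let ?E = "frag_cmul ?b (diagonal_divisor X) - correspondence c + frag_cmul (c 1 - ?b) (correspondence (%_. 1))"
 have diag: "diagonal_divisor X = frag_of (Gam 1)" unfolding diagonal_divisor_def Gam_1 ..
 have K: "kanev_correspondence G H ph V d n g c = Poly_Mapping.map (%a. a div ?b) ?E"
  unfolding kanev_correspondence_def Let_def X_def[symmetric] correspondence_of_double_coset_map ..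
 have L: "lookup (Poly_Mapping.map (%a. a div ?b) ?E) A = lookup ?E A div ?b"
  by (simp add: map.rep_eq when_def)
 show "lookup (kanev_correspondence G H ph V d n g c) A = lookup (correspondence ?k) A"
 proof (cases "A : Gam ` {1..d}")
  case True
  then obtain i where i: "i : {1..d}" "A = Gam i" by blast
  have "lookup (frag_of (Gam 1)) (Gam i) = (if i = 1 then 1 else 0)"
  using inj_onD[OF Gam_inj _ i(1) d_pos] by auto
  hence "lookup ?E (Gam i) = (if i = 1 then 0 else c 1 - c i - ?b)"
  unfolding diag by (simp add: lookup_add lookup_minus lookup_correspondence_Gam[OF i(1)] del: One_nat_def lookup_frag_of)
  thus ?thesis unfolding K L unfolding i(2) lookup_correspondence_Gam[OF i(1)] by simp
 next
  case False
  have "lookup (correspondence e) A = 0" for e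
  using False keys_correspondence[of e] by (auto simp: in_keys_iff)
  moreover have "A ~= Gam 1" using False d_pos by blast
  ultimately show ?thesis unfolding K L unfolding diag by (simp add: lookup_add lookup_minus)
 qed
qed

theorem intersection_number_diagonal:
 assumes k1: "k 1 = 0"
 shows "int (card H) * intersection_number (product_space X X) (correspondence k) (diagonal_divisor X)
  = (SUM i=2..d. k i * (SUM gm:dcoset i. int (card {z : pts V. ph gm z = z})))"
proof -
 let ?A = "(correspondence k)" and ?B = "diagonal_divisor X"
 let ?De = "{(x, x) | x. x : pts X}"
 let ?S = "product_space X X"
 let ?f = "%A. SUM P:A Int ?De. int (local_intersection ?S P A ?De)"
 have diag: "?B = frag_of (Gam 1)" unfolding diagonal_divisor_def Gam_1 ..
 \<comment> \<open>Without a common component, \<open>intersection_number\<close> is the sum of the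
   local numbers.\<close>
 have "Gam 1 ~: keys ?A"
  using lookup_correspondence_Gam[OF d_pos, of k] k1 by (simp add: in_keys_iff)
 hence "intersection_number ?S ?A (?B) = proper_intersection ?S ?A (?B)"
  unfolding intersection_number_def diag by simp
 also have "... = (SUM A:keys ?A. lookup ?A A * ?f A)"
  unfolding proper_intersection_def diag by (simp add: Gam_1 del: One_nat_def)
 also have "... = (SUM i=1..d. k i * ?f (Gam i))" by (rule sum_correspondence)
 also have "... = (SUM i=2..d. k i * ?f (Gam i))"
 proof -
  have "{1..d} = insert 1 {2..d}" using d_pos by auto
  thus ?thesis using k1 by simp
 qed
 finally have "int (card H) * intersection_number ?S ?A (?B)
  = (SUM i=2..d. k i * (int (card H) * ?f (Gam i)))" by (simp add: sum_distrib_left mult_ac)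
 also have "... = (SUM i=2..d. k i * (SUM gm:dcoset i. int (card {z : pts V. ph gm z = z})))"
 proof (rule sum.cong[OF refl])
  fix i assume i: "i : {2..d}"
  hence i1: "i : {1..d}" by auto
  show "k i * (int (card H) * ?f (Gam i)) = k i * (SUM gm:dcoset i. int (card {z : pts V. ph gm z = z}))"
  using arg_cong[OF double_coset_curve.sum_local_intersection_diagonal[OF double_coset_curve[OF i1] g_not_H[OF i]], of int]
  by simp
 qed
 finally show ?thesis .
qed

end

section \<open>Complex representations\<close>

lemma mult_mat_vec_sum:
 assumes "A : carrier_mat n n" "v : carrier_vec n" "i < n"
 shows "(A *\<^sub>v v) $ i = (SUM j<n. A $$ (i, j) * v $ j)"
 using assms by (simp add: scalar_prod_def row_def lessThan_atLeast0)

lemma mult_mat_sum: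
 assumes "A : carrier_mat n n" "B : carrier_mat n n" "i < n" "k < n"
 shows "(A * B) $$ (i, k) = (SUM j<n. A $$ (i, j) * B $$ (j, k))"
 using assms by (simp add: scalar_prod_def row_def col_def lessThan_atLeast0)

lemma subspace_module_vecI:
 fixes U :: "'a::field vec set"
 assumes "U <= carrier_vec n" "0\<^sub>v n : U" "!!v w. v : U ==> w : U ==> v + w : U" "!!c v. v : U ==> c \<cdot>\<^sub>v v : U"
 shows "VectorSpace.subspace class_ring U (module_vec TYPE('a) n)"
 unfolding VectorSpace.subspace_def submodule_def
 using assms vec_vs[of n] vec_module[of n] by (simp add: module_vec_simps)

text \<open>The trace of a projection is the dimension of its image: expand the columns in a basis of the image.\<close>

lemma projection_dim:
 fixes P :: "'a::field_char_0 mat"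
 assumes P: "P : carrier_mat n n" and PU: "!!v. v : carrier_vec n ==> P *\<^sub>v v : U"
  and U: "U <= carrier_vec n" "!!v. v : U ==> P *\<^sub>v v = v"
 shows "of_nat (vectorspace.dim class_ring ((module_vec TYPE('a) n)\<lparr>carrier := U\<rparr>)) = (SUM i<n. P $$ (i, i))"
  and "vectorspace.dim class_ring ((module_vec TYPE('a) n)\<lparr>carrier := U\<rparr>) <= n"
proof -
 let ?p = "%j. P *\<^sub>v unit_vec n j"
 let ?V = "module_vec TYPE('a) n"
 let ?W = "?V\<lparr>carrier := U\<rparr>"
 interpret V: vec_space "TYPE('a)" n .
 have U': "v : carrier_vec n" if "v : U" for v using U(1) that by auto
 have UI: "v : U" if "v : carrier_vec n" "P *\<^sub>v v = v" for v using PU[OF that(1)] that(2) by simp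
 have sub: "VectorSpace.subspace class_ring U ?V"
 proof (rule subspace_module_vecI)
  show "0\<^sub>v n : U" by (rule UI) (use P in "auto intro!: eq_vecI")
  show "v + w : U" if "v : U" "w : U" for v w
  by (rule UI) (use that U' U(2) P in "simp_all add: mult_add_distrib_mat_vec")
  show "c \<cdot>\<^sub>v v : U" if "v : U" for c v
  by (rule UI) (use that U' U(2) P in "simp_all add: mult_mat_vec")
 qed (rule U(1))
 interpret W: vectorspace class_ring ?W by (rule V.subspace_is_vs[OF sub])
 have li: "S <= cr ?W & W.lin_indpt S ==> finite S & card S <= n" for S
 proof -
  assume S: "S <= cr ?W & W.lin_indpt S"
  hence SU: "S <= U" by simp
  have "V.lin_indpt S"
  using V.span_li_not_depend(2)[OF SU] sub S unfolding VectorSpace.subspace_def by simp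
  thus "finite S & card S <= n"
  using V.li_le_dim[of S] SU U(1) V.dim_is_n by auto
 qed
 have "{} <= cr ?W & W.lin_indpt {}" by (simp add: W.lin_dep_def)
 from maximal_exists[of "%S. S <= cr ?W & W.lin_indpt S", OF li this]
 obtain A where A: "finite A" "maximal A (%S. S <= cr ?W & W.lin_indpt S)" by blast
 have basis: "W.basis A" by (rule W.max_li_is_basis[OF A(2)])
 have AU: "A <= U" and cardA: "card A <= n" using A(2) li[of A] unfolding maximal_def by auto
 have dim: "W.dim = card A" by (rule W.dim_basis[OF A(1) basis])
 show "W.dim <= n" using dim cardA by simp
 have lin: "W.lincomb c A : U & (ALL i<n. W.lincomb c A $ i = (SUM a:A. c a * a $ i))" for c
 proof -
  have "finite B ==> B <= U ==> W.lincomb c B : U & (ALL i<n. W.lincomb c B $ i = (SUM a:B. c a * a $ i))" for B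
  proof (induction B rule: finite_induct)
  case empty
  thus ?case using W.lincomb_def sub unfolding VectorSpace.subspace_def submodule_def
  by (simp add: W.lincomb_def module_vec_simps)
  next
  case (insert b B)
  have bU: "b : U" "b : carrier_vec n" using insert U' by auto
  have "W.lincomb c (insert b B) = c b \<cdot>\<^sub>v b + W.lincomb c B"
  unfolding W.lincomb_def using insert sub unfolding VectorSpace.subspace_def submodule_def
  by (subst W.finsum_insert) (auto simp: module_vec_simps)
  moreover have "c b \<cdot>\<^sub>v b : U" "c b \<cdot>\<^sub>v b + W.lincomb c B : U"
  using sub insert bU unfolding VectorSpace.subspace_def submodule_def by (simp_all add: module_vec_simps)
  moreover have "W.lincomb c B : carrier_vec n" using insert U' by simp
  ultimately show ?case using insert bU by simp
  qed
  from this[OF A(1) AU] show ?thesis .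
 qed
 have ex1: "EX! c. c : A \<rightarrow>\<^sub>E UNIV & (ALL i<n. (SUM a:A. c a * a $ i) = u $ i)" if u: "u : U" for u
 proof -
  have "EX! c. c : A \<rightarrow>\<^sub>E UNIV & W.lincomb c A = u"
  using W.basis_criterion[OF A(1)] AU basis u by simp
  moreover have "W.lincomb c A = u <-> (ALL i<n. (SUM a:A. c a * a $ i) = u $ i)" for c
  using lin[of c] U'[OF u] U' by (auto intro!: eq_vecI)
  ultimately show ?thesis by simp
 qed
 define co where "co = (%u. THE c. c : A \<rightarrow>\<^sub>E UNIV & (ALL i<n. (SUM a:A. c a * a $ i) = u $ i))"
 have co: "co u : A \<rightarrow>\<^sub>E UNIV" "!!i. i < n ==> (SUM a:A. co u a * a $ i) = u $ i" if "u : U" for u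
  using theI'[OF ex1[OF that]] unfolding co_def by auto
 have co_eq: "ALL a:A. c a = e a" if that: "ALL i<n. (SUM a:A. c a * a $ i) = (SUM a:A. e a * a $ i)" for c e :: "'a Matrix.vec => 'a"
 proof -
  let ?u = "W.lincomb e A"
  have u: "?u : U" using lin by simp
  have 1: "restrict c A : A \<rightarrow>\<^sub>E UNIV & (ALL i<n. (SUM a:A. restrict c A a * a $ i) = ?u $ i)"
  using that lin[of e] by simp
  have 2: "restrict e A : A \<rightarrow>\<^sub>E UNIV & (ALL i<n. (SUM a:A. restrict e A a * a $ i) = ?u $ i)"
  using lin[of e] by simp
  have "restrict c A = restrict e A"
  using ex1[OF u] 1 2 by (elim ex1E) blast
  thus ?thesis by (metis restrict_apply')
 qed
 have PjU: "?p j : U" for j by (rule PU) simp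
 have Pcol: "(?p j) $ i = P $$ (i, j)" if "i < n" "j < n" for i j using P that by simp
 \<comment> \<open>The coefficient at \<open>b\<close> in \<open>P b = b\<close>, with
   \<open>P b\<close> written through the columns of \<open>P\<close>; summed over the basis it
   yields the trace.\<close>
 have dual: "(SUM j<n. b $ j * co (?p j) b) = 1" if b: "b : A" for b
 proof -
  have bU: "b : U" using b AU by auto
  have "ALL a:A. (SUM j<n. b $ j * co (?p j) a) = (if a = b then 1 else 0)"
  proof (rule co_eq, intro allI impI)
  fix i assume i: "i < n"
  have "(SUM a:A. (SUM j<n. b $ j * co (?p j) a) * a $ i)
  = (SUM j<n. b $ j * (SUM a:A. co (?p j) a * a $ i))"
  unfolding sum_distrib_right sum_distrib_left by (subst sum.swap) (simp add: mult_ac)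
  also have "... = (SUM j<n. P $$ (i, j) * b $ j)"
  by (rule sum.cong) (simp_all add: co(2)[OF PjU i] Pcol[OF i] del: index_mult_mat_vec)
  also have "... = b $ i" using mult_mat_vec_sum[OF P U'[OF bU] i] U(2)[OF bU] by simp
  also have "... = (SUM a:A. (if a = b then 1 else 0) * a $ i)" using A(1) b by (simp add: if_distrib[of "%x. x * _"] cong: if_cong)
  finally show "(SUM a:A. (SUM j<n. b $ j * co (?p j) a) * a $ i) = (SUM a:A. (if a = b then 1 else 0) * a $ i)" .
  qed
  thus ?thesis using b by simp
 qed
 have "(SUM i<n. P $$ (i, i)) = (SUM i<n. SUM a:A. co (?p i) a * a $ i)"
  by (rule sum.cong) (simp_all add: co(2)[OF PjU] Pcol del: index_mult_mat_vec)
 also have "... = (SUM a:A. SUM i<n. a $ i * co (?p i) a)" by (subst sum.swap) (simp add: mult_ac)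
 also have "... = of_nat (card A)" using dual by simp
 finally show "of_nat W.dim = (SUM i<n. P $$ (i, i))" using dim by simp
qed

lemma schur:
 fixes T :: "complex mat"
 assumes rh: "irreducible_rep G n rh" and T: "T : carrier_mat n n" and comm: "!!g. g : cr G ==> T * rh g = rh g * T"
 obtains l where "!!i j. i < n ==> j < n ==> T $$ (i, j) = (if i = j then l else 0)"
proof -
 have n: "0 < n" and car: "!!g. g : cr G ==> rh g : carrier_mat n n"
  using rh unfolding irreducible_rep_def is_rep_def by auto
 obtain l v where v: "v : carrier_vec n" "v ~= 0\<^sub>v n" "T *\<^sub>v v = l \<cdot>\<^sub>v v"
  using spectrum_non_empty[OF T n] T unfolding spectrum_def eigenvalue_def eigenvector_def by auto
 define U where "U = {v : carrier_vec n. T *\<^sub>v v = l \<cdot>\<^sub>v v}"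
 have "VectorSpace.subspace class_ring U (module_vec TYPE(complex) n)"
 proof (rule subspace_module_vecI)
  show "0\<^sub>v n : U" using T unfolding U_def by (auto intro!: eq_vecI)
  show "v + w : U" if "v : U" "w : U" for v w
  using that T unfolding U_def by (auto simp: mult_add_distrib_mat_vec smult_add_distrib_vec)
  show "c \<cdot>\<^sub>v v : U" if "v : U" for c v
  using that T unfolding U_def by (auto simp: mult_mat_vec smult_smult_assoc mult.commute)
 qed (auto simp: U_def)
 moreover have "rh g *\<^sub>v v : U" if g: "g : cr G" and v: "v : U" for g v
 proof -
  have vc: "v : carrier_vec n" "T *\<^sub>v v = l \<cdot>\<^sub>v v" using v by (auto simp: U_def)
  have "T *\<^sub>v (rh g *\<^sub>v v) = (T * rh g) *\<^sub>v v" using assoc_mult_mat_vec[OF T car[OF g] vc(1)] by simp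
  also have "... = rh g *\<^sub>v (T *\<^sub>v v)" unfolding comm[OF g] using assoc_mult_mat_vec[OF car[OF g] T vc(1)] by simp
  also have "... = l \<cdot>\<^sub>v (rh g *\<^sub>v v)" unfolding vc(2) using mult_mat_vec[OF car[OF g] vc(1)] by simp
  finally show ?thesis using mult_mat_vec_carrier[OF car[OF g] vc(1)] by (simp add: U_def)
 qed
 ultimately have "U = {0\<^sub>v n} | U = carrier_vec n" using rh unfolding irreducible_rep_def by blast
 moreover have "v : U" using v by (simp add: U_def)
 ultimately have Uc: "U = carrier_vec n" using v(2) by auto
 show thesis
 proof (rule that[of l])
  fix i j assume ij: "i < n" "j < n"
  have "unit_vec n j : U" unfolding Uc by simp
  hence "(T *\<^sub>v unit_vec n j) $ i = (l \<cdot>\<^sub>v unit_vec n j) $ i" by (simp add: U_def)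
  moreover have "(T *\<^sub>v unit_vec n j) $ i = T $$ (i, j)" using T ij by simp
  ultimately show "T $$ (i, j) = (if i = j then l else 0)" using ij by simp
 qed
qed

lemma (in group) rep_mult_index:
 assumes "is_rep G n rh" "g : cr G" "h : cr G" "i < n" "k < n"
 shows "rh (g *. h) $$ (i, k) = (SUM j<n. rh g $$ (i, j) * rh h $$ (j, k))"
proof -
 have "rh (g *. h) = rh g * rh h" "rh g : carrier_mat n n" "rh h : carrier_mat n n"
  using assms(1-3) unfolding is_rep_def by auto
 thus ?thesis using mult_mat_sum[OF _ _ assms(4,5)] by metis
qed

lemma (in group) character_eq:
 assumes "is_rep G n rh" "g : cr G" shows "chi rh g = (SUM i<n. rh g $$ (i, i))"
 using assms unfolding character_def is_rep_def by auto

lemma (in group) character_commute: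
 assumes "is_rep G n rh" "g : cr G" "h : cr G"
 shows "chi rh (g *. h) = chi rh (h *. g)"
proof -
 have "chi rh (g *. h) = (SUM i<n. SUM j<n. rh g $$ (i, j) * rh h $$ (j, i))"
  using assms by (simp add: character_eq rep_mult_index)
 also have "... = (SUM j<n. SUM i<n. rh h $$ (j, i) * rh g $$ (i, j))" by (subst sum.swap) (simp add: mult.commute)
 also have "... = chi rh (h *. g)" using assms by (simp add: character_eq rep_mult_index)
 finally show ?thesis .
qed

lemma (in group) character_conj:
 assumes "is_rep G n rh" "a : cr G" "x : cr G"
 shows "chi rh (a *. x *. inv a) = chi rh x"
proof -
 have "chi rh (a *. x *. inv a) = chi rh (inv a *. (a *. x))"
  by (rule character_commute) (use assms in auto)
 thus ?thesis using assms by (simp add: m_assoc[symmetric])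
qed

lemma (in group) sum_subgroup_left:
 assumes N: "subgroup N G" "finite N" and a: "a : N"
 shows "(SUM h:N. f (a *. h)) = (SUM h:N. f h)"
proof (rule sum.reindex_bij_witness[of _ "%h. inv a *. h" "%h. a *. h"])
 have c: "!!h. h : N ==> h : cr G" using subgroup.subset[OF N(1)] by auto
 fix h assume h: "h : N"
 show "inv a *. (a *. h) = h" "a *. (inv a *. h) = h" using c[OF h] c[OF a] by (simp_all add: m_assoc[symmetric])
 show "a *. h : N" "inv a *. h : N" using N(1) a h by (simp_all add: subgroup.m_closed subgroup.m_inv_closed)
qed simp

text \<open>The average of \<open>rh\<close> over \<open>N\<close> is a projection onto the fixed
  vectors, and its trace is the average of the character.\<close>

lemma (in group) fixed_dim_sum:
 assumes rh: "is_rep G n rh" and N: "subgroup N G" "finite N"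
 shows "of_nat (card N * fixed_dim n rh N) = (SUM h:N. chi rh h)" "fixed_dim n rh N <= n"
proof -
 have c: "!!h. h : N ==> h : cr G" using subgroup.subset[OF N(1)] by auto
 have car: "rh h : carrier_mat n n" if "h : N" for h using rh c[OF that] unfolding is_rep_def by blast
 have oneN: "\<one> : N" by (rule subgroup.one_closed[OF N(1)])
 have N0: "of_nat (card N) ~= (0 :: complex)" using N(2) oneN by auto
 define P where "P = mat n n (%(i, j). (SUM h:N. rh h $$ (i, j)) / of_nat (card N))"
 define U where "U = {v : carrier_vec n. ALL h:N. rh h *\<^sub>v v = v}"
 have P: "P : carrier_mat n n" by (simp add: P_def)
 have Pv: "(P *\<^sub>v v) $ i = (SUM h:N. (rh h *\<^sub>v v) $ i) / of_nat (card N)" if v: "v : carrier_vec n" and i: "i < n" for v i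
 proof -
  have "(P *\<^sub>v v) $ i = (SUM j<n. (SUM h:N. rh h $$ (i, j)) / of_nat (card N) * v $ j)"
  using mult_mat_vec_sum[OF P v i] i by (simp add: P_def)
  also have "... = (SUM j<n. SUM h:N. rh h $$ (i, j) * v $ j) / of_nat (card N)"
  by (simp add: sum_divide_distrib sum_distrib_right)
  also have "(SUM j<n. SUM h:N. rh h $$ (i, j) * v $ j) = (SUM h:N. SUM j<n. rh h $$ (i, j) * v $ j)" by (rule sum.swap)
  also have "... = (SUM h:N. (rh h *\<^sub>v v) $ i)"
  by (rule sum.cong[OF refl]) (rule mult_mat_vec_sum[OF car v i, symmetric])
  finally show ?thesis .
 qed
 have aP: "rh a * P = P" if a: "a : N" for a
 proof (rule eq_matI)
  fix i k assume "i < dim_row P" "k < dim_col P"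
  hence ik: "i < n" "k < n" by (simp_all add: P_def)
  have "(rh a * P) $$ (i, k) = (SUM j<n. SUM h:N. rh a $$ (i, j) * rh h $$ (j, k)) / of_nat (card N)"
  using mult_mat_sum[OF car[OF a] P ik] ik by (simp add: P_def sum_distrib_left sum_divide_distrib)
  also have "(SUM j<n. SUM h:N. rh a $$ (i, j) * rh h $$ (j, k)) = (SUM h:N. SUM j<n. rh a $$ (i, j) * rh h $$ (j, k))"
  by (rule sum.swap)
  also have "... = (SUM h:N. rh (a *. h) $$ (i, k))"
  by (rule sum.cong[OF refl]) (simp add: rep_mult_index[OF rh c[OF a] c ik])
  also have "... = (SUM h:N. rh h $$ (i, k))" by (rule sum_subgroup_left[OF N a])
  finally show "(rh a * P) $$ (i, k) = P $$ (i, k)" using ik by (simp add: P_def)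
 qed (use P car[OF a] in auto)
 have PU: "P *\<^sub>v v : U" if v: "v : carrier_vec n" for v
  unfolding U_def using P v assoc_mult_mat_vec[OF car P v] aP by auto
 have UP: "P *\<^sub>v v = v" if "v : U" for v
 proof (rule eq_vecI)
  have v: "v : carrier_vec n" "!!h. h : N ==> rh h *\<^sub>v v = v" using that by (auto simp: U_def)
  show "dim_vec (P *\<^sub>v v) = dim_vec v" using P v by simp
  fix i assume "i < dim_vec v"
  hence i: "i < n" using v by simp
  show "(P *\<^sub>v v) $ i = v $ i" unfolding Pv[OF v(1) i] using v(2) N0 by simp
 qed
 have fd: "fixed_dim n rh N = vectorspace.dim class_ring ((module_vec TYPE(complex) n)\<lparr>carrier := U\<rparr>)"
  unfolding fixed_dim_def U_def ..
 have Usub: "U <= carrier_vec n" by (auto simp: U_def)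
 note pd = projection_dim[OF P PU Usub UP]
 show "fixed_dim n rh N <= n" unfolding fd by (rule pd(2))
 have "of_nat (fixed_dim n rh N) = (SUM i<n. P $$ (i, i))" unfolding fd by (rule pd(1))
 also have "... = (SUM i<n. SUM h:N. rh h $$ (i, i)) / of_nat (card N)"
  by (simp add: P_def sum_divide_distrib)
 also have "(SUM i<n. SUM h:N. rh h $$ (i, i)) = (SUM h:N. SUM i<n. rh h $$ (i, i))" by (rule sum.swap)
 also have "... = (SUM h:N. chi rh h)" by (rule sum.cong) (simp_all add: character_eq[OF rh] c)
 finally show "of_nat (card N * fixed_dim n rh N) = (SUM h:N. chi rh h)" using N0 by (simp add: field_simps)
qed

text \<open>For a class function \<open>ps\<close> the sum of \<open>ps gm\<close> times the matrix
  of \<open>inv gm\<close> commutes with the representation, hence is a scalar \<open>l\<close> by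
  Schur's lemma. Its trace, with and without the factor \<open>rh x\<close>, gives two expressions
  in \<open>l\<close>, which is eliminated.\<close>

lemma (in group) central_character:
 assumes fin: "finite (cr G)" and rh: "irreducible_rep G n rh"
  and ps: "!!a x. a : cr G ==> x : cr G ==> ps (a *. x *. inv a) = (ps x :: complex)" and x: "x : cr G"
 shows "of_nat n * (SUM gm:cr G. ps gm * chi rh (x *. inv gm))
  = chi rh x * (SUM gm:cr G. ps gm * chi rh (inv gm))"
proof -
 have rep: "is_rep G n rh" and n: "0 < n" using rh unfolding irreducible_rep_def by auto
 have car: "rh g : carrier_mat n n" if "g : cr G" for g using rep that unfolding is_rep_def by blast
 define T where "T = mat n n (%(i, j). SUM gm:cr G. ps gm * rh (inv gm) $$ (i, j))"
 have T: "T : carrier_mat n n" by (simp add: T_def)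
 have left: "(rh g * T) $$ (i, k) = (SUM gm:cr G. ps gm * rh (g *. inv gm) $$ (i, k))"
  if g: "g : cr G" and ik: "i < n" "k < n" for g i k
 proof -
  have "(rh g * T) $$ (i, k) = (SUM j<n. SUM gm:cr G. ps gm * (rh g $$ (i, j) * rh (inv gm) $$ (j, k)))"
  using mult_mat_sum[OF car[OF g] T ik] ik by (simp add: T_def sum_distrib_left mult_ac)
  also have "... = (SUM gm:cr G. ps gm * (SUM j<n. rh g $$ (i, j) * rh (inv gm) $$ (j, k)))"
  unfolding sum_distrib_left by (rule sum.swap)
  finally show ?thesis using rep_mult_index[OF rep g _ ik] by simp
 qed
 have right: "(T * rh g) $$ (i, k) = (SUM gm:cr G. ps gm * rh (inv gm *. g) $$ (i, k))"
  if g: "g : cr G" and ik: "i < n" "k < n" for g i k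
 proof -
  have "(T * rh g) $$ (i, k) = (SUM j<n. SUM gm:cr G. ps gm * (rh (inv gm) $$ (i, j) * rh g $$ (j, k)))"
  using mult_mat_sum[OF T car[OF g] ik] ik by (simp add: T_def sum_distrib_right mult.assoc)
  also have "... = (SUM gm:cr G. ps gm * (SUM j<n. rh (inv gm) $$ (i, j) * rh g $$ (j, k)))"
  unfolding sum_distrib_left by (rule sum.swap)
  finally show ?thesis using rep_mult_index[OF rep _ g ik] by simp
 qed
 have comm: "T * rh g = rh g * T" if g: "g : cr G" for g
 proof (rule eq_matI)
  show "dim_row (T * rh g) = dim_row (rh g * T)" "dim_col (T * rh g) = dim_col (rh g * T)" using T car[OF g] by auto
  fix i k assume "i < dim_row (rh g * T)" "k < dim_col (rh g * T)"
  hence ik: "i < n" "k < n" using T car[OF g] by auto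
  have "(SUM gm:cr G. ps gm * rh (inv gm *. g) $$ (i, k)) = (SUM gm:cr G. ps gm * rh (g *. inv gm) $$ (i, k))"
  proof (rule sum.reindex_bij_witness[of _ "%y. g *. y *. inv g" "%y. inv g *. y *. g"])
  fix y assume y: "y : cr G"
  have c1: "inv g *. (g *. u) = u" "g *. (inv g *. u) = u" if "u : cr G" for u
  using g that by (simp_all add: m_assoc[symmetric])
  show "inv g *. (g *. y *. inv g) *. g = y" "g *. (inv g *. y *. g) *. inv g = y"
  using g y by (simp_all add: m_assoc c1)
  show "g *. y *. inv g : cr G" "inv g *. y *. g : cr G" using g y by auto
  have "ps (inv g *. y *. g) = ps y" using ps[of "inv g" y] g y by simp
  moreover have "g *. inv (inv g *. y *. g) = inv y *. g" using g y by (simp add: inv_mult_group m_assoc c1)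
  ultimately show "ps (inv g *. y *. g) * rh (g *. inv (inv g *. y *. g)) $$ (i, k) = ps y * rh (inv y *. g) $$ (i, k)" by simp
  qed
  thus "(T * rh g) $$ (i, k) = (rh g * T) $$ (i, k)" unfolding left[OF g ik] right[OF g ik] .
 qed
 from schur[OF rh T comm] obtain l where l: "!!i j. i < n ==> j < n ==> T $$ (i, j) = (if i = j then l else 0)" by blast
 have "(SUM gm:cr G. ps gm * chi rh (inv gm)) = (SUM i<n. T $$ (i, i))"
 proof -
  have "(SUM gm:cr G. ps gm * chi rh (inv gm)) = (SUM gm:cr G. SUM i<n. ps gm * rh (inv gm) $$ (i, i))"
  by (rule sum.cong) (simp_all add: character_eq[OF rep] sum_distrib_left)
  also have "... = (SUM i<n. T $$ (i, i))" by (subst sum.swap) (simp add: T_def)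
  finally show ?thesis .
 qed
 also have "... = of_nat n * l" using l by simp
 finally have 1: "(SUM gm:cr G. ps gm * chi rh (inv gm)) = of_nat n * l" .
 have "(SUM gm:cr G. ps gm * chi rh (x *. inv gm)) = (SUM gm:cr G. SUM i<n. ps gm * rh (x *. inv gm) $$ (i, i))"
  by (rule sum.cong) (simp_all add: character_eq[OF rep] sum_distrib_left x)
 also have "... = (SUM i<n. (rh x * T) $$ (i, i))" by (subst sum.swap) (simp add: left[OF x])
 also have "... = (SUM i<n. SUM j<n. rh x $$ (i, j) * (if j = i then l else 0))"
  by (intro sum.cong refl) (use mult_mat_sum[OF car[OF x] T] l in simp)
 also have "... = (SUM i<n. rh x $$ (i, i) * l)"
 proof (rule sum.cong[OF refl])
  fix i assume i: "i : {..<n}"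
  have "(SUM j<n. rh x $$ (i, j) * (if j = i then l else 0)) = (SUM j<n. if j = i then rh x $$ (i, j) * l else 0)"
  by (rule sum.cong) auto
  thus "(SUM j<n. rh x $$ (i, j) * (if j = i then l else 0)) = rh x $$ (i, i) * l" using i by simp
 qed
 also have "... = chi rh x * l" by (simp add: character_eq[OF rep x] sum_distrib_right)
 finally show ?thesis using 1 by simp
qed

section \<open>Counting conjugates\<close>

context group
begin

text \<open>For a subgroup \<open>K\<close> this is \<open>card K\<close> times the number of cosets
  \<open>a K\<close> fixed by \<open>gm\<close>, so a multiple of a permutation character.\<close>

definition conj_count :: "'a set => 'a => nat" where
 "conj_count K gm = card {a : cr G. inv a *. gm *. a : K}"

lemma cancel_inv: "a : cr G ==> u : cr G ==> inv a *. (a *. u) = u"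
  "a : cr G ==> u : cr G ==> a *. (inv a *. u) = u"
 by (simp_all add: m_assoc[symmetric])

lemma sum_conj_count:
 fixes f :: "'a => 'c::comm_semiring_1"
 assumes fin: "finite (cr G)" and K: "K <= cr G"
 shows "(SUM gm:cr G. of_nat (conj_count K gm) * f gm) = (SUM a:cr G. SUM ka:K. f (a *. ka *. inv a))"
proof -
 have "(SUM gm:cr G. of_nat (conj_count K gm) * f gm) = (SUM gm:cr G. SUM a:cr G. if inv a *. gm *. a : K then f gm else 0)"
  using fin by (simp add: conj_count_def sum.If_cases Int_def)
 also have "... = (SUM a:cr G. SUM gm:cr G. if inv a *. gm *. a : K then f gm else 0)" by (rule sum.swap)
 also have "... = (SUM a:cr G. SUM ka:K. f (a *. ka *. inv a))"
 proof (rule sum.cong[OF refl])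
  fix a assume a: "a : cr G"
  have "(SUM gm:cr G. if inv a *. gm *. a : K then f gm else 0) = (SUM gm:{gm : cr G. inv a *. gm *. a : K}. f gm)"
  by (rule sum.inter_filter[OF fin, symmetric])
  also have "... = (SUM ka:K. f (a *. ka *. inv a))"
  proof (rule sum.reindex_bij_witness[of _ "%ka. a *. ka *. inv a" "%gm. inv a *. gm *. a"])
  fix gm assume g: "gm : {gm : cr G. inv a *. gm *. a : K}"
  hence "gm : cr G" by simp
  thus e: "a *. (inv a *. gm *. a) *. inv a = gm" using a by (simp add: m_assoc cancel_inv)
  show "inv a *. gm *. a : K" using g by simp
  show "f (a *. (inv a *. gm *. a) *. inv a) = f gm" unfolding e ..
  next
  fix ka assume k: "ka : K"
  hence kc: "ka : cr G" using K by auto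
  thus e: "inv a *. (a *. ka *. inv a) *. a = ka" using a by (simp add: m_assoc cancel_inv)
  show "a *. ka *. inv a : {gm : cr G. inv a *. gm *. a : K}" using a k kc e by simp
  qed
  finally show "(SUM gm:cr G. if inv a *. gm *. a : K then f gm else 0) = (SUM ka:K. f (a *. ka *. inv a))" .
 qed
 finally show ?thesis .
qed

lemma conj_count_conj:
 assumes b: "b : cr G" and x: "x : cr G"
 shows "conj_count K (b *. x *. inv b) = conj_count K x"
 unfolding conj_count_def
proof (rule bij_betw_same_card[of "%a. inv b *. a"], rule bij_betw_byWitness[of _ "%a. b *. a"])
 have *: "inv a *. (b *. x *. inv b) *. a = inv (inv b *. a) *. x *. (inv b *. a)" if "a : cr G" for a
  using that b x by (simp add: inv_mult_group m_assoc)
 show "(%a. inv b *. a) ` {a : cr G. inv a *. (b *. x *. inv b) *. a : K} <= {a : cr G. inv a *. x *. a : K}"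
  using b * by auto
 show "(%a. b *. a) ` {a : cr G. inv a *. x *. a : K} <= {a : cr G. inv a *. (b *. x *. inv b) *. a : K}"
 proof (rule image_subsetI)
  fix a assume a: "a : {a : cr G. inv a *. x *. a : K}"
  hence "b *. a : cr G" using b by simp
  from *[OF this] show "b *. a : {a : cr G. inv a *. (b *. x *. inv b) *. a : K}"
  using a b by (simp add: cancel_inv)
 qed
qed (use b in "simp_all add: cancel_inv")

lemma sum_conj_count_one:
 assumes fin: "finite (cr G)" and K: "K <= cr G"
 shows "(SUM gm:cr G. conj_count K gm) = order G * card K"
 using sum_conj_count[OF assms, of "%_. 1 :: nat"] by (simp add: order_def)

lemma conj_count_carrier: "gm : cr G ==> conj_count (cr G) gm = order G"
 unfolding conj_count_def order_def by (rule arg_cong[of _ _ card]) auto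

lemma double_coset_set: "double_coset G H a K = {h *. a *. k | h k. h : H & k : K}"
 unfolding double_coset_def set_mult_def r_coset_def by auto

lemma double_coset_mem_eq:
 assumes H: "subgroup H G" and K: "subgroup K G" and a: "a : cr G" and x: "x : double_coset G H a K"
 shows "double_coset G H x K = double_coset G H a K"
proof -
 let ?A = "double_coset G H x K" and ?B = "double_coset G H a K"
 have Hc: "!!h. h : H ==> h : cr G" and Kc: "!!k. k : K ==> k : cr G"
  using subgroup.subset[OF H] subgroup.subset[OF K] by auto
 obtain h k where hk: "h : H" "k : K" "x = h *. a *. k" using x unfolding double_coset_set by blast
 note c = Hc[OF hk(1)] Kc[OF hk(2)] a
 show ?thesis
 proof
  show "?A <= ?B"
  proof
  fix y assume "y : ?A"
  then obtain u v where uv: "u : H" "v : K" "y = u *. x *. v" unfolding double_coset_set by blast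
  have "y = (u *. h) *. a *. (k *. v)" unfolding uv(3) hk(3) using c Hc[OF uv(1)] Kc[OF uv(2)] by (simp add: m_assoc)
  thus "y : ?B"
  unfolding double_coset_set using subgroup.m_closed[OF H uv(1) hk(1)] subgroup.m_closed[OF K hk(2) uv(2)] by blast
  qed
  show "?B <= ?A"
  proof
  fix y assume "y : ?B"
  then obtain u v where uv: "u : H" "v : K" "y = u *. a *. v" unfolding double_coset_set by blast
  have "y = (u *. inv h) *. x *. (inv k *. v)"
  unfolding uv(3) hk(3) using c Hc[OF uv(1)] Kc[OF uv(2)] by (simp add: m_assoc cancel_inv)
  thus "y : ?A"
  unfolding double_coset_set using subgroup.m_closed[OF H uv(1) subgroup.m_inv_closed[OF H hk(1)]]
  subgroup.m_closed[OF K subgroup.m_inv_closed[OF K hk(2)] uv(2)] by blast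
  qed
 qed
qed

lemma double_coset_self:
 assumes "subgroup H G" "subgroup K G" "a : cr G" shows "a : double_coset G H a K"
proof -
 have "a = \<one> *. a *. \<one>" using assms(3) by simp
 thus ?thesis unfolding double_coset_set using assms(1,2) subgroup.one_closed by blast
qed

lemma double_coset_subset:
 assumes "subgroup H G" "subgroup K G" "a : cr G" shows "double_coset G H a K <= cr G"
 unfolding double_coset_set using assms subgroup.subset[OF assms(1)] subgroup.subset[OF assms(2)] by auto

text \<open>Each summand counts the ways to write \<open>a\<close> as \<open>h *. b *. k\<close>: if
  \<open>a = u *. b *. v\<close>, an \<open>h\<close> on the left corresponds to the pair of
  \<open>h *. u\<close> and \<open>v *. inv (inv a *. h *. a)\<close>. Over all \<open>a\<close>
  this exhausts the pairs in \<open>H\<close> and \<open>K\<close>.\<close>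

lemma sum_double_coset:
 assumes fin: "finite (cr G)" and H: "subgroup H G" and K: "subgroup K G" and b: "b : cr G"
 shows "(SUM a:double_coset G H b K. card {h : H. inv a *. h *. a : K}) = card H * card K"
proof -
 have Hc: "!!h. h : H ==> h : cr G" and Kc: "!!k. k : K ==> k : cr G"
  using subgroup.subset[OF H] subgroup.subset[OF K] by auto
 have fH: "finite H" "finite K" using fin subgroup.subset H K finite_subset by metis+
 let ?F = "%a. {p : H \<times> K. fst p *. b *. snd p = a}"
 have fib: "card {h : H. inv a *. h *. a : K} = card (?F a)" if "a : double_coset G H b K" for a
 proof -
  obtain u v where uv: "u : H" "v : K" "a = u *. b *. v" using \<open>a : double_coset G H b K\<close> unfolding double_coset_set by blast
  note c = Hc[OF uv(1)] Kc[OF uv(2)] b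
  have ac: "a : cr G" using c uv(3) by simp
  show ?thesis
  proof (rule bij_betw_same_card[of "%h. (h *. u, v *. inv (inv a *. h *. a))"], rule bij_betw_byWitness[of _ "%p. fst p *. inv u"])
  show "ALL h:{h : H. inv a *. h *. a : K}. fst (h *. u, v *. inv (inv a *. h *. a)) *. inv u = h"
  using c Hc by (simp add: m_assoc)
  have key: "inv a *. (h *. inv u) *. a = inv k *. v" if "h : H" "k : K" "h *. b *. k = a" for h k
  proof -
  have hk: "h : cr G" "k : cr G" using Hc Kc that by auto
  have "h *. b = a *. inv k" unfolding that(3)[symmetric] using hk b by (simp add: m_assoc)
  hence "h *. (b *. v) = a *. (inv k *. v)" using hk c ac by (simp add: m_assoc[symmetric])
  thus ?thesis using hk c ac unfolding uv(3) by (simp add: m_assoc cancel_inv) (metis cancel_inv(1) m_closed inv_closed m_assoc uv(3))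
  qed
  show "ALL p:?F a. (fst p *. inv u *. u, v *. inv (inv a *. (fst p *. inv u) *. a)) = p"
  proof
  fix p assume p: "p : ?F a"
  hence hk: "fst p : H" "snd p : K" "fst p *. b *. snd p = a" by auto
  have "fst p *. inv u *. u = fst p" using Hc[OF hk(1)] c by (simp add: m_assoc)
  moreover have "v *. inv (inv (snd p) *. v) = snd p" using Kc[OF hk(2)] c by (simp add: inv_mult_group cancel_inv)
  ultimately show "(fst p *. inv u *. u, v *. inv (inv a *. (fst p *. inv u) *. a)) = p"
  unfolding key[OF hk] by simp
  qed
  show "(%p. fst p *. inv u) ` ?F a <= {h : H. inv a *. h *. a : K}"
  proof (rule image_subsetI)
  fix p assume p: "p : ?F a"
  hence hk: "fst p : H" "snd p : K" "fst p *. b *. snd p = a" by auto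
  have "inv (snd p) *. v : K" by (rule subgroup.m_closed[OF K subgroup.m_inv_closed[OF K hk(2)] uv(2)])
  moreover have "fst p *. inv u : H" by (rule subgroup.m_closed[OF H hk(1) subgroup.m_inv_closed[OF H uv(1)]])
  ultimately show "fst p *. inv u : {h : H. inv a *. h *. a : K}" using key[OF hk] by simp
  qed
  show "(%h. (h *. u, v *. inv (inv a *. h *. a))) ` {h : H. inv a *. h *. a : K} <= ?F a"
  proof (rule image_subsetI)
  fix h assume "h : {h : H. inv a *. h *. a : K}"
  hence h: "h : H" "inv a *. h *. a : K" by auto
  have "h *. u : H" by (rule subgroup.m_closed[OF H h(1) uv(1)])
  moreover have "v *. inv (inv a *. h *. a) : K" by (rule subgroup.m_closed[OF K uv(2) subgroup.m_inv_closed[OF K h(2)]])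
  moreover have "h *. u *. b *. (v *. inv (inv a *. h *. a)) = a"
  proof -
  have "h *. u *. b *. (v *. inv (inv a *. h *. a)) = h *. (a *. inv (inv a *. h *. a))"
  unfolding uv(3) using c Hc[OF h(1)] by (simp add: m_assoc)
  also have "... = a" using ac Hc[OF h(1)] by (simp add: inv_mult_group m_assoc cancel_inv)
  finally show ?thesis .
  qed
  ultimately show "(h *. u, v *. inv (inv a *. h *. a)) : ?F a" by simp
  qed
  qed
 qed
 have "(SUM a:double_coset G H b K. card {h : H. inv a *. h *. a : K}) = (SUM a:double_coset G H b K. card (?F a))"
  by (rule sum.cong[OF refl fib])
 also have "... = card (UN a:double_coset G H b K. ?F a)"
 proof (rule card_UN_disjoint[symmetric])
  show "finite (double_coset G H b K)" using double_coset_subset[OF H K b] fin by (rule finite_subset)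
 qed (use fH in auto)
 also have "(UN a:double_coset G H b K. ?F a) = H \<times> K" unfolding double_coset_set by force
 finally show ?thesis by (simp add: card_cartesian_product)
qed

text \<open>After exchanging the sums, the elements \<open>a\<close> are grouped by double cosets,
  each contributing \<open>card H * card K\<close>. This is where the number of double cosets enters
  the final formula.\<close>

lemma sum_conj_count_subgroup:
 assumes fin: "finite (cr G)" and H: "subgroup H G" and K: "subgroup K G"
 shows "(SUM h:H. conj_count K h) = card H * card K * card (double_cosets G H K)"
proof -
 let ?A = "double_cosets G H K"
 have fH: "finite H" using fin subgroup.subset[OF H] finite_subset by metis
 have "(SUM h:H. conj_count K h) = (SUM h:H. SUM a:cr G. if inv a *. h *. a : K then 1 else 0)"
  using fin by (simp add: conj_count_def sum.If_cases Int_def)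
 also have "... = (SUM a:cr G. SUM h:H. if inv a *. h *. a : K then 1 else 0)" by (rule sum.swap)
 also have "... = (SUM a:cr G. card {h : H. inv a *. h *. a : K})"
  using fH by (simp add: sum.If_cases Int_def)
 also have "cr G = \<Union> (?A)"
  unfolding double_cosets_def using double_coset_self[OF H K] double_coset_subset[OF H K] by blast
 also have "(SUM a:\<Union> (?A). card {h : H. inv a *. h *. a : K})
  = (SUM D:?A. SUM a:D. card {h : H. inv a *. h *. a : K})"
 proof (subst sum.Union_disjoint)
  show "ALL A:?A. finite A"
  unfolding double_cosets_def using double_coset_subset[OF H K] fin finite_subset by blast
  show "ALL A:?A. ALL B:?A. A ~= B --> A Int B = {}"
  proof (intro ballI impI)
  fix A B assume AB: "A : ?A" "B : ?A" "A ~= B"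
  then obtain a b where ab: "a : cr G" "A = double_coset G H a K" "b : cr G" "B = double_coset G H b K"
  unfolding double_cosets_def by blast
  show "A Int B = {}"
  proof (rule ccontr)
  assume "A Int B ~= {}"
  then obtain x where "x : double_coset G H a K" "x : double_coset G H b K" using ab by blast
  hence "A = B" using double_coset_mem_eq[OF H K] ab by metis
  thus False using AB(3) by simp
  qed
  qed
 qed simp
 also have "... = (SUM D:?A. card H * card K)"
  by (rule sum.cong[OF refl]) (auto simp: double_cosets_def sum_double_coset[OF fin H K])
 finally show ?thesis by simp
qed

text \<open>\<open>central_character\<close> is applied to the class function
  \<open>conj_count K\<close> and added up over \<open>H\<close>; the character sums over
  \<open>H\<close> and over \<open>K\<close> turn into dimensions of fixed spaces.\<close>

lemma sum_character_conj_count: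
 assumes fin: "finite (cr G)" and rh: "irreducible_rep G n rh" and H: "subgroup H G" and K: "subgroup K G"
 shows "of_nat n * (SUM gm:cr G. of_nat (conj_count K gm) * (SUM h:H. chi rh (h *. inv gm)))
  = (of_nat (card H * fixed_dim n rh H * (order G * (card K * fixed_dim n rh K))) :: complex)"
proof -
 let ?A = "(order G * (card K * fixed_dim n rh K))"
 have rep: "is_rep G n rh" using rh unfolding irreducible_rep_def by blast
 have Hc: "!!h. h : H ==> h : cr G" and Kc: "!!k. k : K ==> k : cr G"
  using subgroup.subset[OF H] subgroup.subset[OF K] by auto
 have fH: "finite H" "finite K" using fin subgroup.subset H K finite_subset by metis+
 let ?ps = "%gm. of_nat (conj_count K gm) :: complex"
 have "(SUM gm:cr G. ?ps gm * chi rh (inv gm)) = (SUM a:cr G. SUM ka:K. chi rh (inv (a *. ka *. inv a)))"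
  by (rule sum_conj_count[OF fin subgroup.subset[OF K]])
 also have "... = (SUM a:cr G. SUM ka:K. chi rh (inv ka))"
 proof (intro sum.cong refl)
  fix a k assume ak: "a : cr G" "k : K"
  have "inv (a *. k *. inv a) = a *. inv k *. inv a" using ak Kc by (simp add: inv_mult_group m_assoc)
  thus "chi rh (inv (a *. k *. inv a)) = chi rh (inv k)"
  using character_conj[OF rep ak(1), of "inv k"] Kc[OF ak(2)] by simp
 qed
 also have "(SUM ka:K. chi rh (inv ka)) = (SUM ka:K. chi rh ka)"
  by (rule sum.reindex_bij_witness[of _ "%x. inv x" "%x. inv x"]) (use Kc subgroup.m_inv_closed[OF K] in auto)
 also have "... = of_nat (card K * fixed_dim n rh K)" by (rule fixed_dim_sum(1)[OF rep K fH(2), symmetric])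
 finally have 1: "(SUM gm:cr G. ?ps gm * chi rh (inv gm)) = of_nat ?A"
  by (simp add: order_def)
 have "of_nat n * (SUM gm:cr G. ?ps gm * (SUM h:H. chi rh (h *. inv gm)))
  = (SUM gm:cr G. SUM h:H. of_nat n * (?ps gm * chi rh (h *. inv gm)))"
  by (simp add: sum_distrib_left)
 also have "... = (SUM h:H. SUM gm:cr G. of_nat n * (?ps gm * chi rh (h *. inv gm)))" by (rule sum.swap)
 also have "... = (SUM h:H. chi rh h * of_nat ?A)"
 proof (rule sum.cong[OF refl])
  fix h assume h: "h : H"
  have "of_nat n * (SUM gm:cr G. ?ps gm * chi rh (h *. inv gm))
  = chi rh h * (SUM gm:cr G. ?ps gm * chi rh (inv gm))"
  by (rule central_character[OF fin rh _ Hc[OF h]]) (simp add: conj_count_conj)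
  thus "(SUM gm:cr G. of_nat n * (?ps gm * chi rh (h *. inv gm))) = chi rh h * of_nat ?A"
  unfolding 1 by (simp add: sum_distrib_left)
 qed
 also have "... = of_nat (card H * fixed_dim n rh H) * of_nat ?A"
  unfolding sum_distrib_right[symmetric] fixed_dim_sum(1)[OF rep H fH(1)] ..
 finally show ?thesis by simp
qed

end

section \<open>Traces of algebraic integers\<close>

interpretation QV: vector_space rat_scale
 by unfold_locales (simp_all add: algebra_simps of_rat_add of_rat_mult)

abbreviation (input) coord where "coord == QV.representation"

text \<open>The lattice generated by \<open>S\<close>, scaled by \<open>w\<close>; the scaling
  accommodates the inverse of a common denominator.\<close>

definition zspan :: "rat => complex set => complex set" where
 "zspan w S = range (%c. SUM s:S. of_int (c s) * (of_rat w * s))"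

lemma zspanI: "x = (SUM s:S. of_int (c s) * (of_rat w * s)) ==> x : zspan w S"
 unfolding zspan_def by blast

lemma zspan_zero: "0 : zspan w S"
 by (rule zspanI[of _ "%_. 0"]) simp

lemma zspan_add:
 assumes "x : zspan w S" "y : zspan w S" shows "x + y : zspan w S"
proof -
 obtain c e where "x = (SUM s:S. of_int (c s) * (of_rat w * s))" "y = (SUM s:S. of_int (e s) * (of_rat w * s))"
  using assms unfolding zspan_def by blast
 thus ?thesis by (intro zspanI[of _ "%s. c s + e s"]) (simp add: sum.distrib distrib_right)
qed

lemma zspan_scale:
 assumes "x : zspan w S" shows "of_int k * x : zspan w S"
proof -
 obtain c where "x = (SUM s:S. of_int (c s) * (of_rat w * s))" using assms unfolding zspan_def by blast
 thus ?thesis by (intro zspanI[of _ "%s. k * c s"]) (simp add: sum_distrib_left mult.assoc)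
qed

lemma zspan_sum: "(!!i. i : I ==> f i : zspan w S) ==> (SUM i:I. f i) : zspan w S"
 by (induction I rule: infinite_finite_induct) (auto intro: zspan_zero zspan_add)

lemma zspan_base:
 assumes "finite S" "s : S" shows "s : zspan 1 S"
proof (rule zspanI[of _ "%x. if x = s then 1 else 0"])
 have "(SUM x:S. of_int (if x = s then 1 else 0) * (of_rat 1 * x)) = (SUM x:S. if x = s then x else 0)"
  by (rule sum.cong) auto
 thus "s = (SUM x:S. of_int (if x = s then 1 else 0) * (of_rat 1 * x))" using assms by simp
qed

lemma zspan_subset_span: "zspan w S <= QV.span S"
proof
 fix x assume "x : zspan w S"
 then obtain c where x: "x = (SUM s:S. of_int (c s) * (of_rat w * s))" unfolding zspan_def by blast
 have "of_int (c s) * (of_rat w * s) : QV.span S" if "s : S" for s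
 proof -
  have "of_rat (of_int (c s) * w) * s : QV.span S" by (rule QV.span_scale[OF QV.span_base[OF that]])
  thus ?thesis by (simp add: of_rat_mult mult.assoc)
 qed
 thus "x : QV.span S" unfolding x by (rule QV.span_sum)
qed

lemma zspan_mult:
 assumes S: "finite S" "!!s t. s : S ==> t : S ==> s * t : S" and x: "x : zspan 1 S" and y: "y : zspan 1 S"
 shows "x * y : zspan 1 S"
proof -
 obtain c e where xy: "x = (SUM s:S. of_int (c s) * (of_rat 1 * s))" "y = (SUM s:S. of_int (e s) * (of_rat 1 * s))"
  using x y unfolding zspan_def by blast
 have "x * y = (SUM s:S. SUM t:S. of_int (c s * e t) * (s * t))"
  unfolding xy sum_product by (simp add: mult_ac)
 also have "... : zspan 1 S" using zspan_base[OF S(1)] S(2) by (intro zspan_sum zspan_scale) auto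
 finally show ?thesis .
qed

text \<open>Subgroups of lattices of finite rank have bases. In the induction, an element
  \<open>m0\<close> whose coefficient at \<open>e\<close> is positive and minimal is added to a
  basis of the part without \<open>e\<close>; division with remainder reduces every element to that
  part.\<close>

lemma zspan_subgroup_basis:
 assumes "finite E" "QV.independent E" "w ~= 0" "M <= zspan w E" "0 : M"
  "!!u v. u : M ==> v : M ==> u + v : M" "!!k u. u : M ==> of_int k * u : M"
 shows "EX B. finite B & QV.independent B & B <= M & M <= zspan 1 B"
 using assms
proof (induction E arbitrary: M rule: finite_induct)
 case empty
 hence "M <= zspan 1 {}" by (simp add: zspan_def)
 thus ?case by (intro exI[of _ "{}"]) (simp add: QV.independent_empty)
next
 case (insert e E)
 have ind: "QV.independent E" "e ~: QV.span E"
  using insert.prems(1) insert.hyps QV.independent_insert by auto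
 define I where "I = {k. EX u:zspan w E. of_int k * (of_rat w * e) + u : M}"
 have dec: "EX k:I. EX u:zspan w E. m = of_int k * (of_rat w * e) + u" if m: "m : M" for m
 proof -
  obtain c where c: "m = (SUM s:insert e E. of_int (c s) * (of_rat w * s))"
  using m insert.prems(3) unfolding zspan_def by blast
  let ?u = "SUM s:E. of_int (c s) * (of_rat w * s)"
  have "?u : zspan w E" by (rule zspanI[OF refl])
  moreover have "m = of_int (c e) * (of_rat w * e) + ?u" unfolding c using insert.hyps by simp
  ultimately show ?thesis using m unfolding I_def by (intro bexI[of _ "c e"] bexI[of _ ?u]) auto
 qed
 show ?case
 proof (cases "I <= {0}")
  case True
  have "M <= zspan w E"
  proof
  fix m assume "m : M"
  from dec[OF this] obtain k u where "k : I" "u : zspan w E" "m = of_int k * (of_rat w * e) + u" by blast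
  thus "m : zspan w E" using True by auto
  qed
  from insert.IH[OF ind(1) insert.prems(2) this insert.prems(4-6)] show ?thesis .
 next
  case False
  then obtain k0 u0 where k0: "k0 ~= 0" "u0 : zspan w E" "of_int k0 * (of_rat w * e) + u0 : M" unfolding I_def by blast
  have "EX n::nat. n > 0 & int n : I"
  proof (cases "k0 > 0")
  case True
  thus ?thesis using k0 unfolding I_def by (intro exI[of _ "nat k0"]) auto
  next
  case False
  have "of_int (-1) * (of_int k0 * (of_rat w * e) + u0) : M" by (rule insert.prems(6)[OF k0(3)])
  moreover have "of_int (-1) * u0 : zspan w E" by (rule zspan_scale[OF k0(2)])
  ultimately have "-k0 : I" unfolding I_def by (intro CollectI bexI[of _ "of_int (-1) * u0"]) (simp_all add: algebra_simps)
  thus ?thesis using False k0(1) by (intro exI[of _ "nat (-k0)"]) auto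
  qed
  define n where "n = (LEAST n::nat. n > 0 & int n : I)"
  have n: "n > 0" "int n : I" using LeastI_ex[OF \<open>EX n::nat. n > 0 & int n : I\<close>] unfolding n_def by auto
  have min: "n <= k" if "k > 0" "int k : I" for k
  unfolding n_def by (rule Least_le) (use that in simp)
  obtain u where u: "u : zspan w E" "of_int (int n) * (of_rat w * e) + u : M" using n(2) unfolding I_def by blast
  define m0 where "m0 = of_int (int n) * (of_rat w * e) + u"
  have m0: "m0 : M" using u by (simp add: m0_def)
  let ?M = "M Int zspan w E"
  have "EX B. finite B & QV.independent B & B <= ?M & ?M <= zspan 1 B"
  by (rule insert.IH[OF ind(1) insert.prems(2)])
  (use insert.prems(4-6) zspan_zero zspan_add zspan_scale in auto)
  then obtain B where B: "finite B" "QV.independent B" "B <= ?M" "?M <= zspan 1 B" by blast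
  have BE: "QV.span B <= QV.span E"
  using B(3) zspan_subset_span[of w E] QV.span_minimal[OF _ QV.subspace_span, of B E] by blast
  have m0B: "m0 ~: QV.span B"
  proof
  assume "m0 : QV.span B"
  hence "m0 : QV.span E" using BE by blast
  hence "m0 - u : QV.span E" using u(1) zspan_subset_span by (intro QV.span_diff) auto
  hence "of_rat (of_nat n * w) * e : QV.span E" by (simp add: m0_def of_rat_mult mult.assoc)
  hence "of_rat (inverse (of_nat n * w)) * (of_rat (of_nat n * w) * e) : QV.span E" by (rule QV.span_scale)
  moreover have "of_rat (inverse (of_nat n * w)) * of_rat (of_nat n * w) = (1 :: complex)"
  unfolding of_rat_mult[symmetric] using n(1) insert.prems(2) by (subst left_inverse) simp_all
  ultimately show False using ind(2) by (metis mult.assoc mult_1)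
  qed
  have m0nB: "m0 ~: B" using m0B QV.span_base by blast
  show ?thesis
  proof (intro exI[of _ "insert m0 B"] conjI)
  show "finite (insert m0 B)" using B(1) by simp
  show "QV.independent (insert m0 B)" by (rule QV.independent_insertI[OF m0B B(2)])
  show "insert m0 B <= M" using m0 B(3) by auto
  show "M <= zspan 1 (insert m0 B)"
  proof
  fix m assume m: "m : M"
  from dec[OF m] obtain k v where kv: "k : I" "v : zspan w E" "m = of_int k * (of_rat w * e) + v" by blast
  let ?q = "k div int n"
  let ?x = "m + of_int (- ?q) * m0"
  have xM: "?x : M" by (rule insert.prems(5)[OF m insert.prems(6)[OF m0]])
  have kq: "k = int n * ?q + k mod int n" by simp
  have "(of_int k :: complex) = of_int (int n * ?q + k mod int n)" using kq by simp
  hence kc: "(of_int k :: complex) = of_nat n * of_int ?q + of_int (k mod int n)" by (simp only: of_int_add of_int_mult of_int_of_nat_eq)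
  have xe: "?x = of_int (k mod int n) * (of_rat w * e) + (v + of_int (- ?q) * u)"
  unfolding kv(3) m0_def kc by (simp add: algebra_simps)
  have vu: "v + of_int (- ?q) * u : zspan w E" by (rule zspan_add[OF kv(2) zspan_scale[OF u(1)]])
  have "k mod int n : I" unfolding I_def using xM vu xe by auto
  moreover have "0 <= k mod int n" "k mod int n < int n" using n(1) by auto
  ultimately have "k mod int n = 0" using min[of "nat (k mod int n)"] by force
  hence "?x : ?M" using xM vu xe by simp
  then obtain c where c: "?x = (SUM s:B. of_int (c s) * (of_rat 1 * s))" using B(4) unfolding zspan_def by blast
  have "m = of_int ?q * m0 + ?x" by simp
  also have "... = (SUM s:insert m0 B. of_int ((c(m0 := ?q)) s) * (of_rat 1 * s))"
  unfolding c using B(1) m0nB by (simp add: sum.insert) (rule sum.cong, auto)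
  finally show "m : zspan 1 (insert m0 B)" by (rule zspanI)
  qed
  qed
 qed
qed

lemma common_denominator:
 fixes T :: "rat set"
 assumes "finite T"
 shows "EX D::int. D > 0 & (ALL r:T. EX k::int. of_int D * r = of_int k)"
proof -
 have Z: "(EX k::int. y = of_int k) <-> y : \<int>" for y :: rat by (auto elim: Ints_cases)
 show ?thesis unfolding Z using assms
 proof (induction T rule: finite_induct)
  case (insert r T)
  then obtain D :: int where D: "D > 0" "ALL r:T. of_int D * r : \<int>" by blast
  obtain a b where r: "r = Rat.Fract a b" "b > 0" by (rule Rat_cases)
  have br: "of_int b * r = of_int a" using r by (simp add: Fract_of_int_quotient)
  have "of_int (D * b) * s : \<int>" if "s : insert r T" for s
  proof (cases "s = r")
  case True
  have "of_int (D * b) * r = of_int (D * a)" unfolding of_int_mult br[symmetric] by (simp only: mult.assoc)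
  thus ?thesis unfolding True by (simp only: Ints_of_int)
  next
  case False
  thus ?thesis using that D(2) Ints_mult[of "of_int b" "of_int D * s"] by (auto simp: mult_ac)
  qed
  thus ?case using D(1) r(2) by (intro exI[of _ "D * b"]) simp
 qed (auto intro: exI[of _ 1])
qed

lemma representation_combination:
 assumes "QV.independent B" "!!u. u : C ==> f u : QV.span B"
 shows "coord B (SUM u:C. of_rat (c u) * f u) e = (SUM u:C. c u * coord B (f u) e)"
proof -
 have "coord B (SUM u:C. of_rat (c u) * f u) = (%b. SUM u:C. coord B (of_rat (c u) * f u) b)"
  by (rule QV.representation_sum[OF assms(1) QV.span_scale[OF assms(2)]])
 also have "... = (%b. SUM u:C. c u * coord B (f u) b)"
  by (intro ext sum.cong refl) (use QV.representation_scale[OF assms] in simp)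
 finally show ?thesis by (rule fun_cong)
qed

text \<open>The elements of \<open>S\<close> are rational combinations of a maximal independent
  subset; \<open>w\<close> is the inverse of a common denominator of all coefficients.\<close>

lemma zspan_independent:
 assumes S: "finite S"
 shows "EX E w. finite E & QV.independent E & w ~= 0 & zspan 1 S <= zspan w E"
proof -
 obtain E where E: "E <= S" "QV.independent E" "S <= QV.span E" by (rule QV.maximal_independent_subset)
 have fE: "finite E" using E(1) S finite_subset by blast
 have "ALL s:S. EX r. s = (SUM e:E. of_rat (r e) * e)"
  using E(3) unfolding QV.span_finite[OF fE] by blast
 from bchoice[OF this] obtain r where r: "ALL s:S. s = (SUM e:E. of_rat (r s e) * e)" ..
 obtain D :: int where D: "D > 0" "ALL x:(%p. r (fst p) (snd p)) ` (S \<times> E). EX k::int. of_int D * x = of_int k"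
  using common_denominator[of "(%p. r (fst p) (snd p)) ` (S \<times> E)"] S fE by auto
 define w :: rat where "w = inverse (of_int D)"
 have Dw: "of_int D * w = 1" using D(1) by (simp add: w_def)
 have "s : zspan w E" if s: "s : S" for s
 proof -
  have "ALL e:E. EX k::int. of_int D * r s e = of_int k" using D(2) s by auto
  from bchoice[OF this] obtain k where k: "ALL e:E. of_int D * r s e = of_int (k e)" ..
  have "s = (SUM e:E. of_int (k e) * (of_rat w * e))"
  proof -
  have "s = (SUM e:E. of_rat (r s e) * e)" using r s by blast
  also have "... = (SUM e:E. of_int (k e) * (of_rat w * e))"
  proof (rule sum.cong[OF refl])
  fix e assume e: "e : E"
  have "r s e = of_int D * r s e * w" using Dw by (simp add: mult_ac)
  also have "... = of_int (k e) * w" using k e by simp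
  finally have "of_rat (r s e) = (of_int (k e) * of_rat w :: complex)" by (simp add: of_rat_mult)
  thus "of_rat (r s e) * e = of_int (k e) * (of_rat w * e)" by (simp add: mult.assoc)
  qed
  finally show ?thesis .
  qed
  thus ?thesis by (rule zspanI)
 qed
 hence "zspan 1 S <= zspan w E"
  by (auto simp: zspan_def[of 1] intro!: zspan_sum zspan_scale)
 moreover have "w ~= 0" using D(1) by (simp add: w_def)
 ultimately show ?thesis using fE E(2) by blast
qed

lemma span_mult_closed:
 assumes S: "finite S" "!!s t. s : S ==> t : S ==> s * t : S" and x: "x : QV.span S" and y: "y : QV.span S"
 shows "x * y : QV.span S"
proof -
 obtain c e where xy: "x = (SUM s:S. of_rat (c s) * s)" "y = (SUM s:S. of_rat (e s) * s)"
  using x y unfolding QV.span_finite[OF S(1)] by blast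
 have "x * y = (SUM s:S. SUM t:S. of_rat (c s * e t) * (s * t))"
  unfolding xy sum_product by (simp add: of_rat_mult mult_ac)
 also have "... : QV.span S" using QV.span_base S(2) by (intro QV.span_sum QV.span_scale) auto
 finally show ?thesis .
qed

text \<open>Multiplication by a nonzero element of a finite-dimensional algebra is injective, hence surjective.\<close>

lemma span_inverse_closed:
 assumes S: "finite S" "!!s t. s : S ==> t : S ==> s * t : S" "1 : S" and x: "x : QV.span S" "x ~= 0"
 shows "inverse x : QV.span S"
proof -
 obtain E where E: "E <= S" "QV.independent E" "S <= QV.span E" by (rule QV.maximal_independent_subset)
 have fE: "finite E" using E(1) S(1) finite_subset by blast
 have SE: "QV.span S = QV.span E"
  using QV.span_mono[OF E(1)] QV.span_minimal[OF E(3) QV.subspace_span] by blast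
 let ?xE = "(%e. x * e) ` E"
 have inj: "inj_on (%e. x * e) E" using x(2) by (auto intro: inj_onI)
 have ind: "QV.independent ?xE"
 proof (rule QV.independent_if_scalars_zero)
  fix f z assume f: "(SUM z:?xE. of_rat (f z) * z) = 0" and z: "z : ?xE"
  have "(SUM z:?xE. of_rat (f z) * z) = x * (SUM e:E. of_rat (f (x * e)) * e)"
  unfolding sum.reindex[OF inj] by (simp add: sum_distrib_left mult_ac)
  hence "(SUM e:E. of_rat (f (x * e)) * e) = 0" using f x(2) by simp
  hence "ALL e:E. f (x * e) = 0"
  using QV.independentD[OF E(2) fE subset_refl, of "%e. f (x * e)"] by blast
  thus "f z = 0" using z by blast
 qed (use fE in simp)
 have xES: "?xE <= QV.span S"
 proof (rule image_subsetI)
  fix e assume "e : E"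
  hence "e : S" using E(1) by auto
  hence "e : QV.span S" by (rule QV.span_base)
  with S(1,2) x(1) show "x * e : QV.span S" by (rule span_mult_closed)
 qed
 have "1 : QV.span ?xE"
 proof (rule ccontr)
  assume no: "1 ~: QV.span ?xE"
  hence "QV.independent (insert 1 ?xE)" by (rule QV.independent_insertI[OF _ ind])
  moreover have "insert 1 ?xE <= QV.span E" using xES QV.span_base[OF S(3)] unfolding SE by simp
  ultimately have "finite (insert 1 ?xE) & card (insert 1 ?xE) <= card E" by (rule QV.independent_span_bound[OF fE])
  moreover have "1 ~: ?xE" using no QV.span_base[of 1 ?xE] by argo
  ultimately show False using fE card_image[OF inj] by simp
 qed
 hence "1 : range (%u. SUM v:?xE. of_rat (u v) * v)" using QV.span_finite[OF finite_imageI[OF fE]] by simp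
 then obtain c where c: "1 = (SUM z:?xE. of_rat (c z) * z)" by (rule imageE)
 have "(SUM z:?xE. of_rat (c z) * z) = x * (SUM e:E. of_rat (c (x * e)) * e)"
  unfolding sum.reindex[OF inj] by (simp add: sum_distrib_left mult_ac)
 from trans[OF c this] have "inverse x = (SUM e:E. of_rat (c (x * e)) * e)" by (rule inverse_unique[OF sym])
 also have "... : QV.span S" by (intro QV.span_sum QV.span_scale QV.span_base) (use E(1) in auto)
 finally show ?thesis .
qed

section \<open>Traces and their integrality\<close>

definition trace_in :: "complex set => complex => rat" where
 "trace_in B x = (SUM e:B. coord B (x * e) e)"

text \<open>\<open>rat_trace\<close> is computed in an arbitrarily chosen basis, whereas integrality
  is visible only in a basis of a lattice.\<close>

lemma trace_in_basis_independent:
 assumes B: "finite B" "QV.independent B" "QV.span B = L" and C: "finite C" "QV.independent C" "QV.span C = L"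
  and x: "!!l. l : L ==> x * l : L"
 shows "trace_in B x = trace_in C x"
proof -
 have BL: "e : L" if "e : B" for e using QV.span_base that B(3) by blast
 have CL: "e : L" if "e : C" for e using QV.span_base that C(3) by blast
 have xB: "x * e : QV.span B" "x * e : QV.span C" if "e : L" for e using x[OF that] B(3) C(3) by auto
 have expB: "coord B (x * e) e = (SUM u:C. coord C e u * coord B (x * u) e)" if e: "e : B" for e
 proof -
  have "e = (SUM u:C. of_rat (coord C e u) * u)"
  using QV.sum_representation_eq[OF C(2) _ C(1) subset_refl, of e] BL[OF e] C(3) by simp
  hence "x * e = x * (SUM u:C. of_rat (coord C e u) * u)" by (rule arg_cong)
  also have "... = (SUM u:C. of_rat (coord C e u) * (x * u))"
  by (simp add: sum_distrib_left mult.left_commute)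
  finally have q: "x * e = (SUM u:C. of_rat (coord C e u) * (x * u))" .
  show ?thesis
  by (rule trans[OF arg_cong[OF q, of "%y. coord B y e"] representation_combination[OF B(2)]]) (rule xB(1)[OF CL])
 qed
 have expC: "coord C (x * u) u = (SUM e:B. coord B (x * u) e * coord C e u)" if u: "u : C" for u
 proof -
  have q: "x * u = (SUM e:B. of_rat (coord B (x * u) e) * e)"
  using QV.sum_representation_eq[OF B(2) _ B(1) subset_refl, of "x * u"] xB CL[OF u] by simp
  show ?thesis
  by (rule trans[OF arg_cong[OF q, of "%y. coord C y u"] representation_combination[OF C(2)]])
  (use BL C(3) in simp)
 qed
 have "trace_in B x = (SUM e:B. SUM u:C. coord C e u * coord B (x * u) e)"
  unfolding trace_in_def by (rule sum.cong[OF refl expB])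
 also have "... = (SUM u:C. SUM e:B. coord B (x * u) e * coord C e u)"
  by (subst sum.swap) (simp add: mult.commute)
 also have "... = trace_in C x"
  unfolding trace_in_def by (rule sum.cong[OF refl expC[symmetric]])
 finally show ?thesis .
qed

text \<open>A number field, with the order of its cyclotomic integers.\<close>

locale cyclotomic_subfield =
 fixes L :: "complex set" and S :: "complex set"
 assumes S: "finite S" "!!s t. s : S ==> t : S ==> s * t : S"
  and L_span: "L <= QV.span S" and L_subspace: "QV.subspace L" and L_mult: "!!x y. x : L ==> y : L ==> x * y : L"
  and L_one: "1 : L"
begin

definition basis :: "complex set" where
 "basis = (SOME B. ~ QV.dependent B & QV.span B = L)"

lemma basis: "finite basis" "QV.independent basis" "QV.span basis = L"
proof -
 obtain B where B: "B <= L" "QV.independent B" "L <= QV.span B" by (rule QV.maximal_independent_subset)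
 have "~ QV.dependent B & QV.span B = L" using B L_subspace QV.span_subspace by blast
 hence *: "~ QV.dependent basis & QV.span basis = L" unfolding basis_def by (rule someI)
 thus "QV.independent basis" "QV.span basis = L" by auto
 hence "basis <= QV.span S" using QV.span_superset[of basis] L_span by blast
 thus "finite basis" using QV.independent_span_bound[OF S(1)] * by blast
qed

lemma rat_trace_eq: "rat_trace L x = trace_in basis x"
 unfolding rat_trace_def trace_in_def Let_def basis_def ..

lemma rat_degree_eq: "rat_degree L = card basis"
proof -
 have "QV.span L = L" using QV.span_subspace[OF subset_refl QV.span_superset L_subspace] .
 hence "QV.span basis = QV.span L" using basis(3) by (simp only:)
 thus ?thesis unfolding rat_degree_def by (rule QV.dim_eq_card[OF _ basis(2)])
qed

lemma rat_degree_pos: "rat_degree L > 0"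
proof -
 have "basis ~= {}"
 proof
  assume "basis = {}"
  hence "L = {0}" using basis(3) by (simp add: QV.span_empty)
  thus False using L_one by simp
 qed
 thus ?thesis unfolding rat_degree_eq using basis(1) by (simp add: card_gt_0_iff)
qed

lemma basis_L: "e : basis ==> e : L"
 using QV.span_base basis(3) by blast

lemma rat_trace_sum:
 assumes "!!i. i : I ==> f i : L"
 shows "rat_trace L (SUM i:I. of_rat (c i) * f i) = (SUM i:I. c i * rat_trace L (f i))"
proof -
 have fe: "f i * e : QV.span basis" if "i : I" "e : basis" for i e
  using L_mult[OF assms[OF that(1)] basis_L[OF that(2)]] basis(3) by simp
 have "coord basis ((SUM i:I. of_rat (c i) * f i) * e) e = (SUM i:I. c i * coord basis (f i * e) e)" if e: "e : basis" for e
 proof -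
  have q: "(SUM i:I. of_rat (c i) * f i) * e = (SUM i:I. of_rat (c i) * (f i * e))" by (simp add: sum_distrib_right mult.assoc)
  show ?thesis unfolding q by (rule representation_combination[OF basis(2) fe[OF _ e]])
 qed
 hence "rat_trace L (SUM i:I. of_rat (c i) * f i) = (SUM e:basis. SUM i:I. c i * coord basis (f i * e) e)"
  unfolding rat_trace_eq trace_in_def by simp
 also have "... = (SUM i:I. SUM e:basis. c i * coord basis (f i * e) e)" by (rule sum.swap)
 finally show ?thesis unfolding rat_trace_eq trace_in_def by (simp add: sum_distrib_left)
qed

lemma rat_trace_rat: "rat_trace L (of_rat c) = c * of_nat (rat_degree L)"
proof -
 have "coord basis (of_rat c * e) e = c" if e: "e : basis" for e
  using QV.representation_scale[OF basis(2) QV.span_base[OF e], of c] QV.representation_basis[OF basis(2) e] by simp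
 hence "(SUM e:basis. coord basis (of_rat c * e) e) = (SUM e:basis. c)" by (rule sum.cong[OF refl])
 thus ?thesis unfolding rat_trace_eq trace_in_def rat_degree_eq by (simp only: sum_constant) (rule mult.commute)
qed

text \<open>Multiplication by \<open>y\<close> preserves the lattice \<open>M\<close> of those
  elements of \<open>L\<close> that are integral combinations of \<open>S\<close>. A basis of
  \<open>M\<close> is also a rational basis of \<open>L\<close>, because denominators can be
  cleared, and in it the matrix of \<open>y\<close> is integral.\<close>

lemma rat_trace_integral:
 assumes y: "y : L" "y : zspan 1 S"
 shows "EX k::int. rat_trace L y = of_int k"
proof -
 define M where "M = L Int zspan 1 S"
 obtain E w where E: "finite E" "QV.independent E" "w ~= 0" "zspan 1 S <= zspan w E" using zspan_independent[OF S(1)] by blast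
 have scaleL: "of_int k * u : L" if "u : L" for k u
  using QV.subspace_scale[OF L_subspace that, of "of_int k"] by simp
 have "EX B. finite B & QV.independent B & B <= M & M <= zspan 1 B"
 proof (rule zspan_subgroup_basis[OF E(1-3)])
  show "M <= zspan w E" "0 : M" using E(4) QV.subspace_0[OF L_subspace] zspan_zero by (auto simp: M_def)
  show "u + v : M" if "u : M" "v : M" for u v
  using that QV.subspace_add[OF L_subspace] zspan_add by (auto simp: M_def)
  show "of_int k * u : M" if "u : M" for k u
  using that scaleL zspan_scale by (auto simp: M_def)
 qed
 then obtain B where B: "finite B" "QV.independent B" "B <= M" "M <= zspan 1 B" by blast
 have spanB: "QV.span B = L"
 proof
  show "QV.span B <= L" using B(3) by (intro QV.span_minimal L_subspace) (auto simp: M_def)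
  show "L <= QV.span B"
  proof
  fix u assume u: "u : L"
  then obtain r where r: "u = (SUM s:S. of_rat (r s) * s)" using L_span unfolding QV.span_finite[OF S(1)] by blast
  obtain D :: int where D: "D > 0" "ALL x:r ` S. EX k::int. of_int D * x = of_int k"
  using common_denominator[of "r ` S"] S(1) by blast
  hence "ALL s:S. EX k::int. of_int D * r s = of_int k" by blast
  from bchoice[OF this] obtain k where k: "ALL s:S. of_int D * r s = of_int (k s)" ..
  have "of_int D * u = (SUM s:S. of_int (k s) * (of_rat 1 * s))"
  unfolding r sum_distrib_left
  proof (rule sum.cong[OF refl])
  fix s assume "s : S"
  hence "of_rat (of_int D * r s) = (of_rat (of_int (k s)) :: complex)" using k by simp
  hence "of_int D * of_rat (r s) = (of_int (k s) :: complex)" by (simp add: of_rat_mult)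
  thus "of_int D * (of_rat (r s) * s) = of_int (k s) * (of_rat 1 * s)" by (simp add: mult.assoc[symmetric])
  qed
  hence "of_int D * u : zspan 1 S" by (rule zspanI)
  hence "of_int D * u : M" using scaleL[OF u] by (simp add: M_def)
  hence "of_int D * u : QV.span B" using B(4) zspan_subset_span by blast
  hence "of_rat (inverse (of_int D)) * (of_int D * u) : QV.span B" by (rule QV.span_scale)
  thus "u : QV.span B" using D(1) by (simp add: of_rat_inverse mult.assoc[symmetric])
  qed
 qed
 have "rat_trace L y = trace_in B y"
  unfolding rat_trace_eq by (rule trace_in_basis_independent[OF basis B(1,2) spanB L_mult[OF y(1)]])
 moreover have "EX k::int. coord B (y * e) e = of_int k" if e: "e : B" for e
 proof -
  have "e : M" using e B(3) by blast
  hence "y * e : M" using L_mult[OF y(1)] zspan_mult[OF S y(2)] by (auto simp: M_def)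
  then obtain c where c: "y * e = (SUM b:B. of_int (c b) * (of_rat 1 * b))" using B(4) unfolding zspan_def by blast
  have "coord B (y * e) e = coord B (SUM b:B. of_rat (of_int (c b)) * b) e" unfolding c by simp
  also have "... = (SUM b:B. of_int (c b) * coord B b e)"
  by (rule representation_combination[OF B(2) QV.span_base])
  also have "... = (SUM b:B. of_int (c b) * (if e = b then 1 else 0))"
  by (rule sum.cong[OF refl]) (simp add: QV.representation_basis[OF B(2)])
  also have "... = (SUM b:B. of_int (c b * (if e = b then 1 else 0)))" by (rule sum.cong) auto
  finally show ?thesis by (metis of_int_sum)
 qed
 hence "ALL e:B. EX k::int. coord B (y * e) e = of_int k" by blast
 from bchoice[OF this] obtain k where k: "ALL e:B. coord B (y * e) e = of_int (k e)" ..
 ultimately have "rat_trace L y = of_int (SUM e:B. k e)" unfolding trace_in_def by simp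
 thus ?thesis by blast
qed

end

section \<open>Character fields\<close>

lemma trace_commute:
 fixes A B :: "'a::field mat"
 assumes "A : carrier_mat n n" "B : carrier_mat n n"
 shows "(SUM i<n. (A * B) $$ (i, i)) = (SUM i<n. (B * A) $$ (i, i))"
proof -
 have "(SUM i<n. (A * B) $$ (i, i)) = (SUM i<n. SUM j<n. B $$ (j, i) * A $$ (i, j))"
  using mult_mat_sum[OF assms] by (simp add: mult.commute)
 also have "... = (SUM j<n. SUM i<n. B $$ (j, i) * A $$ (i, j))" by (rule sum.swap)
 finally show ?thesis using mult_mat_sum[OF assms(2,1)] by simp
qed

text \<open>The trace is the sum of the diagonal entries of a triangular form, which are eigenvalues.\<close>

lemma (in group) character_root_of_unity_sum:
 assumes fin: "finite (cr G)" and rh: "is_rep G n rh" and x: "x : cr G"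
 shows "EX f. (ALL i<n. f i < order G) & character rh x = (SUM i<n. cis (2 * pi / order G) ^ f i)"
proof -
 have A: "rh (x [^] (k::nat)) : carrier_mat n n" "rh x : carrier_mat n n" for k
  using rh x unfolding is_rep_def by simp_all
 obtain es where es: "char_poly (rh x) = (\<Prod>a\<leftarrow>es. [:- a, 1:])" using char_poly_factorized[OF A(2)] by blast
 obtain B where B: "B : carrier_mat n n" "upper_triangular B" "similar_mat (rh x) B"
  using schur_decomposition_exists[OF A(2) es] by blast
 obtain P Q where "similar_mat_wit (rh x) B P Q" using B(3) unfolding similar_mat_def by blast
 note w = similar_mat_witD2[OF A(2) this]
 have "character rh x = (SUM i<n. (P * (B * Q)) $$ (i, i))"
  using character_eq[OF rh x] w by simp
 also have "... = (SUM i<n. (B * Q * P) $$ (i, i))" by (rule trace_commute) (use w in auto)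
 also have "B * Q * P = B" using w by simp
 finally have chi: "character rh x = (SUM i<n. B $$ (i, i))" .
 have "EX k<order G. B $$ (i, i) = cis (2 * pi / order G) ^ k" if i: "i < n" for i
 proof -
  let ?e = "B $$ (i, i)"
  have "poly (char_poly (rh x)) ?e = 0"
  unfolding char_poly_similar[OF B(3)] char_poly_upper_triangular[OF B(1,2)] poly_prod_list
  using i B(1) by (auto simp: prod_list_zero_iff diag_mat_def)
  then obtain v where v: "v : carrier_vec n" "v ~= 0\<^sub>v n" "rh x *\<^sub>v v = ?e \<cdot>\<^sub>v v"
  using eigenvalue_root_char_poly[OF A(2)] A(2) unfolding eigenvalue_def eigenvector_def by auto
  have "rh (x [^] k) *\<^sub>v v = ?e ^ k \<cdot>\<^sub>v v" for k :: nat
  proof (induction k)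
  case 0
  thus ?case using rh v(1) unfolding is_rep_def by simp
  next
  case (Suc k)
  have "rh (x [^] Suc k) = rh (x [^] k) * rh x" using rh x unfolding is_rep_def by simp
  hence "rh (x [^] Suc k) *\<^sub>v v = rh (x [^] k) *\<^sub>v (?e \<cdot>\<^sub>v v)" using assoc_mult_mat_vec[OF A v(1)] v(3) by simp
  thus ?case using mult_mat_vec[OF A(1) v(1)] Suc by (simp add: smult_smult_assoc)
  qed
  from this[of "order G"] have "v = ?e ^ order G \<cdot>\<^sub>v v" using pow_order_eq_1[OF x] rh v(1) unfolding is_rep_def by simp
  moreover obtain j where "j < n" "v $ j ~= 0" using v(1,2) by (metis carrier_vecD eq_vecI index_zero_vec)
  ultimately have "?e ^ order G = 1" using v(1) by (metis carrier_vecD index_smult_vec(1) mult_cancel_right1)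
  hence "?e : {z. z ^ order G = 1}" by simp
  also have "... = (%k. cis (2 * pi * real k / real (order G))) ` {..<order G}"
  by (rule bij_betw_imp_surj_on[OF Complex.bij_betw_roots_unity, symmetric])
  (use fin order_gt_0_iff_finite in simp)
  finally obtain k where "k < order G" "?e = cis (2 * pi * real k / real (order G))" by auto
  moreover have "cis (2 * pi * real k / real (order G)) = cis (2 * pi / order G) ^ k"
  unfolding Complex.DeMoivre by (simp add: mult.commute)
  ultimately show ?thesis by auto
 qed
 then obtain f where "ALL i<n. f i < order G & B $$ (i, i) = cis (2 * pi / order G) ^ f i" by metis
 thus ?thesis unfolding chi by (intro exI[of _ f]) simp
qed

lemma character_field_closed:
 shows "1 : character_field G rh" "!!x. x : cr G ==> character rh x : character_field G rh"
  "!!u. u : character_field G rh ==> - u : character_field G rh"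
  "!!u. u : character_field G rh ==> inverse u : character_field G rh"
  "!!u v. u : character_field G rh ==> v : character_field G rh ==> u + v : character_field G rh"
  "!!u v. u : character_field G rh ==> v : character_field G rh ==> u * v : character_field G rh"
proof -
 let ?A = "character_field G rh"
 let ?S = "character rh ` cr G"
 let ?L = "generate_field class_ring ?S"
 note g = generate_field.intros[where R = "class_ring" and H = ?S, unfolded class_ring_simps]
 show one: "1 : ?A" unfolding character_field_def by (rule g(1))
 show "character rh x : ?A" if "x : cr G" for x
  unfolding character_field_def by (rule g(2)) (use that in simp)
 show minus: "- u : ?A" if "u : ?A" for u
  using g(3) that unfolding character_field_def by blast
 show add: "u + v : ?A" if "u : ?A" "v : ?A" for u v
  using g(5) that unfolding character_field_def by blast
 show "u * v : ?A" if "u : ?A" "v : ?A" for u v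
  using g(6) that unfolding character_field_def by blast
 show "inverse u : ?A" if u: "u : ?A" for u
 proof (cases "u = 0")
  case True
  thus ?thesis using add[OF one minus[OF one]] by simp
 next
  case False
  have "m_inv class_ring u = inverse u" using False by (simp add: class_ring_simps)
  thus ?thesis using g(4)[of u] False u unfolding character_field_def by simp
 qed
qed

text \<open>Character values are sums of roots of unity of exponent \<open>order G\<close>, and the
  rational span of these roots is a field, so it contains the field generated by the values.\<close>

lemma (in group) character_field_cyclotomic:
 assumes fin: "finite (cr G)" and rh: "is_rep G n rh"
 defines "S == (%i. cis (2 * pi / order G) ^ i) ` {..<order G}"
 shows "cyclotomic_subfield (character_field G rh) S" "!!x. x : cr G ==> character rh x : zspan 1 S"
proof -
 let ?L = "character_field G rh"
 define N where "N = order G"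
 have N: "N > 0" using fin order_gt_0_iff_finite by (simp add: N_def)
 define ze where "ze = cis (2 * pi / real N)"
 have zN: "ze ^ N = 1" unfolding ze_def Complex.DeMoivre using N by simp
 have S: "S = (%i. ze ^ i) ` {..<N}" by (simp add: S_def ze_def N_def)
 have fS: "finite S" by (simp add: S)
 have multS: "s * t : S" if st: "s : S" "t : S" for s t
 proof -
  obtain i where i: "s = ze ^ i" using st(1) unfolding S by blast
  obtain j where j: "t = ze ^ j" using st(2) unfolding S by blast
  have "ze ^ (i + j) = ze ^ (N * ((i + j) div N) + (i + j) mod N)" by simp
  also have "... = ze ^ ((i + j) mod N)" unfolding power_add power_mult zN by simp
  finally show ?thesis unfolding i j S power_add[symmetric] using N by auto
 qed
 have oneS: "1 : S" unfolding S using N by (intro image_eqI[of _ _ 0]) auto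
 show chi: "character rh x : zspan 1 S" if x: "x : cr G" for x
 proof -
  obtain f where f: "ALL i<n. f i < order G" "character rh x = (SUM i<n. cis (2 * pi / order G) ^ f i)"
  using character_root_of_unity_sum[OF fin rh x] by blast
  show ?thesis unfolding f(2) by (intro zspan_sum zspan_base fS) (use f(1) in "auto simp: S_def")
 qed
 note cl = character_field_closed[where G = G and rh = rh]
 have ofint: "of_int k : ?L" for k
 proof (induction k rule: int_induct[of _ 0])
  case base
  show ?case using cl(5)[OF cl(1) cl(3)[OF cl(1)]] by simp
 next
  case (step1 i)
  thus ?case using cl(5)[OF _ cl(1), of "of_int i"] by simp
 next
  case (step2 i)
  thus ?case using cl(5)[OF _ cl(3)[OF cl(1)], of "of_int i"] by simp
 qed
 have ofrat: "of_rat q : ?L" for q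
 proof -
  obtain a b where ab: "quotient_of q = (a, b)" by (rule prod.exhaust)
  have "of_rat q = of_int a * inverse (of_int b :: complex)"
  unfolding quotient_of_div[OF ab] of_rat_divide divide_inverse of_rat_mult of_rat_inverse by simp
  thus ?thesis using cl(6)[OF ofint cl(4)[OF ofint]] by simp
 qed
 show "cyclotomic_subfield ?L S"
 proof
  show "finite S" by (rule fS)
  show "s * t : S" if "s : S" "t : S" for s t by (rule multS[OF that])
  show "1 : ?L" by (rule cl(1))
  show "x * y : ?L" if "x : ?L" "y : ?L" for x y by (rule cl(6)[OF that])
  show "QV.subspace ?L"
  proof (rule QV.subspaceI)
  show "0 : ?L" using ofint[of 0] by simp
  show "x + y : ?L" if "x : ?L" "y : ?L" for x y by (rule cl(5)[OF that])
  show "of_rat c * x : ?L" if "x : ?L" for c x by (rule cl(6)[OF ofrat that])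
  qed
  show "?L <= QV.span S"
  proof
  fix u assume "u : ?L"
  hence "u : generate_field class_ring (character rh ` cr G)" unfolding character_field_def .
  thus "u : QV.span S"
  proof (induction rule: generate_field.induct)
  case one
  thus ?case using QV.span_base[OF oneS] by (simp add: class_ring_simps)
  next
  case (incl h)
  thus ?case using chi zspan_subset_span[of 1 S] by auto
  next
  case (a_inv h)
  thus ?case using QV.span_neg by (simp add: class_ring_simps)
  next
  case (m_inv h)
  hence h: "h ~= 0" "h : QV.span S" by (simp_all add: class_ring_simps)
  have "inverse h : QV.span S" using fS multS oneS h(2,1) by (rule span_inverse_closed)
  thus ?case using h(1) by (simp add: class_ring_simps)
  next
  case (eng_add h1 h2)
  thus ?case using QV.span_add by (simp add: class_ring_simps)
  next
  case (eng_mult h1 h2)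
  hence h: "h1 : QV.span S" "h2 : QV.span S" by auto
  have "h1 * h2 : QV.span S" using fS multS h by (rule span_mult_closed)
  thus ?case by (simp add: class_ring_simps)
  qed
  qed
 qed
qed

section \<open>Fixed points and the geometric signature\<close>

context group
begin

definition conjugate :: "'a => 'a set => 'a set" where
 "conjugate a K = (%k. a *. k *. inv a) ` K"

lemma conjugate_eq_coset: "a <# K #> inv a = conjugate a K"
 unfolding conjugate_def l_coset_def r_coset_def by blast

lemma conjugate_conjugate:
 assumes "a : cr G" "b : cr G" "K <= cr G"
 shows "conjugate a (conjugate b K) = conjugate (a *. b) K"
 unfolding conjugate_def image_image
 by (rule image_cong) (use assms in "auto simp: inv_mult_group m_assoc")

lemma conjugate_subgroup:
 assumes a: "a : cr G" and K: "subgroup K G"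
 shows "subgroup (conjugate a K) G"
proof
 let ?A = "conjugate a K"
 have Kc: "!!k. k : K ==> k : cr G" using subgroup.subset[OF K] by auto
 show "?A <= cr G" using a Kc by (auto simp: conjugate_def)
 have "a *. \<one> *. inv a = \<one>" using a by simp
 thus "\<one> : ?A" unfolding conjugate_def using subgroup.one_closed[OF K] by (metis imageI)
 fix x assume "x : ?A"
 then obtain k where k: "k : K" "x = a *. k *. inv a" by (auto simp: conjugate_def)
 have "inv x = a *. inv k *. inv a" using a Kc[OF k(1)] by (simp add: k(2) inv_mult_group m_assoc)
 thus "inv x : ?A" unfolding conjugate_def using subgroup.m_inv_closed[OF K k(1)] by blast
 fix y assume "y : ?A"
 then obtain l where l: "l : K" "y = a *. l *. inv a" by (auto simp: conjugate_def)
 have "x *. y = a *. (k *. l) *. inv a" using a Kc[OF k(1)] Kc[OF l(1)] by (simp add: k(2) l(2) m_assoc cancel_inv)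
 thus "x *. y : ?A" unfolding conjugate_def using subgroup.m_closed[OF K k(1) l(1)] by blast
qed

lemma cyclic_classE:
 assumes "cyclic_class G C"
 obtains K where "subgroup K G" "C = (%a. conjugate a K) ` cr G"
proof -
 obtain x where x: "x : cr G" "C = (%a. a <# generate G {x} #> inv a) ` cr G"
  using assms unfolding cyclic_class_def by blast
 have "subgroup (generate G {x}) G" using generate_is_subgroup[of "{x}"] x(1) by simp
 thus thesis using x(2) unfolding conjugate_eq_coset by (rule that)
qed

lemma cyclic_class_subgroup: "cyclic_class G C ==> K : C ==> subgroup K G"
 by (elim cyclic_classE) (auto intro: conjugate_subgroup)

lemma cyclic_class_conjugate:
 assumes C: "cyclic_class G C" and K: "K : C" "K' : C"
 shows "EX a:cr G. K' = conjugate a K"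
proof (rule cyclic_classE[OF C])
 fix K0 assume K0: "subgroup K0 G" "C = (%a. conjugate a K0) ` cr G"
 obtain a where a: "a : cr G" "K = conjugate a K0" using K(1) K0(2) by blast
 obtain b where b: "b : cr G" "K' = conjugate b K0" using K(2) K0(2) by blast
 have "conjugate (b *. inv a) K = conjugate (b *. inv a *. a) K0"
  unfolding a(2) by (rule conjugate_conjugate) (use a b subgroup.subset[OF K0(1)] in auto)
 also have "b *. inv a *. a = b" using a b by (simp add: m_assoc)
 finally show ?thesis using a b by (intro bexI[of _ "b *. inv a"]) auto
qed

lemma cyclic_class_closed:
 assumes C: "cyclic_class G C" and K: "K : C" and a: "a : cr G"
 shows "conjugate a K : C"
proof (rule cyclic_classE[OF C])
 fix K0 assume K0: "subgroup K0 G" "C = (%a. conjugate a K0) ` cr G"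
 obtain b where b: "b : cr G" "K = conjugate b K0" using K K0(2) by blast
 have "conjugate a K = conjugate (a *. b) K0"
  unfolding b(2) by (rule conjugate_conjugate[OF a b(1) subgroup.subset[OF K0(1)]])
 thus ?thesis using K0(2) a b(1) by simp
qed

lemma cyclic_class_eq:
 assumes C: "cyclic_class G C" "cyclic_class G C'" and K: "K : C" "K : C'"
 shows "C = C'"
proof -
 have "A <= B" if "cyclic_class G A" "cyclic_class G B" "K : A" "K : B" for A B
 proof
  fix L assume "L : A"
  from cyclic_class_conjugate[OF that(1,3) this] obtain a where "a : cr G" "L = conjugate a K" ..
  thus "L : B" using cyclic_class_closed[OF that(2,4)] by simp
 qed
 thus ?thesis using C K by (metis subset_antisym)
qed

end

context curve_action
begin

lemma stabilizer_act:
 assumes a: "a : cr G" and z: "z : pts V"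
 shows "stab (ph a z) = conjugate a (stab z)"
proof
 show "conjugate a (stab z) <= stab (ph a z)"
  unfolding conjugate_def stabilizer_def using a z by (auto simp: act_mult act_inv act_closed)
 show "stab (ph a z) <= conjugate a (stab z)"
 proof
  fix x assume "x : stab (ph a z)"
  hence x: "x : cr G" "ph x (ph a z) = ph a z" by (auto simp: stabilizer_def)
  have "inv a *. x *. a : stab z"
  unfolding stabilizer_def using a z x by (simp add: act_mult act_inv act_closed)
  moreover have "x = a *. (inv a *. x *. a) *. inv a" using a x(1) by (simp add: m_assoc cancel_inv)
  ultimately show "x : conjugate a (stab z)" unfolding conjugate_def by blast
 qed
qed

text \<open>\<open>gm\<close> fixes \<open>ph a z\<close> exactly if \<open>inv a *. gm *. a\<close>
  stabilizes \<open>z\<close>, and each point of the orbit is \<open>ph a z\<close> for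
  \<open>card (stab z)\<close> elements \<open>a\<close>.\<close>

lemma fixed_on_orbit:
 assumes z: "z : pts V" and gm: "gm : cr G"
 shows "card {w : orbit G ph z. ph gm w = w} * card (stab z) = conj_count (stab z) gm"
proof -
 interpret Q: curve_quotient V G ph "cr G" 
  by (intro curve_quotient.intro curve_quotient_axioms.intro curve_action_axioms subgroup_self)
 have orb: "Q.pr z = orbit G ph z" by (simp add: Q.pr_def orbit_def)
 have ram: "Q.ramif z = card (stab z)" unfolding Q.ramif_def by (rule arg_cong[of _ _ card]) (auto simp: stabilizer_def)
 let ?W = "{w : orbit G ph z. ph gm w = w}"
 have "{a : cr G. inv a *. gm *. a : stab z} = (UN w:?W. {a : cr G. ph a z = w})"
 proof (rule Set.set_eqI)
  fix a
  show "a : {a : cr G. inv a *. gm *. a : stab z} <-> a : (UN w:?W. {a : cr G. ph a z = w})"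
  proof (cases "a : cr G")
  case True
  have "inv a *. gm *. a : stab z <-> ph (inv a) (ph gm (ph a z)) = z"
  unfolding stabilizer_def using True gm z by (simp add: act_mult act_closed)
  also have "... <-> ph gm (ph a z) = ph a z"
  proof
  assume "ph (inv a) (ph gm (ph a z)) = z"
  hence "ph a (ph (inv a) (ph gm (ph a z))) = ph a z" by simp
  thus "ph gm (ph a z) = ph a z" using act_inv'[OF True act_closed[OF gm act_closed[OF True z]]] by simp
  qed (simp add: act_inv[OF True z])
  finally show ?thesis using True by (auto simp: orbit_def)
  qed simp
 qed
 hence "conj_count (stab z) gm = card (UN w:?W. {a : cr G. ph a z = w})" by (simp add: conj_count_def)
 also have "... = (SUM w:?W. card {a : cr G. ph a z = w})"
  by (rule card_UN_disjoint) (use Q.finite_pr[of z] finite_G in "auto simp: orb")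
 also have "... = (SUM w:?W. card (stab z))"
  by (rule sum.cong[OF refl]) (use Q.card_hits[OF z] in "simp add: orb ram")
 finally show ?thesis by simp
qed

text \<open>A nontrivial element fixes only points over branch points. The fibre over a branch point
  of type \<open>C j\<close> contains a point whose stabilizer is exactly \<open>Gj j\<close>, and
  \<open>fixed_on_orbit\<close> at this point gives the summand.\<close>

lemma fixed_points_signature:
 assumes sig: "geometric_signature G ph V g t C m" and Gj: "!!j. j : {1..t} ==> Gj j : C j"
  and gm: "gm : cr G" "gm ~= \<one>"
 shows "(of_nat (card {z : pts V. ph gm z = z}) :: rat)
  = (SUM j=1..t. of_nat (m j) * of_nat (conj_count (Gj j) gm) / of_nat (card (Gj j)))"
proof -
 interpret Q: curve_quotient V G ph "cr G" 
  by (intro curve_quotient.intro curve_quotient_axioms.intro curve_action_axioms subgroup_self)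
 have orb: "Q.pr z = orbit G ph z" for z by (simp add: Q.pr_def orbit_def)
 have ram: "Q.ramif z = card (stab z)" for z
  unfolding Q.ramif_def by (rule arg_cong[of _ _ card]) (auto simp: stabilizer_def)
 let ?BP = "branch_points G ph (pts V)"
 define T where "T = (%j. {y : ?BP. ALL z:y. stab z : C j})"
 have s: "inj_on C {1..t}" "!!j. j : {1..t} ==> cyclic_class G (C j)" "finite ?BP" "card ?BP = (SUM j=1..t. m j)"
  "!!j. j : {1..t} ==> card (T j) = m j"
  using sig unfolding geometric_signature_def T_def by simp_all
 have BP: "EX z:pts V. y = orbit G ph z" if "y : ?BP" for y
  using that unfolding branch_points_def orbits_def by blast
 have self: "z : orbit G ph z" if "z : pts V" for z using Q.pr_self[OF that] by (simp add: orb)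
 have TBP: "T j <= ?BP" for j by (auto simp: T_def)
 have finite_T: "finite (T j)" for j using TBP s(3) by (rule finite_subset)
 have disj: "T i Int T j = {}" if "i : {1..t}" "j : {1..t}" "i ~= j" for i j
 proof (rule ccontr)
  assume "T i Int T j ~= {}"
  then obtain y where y: "y : T i" "y : T j" by blast
  then obtain z where z: "z : pts V" "y = orbit G ph z" using BP TBP by blast
  have "stab z : C i" "stab z : C j" using y self[OF z(1)] z(2) unfolding T_def by blast+
  hence "C i = C j" using cyclic_class_eq[OF s(2)[OF that(1)] s(2)[OF that(2)]] by blast
  thus False using s(1) that unfolding inj_on_def by blast
 qed
 \<comment> \<open>The sets \<open>T j\<close> are disjoint and the signature makes their sizes add
   up to the number of branch points, so no branch point has another type.\<close>
 have cover: "(UN j:{1..t}. T j) = ?BP"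
 proof (rule card_subset_eq[OF s(3)])
  show "(UN j:{1..t}. T j) <= ?BP" using TBP by blast
  have "card (UN j:{1..t}. T j) = (SUM j=1..t. card (T j))"
  proof (rule card_UN_disjoint)
  show "ALL i:{1..t}. finite (T i)" using finite_T by simp
  show "ALL i:{1..t}. ALL j:{1..t}. i ~= j --> T i Int T j = {}" using disj by (intro ballI impI)
  qed simp
  thus "card (UN j:{1..t}. T j) = card ?BP" using s(4,5) by simp
 qed
 let ?fix = "%y. {w : y. ph gm w = w}"
 have fixT: "of_nat (card (?fix y)) = (of_nat (conj_count (Gj j) gm) / of_nat (card (Gj j)) :: rat)"
  if j: "j : {1..t}" and y: "y : T j" for j y
 proof -
  obtain z where z: "z : pts V" "y = orbit G ph z" using BP TBP y by blast
  have "stab z : C j" using y self[OF z(1)] z(2) unfolding T_def by blast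
  from cyclic_class_conjugate[OF s(2)[OF j] this Gj[OF j]] obtain a where
  a: "a : cr G" "Gj j = conjugate a (stab z)" ..
  have az: "ph a z : pts V" by (rule act_closed[OF a(1) z(1)])
  have st: "stab (ph a z) = Gj j" using stabilizer_act[OF a(1) z(1)] a(2) by simp
  have oz: "orbit G ph (ph a z) = y" unfolding z(2) orb[symmetric] by (rule Q.pr_act[OF a(1) z(1)])
  have "card (?fix y) * card (Gj j) = conj_count (Gj j) gm" using fixed_on_orbit[OF az gm(1)] unfolding st oz .
  from arg_cong[OF this, of of_nat]
  have "(of_nat (card (?fix y)) :: rat) * of_nat (card (Gj j)) = of_nat (conj_count (Gj j) gm)" by simp
  moreover have "card (Gj j) > 0" using Q.ramif_pos[OF az] unfolding ram st .
  ultimately show ?thesis by (simp add: field_simps)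
 qed
 have "{z : pts V. ph gm z = z} = (UN y:?BP. ?fix y)"
 proof
  show "{z : pts V. ph gm z = z} <= (UN y:?BP. ?fix y)"
  proof
  fix z assume "z : {z : pts V. ph gm z = z}"
  hence z: "z : pts V" "ph gm z = z" by auto
  have "{\<one>, gm} <= stab z" using z gm act_one by (auto simp: stabilizer_def)
  moreover have "finite (stab z)" using finite_G by (simp add: stabilizer_def)
  ultimately have "card {\<one>, gm} <= card (stab z)" by (intro card_mono)
  hence 2: "2 <= card (stab z)" using gm(2) by simp
  have eq: "card (orbit G ph z) * card (stab z) = order G"
  using Q.card_pr[OF z(1)] unfolding orb ram order_def .
  have "card (orbit G ph z) > 0" using Q.finite_pr[of z] self[OF z(1)] unfolding orb by (auto simp: card_gt_0_iff)
  hence "card (orbit G ph z) * 1 < card (orbit G ph z) * card (stab z)" using 2 by (intro mult_strict_left_mono) auto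
  hence "card (orbit G ph z) < order G" using eq by simp
  hence "orbit G ph z : ?BP" unfolding branch_points_def orbits_def using z(1) by blast
  thus "z : (UN y:?BP. ?fix y)" using self[OF z(1)] z(2) by blast
  qed
  show "(UN y:?BP. ?fix y) <= {z : pts V. ph gm z = z}"
  using BP Q.pr_subset unfolding orb by blast
 qed
 hence "card {z : pts V. ph gm z = z} = card (UN y:?BP. ?fix y)" by simp
 also have "... = (SUM y:?BP. card (?fix y))"
 proof (rule card_UN_disjoint[OF s(3)])
  show "ALL y:?BP. finite (?fix y)"
  proof
  fix y assume "y : ?BP"
  then obtain z where "y = orbit G ph z" using BP by blast
  thus "finite (?fix y)" using Q.finite_pr[of z] by (simp add: orb)
  qed
  show "ALL x:?BP. ALL y:?BP. x ~= y --> ?fix x Int ?fix y = {}"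
  proof (intro ballI impI)
  fix x y assume xy: "x : ?BP" "y : ?BP" "x ~= y"
  obtain u v where uv: "u : pts V" "x = Q.pr u" "v : pts V" "y = Q.pr v" using BP[OF xy(1)] BP[OF xy(2)] unfolding orb by blast
  show "?fix x Int ?fix y = {}"
  proof (rule ccontr)
  assume "?fix x Int ?fix y ~= {}"
  then obtain w where "w : Q.pr u" "w : Q.pr v" using uv by blast
  hence "x = y" using Q.pr_mem_eq[OF uv(1)] Q.pr_mem_eq[OF uv(3)] uv by metis
  thus False using xy(3) by simp
  qed
  qed
 qed
 also have "... = (SUM j=1..t. SUM y:T j. card (?fix y))"
  unfolding cover[symmetric]
 proof (rule sum.UNION_disjoint)
  show "ALL i:{1..t}. finite (T i)" using finite_T by simp
  show "ALL i:{1..t}. ALL j:{1..t}. i ~= j --> T i Int T j = {}" using disj by (intro ballI impI)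
 qed simp
 finally have "(of_nat (card {z : pts V. ph gm z = z}) :: rat) = (SUM j=1..t. SUM y:T j. of_nat (card (?fix y)))" by simp
 also have "... = (SUM j=1..t. SUM y:T j. of_nat (conj_count (Gj j) gm) / of_nat (card (Gj j)))"
  by (intro sum.cong refl fixT)
 also have "... = (SUM j=1..t. of_nat (m j) * of_nat (conj_count (Gj j) gm) / of_nat (card (Gj j)))"
  by (rule sum.cong[OF refl]) (simp add: s(5))
 finally show ?thesis .
qed

end

context hecke_curve
begin

lemma sum_dcosets: "(SUM i=1..d. SUM gm:dcoset i. f gm) = (SUM gm:cr G. f gm)"
 unfolding dcoset_cover
proof (rule sum.UNION_disjoint[symmetric])
 show "ALL i:{1..d}. finite (dcoset i)" using double_coset_curve.finite_D[OF double_coset_curve] by blast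
 show "ALL i:{1..d}. ALL j:{1..d}. i ~= j --> dcoset i Int dcoset j = {}" using dcoset_inj by blast
qed simp

theorem kanev_intersection:
 assumes sig: "geometric_signature G ph V g0 t C m" and Gj: "!!j. j : {1..t} ==> Gj j : C j"
  and B: "!!i gm. i : {1..d} ==> gm : dcoset i ==> B gm = (of_int (c i) :: rat)" and b: "kanev_gcd d c ~= 0"
 shows "of_nat (card H) * of_int (intersection_number (product_space X X) (kanev_correspondence G H ph V d n g c) (diagonal_divisor X))
  = (SUM j=1..t. of_nat (m j) / of_nat (card (Gj j)) *
  ((of_int (c 1) * of_nat (SUM gm:cr G. conj_count (Gj j) gm) - (SUM gm:cr G. of_nat (conj_count (Gj j) gm) * B gm))
  / of_int (kanev_gcd d c)
  - of_nat (SUM gm:cr G. conj_count (Gj j) gm) + of_nat (SUM gm:H. conj_count (Gj j) gm)))"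
proof -
 let ?b = "kanev_gcd d c"
 let ?k = "%i. if i = 1 then 0 else (c 1 - c i - ?b) div ?b"
 \<comment> \<open>The coefficient attached to the double coset of \<open>gm\<close>, extended to
   the whole group. On \<open>H\<close> it is -1, whereas the diagonal has coefficient 0; the sum
   over the group is corrected for this below.\<close>
 define e where "e = (%gm. (of_int (c 1) - B gm) / of_int ?b - 1)"
 define F where "F = (%gm. card {z : pts V. ph gm z = z})"
 define N where "N = (%j gm. of_nat (conj_count (Gj j) gm) :: rat)"
 have kb: "of_int (?k i) = e gm" if i: "i : {2..d}" and gm: "gm : dcoset i" for i gm
 proof -
  have "?b dvd c 1 - c i" unfolding kanev_gcd_def using i by (intro Gcd_dvd) auto
  hence "?b dvd c 1 - c i - ?b" by simp
  hence "(of_int ((c 1 - c i - ?b) div ?b) :: rat) = of_int (c 1 - c i - ?b) / of_int ?b" by (rule of_int_div)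
  also have "... = e gm" using B[of i gm] i gm b by (simp add: e_def diff_divide_distrib)
  finally show ?thesis using i by simp
 qed
 have ne1: "gm ~= \<one>" if i: "i : {2..d}" and gm: "gm : dcoset i" for i gm
 proof -
  have i1: "i : {1..d}" using i by auto
  have "gm ~: H" by (rule double_coset_curve.D_not_H[OF double_coset_curve[OF i1] g_not_H[OF i] gm])
  thus ?thesis using H_one by blast
 qed
 have dcG: "gm : cr G" if "i : {2..d}" "gm : dcoset i" for i gm
  using double_coset_curve.D_carrier[OF double_coset_curve, of i] that by auto
 have "(of_nat (card H) * of_int (intersection_number (product_space X X) (kanev_correspondence G H ph V d n g c) (diagonal_divisor X)) :: rat)
  = of_int (int (card H) * intersection_number (product_space X X) (correspondence ?k) (diagonal_divisor X))"
  unfolding kanev_correspondence_eq by simp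
 also have "... = of_int (SUM i=2..d. ?k i * (SUM gm:dcoset i. int (F gm)))"
  unfolding F_def by (subst intersection_number_diagonal) simp_all
 also have "... = (SUM i=2..d. SUM gm:dcoset i. of_int (?k i) * of_nat (F gm))"
  by (simp add: sum_distrib_left)
 also have "... = (SUM i=2..d. SUM gm:dcoset i. SUM j=1..t. of_nat (m j) / of_nat (card (Gj j)) * (N j gm * e gm))"
 proof (intro sum.cong[OF refl])
  fix i gm assume i: "i : {2..d}" and gm: "gm : dcoset i"
  have "(of_nat (F gm) :: rat) = (SUM j=1..t. of_nat (m j) * N j gm / of_nat (card (Gj j)))"
  unfolding F_def N_def by (rule fixed_points_signature[OF sig _ dcG[OF i gm] ne1[OF i gm]]) (rule Gj)
  hence "e gm * of_nat (F gm) = (SUM j=1..t. e gm * (of_nat (m j) * N j gm / of_nat (card (Gj j))))"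
  by (simp only: sum_distrib_left)
  thus "of_int (?k i) * of_nat (F gm) = (SUM j=1..t. of_nat (m j) / of_nat (card (Gj j)) * (N j gm * e gm))"
  unfolding kb[OF i gm] by (simp only: times_divide_eq_left times_divide_eq_right mult_ac)
 qed
 also have "... = (SUM i=2..d. SUM j=1..t. of_nat (m j) / of_nat (card (Gj j)) * (SUM gm:dcoset i. N j gm * e gm))"
  unfolding sum_distrib_left by (intro sum.cong[OF refl] sum.swap)
 also have "... = (SUM j=1..t. of_nat (m j) / of_nat (card (Gj j)) * (SUM i=2..d. SUM gm:dcoset i. N j gm * e gm))"
  unfolding sum_distrib_left by (rule sum.swap)
 also have "... = (SUM j=1..t. of_nat (m j) / of_nat (card (Gj j)) *
  ((of_int (c 1) * of_nat (SUM gm:cr G. conj_count (Gj j) gm) - (SUM gm:cr G. of_nat (conj_count (Gj j) gm) * B gm))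
  / of_int ?b
  - of_nat (SUM gm:cr G. conj_count (Gj j) gm) + of_nat (SUM gm:H. conj_count (Gj j) gm)))"
 proof (rule sum.cong[OF refl])
  fix j
  have "{1..d} = insert 1 {2..d}" using d_pos by auto
  hence "(SUM gm:cr G. N j gm * e gm) = (SUM gm:dcoset 1. N j gm * e gm) + (SUM i=2..d. SUM gm:dcoset i. N j gm * e gm)"
  unfolding sum_dcosets[symmetric] by simp
  moreover have "(SUM gm:dcoset 1. N j gm * e gm) = - (SUM gm:H. N j gm)"
  proof -
  have "(SUM gm:dcoset 1. N j gm * e gm) = (SUM gm:dcoset 1. - N j gm)"
  by (rule sum.cong[OF refl]) (use B[OF d_pos] in "simp add: e_def")
  thus ?thesis unfolding dcoset_1 by (simp add: sum_negf)
  qed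
  moreover have "(SUM gm:cr G. N j gm * e gm)
  = (of_int (c 1) * (SUM gm:cr G. N j gm) - (SUM gm:cr G. N j gm * B gm)) / of_int ?b - (SUM gm:cr G. N j gm)"
  proof -
  have "(SUM gm:cr G. N j gm * e gm) = (SUM gm:cr G. (of_int (c 1) * N j gm - N j gm * B gm) / of_int ?b - N j gm)"
  by (rule sum.cong[OF refl]) (simp add: e_def right_diff_distrib left_diff_distrib mult.commute)
  thus ?thesis by (simp add: sum_subtractf sum_divide_distrib[symmetric] sum_distrib_left)
  qed
  ultimately have "(SUM i=2..d. SUM gm:dcoset i. N j gm * e gm)
  = (of_int (c 1) * (SUM gm:cr G. N j gm) - (SUM gm:cr G. N j gm * B gm)) / of_int ?b - (SUM gm:cr G. N j gm) + (SUM gm:H. N j gm)"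
  by simp
  thus "of_nat (m j) / of_nat (card (Gj j)) * (SUM i=2..d. SUM gm:dcoset i. N j gm * e gm) = of_nat (m j) / of_nat (card (Gj j)) *
  ((of_int (c 1) * of_nat (SUM gm:cr G. conj_count (Gj j) gm) - (SUM gm:cr G. of_nat (conj_count (Gj j) gm) * B gm))
  / of_int ?b
  - of_nat (SUM gm:cr G. conj_count (Gj j) gm) + of_nat (SUM gm:H. conj_count (Gj j) gm))"
  by (simp add: N_def)
 qed
 finally show ?thesis .
qed

end

section \<open>The Kanev numbers\<close>

text \<open>\<open>M\<close> stands for \<open>m j\<close>, \<open>K\<close> for the order of
  \<open>Gj j\<close>, \<open>R\<close> for \<open>r\<close>, \<open>h\<close> and \<open>G\<close>
  for the orders of the groups \<open>H\<close> and \<open>G\<close>, \<open>l\<close> for the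
  degree of \<open>L\<close>, \<open>F\<close> for the sum of the dimensions of the spaces fixed by
  \<open>Gj j\<close>, \<open>e\<close> for the common dimension of the representations,
  \<open>b\<close> for the gcd and \<open>D\<close> for the number of double cosets.\<close>

lemma intersection_arithmetic:
 fixes M K R h l G F e b D :: rat
 assumes "K ~= 0" "h ~= 0" "b ~= 0" "e ~= 0"
 shows "M / K * ((R * h * l * (G * K) - h * G * K * l * F / e) / b - G * K + h * K * D)
  = h * (M * (G / (b * e) * l * (R * e - F) - (G / h - D)))"
proof -
 let ?A = "(R * e - F)" and ?B = "(R * h * l * (G * K) - h * G * K * l * F / e)"
 define X where "X = h * G * l * (?A / e) / b"
 have "K * (h * G * l * (?A / e)) = K * (h * G * l) * R * (e / e) - K * (h * G * l) * F / e"
  by (simp add: right_diff_distrib diff_divide_distrib)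
 hence 1: "R * h * l * (G * K) - h * G * K * l * F / e = K * (h * G * l * (?A / e))"
  using assms(4) by (simp add: mult_ac)
 have "?B / b - G * K + h * K * D = K * (X - G + h * D)"
  unfolding 1 X_def by (simp add: distrib_left right_diff_distrib mult_ac)
 hence "M / K * (?B / b - G * K + h * K * D) = M * (X - G + h * D)"
  using assms(1) by simp
 also have "X = h * (G / (b * e) * l * ?A)" unfolding X_def by (simp add: mult_ac)
 also have "h * (G / (b * e) * l * ?A) - G + h * D = h * (G / (b * e) * l * ?A - (G / h - D))"
  using assms(2) by (simp add: right_diff_distrib)
 finally show ?thesis by (simp only: mult.left_commute)
qed

context hecke_curve
begin

text \<open>For \<open>gm = a *. g i 1 *. b\<close> the factor \<open>inv a\<close> is moved to the
  front by \<open>character_commute\<close>, and the sum over \<open>H\<close> absorbs both factors.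
  The function \<open>f\<close> will be the trace to the rationals.\<close>

lemma character_sum_dcoset:
 assumes rh: "is_rep G k rh" and i: "i : {1..d}" and gm: "gm : dcoset i"
 shows "(SUM h:H. f (chi rh (h *. inv gm))) = (SUM h:H. f (chi rh (h *. inv (g i 1))))"
proof (rule double_coset_curve.DE[OF double_coset_curve[OF i] gm])
 fix a b assume ab: "a : H" "b : H" "gm = a *. g i 1 *. b"
 have gc: "g i 1 : cr G" by (rule g_carrier[OF i n_pos[OF i]])
 note c = H_carrier[OF ab(1)] H_carrier[OF ab(2)] gc
 show ?thesis
 proof (rule sum.reindex_bij_witness[of _ "%h. a *. h *. b" "%h. inv a *. h *. inv b"])
  fix h assume h: "h : H"
  have hc: "h : cr G" by (rule H_carrier[OF h])
  show "a *. (inv a *. h *. inv b) *. b = h" "inv a *. (a *. h *. b) *. inv b = h" using c hc by (simp_all add: m_assoc cancel_inv)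
  show "inv a *. h *. inv b : H" "a *. h *. b : H" using ab h by (simp_all add: H_mult H_inv)
  have "h *. inv gm = (h *. inv b *. inv (g i 1)) *. inv a" unfolding ab(3) using c hc by (simp add: inv_mult_group m_assoc)
  hence "chi rh (h *. inv gm) = chi rh (inv a *. (h *. inv b *. inv (g i 1)))"
  using character_commute[OF rh, of "h *. inv b *. inv (g i 1)" "inv a"] c hc by simp
  also have "inv a *. (h *. inv b *. inv (g i 1)) = (inv a *. h *. inv b) *. inv (g i 1)" using c hc by (simp add: m_assoc)
  finally show "f (chi rh (inv a *. h *. inv b *. inv (g i 1))) = f (chi rh (h *. inv gm))" by simp
 qed
qed

end

locale kanev_curve = hecke_curve V G ph H d n g
 for V :: "('p, 'k::field_char_0) function_space" and G :: "('g, 'm) monoid_scheme" (structure) and ph H d n g +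
 fixes r :: nat and dimV :: "nat => nat" and rh :: "nat => 'g => complex mat" and e :: nat and L :: "complex set"
 assumes r_pos: "1 <= r" and irr: "k : {1..r} ==> irreducible_rep G (dimV k) (rh k)"
  and star: "hypothesis_star G H r dimV rh e L"
begin

definition bi :: "nat => int" where "bi = (%i. SUM k=1..r. kanev_a G H L (rh k) (g i 1))"

text \<open>Extends the numbers \<open>bi\<close> from representatives to all of the group, with
  rational values so that no rounding enters; \<open>B_dcoset\<close> relates the two.\<close>

definition B :: "'g => rat" where "B gm = (SUM k=1..r. SUM h:H. rat_trace L (chi (rh k) (h *. inv gm)))"

lemma dimV: "k : {1..r} ==> dimV k = e" and L: "k : {1..r} ==> character_field G (rh k) = L"
 and fixed_H: "k : {1..r} ==> fixed_dim e (rh k) H = 1"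
 and fixed_0: "subgroup K G ==> H \<subset> K ==> EX k:{1..r}. fixed_dim e (rh k) K = 0"
proof -
 note star = star[unfolded hypothesis_star_def]
 note s = star[THEN conjunct1] star[THEN conjunct2, THEN conjunct1] star[THEN conjunct2, THEN conjunct2, THEN conjunct1]
  star[THEN conjunct2, THEN conjunct2, THEN conjunct2]
 show "k : {1..r} ==> dimV k = e" "k : {1..r} ==> character_field G (rh k) = L" using s(1,2) by simp_all
 show "k : {1..r} ==> fixed_dim e (rh k) H = 1" using s(1,3) by simp
 show "EX k:{1..r}. fixed_dim e (rh k) K = 0" if "subgroup K G" "H \<subset> K"
 proof -
  obtain k where "k : {1..r}" "fixed_dim (dimV k) (rh k) K = 0" using s(4) \<open>subgroup K G\<close> \<open>H \<subset> K\<close> by blast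
  thus ?thesis using s(1) by (intro bexI[of _ k]) simp_all
 qed
qed

lemma irr_e: "k : {1..r} ==> irreducible_rep G e (rh k)"
 using irr dimV by metis

lemma rep_e: "k : {1..r} ==> is_rep G e (rh k)"
 using irr_e unfolding irreducible_rep_def by blast

lemma e_pos: "e > 0"
 using irr_e[of 1] r_pos unfolding irreducible_rep_def by simp

lemma L_field: obtains S where "cyclotomic_subfield L S" "!!k x. k : {1..r} ==> x : cr G ==> chi (rh k) x : zspan 1 S"
proof
 have 1: "1 : {1..r}" using r_pos by simp
 show "cyclotomic_subfield L ((%i. cis (2 * pi / order G) ^ i) ` {..<order G})"
  using character_field_cyclotomic(1)[OF finite_G rep_e[OF 1]] L[OF 1] by simp
 show "chi (rh k) x : zspan 1 ((%i. cis (2 * pi / order G) ^ i) ` {..<order G})" if "k : {1..r}" "x : cr G" for k x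
  by (rule character_field_cyclotomic(2)[OF finite_G rep_e[OF that(1)] that(2)])
qed

lemma character_L: "k : {1..r} ==> x : cr G ==> chi (rh k) x : L"
 using character_field_closed(2)[of x G "rh k"] L by simp

lemma rat_degree_pos: "rat_degree L > 0"
 by (rule L_field) (rule cyclotomic_subfield.rat_degree_pos)

lemma rat_trace_sum: "(!!i. i : I ==> f i : L) ==> rat_trace L (SUM i:I. of_rat (c i) * f i) = (SUM i:I. c i * rat_trace L (f i))"
 by (rule L_field) (rule cyclotomic_subfield.rat_trace_sum)

lemma rat_trace_rat: "rat_trace L (of_rat c) = c * of_nat (rat_degree L)"
 by (rule L_field) (rule cyclotomic_subfield.rat_trace_rat)

lemma rat_trace_character: "k : {1..r} ==> x : cr G ==> EX z::int. rat_trace L (chi (rh k) x) = of_int z"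
 by (rule L_field) (rule cyclotomic_subfield.rat_trace_integral[OF _ character_L])

lemma B_dcoset:
 assumes i: "i : {1..d}" and gm: "gm : dcoset i"
 shows "B gm = of_int (bi i)"
proof -
 have "(SUM h:H. rat_trace L (chi (rh k) (h *. inv gm))) = of_int (kanev_a G H L (rh k) (g i 1))" if k: "k : {1..r}" for k
 proof -
  have gc: "g i 1 : cr G" by (rule g_carrier[OF i n_pos[OF i]])
  have "ALL h:H. EX z::int. rat_trace L (chi (rh k) (h *. inv (g i 1))) = of_int z"
  using rat_trace_character[OF k] H_carrier gc by simp
  from bchoice[OF this] obtain z where z: "ALL h:H. rat_trace L (chi (rh k) (h *. inv (g i 1))) = of_int (z h)" ..
  hence eq: "(SUM h:H. rat_trace L (chi (rh k) (h *. inv (g i 1)))) = of_int (SUM h:H. z h)" by simp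
  show ?thesis unfolding kanev_a_def character_sum_dcoset[OF rep_e[OF k] i gm] eq floor_of_int ..
 qed
 thus ?thesis unfolding B_def bi_def by simp
qed

text \<open>The complex identity \<open>sum_character_conj_count\<close> has a rational right-hand
  side, which the trace from \<open>L\<close> multiplies by \<open>rat_degree L\<close>; on the left
  the trace passes into the sum. The space fixed by \<open>H\<close> contributes the factor 1 by
  hypothesis.\<close>

lemma sum_B:
 assumes K: "subgroup K G"
 shows "of_nat e * (SUM gm:cr G. of_nat (conj_count K gm) * B gm)
  = of_nat (card H * order G * card K * rat_degree L) * of_nat (SUM k=1..r. fixed_dim e (rh k) K)"
proof -
 have one: "of_nat e * (SUM gm:cr G. of_nat (conj_count K gm) * (SUM h:H. rat_trace L (chi (rh k) (h *. inv gm))))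
  = of_nat (card H * order G * card K * rat_degree L) * of_nat (fixed_dim e (rh k) K)" if k: "k : {1..r}" for k
 proof -
  \<comment> \<open>A single sum over pairs with rational coefficients is the form in which
    \<open>rat_trace_sum\<close> applies.\<close>
  let ?I = "cr G \<times> H"
  let ?x = "%p. snd p *. inv (fst p)"
  let ?s = "SUM p:?I. of_rat (of_nat (e * conj_count K (fst p))) * chi (rh k) (?x p)"
  have "?s = (SUM p:?I. of_nat e * (of_nat (conj_count K (fst p)) * chi (rh k) (?x p)))"
  unfolding of_rat_of_nat_eq by (simp only: of_nat_mult mult.assoc)
  also have "... = (SUM gm:cr G. SUM h:H. of_nat e * (of_nat (conj_count K gm) * chi (rh k) (h *. inv gm)))"
  by (simp only: sum.cartesian_product' fst_conv snd_conv)
  also have "... = of_nat e * (SUM gm:cr G. of_nat (conj_count K gm) * (SUM h:H. chi (rh k) (h *. inv gm)))"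
  by (simp only: sum_distrib_left)
  also have "... = of_nat (card H * fixed_dim e (rh k) H * (order G * (card K * fixed_dim e (rh k) K)))"
  by (rule sum_character_conj_count[OF finite_G irr_e[OF k] subgroup_H K])
  also have "... = of_rat (of_nat (card H * fixed_dim e (rh k) H * (order G * (card K * fixed_dim e (rh k) K))))"
  by (simp only: of_rat_of_nat_eq)
  finally have s: "?s = of_rat (of_nat (card H * fixed_dim e (rh k) H * (order G * (card K * fixed_dim e (rh k) K))))" .
  have "rat_trace L ?s = (SUM p:?I. of_nat (e * conj_count K (fst p)) * rat_trace L (chi (rh k) (?x p)))"
  by (rule rat_trace_sum) (use character_L[OF k] H_carrier in auto)
  also have "... = (SUM p:?I. of_nat e * (of_nat (conj_count K (fst p)) * rat_trace L (chi (rh k) (?x p))))"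
  by (simp only: of_nat_mult mult.assoc)
  also have "... = (SUM gm:cr G. SUM h:H. of_nat e * (of_nat (conj_count K gm) * rat_trace L (chi (rh k) (h *. inv gm))))"
  by (simp only: sum.cartesian_product' fst_conv snd_conv)
  also have "... = of_nat e * (SUM gm:cr G. of_nat (conj_count K gm) * (SUM h:H. rat_trace L (chi (rh k) (h *. inv gm))))"
  by (simp only: sum_distrib_left)
  finally have "of_nat e * (SUM gm:cr G. of_nat (conj_count K gm) * (SUM h:H. rat_trace L (chi (rh k) (h *. inv gm))))
  = of_nat (card H * fixed_dim e (rh k) H * (order G * (card K * fixed_dim e (rh k) K))) * of_nat (rat_degree L)"
  unfolding s rat_trace_rat by (rule sym)
  thus ?thesis unfolding fixed_H[OF k] of_nat_mult of_nat_1 mult_1_right by (simp only: mult_ac)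
 qed
 have "of_nat e * (SUM gm:cr G. of_nat (conj_count K gm) * B gm)
  = of_nat e * (SUM gm:cr G. SUM k=1..r. of_nat (conj_count K gm) * (SUM h:H. rat_trace L (chi (rh k) (h *. inv gm))))"
  unfolding B_def sum_distrib_left ..
 also have "... = (SUM k=1..r. of_nat e * (SUM gm:cr G. of_nat (conj_count K gm) * (SUM h:H. rat_trace L (chi (rh k) (h *. inv gm)))))"
  unfolding sum_distrib_left[of "of_nat e :: rat" _ "{1..r}", symmetric] by (subst sum.swap) (rule refl)
 also have "... = (SUM k=1..r. of_nat (card H * order G * card K * rat_degree L) * of_nat (fixed_dim e (rh k) K))"
  by (rule sum.cong[OF refl one])
 finally show ?thesis by (simp add: sum_distrib_left)
qed

text \<open>The values of each character over \<open>H\<close> add up to \<open>card H\<close>,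
  since the fixed space is a line, and the trace of a rational number brings in the degree.\<close>

lemma bi_1: "of_int (bi 1) = (of_nat (r * card H * rat_degree L) :: rat)"
proof -
 have "(SUM h:H. rat_trace L (chi (rh k) (h *. inv \<one>))) = of_nat (card H * rat_degree L)" if k: "k : {1..r}" for k
 proof -
  have "(SUM h:H. rat_trace L (chi (rh k) (h *. inv \<one>))) = (SUM h:H. 1 * rat_trace L (chi (rh k) h))"
  by (rule sum.cong[OF refl]) (simp add: H_carrier)
  also have "... = rat_trace L (SUM h:H. of_rat 1 * chi (rh k) h)"
  by (rule rat_trace_sum[symmetric]) (use character_L[OF k] H_carrier in auto)
  also have "(SUM h:H. of_rat 1 * chi (rh k) h) = of_rat (of_nat (card H))"
  using fixed_dim_sum(1)[OF rep_e[OF k] subgroup_H finite_H] fixed_H[OF k] by simp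
  finally show ?thesis unfolding rat_trace_rat by simp
 qed
 hence "B \<one> = of_nat (r * card H * rat_degree L)" unfolding B_def by simp
 moreover have "\<one> : dcoset 1" using H_one by (simp only: dcoset_1)
 ultimately show ?thesis using B_dcoset[OF d_pos] by simp
qed

text \<open>If all \<open>bi\<close> agree, \<open>B\<close> is constant with the value from
  \<open>bi_1\<close>, and \<open>sum_B\<close> for the whole group forces the dimensions of the
  spaces fixed by \<open>G\<close> to add up to \<open>r * e\<close>. If \<open>H\<close> were a
  proper subgroup, one of them would be 0 by hypothesis while none exceeds \<open>e\<close>. So the
  gcd vanishes only as the gcd of an empty set.\<close>

lemma kanev_gcd_eq_0:
 assumes "kanev_gcd d bi = 0"
 shows "H = cr G"
proof (rule ccontr)
 let ?A = "(r * card H * rat_degree L)"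
 assume "H ~= cr G"
 hence sub: "H \<subset> cr G" using H_carrier by blast
 have eq: "B gm = of_int (bi 1)" if gm: "gm : cr G" for gm
 proof -
  have "gm : (UN i:{1..d}. dcoset i)" using gm unfolding dcoset_cover .
  then obtain i where i: "i : {1..d}" "gm : dcoset i" by (rule UN_E)
  have "bi i = bi 1"
  proof (cases "i = 1")
  case False
  hence "i : {2..d}" using i(1) by auto
  hence "bi 1 - bi i : (%i. bi 1 - bi i) ` {2..d}" by (rule imageI)
  hence "bi 1 - bi i = 0" using assms unfolding kanev_gcd_def Gcd_0_iff by (auto simp only: subset_iff singleton_iff)
  thus ?thesis by simp
  qed simp
  thus ?thesis using B_dcoset[OF i] by simp
 qed
 define A where "A = card H * order G * order G * rat_degree L"
 have "(SUM gm:cr G. of_nat (conj_count (cr G) gm) * B gm) = (SUM gm:cr G. of_nat (order G) * of_nat ?A)"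
  by (rule sum.cong[OF refl]) (simp only: conj_count_carrier eq bi_1)
 also have "... = of_nat (order G) * (of_nat (order G) * of_nat ?A)"
  unfolding sum_constant order_def ..
 finally have "(SUM gm:cr G. of_nat (conj_count (cr G) gm) * B gm) = of_nat (order G) * (of_nat (order G) * of_nat ?A)" .
 with sum_B[OF subgroup_self]
 have "of_nat e * (of_nat (order G) * (of_nat (order G) * of_nat ?A))
  = (of_nat (card H * order G * card (cr G) * rat_degree L) * of_nat (SUM k=1..r. fixed_dim e (rh k) (cr G)) :: rat)"
  by (simp only:)
 hence "e * (order G * (order G * ?A))
  = card H * order G * card (cr G) * rat_degree L * (SUM k=1..r. fixed_dim e (rh k) (cr G))"
  unfolding of_nat_mult[symmetric] of_nat_eq_iff .
 hence "A * (r * e) = A * (SUM k=1..r. fixed_dim e (rh k) (cr G))"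
  unfolding A_def order_def by (simp only: mult_ac)
 moreover have "A > 0"
 proof -
  have "card H > 0" using finite_H H_one by (auto simp: card_gt_0_iff)
  moreover have "order G > 0" using order_gt_0_iff_finite finite_G by simp
  ultimately show ?thesis unfolding A_def using rat_degree_pos by simp
 qed
 ultimately have sum: "(SUM k=1..r. fixed_dim e (rh k) (cr G)) = r * e" by simp
 obtain k0 where k0: "k0 : {1..r}" "fixed_dim e (rh k0) (cr G) = 0" using fixed_0[OF subgroup_self sub] by blast
 have "(SUM k=1..r. fixed_dim e (rh k) (cr G)) < (SUM k=1..r. e)"
 proof (rule sum_strict_mono_ex1)
  show "ALL k:{1..r}. fixed_dim e (rh k) (cr G) <= e"
  using fixed_dim_sum(2)[OF rep_e subgroup_self finite_G] by blast
  show "EX k:{1..r}. fixed_dim e (rh k) (cr G) < e" using k0(2) e_pos by (intro bexI[OF _ k0(1)]) simp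
 qed simp
 thus False using sum by simp
qed

theorem kanev_fixed_points:
 assumes sig: "geometric_signature G ph V g0 t C m" and Gj: "!!j. j : {1..t} ==> Gj j : C j"
 defines "q == of_nat (order G) / (of_int (kanev_gcd d bi) * of_nat e)"
 shows "of_int (intersection_number (product_space X X) (kanev_correspondence G H ph V d n g bi) (diagonal_divisor X))
  = (SUM j=1..t. of_nat (m j) *
  (q * of_nat (rat_degree L) * (SUM i=1..r. of_nat e - of_nat (fixed_dim e (rh i) (Gj j)))
  - (of_nat (card (rcosets H)) - of_nat (card (double_cosets G H (Gj j))))) :: rat)"
proof -
 let ?A = "card (rcosets H)" and ?B = "kanev_gcd d bi"
 let ?T = "%j. q * of_nat (rat_degree L) * (SUM i=1..r. of_nat e - of_nat (fixed_dim e (rh i) (Gj j)))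
  - (of_nat (?A) - of_nat (card (double_cosets G H (Gj j)))) :: rat"
 let ?I = "intersection_number (product_space X X) (kanev_correspondence G H ph V d n g bi) (diagonal_divisor X)"
 have sub: "subgroup (Gj j) G" if "j : {1..t}" for j
  using cyclic_class_subgroup[OF _ Gj[OF that]] sig that unfolding geometric_signature_def by simp
 have lag: "?A * card H = order G" by (rule lagrange[OF subgroup_H])
 have H0: "card H > 0" using finite_H H_one by (auto simp: card_gt_0_iff)
 show ?thesis
 proof (cases "?B = 0")
  \<comment> \<open>Here \<open>H\<close> is the whole group. As division by 0 gives 0, both the
    correspondence and \<open>q\<close> become 0, while the index and the number of double cosets
    are both 1; so both sides vanish.\<close>
  case True
  have HG: "H = cr G" by (rule kanev_gcd_eq_0[OF True])
  have "int (card H) * ?I = (SUM i=2..d. (if i = 1 then 0 else (bi 1 - bi i - ?B) div ?B)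
  * (SUM gm:dcoset i. int (card {z : pts V. ph gm z = z})))"
  unfolding kanev_correspondence_eq by (rule intersection_number_diagonal) simp
  also have "... = 0" unfolding True by (rule sum.neutral) simp
  finally have I: "?I = 0" using H0 by simp
  have "?A = 1" using lag H0 unfolding HG order_def by simp
  moreover have "card (double_cosets G H (Gj j)) = 1" if j: "j : {1..t}" for j
  proof -
  have "double_cosets G H (Gj j) = {cr G}"
  proof -
  have "double_coset G H a (Gj j) = cr G" if a: "a : cr G" for a
  proof
  show "double_coset G H a (Gj j) <= cr G" by (rule double_coset_subset[OF subgroup_H sub[OF j] a])
  show "cr G <= double_coset G H a (Gj j)"
  proof
  fix x assume x: "x : cr G"
  have "x = (x *. inv a) *. a *. \<one>" using a x by (simp add: m_assoc)
  thus "x : double_coset G H a (Gj j)"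
  unfolding double_coset_set HG using a x subgroup.one_closed[OF sub[OF j]] by blast
  qed
  qed
  thus ?thesis unfolding double_cosets_def using one_closed by auto
  qed
  thus ?thesis by simp
  qed
  ultimately have "(SUM j=1..t. of_nat (m j) *
  ?T j :: rat) = 0"
  by (intro sum.neutral) (simp add: q_def True)
  thus ?thesis using I by simp
 next
  case False
  let ?b = "of_int (?B) :: rat"
  let ?h = "of_nat (card H) :: rat" and ?G = "of_nat (order G) :: rat" and ?e = "of_nat e :: rat" and ?l = "of_nat (rat_degree L) :: rat"
  have b: "?b ~= 0" using False by simp
  have h: "?h ~= 0" using H0 by simp
  have e0: "?e ~= 0" using e_pos by simp
  have "?h * of_int ?I = (SUM j=1..t. of_nat (m j) / of_nat (card (Gj j)) *
  ((of_int (bi 1) * of_nat (SUM gm:cr G. conj_count (Gj j) gm) - (SUM gm:cr G. of_nat (conj_count (Gj j) gm) * B gm)) / ?b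
  - of_nat (SUM gm:cr G. conj_count (Gj j) gm) + of_nat (SUM gm:H. conj_count (Gj j) gm)))"
  by (rule kanev_intersection[OF sig Gj B_dcoset False])
  also have "... = (SUM j=1..t. ?h * (of_nat (m j) *
  ?T j))"
  proof (rule sum.cong[OF refl])
  fix j assume j: "j : {1..t}"
  let ?K = "of_nat (card (Gj j)) :: rat" and ?F = "of_nat (SUM k=1..r. fixed_dim e (rh k) (Gj j)) :: rat"
  let ?D = "of_nat (card (double_cosets G H (Gj j))) :: rat" and ?R = "of_nat r :: rat" and ?c = "of_nat (?A) :: rat"
  have "card (Gj j) > 0"
  using subgroup.one_closed[OF sub[OF j]] subgroup.subset[OF sub[OF j]] finite_G finite_subset card_gt_0_iff by blast
  hence K: "?K ~= 0" by simp
  have 1: "of_nat (SUM gm:cr G. conj_count (Gj j) gm) = ?G * ?K"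
  unfolding sum_conj_count_one[OF finite_G subgroup.subset[OF sub[OF j]]] by simp
  have 2: "of_nat (SUM gm:H. conj_count (Gj j) gm) = ?h * ?K * ?D"
  unfolding sum_conj_count_subgroup[OF finite_G subgroup_H sub[OF j]] by simp
  have 3: "(SUM gm:cr G. of_nat (conj_count (Gj j) gm) * B gm) = ?h * ?G * ?K * ?l * ?F / ?e"
  using sum_B[OF sub[OF j]] e0 by (simp add: field_simps)
  have 4: "of_int (bi 1) = ?R * ?h * ?l" unfolding bi_1 by simp
  have 5: "?c * ?h = ?G" unfolding of_nat_mult[symmetric] lag ..
  have 6: "(SUM i=1..r. ?e - of_nat (fixed_dim e (rh i) (Gj j))) = ?R * ?e - ?F" by (simp add: sum_subtractf)
  have "of_nat (m j) / ?K * ((?R * ?h * ?l * (?G * ?K) - ?h * ?G * ?K * ?l * ?F / ?e) / ?b - ?G * ?K + ?h * ?K * ?D)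
  = ?h * (of_nat (m j) * (?G / (?b * ?e) * ?l * (?R * ?e - ?F) - (?G / ?h - ?D)))"
  by (rule intersection_arithmetic[OF K h b e0])
  also have "?G / ?h = ?c" using 5 h by (simp add: field_simps)
  finally show "of_nat (m j) / ?K *
  ((of_int (bi 1) * of_nat (SUM gm:cr G. conj_count (Gj j) gm) - (SUM gm:cr G. of_nat (conj_count (Gj j) gm) * B gm)) / ?b
  - of_nat (SUM gm:cr G. conj_count (Gj j) gm) + of_nat (SUM gm:H. conj_count (Gj j) gm))
  = ?h * (of_nat (m j) * (q * ?l * (SUM i=1..r. ?e - of_nat (fixed_dim e (rh i) (Gj j))) - (?c - ?D)))"
  unfolding 1 2 3 4 6 q_def .
  qed
  also have "... = ?h * (SUM j=1..t. of_nat (m j) *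
  ?T j)" by (rule sum_distrib_left[symmetric])
  finally show ?thesis using h by simp
 qed
qed

end

theorem proposition4p8:
  fixes G :: "('g, 'm) monoid_scheme" and H :: "'g set"
    and Zset :: "(nat \<Rightarrow> 'k::{alg_closed_field, field_char_0}) set"
    and N :: nat and \<phi> :: "'g \<Rightarrow> (nat \<Rightarrow> 'k) \<Rightarrow> (nat \<Rightarrow> 'k)"
    and r :: nat and dimW :: "nat \<Rightarrow> nat" and W :: "nat \<Rightarrow> 'g \<Rightarrow> rat mat"
    and dimV :: "nat \<Rightarrow> nat" and V :: "nat \<Rightarrow> 'g \<Rightarrow> complex mat"
    and n :: nat and L :: "complex set"
    and t :: nat and C :: "nat \<Rightarrow> 'g set set" and m :: "nat \<Rightarrow> nat" and Gj :: "nat \<Rightarrow> 'g set"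
    and d :: nat and ni :: "nat \<Rightarrow> nat" and g :: "nat \<Rightarrow> nat \<Rightarrow> 'g"
    and bi :: "nat \<Rightarrow> int" and q :: rat
  defines "Z \<equiv> proj_variety Zset"
  defines "X \<equiv> quotient_space (G\<lparr>carrier := H\<rparr>) \<phi> Z"
  defines "bi \<equiv> (\<lambda>i. \<Sum>k=1..r. kanev_a G H L (V k) (g i 1))"
  defines "q \<equiv> of_nat (order G) / (of_int (kanev_gcd d bi) * of_nat n)"
  assumes "group G" and "finite (carrier G)" and "subgroup H G"
    and "smooth_projective_curve N Zset" and "acts_faithfully_on G \<phi> Z"
    and "1 \<le> r"
    and "\<And>k. k \<in> {1..r} \<Longrightarrow> irreducible_rep G (dimW k) (W k) \<and> nontrivial_rep G (W k)"
    and "\<And>k l. k \<in> {1..r} \<Longrightarrow> l \<in> {1..r} \<Longrightarrow> k \<noteq> l \<Longrightarrow> \<not> rep_iso G (W k) (W l)"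
    and "\<And>k. k \<in> {1..r} \<Longrightarrow> associated_rep G (W k) (dimV k) (V k)"
    and "hypothesis_star G H r dimV V n L"
    and "double_coset_reps G H d ni g"
    and "geometric_signature G \<phi> Z 0 t C m"
    and "\<And>j. j \<in> {1..t} \<Longrightarrow> Gj j \<in> C j"
  shows "of_int (intersection_number (product_space X X)
            (kanev_correspondence G H \<phi> Z d ni g bi) (diagonal_divisor X)) =
    (\<Sum>j=1..t. of_nat (m j) *
       (q * of_nat (rat_degree L) *
          (\<Sum>i=1..r. of_nat (dimV i) - of_nat (fixed_dim (dimV i) (V i) (Gj j)))
        - (of_nat (card (rcosets\<^bsub>G\<^esub> H)) - of_nat (card (double_cosets G H (Gj j))))))"
proof -
 interpret smooth_projective N Zset
  using assms(8) by (rule smooth_projective.intro)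
 interpret K: kanev_curve "proj_variety Zset" G \<phi> H d ni g r dimV V n L
 proof (intro kanev_curve.intro hecke_curve.intro curve_quotient.intro curve_action.intro)
  show "algebraic_curve (proj_variety Zset)" ..
  show "group G" by (rule assms(5))
  show "curve_action_axioms (proj_variety Zset) G \<phi>"
  using assms(6,9) unfolding Z_def by (rule curve_action_axioms.intro)
  show "curve_quotient_axioms G H" by (rule curve_quotient_axioms.intro[OF assms(7)])
  show "hecke_curve_axioms G H d ni g" by (rule hecke_curve_axioms.intro[OF assms(15)])
  show "kanev_curve_axioms G H r dimV V n L"
  proof
  show "1 <= r" by (rule assms(10))
  show "irreducible_rep G (dimV k) (V k)" if "k : {1..r}" for k
  using assms(13)[OF that] unfolding associated_rep_def by (rule conjunct1)
  show "hypothesis_star G H r dimV V n L" by (rule assms(14))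
  qed
 qed
 have X: "X = K.X" unfolding X_def Z_def K.X_def ..
 have bi: "bi = K.bi" unfolding bi_def K.bi_def ..
 have dims: "(SUM i=1..r. of_nat (dimV i) - of_nat (fixed_dim (dimV i) (V i) K) :: rat)
  = (SUM i=1..r. of_nat n - of_nat (fixed_dim n (V i) K))" for K
  by (rule sum.cong[OF refl]) (simp only: K.dimV)
 show ?thesis
  unfolding dims X q_def bi Z_def
  by (rule K.kanev_fixed_points[OF assms(16)[unfolded Z_def] assms(17)])
qed

end
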